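(* Consider the sequence (indexed by $n\in\mathbb{N}$) of critically loaded multiclass single-server queueing systems described in the context. Assume: (i) (moderate deviation principle) $(\tilde A^n,\tilde S^n)$ satisfies the large deviation principle with speed $b_n^{-2}$ and rate function $\mathbb{I}$ in $\mathcal{D}([0,T],\mathbb{R}^{2d})$, that is, for every open $G\subset\mathcal{D}([0,T],\mathbb{R}^{2d})$, $$\liminf_{n\to\infty}\frac{1}{b_n^2}\log\mathbb{P}\big((\tilde A^n,\tilde S^n)\in G\big)\ge-\inf_{\psi\in G}\mathbb{I}(\psi),$$ and for every closed $F\subset\mathcal{D}([0,T],\mathbb{R}^{2d})$, $$\limsup_{n\to\infty}\frac{1}{b_n^2}\log\mathbb{P}\big((\tilde A^n,\tilde S^n)\in F\big)\le-\inf_{\psi\in F}\mathbb{I}(\psi);$$ (ii) for every constant $u$, $$\limsup_{n\to\infty}\frac{1}{b_n^2}\log\mathbb{E}\Big[e^{b_n^2u(\|\tilde A^n\|_T+\|\tilde S^n\|_T)}\Big]<\infty.$$ Then the preemptive generalized $c\mu$ rule $B^{*,n}$ is asymptotically optimal, that is, $$\lim_{n\to\infty}J^n(B^{*,n})=V,$$ where $V$ is the value of the differential game defined in the context.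
   Context: **General notation.** $T>0$ is fixed, $d$ is a positive integer, $\mathcal{I}=\{1,\dots,d\}$. $\|\cdot\|$ is the Euclidean norm and $\|f\|_t=\sup_{0\le s\le t}\|f(s)\|$. $\mathcal{C}([0,T],\mathbb{R}^k)$ is the space of continuous functions, $\mathcal{C}_0([0,T],\mathbb{R}^k)$ its subset of functions starting from $0$. $\mathcal{D}([0,T],\mathbb{R}^k)$ is the space of right-continuous functions with finite left limits (RCLL), with the Skorohod $J_1$ metric. $\mathcal{AC}_0$ is the set of absolutely continuous $\psi:[0,T]\to\mathbb{R}^d$ with $\psi(0)=0$. **Primitives.** On a complete probability space $(\Omega,\mathcal{F},\mathbb{P})$ there are $d$ independent sequences $\{IA_i(l):l\in\mathbb{N}\}$, $i\in\mathcal{I}$, of i.i.d. positive random variables with mean $1$ and variance $\sigma^2_{IA,i}\in(0,\infty)$, and $d$ independent sequences $\{ST_i(l):l\in\mathbb{N}\}$, $i\in\mathcal{I}$, of i.i.d. positive random variables with mean $1$ and variance $\sigma^2_{ST,i}\in(0,\infty)$. Given parameters $\lambda_i^n,\mu_i^n>0$, for $t\ge0$ let $$A_i^n(t)=\sup\Big\{l\ge0:\sum_{k=1}^l\frac{IA_i(k)}{\lambda_i^n}\le t\Big\},\qquad S_i^n(t)=\sup\Big\{l\ge0:\sum_{k=1}^l\frac{ST_i(k)}{\mu_i^n}\le t\Big\}$$ (class-$i$ arrivals up to time $t$; class-$i$ service completions by the time the server has devoted $t$ units of time to class $i$). The sequence $\{b_n\}$ satisfies $b_n\to\infty$, $b_n/\sqrt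 n\to0$. As $n\to\infty$: $\lambda_i^n/n\to\lambda_i\in(0,\infty)$, $\mu_i^n/n\to\mu_i\in(0,\infty)$, $\tilde\lambda_i^n:=\frac{1}{b_n\sqrt n}(\lambda_i^n-n\lambda_i)\to\tilde\lambda_i\in\mathbb{R}$, $\tilde\mu_i^n:=\frac{1}{b_n\sqrt n}(\mu_i^n-n\mu_i)\to\tilde\mu_i\in\mathbb{R}$. With $\rho_i=\lambda_i/\mu_i$, the system is critically loaded: $\sum_{i=1}^d\rho_i=1$. **Controlled system.** Let $\mathcal{S}=\{x\in[0,1]^d:\sum_ix_i\le1\}$. A control $B^n$ is an $\mathcal{S}$-valued process, $B^n_i(t)$ being the fraction of the server's effort given to class $i$ at time $t$. Put $T_i^n(t)=\int_0^tB_i^n(s)\,ds$, $D_i^n(t)=S_i^n(T_i^n(t))$ (class-$i$ departures), and $Q_i^n(t)=A_i^n(t)-D_i^n(t)$ (number of class-$i$ customers in the system; the system starts empty). $B^n$ is admissible if it has RCLL sample paths, is adapted to the filtration $\sigma\{A_i^n(s),S_i^n(T_i^n(s)),i\in\mathcal{I},s\le t\}$, and for all $i,t$, $Q_i^n(t)=0$ implies $B_i^n(t)=0$. **Scaled processes.** $\tilde A_i^n(t)=\frac{1}{b_n\sqrt n}(A_i^n(t)-\lambda_i^nt)$, $\tilde S_i^n(t)=\frac{1}{b_n\sqrt n}(S_i^n(t)-\mu_i^nt)$, $\tilde Q_i^n(t)=\frac{1}{b_n\sqrt n}Q_i^n(t)$. **Rate function.** For $\psi\in\mathcal{D}([0,T],\mathbb{R}^d)$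 and $k=1,2$, let $\mathbb{I}_k(\psi)=\sum_{i=1}^d\frac{1}{2\hat\sigma_{k,i}^2}\int_0^T\dot\psi_i^2\,ds$ if $\psi\in\mathcal{AC}_0$ and $\mathbb{I}_k(\psi)=\infty$ otherwise, where $\hat\sigma_{1,i}^2=\lambda_i\sigma_{IA,i}^2$, $\hat\sigma_{2,i}^2=\mu_i\sigma_{ST,i}^2$. For $\psi=(\psi^{(1)},\psi^{(2)})\in\mathcal{D}([0,T],\mathbb{R}^{2d})$, $\mathbb{I}(\psi)=\mathbb{I}_1(\psi^{(1)})+\mathbb{I}_2(\psi^{(2)})$. **Cost.** For $i\in\mathcal{I}$, $C_i:\mathbb{R}_+\to\mathbb{R}_+$ is strictly increasing, strictly convex, continuously differentiable, with $C_i(0)=C_i'(0)=0$, and there is a constant $u_1$ with $C_i(x)\le u_1x$ for all $x\in\mathbb{R}_+$, $i\in\mathcal{I}$. Let $C(x)=\sum_iC_i(x_i)$. The cost of an admissible control $B^n$ is $$J^n(B^n)=\frac{1}{b_n^2}\log\mathbb{E}\Big[\exp\Big(b_n^2\int_0^TC(\tilde Q^n(t))\,dt\Big)\Big].$$ **Preemptive generalized $c\mu$ rule.** For $i\in\mathcal{I}$ let $\mathcal{Q}_i$ be the set of $q\in\mathbb{R}_+^d\setminus\{0\}$ such that $i$ is the smallest index in $\{k\in\mathcal{I}:\mu_kC_k'(q_k)=\max_{j}\mu_jC_j'(q_j)\}$. The control $B^{*,n}$ is the admissible control given by $B_i^{*,n}(t)=1_{\{\tilde Q^n(t)\in\mathcal{Q}_i\}}$,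 $i\in\mathcal{I}$ (this, with the equations above, determines all processes uniquely from $(A^n,S^n)$). **Differential game.** Let $\theta=(\mu_1^{-1},\dots,\mu_d^{-1})$, $y_i=\tilde\lambda_i-\rho_i\tilde\mu_i$, $y=(y_1,\dots,y_d)$, $\iota$ the identity map on $[0,T]$, $\mathcal{P}=\mathcal{C}_0([0,T],\mathbb{R}^{2d})$, and $\mathcal{E}=\{\zeta\in\mathcal{C}([0,T],\mathbb{R}^d):\theta\cdot\zeta\text{ starts from zero and is non-decreasing}\}$, both with the uniform topology. For $\psi\in\mathcal{D}([0,T],\mathbb{R}^d)$ let $\rho[\psi]_i(t)=\psi_i(\rho_it)$. For $\psi=(\psi^{(1)},\psi^{(2)})\in\mathcal{P}$ and $\zeta\in\mathcal{E}$, the dynamics for the data $(\psi,\zeta)$ is $\varphi=y\iota+\psi^{(1)}-\rho[\psi^{(2)}]+\zeta$. A strategy is a measurable map $\alpha:\mathcal{P}\to\mathcal{E}$ that is causal: for all $\psi,\tilde\psi\in\mathcal{P}$ and $t\in[0,T]$, if $(\psi^{(1)},\rho[\psi^{(2)}])(s)=(\tilde\psi^{(1)},\rho[\tilde\psi^{(2)}])(s)$ for all $s\in[0,t]$, then $\alpha[\psi](s)=\alpha[\tilde\psi](s)$ for all $s\in[0,t]$. It is admissible if for every $\psi\in\mathcal{P}$ the dynamics $\varphi$ for $(\psi,\alpha[\psi])$ satisfies $\varphi_i(t)\ge0$ for all $i\in\mathcal{I}$ and $t\in[0,T]$; $\mathcal{A}$ denotes the set of admissible strategies. The cost is $c(\psi,\zeta)=\int_0^TC(\varphi(t))\,dt-\mathbb{I}(\psi)$,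 with $\varphi$ the dynamics for $(\psi,\zeta)$, and the value of the game is $$V=\inf_{\alpha\in\mathcal{A}}\sup_{\psi\in\mathcal{P}}c(\psi,\alpha[\psi]).$$ *)

theory Defs
  imports "HOL-Probability.Probability"
begin

text \<open>
  Classes are indexed by a type \<open>'d\<close> of sort \<open>{finite, linorder}\<close>, which stands for the
  ordered index set \<open>{1, \<dots>, d}\<close> with \<open>d = CARD('d)\<close>; the order is only used for the
  tie-breaking of the priority rule. Euclidean space of dimension \<open>2 d\<close> is the product type
  \<open>(real^'d) \<times> (real^'d)\<close>, whose norm is the Euclidean one. Functions on \<open>[0, T]\<close> are the
  \<open>extensional\<close> functions on \<open>{0..T}\<close>.
\<close>

section \<open>Path spaces\<close>

text \<open>Right-continuous with finite left limits on \<open>[0, T]\<close>.\<close>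
definition rcll_on :: "real \<Rightarrow> (real \<Rightarrow> 'a::topological_space) \<Rightarrow> bool" where
  "rcll_on T f \<longleftrightarrow>
     (\<forall>t\<in>{0..<T}. (f \<longlongrightarrow> f t) (at_right t)) \<and>
     (\<forall>t\<in>{0<..T}. \<exists>l. (f \<longlongrightarrow> l) (at_left t))"

definition skorokhod_space :: "real \<Rightarrow> (real \<Rightarrow> 'a::topological_space) set" where
  "skorokhod_space T = {f \<in> extensional {0..T}. rcll_on T f}"

definition time_changes :: "real \<Rightarrow> (real \<Rightarrow> real) set" where
  "time_changes T =
     {\<tau>. strict_mono_on {0..T} \<tau> \<and> continuous_on {0..T} \<tau> \<and> \<tau> ` {0..T} = {0..T}}"

text \<open>
  The Skorokhod \<open>J1\<close> metric. The value outside the carrier is irrelevant; it makes the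
  library locale \<open>Metric_space\<close> applicable.
\<close>
definition skorokhod_dist ::
  "real \<Rightarrow> (real \<Rightarrow> 'a::metric_space) \<Rightarrow> (real \<Rightarrow> 'a) \<Rightarrow> real" where
  "skorokhod_dist T x y =
     (if x \<in> skorokhod_space T \<and> y \<in> skorokhod_space T then
        Inf {e. 0 < e \<and> (\<exists>\<tau>\<in>time_changes T. \<forall>t\<in>{0..T}. \<bar>\<tau> t - t\<bar> \<le> e \<and> dist (x (\<tau> t)) (y t) \<le> e)}
      else 0)"

definition skorokhod_topology :: "real \<Rightarrow> (real \<Rightarrow> 'a::metric_space) topology" where
  "skorokhod_topology T = Metric_space.mtopology (skorokhod_space T) (skorokhod_dist T)"

lemma rcll_on_bounded:
  fixes f :: "real \<Rightarrow> 'a::metric_space"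
  assumes "rcll_on T f"
  shows "bounded (f ` {0..T})"
proof -
  have "\<exists>U. open U \<and> t \<in> U \<and> bounded (f ` (U \<inter> {0..T}))" if t: "t \<in> {0..T}" for t
  proof -
    have "\<exists>b>t. bounded (f ` ({t<..<b} \<inter> {0..T}))"
    proof (cases "t < T")
      case True
      then have "(f \<longlongrightarrow> f t) (at_right t)"
        using assms t by (auto simp: rcll_on_def)
      then have "\<forall>\<^sub>F s in at_right t. dist (f s) (f t) < 1"
        by (rule tendstoD) simp
      then obtain b where b: "b > t" "\<And>s. t < s \<Longrightarrow> s < b \<Longrightarrow> dist (f s) (f t) < 1"
        unfolding eventually_at_right_field by blast
      then have "f ` ({t<..<b} \<inter> {0..T}) \<subseteq> ball (f t) 1"
        by (auto simp: dist_commute)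
      then show ?thesis
        using b(1) bounded_ball bounded_subset by blast
    next
      case False
      then have "{t<..<t+1} \<inter> {0..T} = {}" using t by auto
      then show ?thesis
        by (intro exI[of _ "t+1"]) auto
    qed
    then obtain b where b: "b > t" "bounded (f ` ({t<..<b} \<inter> {0..T}))" by blast
    have "\<exists>a<t. bounded (f ` ({a<..<t} \<inter> {0..T}))"
    proof (cases "0 < t")
      case True
      then have "t \<in> {0<..T}" using t by auto
      then obtain l where "(f \<longlongrightarrow> l) (at_left t)"
        using assms unfolding rcll_on_def by blast
      then have "\<forall>\<^sub>F s in at_left t. dist (f s) l < 1"
        by (rule tendstoD) simp
      then obtain a where a: "a < t" "\<And>s. a < s \<Longrightarrow> s < t \<Longrightarrow> dist (f s) l < 1"
        unfolding eventually_at_left_field by blast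
      then have "f ` ({a<..<t} \<inter> {0..T}) \<subseteq> ball l 1"
        by (auto simp: dist_commute)
      then show ?thesis
        using a(1) bounded_ball bounded_subset by blast
    next
      case False
      then have "{t-1<..<t} \<inter> {0..T} = {}" using t by auto
      then show ?thesis
        by (intro exI[of _ "t-1"]) auto
    qed
    then obtain a where a: "a < t" "bounded (f ` ({a<..<t} \<inter> {0..T}))" by blast
    have "{a<..<b} \<inter> {0..T} \<subseteq> ({a<..<t} \<inter> {0..T}) \<union> ({t} \<union> ({t<..<b} \<inter> {0..T}))"
      by auto
    then have "f ` ({a<..<b} \<inter> {0..T}) \<subseteq>
        f ` ({a<..<t} \<inter> {0..T}) \<union> ({f t} \<union> f ` ({t<..<b} \<inter> {0..T}))"
      by blast
    moreover have "bounded (f ` ({a<..<t} \<inter> {0..T}) \<union> ({f t} \<union> f ` ({t<..<b} \<inter> {0..T})))"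
      using a(2) b(2) by (simp add: bounded_Un)
    ultimately have "bounded (f ` ({a<..<b} \<inter> {0..T}))"
      using bounded_subset by blast
    then show ?thesis
      using a(1) b(1) by (intro exI[of _ "{a<..<b}"]) auto
  qed
  then obtain U where U: "\<And>t. t \<in> {0..T} \<Longrightarrow> open (U t) \<and> t \<in> U t \<and> bounded (f ` (U t \<inter> {0..T}))"
    by metis
  obtain K where K: "K \<subseteq> {0..T}" "finite K" "{0..T} \<subseteq> (\<Union>t\<in>K. U t)"
    by (rule compactE_image[of "{0..T}" "{0..T}" U]) (use U in auto)
  have "f ` {0..T} \<subseteq> (\<Union>t\<in>K. f ` (U t \<inter> {0..T}))"
    using K(3) by force
  moreover have "bounded (\<Union>t\<in>K. f ` (U t \<inter> {0..T}))"
    using K U by (intro bounded_UN) auto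
  ultimately show ?thesis
    using bounded_subset by blast
qed

lemma time_changes_inverse:
  assumes "\<tau> \<in> time_changes T"
  obtains \<sigma> where "\<sigma> \<in> time_changes T"
    "\<And>t. t \<in> {0..T} \<Longrightarrow> \<sigma> (\<tau> t) = t" "\<And>t. t \<in> {0..T} \<Longrightarrow> \<tau> (\<sigma> t) = t"
proof
  define \<sigma> where "\<sigma> = inv_into {0..T} \<tau>"
  from assms have m: "strict_mono_on {0..T} \<tau>" and c: "continuous_on {0..T} \<tau>"
    and i: "\<tau> ` {0..T} = {0..T}" by (auto simp: time_changes_def)
  have inj: "inj_on \<tau> {0..T}"
    using m strict_mono_on_imp_inj_on by blast
  show 1: "\<sigma> (\<tau> t) = t" if "t \<in> {0..T}" for t
    using inj that by (simp add: \<sigma>_def)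
  show 2: "\<tau> (\<sigma> t) = t" if "t \<in> {0..T}" for t
    using i that by (simp add: \<sigma>_def f_inv_into_f)
  have im: "\<sigma> ` {0..T} = {0..T}"
    using i inj unfolding \<sigma>_def by (metis inv_into_image_cancel order_refl)
  have "strict_mono_on {0..T} \<sigma>"
  proof (rule strict_mono_onI)
    fix r s assume rs: "r \<in> {0..T}" "s \<in> {0..T}" "r < s"
    then have "\<sigma> r \<in> {0..T}" "\<sigma> s \<in> {0..T}" using im by blast+
    then show "\<sigma> r < \<sigma> s"
      using 2[OF rs(1)] 2[OF rs(2)] rs(3) strict_mono_onD[OF m, of "\<sigma> s" "\<sigma> r"]
      by (metis linorder_less_linear order_less_asym)
  qed
  moreover have "continuous_on {0..T} \<sigma>"
    using continuous_on_inv[OF c, of \<sigma>] 1 i by simp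
  ultimately show "\<sigma> \<in> time_changes T"
    using im by (simp add: time_changes_def)
qed

lemma Metric_space_skorokhod:
  "Metric_space (skorokhod_space T) (skorokhod_dist T :: (real \<Rightarrow> 'a::metric_space) \<Rightarrow> _)"
proof -
  define E where "E x y = {e. 0 < e \<and> (\<exists>\<tau>\<in>time_changes T. \<forall>t\<in>{0..T}. \<bar>\<tau> t - t\<bar> \<le> e \<and> dist (x (\<tau> t)) (y t) \<le> e)}"
    for x y :: "real \<Rightarrow> 'a"
  let ?D = "skorokhod_space T :: (real \<Rightarrow> 'a) set"
  have d: "skorokhod_dist T x y = Inf (E x y)" if "x \<in> ?D" "y \<in> ?D" for x y
    using that by (simp add: skorokhod_dist_def E_def)
  have bdd: "bdd_below (E x y)" for x y
    by (rule bdd_belowI[of _ 0]) (auto simp: E_def)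
  have idt: "(\<lambda>t. t) \<in> time_changes T"
    by (auto simp: time_changes_def strict_mono_on_def)
  have ne: "E x y \<noteq> {}" if xy: "x \<in> ?D" "y \<in> ?D" for x y
  proof -
    have "bounded (x ` {0..T} \<union> y ` {0..T})"
      using xy rcll_on_bounded by (auto simp: skorokhod_space_def bounded_Un)
    then obtain B where B: "\<And>u v. u \<in> x ` {0..T} \<union> y ` {0..T} \<Longrightarrow> v \<in> x ` {0..T} \<union> y ` {0..T} \<Longrightarrow> dist u v \<le> B"
      using bounded_two_points by metis
    have "max B 1 \<in> E x y"
      unfolding E_def using B idt by (auto intro!: bexI[of _ "\<lambda>t. t"] simp: le_max_iff_disj)
    then show ?thesis by blast
  qed
  have nn: "0 \<le> Inf (E x y)" if "x \<in> ?D" "y \<in> ?D" for x y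
    by (rule cInf_greatest[OF ne[OF that]]) (simp add: E_def)
  have com: "E x y \<subseteq> E y x" for x y
  proof
    fix e assume "e \<in> E x y"
    then obtain \<tau> where e: "0 < e" "\<tau> \<in> time_changes T"
      and *: "\<And>t. t \<in> {0..T} \<Longrightarrow> \<bar>\<tau> t - t\<bar> \<le> e \<and> dist (x (\<tau> t)) (y t) \<le> e"
      by (auto simp: E_def)
    obtain \<sigma> where \<sigma>: "\<sigma> \<in> time_changes T"
      "\<And>t. t \<in> {0..T} \<Longrightarrow> \<sigma> (\<tau> t) = t" "\<And>t. t \<in> {0..T} \<Longrightarrow> \<tau> (\<sigma> t) = t"
      using time_changes_inverse[OF e(2)] by blast
    have "\<bar>\<sigma> t - t\<bar> \<le> e \<and> dist (y (\<sigma> t)) (x t) \<le> e" if t: "t \<in> {0..T}" for t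
    proof -
      have "\<sigma> t \<in> {0..T}" using \<sigma>(1) t by (auto simp: time_changes_def)
      from *[OF this] show ?thesis
        using \<sigma>(3)[OF t] by (simp add: dist_commute abs_minus_commute)
    qed
    then show "e \<in> E y x" using e(1) \<sigma>(1) unfolding E_def by blast
  qed
  have comp: "e1 + e2 \<in> E x z" if e: "e1 \<in> E x y" "e2 \<in> E y z" for e1 e2 x y z
  proof -
    obtain \<tau>1 where 1: "0 < e1" "\<tau>1 \<in> time_changes T"
      "\<And>t. t \<in> {0..T} \<Longrightarrow> \<bar>\<tau>1 t - t\<bar> \<le> e1 \<and> dist (x (\<tau>1 t)) (y t) \<le> e1"
      using e by (auto simp: E_def)
    obtain \<tau>2 where 2: "0 < e2" "\<tau>2 \<in> time_changes T"
      "\<And>t. t \<in> {0..T} \<Longrightarrow> \<bar>\<tau>2 t - t\<bar> \<le> e2 \<and> dist (y (\<tau>2 t)) (z t) \<le> e2"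
      using e by (auto simp: E_def)
    have im: "\<tau>2 t \<in> {0..T}" if "t \<in> {0..T}" for t
      using that 2(2) by (auto simp: time_changes_def)
    have "\<tau>1 \<circ> \<tau>2 \<in> time_changes T"
    proof -
      have "(\<tau>1 \<circ> \<tau>2) ` {0..T} = {0..T}"
        using 1(2) 2(2) unfolding time_changes_def image_comp[symmetric] by auto
      moreover have "continuous_on {0..T} (\<tau>1 \<circ> \<tau>2)"
        using 1(2) 2(2) by (intro continuous_on_compose) (auto simp: time_changes_def)
      moreover have "strict_mono_on {0..T} (\<tau>1 \<circ> \<tau>2)"
      proof (rule strict_mono_onI)
        fix r s assume rs: "r \<in> {0..T}" "s \<in> {0..T}" "r < s"
        have "strict_mono_on {0..T} \<tau>1" "strict_mono_on {0..T} \<tau>2"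
          using 1(2) 2(2) by (auto simp: time_changes_def)
        then show "(\<tau>1 \<circ> \<tau>2) r < (\<tau>1 \<circ> \<tau>2) s"
          using rs im[OF rs(1)] im[OF rs(2)] by (simp add: strict_mono_on_def)
      qed
      ultimately show ?thesis by (simp add: time_changes_def)
    qed
    moreover have "\<bar>\<tau>1 (\<tau>2 t) - t\<bar> \<le> e1 + e2 \<and> dist (x (\<tau>1 (\<tau>2 t))) (z t) \<le> e1 + e2"
      if t: "t \<in> {0..T}" for t
    proof -
      have "dist (x (\<tau>1 (\<tau>2 t))) (z t) \<le> dist (x (\<tau>1 (\<tau>2 t))) (y (\<tau>2 t)) + dist (y (\<tau>2 t)) (z t)"
        by (rule dist_triangle)
      then show ?thesis
        using 1(3)[OF im[OF t]] 2(3)[OF t] by linarith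
    qed
    ultimately show ?thesis
      using 1(1) 2(1) by (auto simp: E_def intro!: bexI[of _ "\<tau>1 \<circ> \<tau>2"])
  qed
  have eq: "x = y" if xy: "x \<in> ?D" "y \<in> ?D" and 0: "Inf (E x y) = 0" for x y
  proof (rule extensionalityI)
    show "x \<in> extensional {0..T}" "y \<in> extensional {0..T}"
      using xy by (auto simp: skorokhod_space_def)
    have small: "\<exists>\<tau>\<in>time_changes T. \<forall>t\<in>{0..T}. \<bar>\<tau> t - t\<bar> < e \<and> dist (x (\<tau> t)) (y t) < e" if epos: "0 < e" for e
    proof -
      obtain e' where "e' \<in> E x y" "e' < e"
        using cInf_lessD[OF ne[OF xy], of e] 0 epos by auto
      then show ?thesis unfolding E_def by force
    qed
    fix t assume t: "t \<in> {0..T}"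
    have "dist (x t) (y t) \<le> 3 * e" if e: "0 < e" for e
    proof (cases "t = T")
      case True
      obtain \<tau> where \<tau>: "\<tau> \<in> time_changes T"
        "\<And>t. t \<in> {0..T} \<Longrightarrow> \<bar>\<tau> t - t\<bar> < e \<and> dist (x (\<tau> t)) (y t) < e"
        using small[OF e] by blast
      have "\<tau> T = T"
      proof -
        have im: "\<tau> ` {0..T} = {0..T}" and m: "strict_mono_on {0..T} \<tau>"
          using \<tau>(1) by (auto simp: time_changes_def)
        have "T \<in> \<tau> ` {0..T}" unfolding im using t True by simp
        then obtain s where s: "s \<in> {0..T}" "\<tau> s = T" by blast
        have "\<tau> T \<in> {0..T}" using im t True by blast
        moreover have "\<tau> s \<le> \<tau> T"
        proof (cases "s = T")
          case False
          then have "s < T" using s by simp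
          then show ?thesis using strict_mono_onD[OF m s(1), of T] t True by simp
        qed simp
        ultimately show ?thesis using s by auto
      qed
      then show ?thesis using \<tau>(2)[OF t] True e by auto
    next
      case False
      then have tT: "t \<in> {0..<T}" using t by auto
      have "(x \<longlongrightarrow> x t) (at_right t)" "(y \<longlongrightarrow> y t) (at_right t)"
        using xy tT unfolding skorokhod_space_def rcll_on_def by blast+
      then have "\<forall>\<^sub>F s in at_right t. dist (x s) (x t) < e" "\<forall>\<^sub>F s in at_right t. dist (y s) (y t) < e"
        using e by (blast intro: tendstoD)+
      then have "\<forall>\<^sub>F s in at_right t. dist (x s) (x t) < e \<and> dist (y s) (y t) < e"
        by (rule eventually_conj)
      then obtain b where b: "b > t" "\<And>s. t < s \<Longrightarrow> s < b \<Longrightarrow> dist (x s) (x t) < e \<and> dist (y s) (y t) < e"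
        unfolding eventually_at_right_field by blast
      define h where "h = (min b T - t) / 2"
      have h: "h > 0" "t + 2 * h \<le> b" "t + 2 * h \<le> T" using b(1) tT by (auto simp: h_def min_def field_simps)
      obtain \<tau> where \<tau>: "\<And>t. t \<in> {0..T} \<Longrightarrow> \<bar>\<tau> t - t\<bar> < min e h \<and> dist (x (\<tau> t)) (y t) < min e h"
        using small[of "min e h"] e h(1) by (metis min_less_iff_conj)
      have s: "t + h \<in> {0..T}" using h t by auto
      have "\<bar>\<tau> (t + h) - (t + h)\<bar> < h" and d: "dist (x (\<tau> (t + h))) (y (t + h)) < e" using \<tau>[OF s] by auto
      then have "t < \<tau> (t + h)" "\<tau> (t + h) < b" using h by auto
      then have "dist (x (\<tau> (t + h))) (x t) < e" using b(2) by blast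
      moreover have "dist (y (t + h)) (y t) < e" using b(2)[of "t + h"] h by auto
      moreover have "dist (x t) (y t) \<le> dist (x t) (x (\<tau> (t + h))) + dist (x (\<tau> (t + h))) (y t)"
        by (rule dist_triangle)
      moreover have "dist (x (\<tau> (t + h))) (y t) \<le> dist (x (\<tau> (t + h))) (y (t + h)) + dist (y (t + h)) (y t)"
        by (rule dist_triangle)
      moreover have "dist (x t) (x (\<tau> (t + h))) = dist (x (\<tau> (t + h))) (x t)"
        by (rule dist_commute)
      ultimately show ?thesis using d by linarith
    qed
    from this[of "dist (x t) (y t) / 6"] have "\<not> 0 < dist (x t) (y t)" by linarith
    then show "x t = y t" by simp
  qed
  show ?thesis
  proof
    show "0 \<le> skorokhod_dist T x y" for x y :: "real \<Rightarrow> 'a"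
    proof (cases "x \<in> ?D \<and> y \<in> ?D")
      case True
      then show ?thesis using d nn by simp
    qed (auto simp: skorokhod_dist_def)
    show "skorokhod_dist T x y = skorokhod_dist T y x" for x y :: "real \<Rightarrow> 'a"
    proof (cases "x \<in> ?D \<and> y \<in> ?D")
      case True
      then show ?thesis using d com by (metis subset_antisym)
    qed (auto simp: skorokhod_dist_def)
    show "skorokhod_dist T x y = 0 \<longleftrightarrow> x = y" if xy: "x \<in> ?D" "y \<in> ?D" for x y
    proof
      show "x = y" if "skorokhod_dist T x y = 0"
        using eq[OF xy] d[OF xy] that by simp
      assume "x = y"
      then have "e \<in> E x y" if "0 < e" for e
        using that idt by (auto simp: E_def intro!: bexI[of _ "\<lambda>t. t"])
      then have "Inf (E x y) \<le> e" if "0 < e" for e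
        by (rule cInf_lower[OF _ bdd]) (rule that)
      from this[of "Inf (E x y) / 2"] have "Inf (E x y) \<le> 0"
        by linarith
      moreover have "0 \<le> Inf (E x y)"
        using nn[OF xy] .
      ultimately show "skorokhod_dist T x y = 0"
        using d[OF xy] by simp
    qed
    show "skorokhod_dist T x z \<le> skorokhod_dist T x y + skorokhod_dist T y z"
      if xyz: "x \<in> ?D" "y \<in> ?D" "z \<in> ?D" for x y z
    proof -
      have "Inf (E x z) - Inf (E y z) \<le> Inf (E x y)"
      proof (rule cInf_greatest[OF ne])
        fix e1 assume e1: "e1 \<in> E x y"
        have "Inf (E x z) - e1 \<le> Inf (E y z)"
        proof (rule cInf_greatest[OF ne])
          fix e2 assume "e2 \<in> E y z"
          from comp[OF e1 this] have "Inf (E x z) \<le> e1 + e2"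
            using bdd cInf_lower by blast
          then show "Inf (E x z) - e1 \<le> e2" by simp
        qed (use xyz in auto)
        then show "Inf (E x z) - Inf (E y z) \<le> e1" by simp
      qed (use xyz in auto)
      then show ?thesis using xyz by (simp add: d)
    qed
  qed
qed

text \<open>Continuous functions on \<open>[0, T]\<close> with the metric of uniform convergence.\<close>
definition cont_metric :: "real \<Rightarrow> (real \<Rightarrow> 'a::metric_space) metric" where
  "cont_metric T = cfunspace (top_of_set {0..T}) euclidean_metric"

lemma mspace_cont_metric:
  "mspace (cont_metric T) = {f \<in> extensional {0..T}. continuous_on {0..T} (f :: real \<Rightarrow> 'a::metric_space)}"
  by (auto simp: cont_metric_def intro!: compact_imp_bounded compact_continuous_image)

definition borel_sigma :: "'a topology \<Rightarrow> 'a measure" where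
  "borel_sigma X = sigma (topspace X) {U. openin X U}"


section \<open>Large deviations\<close>

definition ln_ennreal :: "ennreal \<Rightarrow> ereal" where
  "ln_ennreal x = (if x = 0 then -\<infinity> else if x = \<infinity> then \<infinity> else ereal (ln (enn2real x)))"

text \<open>Large deviation principle with speed \<open>1 / (b n)\<^sup>2\<close>.\<close>
definition satisfies_LDP ::
  "'w measure \<Rightarrow> 'x topology \<Rightarrow> (nat \<Rightarrow> real) \<Rightarrow> (nat \<Rightarrow> 'w \<Rightarrow> 'x) \<Rightarrow> ('x \<Rightarrow> ereal) \<Rightarrow> bool" where
  "satisfies_LDP M X b Z I \<longleftrightarrow>
     (\<forall>G. openin X G \<longrightarrow>
        liminf (\<lambda>n. ereal (1 / (b n)\<^sup>2) * ln_ennreal (emeasure M {\<omega> \<in> space M. Z n \<omega> \<in> G}))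
          \<ge> - (INF \<psi>\<in>G. I \<psi>)) \<and>
     (\<forall>F. closedin X F \<longrightarrow>
        limsup (\<lambda>n. ereal (1 / (b n)\<^sup>2) * ln_ennreal (emeasure M {\<omega> \<in> space M. Z n \<omega> \<in> F}))
          \<le> - (INF \<psi>\<in>F. I \<psi>))"

definition abs_continuous_on :: "real \<Rightarrow> real \<Rightarrow> (real \<Rightarrow> 'a::real_normed_vector) \<Rightarrow> bool" where
  "abs_continuous_on a b f \<longleftrightarrow>
     (\<forall>\<epsilon>>0. \<exists>\<delta>>0. \<forall>(m::nat) (u::nat \<Rightarrow> real) (v::nat \<Rightarrow> real).
        (\<forall>k<m. a \<le> u k \<and> u k \<le> v k \<and> v k \<le> b) \<and>
        (\<forall>j<m. \<forall>k<m. j \<noteq> k \<longrightarrow> {u j<..<v j} \<inter> {u k<..<v k} = {}) \<and>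
        (\<Sum>k<m. v k - u k) < \<delta>
        \<longrightarrow> (\<Sum>k<m. norm (f (v k) - f (u k))) < \<epsilon>)"

text \<open>\<open>s i\<close> is the variance parameter (called sigma hat squared in the usual notation).\<close>
definition rate_part :: "real \<Rightarrow> ('d::finite \<Rightarrow> real) \<Rightarrow> (real \<Rightarrow> real^'d) \<Rightarrow> ereal" where
  "rate_part T s \<psi> =
     (if abs_continuous_on 0 T \<psi> \<and> \<psi> 0 = 0 then
        (\<Sum>i\<in>UNIV. ereal (1 / (2 * s i)) *
           enn2ereal (\<integral>\<^sup>+t\<in>{0..T}. ennreal ((deriv (\<lambda>r. \<psi> r $ i) t)\<^sup>2) \<partial>lborel))
      else \<infinity>)"

definition rate_function ::
  "real \<Rightarrow> ('d::finite \<Rightarrow> real) \<Rightarrow> ('d \<Rightarrow> real) \<Rightarrow> (real \<Rightarrow> (real^'d) \<times> (real^'d)) \<Rightarrow> ereal" where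
  "rate_function T s1 s2 \<psi> = rate_part T s1 (\<lambda>t. fst (\<psi> t)) + rate_part T s2 (\<lambda>t. snd (\<psi> t))"


section \<open>The controlled queueing system\<close>

text \<open>
  Only the entries \<open>X 1, X 2, \<dots>\<close> are used. If the partial sums stay bounded by \<open>t\<close>, the set is
  infinite and its \<open>Sup\<close> in \<open>nat\<close> is a meaningless number; for i.i.d. positive variables this
  is a null event.
\<close>
definition renewal_count :: "(nat \<Rightarrow> real) \<Rightarrow> real \<Rightarrow> real \<Rightarrow> nat" where
  "renewal_count X r t = Sup {l::nat. (\<Sum>k=1..l. X k / r) \<le> t}"

definition renewal_processes ::
  "('d \<Rightarrow> nat \<Rightarrow> 'w \<Rightarrow> real) \<Rightarrow> ('d \<Rightarrow> real) \<Rightarrow> 'd \<Rightarrow> real \<Rightarrow> 'w \<Rightarrow> nat" where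
  "renewal_processes X r i t \<omega> = renewal_count (\<lambda>k. X i k \<omega>) (r i) t"

text \<open>
  In the following, \<open>A\<close> and \<open>S\<close> are the arrival and potential service processes, \<open>B\<close> is the
  control, and \<open>c\<close> is a scaling factor.
\<close>
definition effort :: "(real \<Rightarrow> 'w \<Rightarrow> real^'d) \<Rightarrow> 'd \<Rightarrow> real \<Rightarrow> 'w \<Rightarrow> real" where
  "effort B i t \<omega> = integral {0..t} (\<lambda>s. B s \<omega> $ i)"

definition departures ::
  "('d \<Rightarrow> real \<Rightarrow> 'w \<Rightarrow> nat) \<Rightarrow> (real \<Rightarrow> 'w \<Rightarrow> real^'d) \<Rightarrow> 'd \<Rightarrow> real \<Rightarrow> 'w \<Rightarrow> nat" where
  "departures S B i t \<omega> = S i (effort B i t \<omega>) \<omega>"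

definition queue_length ::
  "('d \<Rightarrow> real \<Rightarrow> 'w \<Rightarrow> nat) \<Rightarrow> ('d \<Rightarrow> real \<Rightarrow> 'w \<Rightarrow> nat) \<Rightarrow> (real \<Rightarrow> 'w \<Rightarrow> real^'d) \<Rightarrow>
   'd \<Rightarrow> real \<Rightarrow> 'w \<Rightarrow> real" where
  "queue_length A S B i t \<omega> = real (A i t \<omega>) - real (departures S B i t \<omega>)"

definition scaled_queue ::
  "real \<Rightarrow> ('d::finite \<Rightarrow> real \<Rightarrow> 'w \<Rightarrow> nat) \<Rightarrow> ('d \<Rightarrow> real \<Rightarrow> 'w \<Rightarrow> nat) \<Rightarrow> (real \<Rightarrow> 'w \<Rightarrow> real^'d) \<Rightarrow>
   real \<Rightarrow> 'w \<Rightarrow> real^'d" where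
  "scaled_queue c A S B t \<omega> = (\<chi> i. queue_length A S B i t \<omega> / c)"

definition scaled_deviation ::
  "real \<Rightarrow> ('d::finite \<Rightarrow> real) \<Rightarrow> ('d \<Rightarrow> real \<Rightarrow> 'w \<Rightarrow> nat) \<Rightarrow> real \<Rightarrow> 'w \<Rightarrow> real^'d" where
  "scaled_deviation c r N t \<omega> = (\<chi> i. (real (N i t \<omega>) - r i * t) / c)"

definition effort_set :: "(real^'d::finite) set" where
  "effort_set = {x. (\<forall>i. 0 \<le> x $ i \<and> x $ i \<le> 1) \<and> (\<Sum>i\<in>UNIV. x $ i) \<le> 1}"

definition observed_filtration ::
  "'w measure \<Rightarrow> ('d \<Rightarrow> real \<Rightarrow> 'w \<Rightarrow> nat) \<Rightarrow> ('d \<Rightarrow> real \<Rightarrow> 'w \<Rightarrow> nat) \<Rightarrow>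
   (real \<Rightarrow> 'w \<Rightarrow> real^'d) \<Rightarrow> real \<Rightarrow> 'w measure" where
  "observed_filtration M A S B t = sigma (space M)
     ({{\<omega> \<in> space M. A i s \<omega> = k} | i s k. s \<in> {0..t}} \<union>
      {{\<omega> \<in> space M. departures S B i s \<omega> = k} | i s k. s \<in> {0..t}})"

text \<open>
  Path properties hold almost surely, because on a null event the renewal processes may fail
  to have finite values.
\<close>
definition admissible_control ::
  "'w measure \<Rightarrow> real \<Rightarrow> ('d::finite \<Rightarrow> real \<Rightarrow> 'w \<Rightarrow> nat) \<Rightarrow> ('d \<Rightarrow> real \<Rightarrow> 'w \<Rightarrow> nat) \<Rightarrow>
   (real \<Rightarrow> 'w \<Rightarrow> real^'d) \<Rightarrow> bool" where
  "admissible_control M T A S B \<longleftrightarrow>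
     (\<forall>t\<in>{0..T}. B t \<in> borel_measurable M) \<and>
     (\<forall>t\<in>{0..T}. \<forall>\<omega>\<in>space M. B t \<omega> \<in> effort_set) \<and>
     (AE \<omega> in M. rcll_on T (\<lambda>t. B t \<omega>)) \<and>
     (\<forall>t\<in>{0..T}. B t \<in> borel_measurable (observed_filtration M A S B t)) \<and>
     (AE \<omega> in M. \<forall>t\<in>{0..T}. \<forall>i. queue_length A S B i t \<omega> = 0 \<longrightarrow> B t \<omega> $ i = 0)"

definition total_cost :: "('d::finite \<Rightarrow> real \<Rightarrow> real) \<Rightarrow> real^'d \<Rightarrow> real" where
  "total_cost C x = (\<Sum>i\<in>UNIV. C i (x $ i))"

definition risk_sensitive_cost ::
  "'w measure \<Rightarrow> real \<Rightarrow> ('d::finite \<Rightarrow> real \<Rightarrow> real) \<Rightarrow> real \<Rightarrow> (real \<Rightarrow> 'w \<Rightarrow> real^'d) \<Rightarrow> ereal" where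
  "risk_sensitive_cost M T C \<beta> Q = ereal (1 / \<beta>\<^sup>2) *
     ln_ennreal (\<integral>\<^sup>+\<omega>. ennreal (exp (\<beta>\<^sup>2 * integral {0..T} (\<lambda>t. total_cost C (Q t \<omega>)))) \<partial>M)"

text \<open>\<open>C' k\<close> is the derivative of the cost function of class \<open>k\<close>.\<close>
definition priority_region ::
  "('d::{finite,linorder} \<Rightarrow> real) \<Rightarrow> ('d \<Rightarrow> real \<Rightarrow> real) \<Rightarrow> 'd \<Rightarrow> (real, 'd) vec set" where
  "priority_region \<mu> C' i =
     {q. (\<forall>k. 0 \<le> q $ k) \<and> q \<noteq> 0 \<and>
         i = Min {k. \<mu> k * C' k (q $ k) = (MAX j. \<mu> j * C' j (q $ j))}}"

definition generalized_cmu ::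
  "'w measure \<Rightarrow> real \<Rightarrow> ('d::{finite,linorder} \<Rightarrow> real) \<Rightarrow> ('d \<Rightarrow> real \<Rightarrow> real) \<Rightarrow> real \<Rightarrow>
   ('d \<Rightarrow> real \<Rightarrow> 'w \<Rightarrow> nat) \<Rightarrow> ('d \<Rightarrow> real \<Rightarrow> 'w \<Rightarrow> nat) \<Rightarrow> (real \<Rightarrow> 'w \<Rightarrow> (real, 'd) vec) \<Rightarrow> bool" where
  "generalized_cmu M T \<mu> C' c A S B \<longleftrightarrow>
     admissible_control M T A S B \<and>
     (AE \<omega> in M. \<forall>t\<in>{0..T}. \<forall>i.
        B t \<omega> $ i = indicator (priority_region \<mu> C' i) (scaled_queue c A S B t \<omega>))"


section \<open>The differential game\<close>

definition game_data :: "real \<Rightarrow> (real \<Rightarrow> (real^'d::finite) \<times> (real^'d)) set" where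
  "game_data T = {\<psi> \<in> mspace (cont_metric T). \<psi> 0 = 0}"

definition game_controls :: "real \<Rightarrow> ('d::finite \<Rightarrow> real) \<Rightarrow> (real \<Rightarrow> real^'d) set" where
  "game_controls T \<mu> =
     {\<zeta> \<in> mspace (cont_metric T).
        (\<chi> i. 1 / \<mu> i) \<bullet> \<zeta> 0 = 0 \<and> mono_on {0..T} (\<lambda>t. (\<chi> i. 1 / \<mu> i) \<bullet> \<zeta> t)}"

definition time_scale :: "('d::finite \<Rightarrow> real) \<Rightarrow> (real \<Rightarrow> real^'d) \<Rightarrow> real \<Rightarrow> real^'d" where
  "time_scale \<rho> \<psi> t = (\<chi> i. \<psi> (\<rho> i * t) $ i)"

definition game_dynamics ::
  "('d::finite \<Rightarrow> real) \<Rightarrow> real^'d \<Rightarrow> (real \<Rightarrow> (real^'d) \<times> (real^'d)) \<Rightarrow> (real \<Rightarrow> real^'d) \<Rightarrow>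
   real \<Rightarrow> real^'d" where
  "game_dynamics \<rho> y \<psi> \<zeta> t =
     t *\<^sub>R y + fst (\<psi> t) - time_scale \<rho> (\<lambda>s. snd (\<psi> s)) t + \<zeta> t"

definition game_strategies ::
  "real \<Rightarrow> ('d::finite \<Rightarrow> real) \<Rightarrow> ('d \<Rightarrow> real) \<Rightarrow>
   ((real \<Rightarrow> (real^'d) \<times> (real^'d)) \<Rightarrow> (real \<Rightarrow> real^'d)) set" where
  "game_strategies T \<mu> \<rho> =
     {\<alpha>. \<alpha> \<in> borel_sigma (subtopology (mtopology_of (cont_metric T)) (game_data T))
             \<rightarrow>\<^sub>M borel_sigma (subtopology (mtopology_of (cont_metric T)) (game_controls T \<mu>)) \<and>
         (\<forall>\<psi>\<in>game_data T. \<forall>\<psi>'\<in>game_data T. \<forall>t\<in>{0..T}.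
            (\<forall>s\<in>{0..t}. fst (\<psi> s) = fst (\<psi>' s) \<and>
               time_scale \<rho> (\<lambda>r. snd (\<psi> r)) s = time_scale \<rho> (\<lambda>r. snd (\<psi>' r)) s)
            \<longrightarrow> (\<forall>s\<in>{0..t}. \<alpha> \<psi> s = \<alpha> \<psi>' s))}"

definition admissible_strategies ::
  "real \<Rightarrow> ('d::finite \<Rightarrow> real) \<Rightarrow> ('d \<Rightarrow> real) \<Rightarrow> real^'d \<Rightarrow>
   ((real \<Rightarrow> (real^'d) \<times> (real^'d)) \<Rightarrow> (real \<Rightarrow> real^'d)) set" where
  "admissible_strategies T \<mu> \<rho> y =
     {\<alpha> \<in> game_strategies T \<mu> \<rho>. \<forall>\<psi>\<in>game_data T. \<forall>t\<in>{0..T}. \<forall>i.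
        0 \<le> game_dynamics \<rho> y \<psi> (\<alpha> \<psi>) t $ i}"

text \<open>\<open>I\<close> is the rate function.\<close>
definition game_cost ::
  "real \<Rightarrow> ('d::finite \<Rightarrow> real) \<Rightarrow> real^'d \<Rightarrow> ('d \<Rightarrow> real \<Rightarrow> real) \<Rightarrow>
   ((real \<Rightarrow> (real^'d) \<times> (real^'d)) \<Rightarrow> ereal) \<Rightarrow>
   (real \<Rightarrow> (real^'d) \<times> (real^'d)) \<Rightarrow> (real \<Rightarrow> real^'d) \<Rightarrow> ereal" where
  "game_cost T \<rho> y C I \<psi> \<zeta> =
     ereal (integral {0..T} (\<lambda>t. total_cost C (game_dynamics \<rho> y \<psi> \<zeta> t))) - I \<psi>"

definition game_value ::
  "real \<Rightarrow> ('d::finite \<Rightarrow> real) \<Rightarrow> ('d \<Rightarrow> real) \<Rightarrow> real^'d \<Rightarrow> ('d \<Rightarrow> real \<Rightarrow> real) \<Rightarrow>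
   ((real \<Rightarrow> (real^'d) \<times> (real^'d)) \<Rightarrow> ereal) \<Rightarrow> ereal" where
  "game_value T \<mu> \<rho> y C I =
     (INF \<alpha>\<in>admissible_strategies T \<mu> \<rho> y. SUP \<psi>\<in>game_data T. game_cost T \<rho> y C I \<psi> (\<alpha> \<psi>))"

end

theory Submission
  imports Defs
begin

text \<open>
  Both the limit of the costs and the value of the game equal the supremum, over the paths
  \<open>\<psi>\<close> that start at zero, of \<open>path_cost \<psi> - I \<psi>\<close>, where \<open>path_cost \<psi>\<close> is the cost of
  the best response to \<open>\<psi>\<close>. The reason is a reduction to one dimension. The workload
  \<open>\<theta> \<bullet> x\<close> of a queue vector \<open>x\<close> reacts to a control only through a non-decreasing
  term, hence it is at least the reflection at zero of the workload of the free path
  (\<open>reflected_minimal\<close>). Among all queue vectors of a given workload there is a cheapest one, the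
  equilibrium, at which the indices \<open>\<mu>\<^sub>i C\<^sub>i'(x\<^sub>i)\<close> coincide.

  In the game, the control that keeps the workload at the reflection and the queues at the
  equilibrium is causal, continuous and optimal against every path at once. Infimum and supremum
  can therefore be exchanged, which is \<open>game_value_eq\<close>.

  In the queueing system, the workload under a work-conserving rule is the reflection of its own
  input (\<open>pre_workload_eq_reflected\<close>), and the generalized \<open>c\<mu>\<close> rule never serves a class that
  holds less than its equilibrium share. Such a class is refilled within a time that is negligible
  for the scaled path, so all queues stay near the equilibrium (\<open>state_space_collapse\<close>).
  Consequently, if the scaled arrivals and services stay within \<open>\<delta>\<close> of \<open>\<psi>\<close>, then the cost is
  within a multiple of \<open>\<delta>\<close> of \<open>path_cost \<psi>\<close> (\<open>cost_tracks_path_cost\<close>). This estimate holds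
  path by path.

  It remains to apply the Laplace principle. For the lower bound, one open tube around a nearly optimal
  \<open>\<psi>\<close> suffices. For the upper bound, a level set of the rate function is covered by finitely many
  closed tubes; outside of them the large deviation bound is strong, and the exponential moments
  dominate the cost, which grows linearly in the deviations. Finiteness of the cover rests on the
  equicontinuity of the level sets. As the rate function is written with the pointwise derivative
  of an absolutely continuous function, this needs the theorem of Lebesgue that such a
  function is differentiable almost everywhere and is the integral of its derivative; it is
  derived from the covering theorem of Vitali.
\<close>

section \<open>Absolutely continuous functions\<close>

lemma sum_increments_division:
  fixes f :: "real \<Rightarrow> real"
  assumes "q division_of {a..b}" "a \<le> b"
  shows "(\<Sum>K\<in>q. f (Sup K) - f (Inf K)) = f b - f a"
proof -
  have K: "\<exists>u v. u \<le> v \<and> K = {u..v}" if "K \<in> q" for K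
    using division_ofD(3,4)[OF assms(1) that] by (metis atLeastatMost_empty_iff box_real(2))
  have "(\<lambda>K. (Inf K, K)) ` q tagged_division_of {a..b}"
  proof (rule tagged_division_ofI)
    show "finite ((\<lambda>K. (Inf K, K)) ` q)" using assms(1) by auto
    fix x k assume "(x, k) \<in> (\<lambda>K. (Inf K, K)) ` q"
    then have k: "k \<in> q" "x = Inf k" by auto
    then show "x \<in> k" using K[OF k(1)] by auto
    show "k \<subseteq> {a..b}" using division_ofD(2)[OF assms(1) k(1)] .
    show "\<exists>a b. k = cbox a b" using division_ofD(4)[OF assms(1) k(1)] .
  next
    fix x1 k1 x2 k2
    assume "(x1, k1) \<in> (\<lambda>K. (Inf K, K)) ` q" "(x2, k2) \<in> (\<lambda>K. (Inf K, K)) ` q" "(x1, k1) \<noteq> (x2, k2)"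
    then show "interior k1 \<inter> interior k2 = {}"
      using division_ofD(5)[OF assms(1), of k1 k2] by auto
  next
    show "\<Union> {k. \<exists>x. (x, k) \<in> (\<lambda>K. (Inf K, K)) ` q} = {a..b}"
    proof -
      have "{k. \<exists>x. (x, k) \<in> (\<lambda>K. (Inf K, K)) ` q} = q" by auto
      then show ?thesis using division_ofD(6)[OF assms(1)] by simp
    qed
  qed
  from additive_tagged_division_1[OF assms(2) this, of f]
  show ?thesis
    by (subst (asm) sum.reindex) (auto simp: inj_on_def)
qed

text \<open>The coverings below produce disjoint intervals in the form of divisions, whereas the
  definition of absolute continuity enumerates them by natural numbers.\<close>
lemma abs_continuous_on_division:
  fixes f :: "real \<Rightarrow> real"
  assumes "abs_continuous_on a b f" "\<epsilon> > 0"
  shows "\<exists>\<delta>>0. \<forall>\<D>. \<D> division_of \<Union>\<D> \<longrightarrow> \<Union>\<D> \<subseteq> {a..b} \<longrightarrow> (\<Sum>K\<in>\<D>. Sup K - Inf K) < \<delta> \<longrightarrow>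
       (\<Sum>K\<in>\<D>. \<bar>f (Sup K) - f (Inf K)\<bar>) < \<epsilon>"
proof -
  obtain \<delta> where \<delta>: "\<delta> > 0" and *: "\<forall>(m::nat) (u::nat \<Rightarrow> real) (v::nat \<Rightarrow> real).
        (\<forall>k<m. a \<le> u k \<and> u k \<le> v k \<and> v k \<le> b) \<and>
        (\<forall>j<m. \<forall>k<m. j \<noteq> k \<longrightarrow> {u j<..<v j} \<inter> {u k<..<v k} = {}) \<and>
        (\<Sum>k<m. v k - u k) < \<delta>
        \<longrightarrow> (\<Sum>k<m. norm (f (v k) - f (u k))) < \<epsilon>"
    using mp[OF spec[OF assms(1)[unfolded abs_continuous_on_def]] assms(2)]
    by (elim exE conjE) (rule that)
  show ?thesis
  proof (intro exI[of _ \<delta>] conjI \<delta> allI impI)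
    fix \<D> :: "real set set"
    assume D: "\<D> division_of \<Union>\<D>" "\<Union>\<D> \<subseteq> {a..b}" "(\<Sum>K\<in>\<D>. Sup K - Inf K) < \<delta>"
    have K: "\<exists>u v. u \<le> v \<and> K = {u..v}" if "K \<in> \<D>" for K
      using division_ofD(3,4)[OF D(1) that] by (metis atLeastatMost_empty_iff box_real(2))
    obtain h where h: "bij_betw h {..<card \<D>} \<D>"
      using ex_bij_betw_nat_finite[of \<D>] division_ofD(1)[OF D(1)] by (auto simp: atLeast0LessThan)
    have hD: "h k \<in> \<D>" if "k < card \<D>" for k using h that by (auto simp: bij_betw_def)
    have "(\<Sum>k<card \<D>. norm (f (Sup (h k)) - f (Inf (h k)))) < \<epsilon>"
    proof (rule *[rule_format], intro conjI allI impI)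
      fix k assume k: "k < card \<D>"
      obtain u v where uv: "u \<le> v" "h k = {u..v}" using K[OF hD[OF k]] by blast
      moreover have "h k \<subseteq> {a..b}" using hD[OF k] D(2) by auto
      ultimately show "a \<le> Inf (h k)" "Inf (h k) \<le> Sup (h k)" "Sup (h k) \<le> b" by auto
      fix j assume j: "j < card \<D>" and ne: "j \<noteq> k"
      obtain u' v' where uv': "u' \<le> v'" "h j = {u'..v'}" using K[OF hD[OF j]] by blast
      have "h j \<noteq> h k" using h j k ne by (auto simp: bij_betw_def inj_on_def)
      then have "interior (h j) \<inter> interior (h k) = {}"
        using division_ofD(5)[OF D(1) hD[OF j] hD[OF k]] by simp
      then show "{Inf (h j)<..<Sup (h j)} \<inter> {Inf (h k)<..<Sup (h k)} = {}"
        using uv uv' by (simp add: interior_atLeastAtMost_real)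
    next
      show "(\<Sum>k<card \<D>. Sup (h k) - Inf (h k)) < \<delta>"
        using D(3) sum.reindex_bij_betw[OF h, of "\<lambda>K. Sup K - Inf K"] by simp
    qed
    then show "(\<Sum>K\<in>\<D>. \<bar>f (Sup K) - f (Inf K)\<bar>) < \<epsilon>"
      using sum.reindex_bij_betw[OF h, of "\<lambda>K. \<bar>f (Sup K) - f (Inf K)\<bar>"] by simp
  qed
qed

lemma measure_division_eq:
  fixes \<D> :: "real set set"
  assumes "\<D> division_of S"
  shows "(\<Sum>K\<in>\<D>. Sup K - Inf K) = measure lebesgue S" "S \<in> lmeasurable"
proof -
  have "(\<Sum>K\<in>\<D>. Sup K - Inf K) = sum (measure lebesgue) \<D>"
  proof (rule sum.cong[OF refl])
    fix K assume "K \<in> \<D>"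
    then obtain u v where "u \<le> v" "K = {u..v}"
      using division_ofD(3,4)[OF assms] by (metis atLeastatMost_empty_iff box_real(2))
    then show "Sup K - Inf K = measure lebesgue K" by simp
  qed
  then show "(\<Sum>K\<in>\<D>. Sup K - Inf K) = measure lebesgue S"
    using content_division[OF assms] by simp
  show "S \<in> lmeasurable"
    using lmeasurable_division[OF assms] .
qed

text \<open>The covering theorem of Vitali provides countably many intervals that miss a null set.
  Keeping only finitely many of them loses in addition a set of small measure; in exchange the
  intervals can be inserted in the definition of absolute continuity.\<close>
lemma vitali_finite_intervals:
  fixes E O' :: "real set"
  assumes O': "open O'" "O' \<subseteq> {a..b}" and EO: "E \<subseteq> O'"
    and cov: "\<And>x d. x \<in> E \<Longrightarrow> d > 0 \<Longrightarrow> \<exists>u v. u < v \<and> x \<in> {u..v} \<and> v - u < d \<and> P u v"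
    and \<eta>: "\<eta> > 0"
  obtains \<I> N where "\<I> division_of \<Union>\<I>" "\<Union>\<I> \<subseteq> O'" "\<And>K. K \<in> \<I> \<Longrightarrow> \<exists>u v. u < v \<and> K = {u..v} \<and> P u v"
    "N \<in> lmeasurable" "measure lebesgue N < \<eta>" "E \<subseteq> \<Union>\<I> \<union> N"
proof -
  define C0 where "C0 = {(u, v). u < v \<and> P u v \<and> {u..v} \<subseteq> O'}"
  define m r where "m = (\<lambda>(u::real, v). (u + v) / 2)" and "r = (\<lambda>(u::real, v). (v - u) / 2)"
  have cb: "cball (m i) (r i) = {fst i..snd i}" for i
    unfolding m_def r_def by (cases i) (simp add: cball_eq_atLeastAtMost field_simps)
  have r0: "0 < r i" if "i \<in> C0" for i using that by (auto simp: C0_def r_def)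
  have vit: "\<exists>i. i \<in> C0 \<and> x \<in> cball (m i) (r i) \<and> r i < d" if x: "x \<in> E" and d: "d > 0" for x d
  proof -
    obtain e where e: "e > 0" "ball x e \<subseteq> O'" using O'(1) EO x openE by blast
    obtain u v where uv: "u < v" "x \<in> {u..v}" "v - u < min e d" "P u v"
      using cov[OF x, of "min e d"] e d by auto
    have "{u..v} \<subseteq> ball x e" using uv by (auto simp: dist_real_def)
    then show ?thesis using uv e unfolding cb by (intro exI[of _ "(u, v)"]) (auto simp: C0_def r_def)
  qed
  obtain C where C: "countable C" "C \<subseteq> C0"
    "pairwise (\<lambda>i j. disjnt (cball (m i) (r i)) (cball (m j) (r j))) C"
    "negligible (E - (\<Union>i\<in>C. cball (m i) (r i)))"
    by (rule Vitali_covering_theorem_cballs[of C0 r E m, OF r0 vit])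
  have CD: "fst i < snd i" "P (fst i) (snd i)" "{fst i..snd i} \<subseteq> O'" if "i \<in> C" for i
    using subsetD[OF C(2) that] unfolding C0_def by (simp_all add: case_prod_beta)
  define I where "I i = {fst i..snd i}" for i :: "real \<times> real"
  show thesis
  proof (cases "C = {}")
    case True
    then show ?thesis using C(4) \<eta> by (intro that[of "{}" E]) (auto simp: negligible_iff_measure)
  next
    case False
    define A where "A n = (\<Union>i\<in>from_nat_into C ` {..<n}. I i)" for n
    have U: "(\<Union>n. A n) = (\<Union>i\<in>C. I i)"
    proof -
      have "(\<Union>n. A n) = (\<Union>i\<in>range (from_nat_into C). I i)" unfolding A_def by auto
      then show ?thesis using range_from_nat_into[OF False C(1)] by simp
    qed
    have Am: "A n \<in> lmeasurable" for n unfolding A_def I_def by (intro fmeasurable.finite_UN) auto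
    have "(\<Union>i\<in>C. I i) \<subseteq> {a..b}" using CD(3) O'(2) unfolding I_def by blast
    then have Ul: "(\<Union>n. A n) \<in> lmeasurable"
      proof -
      have "(\<Union>n. A n) \<in> sets lebesgue" using Am by (intro sets.countable_UN) (auto simp: fmeasurableD)
      with \<open>(\<Union>i\<in>C. I i) \<subseteq> {a..b}\<close> show ?thesis
        unfolding U by - (rule fmeasurableI2[of "{a..b}"], auto)
    qed
    have "(\<lambda>n. measure lebesgue (A n)) \<longlonglongrightarrow> measure lebesgue (\<Union>n. A n)"
    proof (rule Lim_measure_incseq)
      show "incseq A" unfolding A_def by (rule incseq_SucI) force
      show "range A \<subseteq> sets lebesgue" using Am fmeasurableD by blast
      show "emeasure lebesgue (\<Union>n. A n) \<noteq> \<infinity>" using fmeasurableD2[OF Ul] by simp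
    qed
    from order_tendstoD(1)[OF this, of "measure lebesgue (\<Union>n. A n) - \<eta>"] \<eta>
    obtain n where n: "measure lebesgue (\<Union>n. A n) - \<eta> < measure lebesgue (A n)"
      by (auto simp: eventually_sequentially)
    let ?D = "I ` from_nat_into C ` {..<n}"
    have inC: "from_nat_into C k \<in> C" for k using from_nat_into[OF False] .
    have d: "?D division_of \<Union>?D"
      unfolding division_of_def
    proof (intro conjI ballI impI)
      fix K1 K2 assume K: "K1 \<in> ?D" "K2 \<in> ?D" "K1 \<noteq> K2"
      then obtain i j where ij: "i \<in> C" "j \<in> C" "K1 = I i" "K2 = I j" using inC by blast
      then have "i \<noteq> j" using K by auto
      then have "disjnt (I i) (I j)" using C(3) ij unfolding pairwise_def cb I_def by blast
      then show "interior K1 \<inter> interior K2 = {}"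
        using ij interior_subset unfolding disjnt_def by blast
    next
      fix K assume "K \<in> ?D"
      then obtain i where i: "i \<in> C" "K = I i" using inC by blast
      then show "K \<noteq> {}" using CD(1)[OF i(1)] unfolding I_def by simp
      show "\<exists>a b. K = cbox a b" using i by (auto simp: I_def box_real(2)[symmetric] simp del: box_real)
    qed auto
    have AD: "A n = \<Union>?D" unfolding A_def by auto
    show ?thesis
    proof (rule that[OF d, of "(E - (\<Union>i\<in>C. I i)) \<union> ((\<Union>n. A n) - A n)"])
      show "\<Union>?D \<subseteq> O'"
        using inC CD(3) unfolding I_def by blast
      show "\<exists>u v. u < v \<and> K = {u..v} \<and> P u v" if K: "K \<in> ?D" for K
      proof -
        from K obtain k where "K = I (from_nat_into C k)" by blast
        then obtain i where "i \<in> C" "K = I i" using inC[of k] by metis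
        then show ?thesis using CD unfolding I_def by (intro exI[of _ "fst i"] exI[of _ "snd i"]) simp
      qed
      have ng: "negligible (E - (\<Union>i\<in>C. I i))" using C(4) unfolding cb I_def .
      have Dl: "(\<Union>n. A n) - A n \<in> lmeasurable" using Ul Am by (simp add: fmeasurable_Diff fmeasurableD)
      then show "(E - (\<Union>i\<in>C. I i)) \<union> ((\<Union>n. A n) - A n) \<in> lmeasurable"
        using ng by (intro fmeasurable.Un) (auto simp: negligible_iff_measure)
      have "measure lebesgue ((E - (\<Union>i\<in>C. I i)) \<union> ((\<Union>n. A n) - A n)) \<le>
          measure lebesgue (E - (\<Union>i\<in>C. I i)) + measure lebesgue ((\<Union>n. A n) - A n)"
        using ng Dl by (intro measure_Un_le) (auto simp: negligible_iff_measure fmeasurableD)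
      also have "\<dots> = measure lebesgue ((\<Union>n. A n) - A n)"
        using ng by (simp add: negligible_iff_measure)
      also have "\<dots> = measure lebesgue (\<Union>n. A n) - measure lebesgue (A n)"
        using Ul Am by (intro measurable_measure_Diff) (auto simp: fmeasurableD)
      finally show "measure lebesgue ((E - (\<Union>i\<in>C. I i)) \<union> ((\<Union>n. A n) - A n)) < \<eta>"
        using n by simp
      show "E \<subseteq> \<Union>?D \<union> ((E - (\<Union>i\<in>C. I i)) \<union> ((\<Union>n. A n) - A n))"
        using AD U by auto
    qed
  qed
qed

lemma open_superset_small:
  fixes E :: "real set"
  assumes "E \<subseteq> T" "T \<in> lmeasurable" "measure lebesgue T < e" "E \<subseteq> {a<..<b}"
  obtains O' where "open O'" "E \<subseteq> O'" "O' \<subseteq> {a<..<b}" "measure lebesgue O' < e" "O' \<in> lmeasurable"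
proof -
  obtain U where U: "open U" "T \<subseteq> U" "U - T \<in> lmeasurable"
    "emeasure lebesgue (U - T) < ennreal (e - measure lebesgue T)"
    by (rule sets_lebesgue_outer_open[of T "e - measure lebesgue T"]) (use assms(2,3) in \<open>auto simp: fmeasurableD\<close>)
  have m: "measure lebesgue (U - T) < e - measure lebesgue T"
    using U(3,4) assms(3) by (simp add: emeasure_eq_measure2 ennreal_less_iff)
  have Ul: "U \<in> lmeasurable"
  proof -
    have "U = T \<union> (U - T)" using U by auto
    then show ?thesis using assms(2) U(3) by (metis fmeasurable.Un)
  qed
  have O'l: "U \<inter> {a<..<b} \<in> lmeasurable"
    using U(1) by - (rule fmeasurableI2[of "{a<..<b}"], auto)
  have "measure lebesgue (U \<inter> {a<..<b}) \<le> measure lebesgue U"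
    using Ul O'l by (intro measure_mono_fmeasurable) (auto simp: fmeasurableD)
  also have "\<dots> = measure lebesgue (U - T) + measure lebesgue T"
    using measurable_measure_Diff[OF Ul, of T] assms(2) U(2) by (simp add: fmeasurableD)
  also have "\<dots> < e" using m by simp
  finally show thesis
    using U assms O'l by (intro that[of "U \<inter> {a<..<b}"]) auto
qed

text \<open>Let \<open>e\<close> be the outer measure of the set. Cover the set, up to a small part, by
  intervals of slope above \<open>r\<close>, and inside their interiors again by intervals of slope below
  \<open>- r\<close>. Both families have total length close to \<open>e\<close>, so the first exceeds the second by
  intervals of small total length, on which absolute continuity makes the increments of \<open>f\<close>
  small. Hence the increments of \<open>f\<close> over the two families almost agree, although they are about
  \<open>r * e\<close> or more and \<open>- r * e\<close> or less. This forces \<open>e = 0\<close>. Outer measure is used since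
  measurability of the set is not obvious.\<close>
lemma negligible_oscillating_slopes:
  fixes f :: "real \<Rightarrow> real"
  assumes ac: "abs_continuous_on a b f" and r: "r > 0"
  shows "negligible {x\<in>{a<..<b}. \<forall>d>0.
      (\<exists>u v. u < v \<and> x \<in> {u..v} \<and> v - u < d \<and> f v - f u > r * (v - u)) \<and>
      (\<exists>u v. u < v \<and> x \<in> {u..v} \<and> v - u < d \<and> f v - f u < - r * (v - u))}" (is "negligible ?E")
proof (rule ccontr)
  let ?inc = "\<lambda>K. f (Sup K) - f (Inf K)"
  let ?len = "\<lambda>K::real set. Sup K - Inf K"
  assume "\<not> negligible ?E"
  define e where "e = Inf {measure lebesgue T |T. ?E \<subseteq> T \<and> T \<in> lmeasurable}"
  have elow: "e \<le> measure lebesgue T" if "?E \<subseteq> T" "T \<in> lmeasurable" for T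
    unfolding e_def using that by (intro cInf_lower bdd_belowI[of _ 0]) auto
  have ne: "{measure lebesgue T |T. ?E \<subseteq> T \<and> T \<in> lmeasurable} \<noteq> {}"
  proof -
    have "?E \<subseteq> {a..b}" by auto
    moreover have "{a..b} \<in> lmeasurable" by simp
    ultimately show ?thesis by blast
  qed
  have epos: "e > 0"
  proof -
    obtain e0 where e0: "e0 > 0" "\<And>T. ?E \<subseteq> T \<Longrightarrow> T \<in> lmeasurable \<Longrightarrow> e0 \<le> measure lebesgue T"
      using \<open>\<not> negligible ?E\<close> unfolding negligible_outer by (meson not_less)
    then have "e0 \<le> e" unfolding e_def by (intro cInf_greatest[OF ne]) auto
    then show ?thesis using e0 by simp
  qed
  have re: "r * e / 2 > 0" using r epos by simp
  obtain \<delta> where \<delta>: "\<delta> > 0" and ac0: "\<forall>\<D>. \<D> division_of \<Union>\<D> \<longrightarrow> \<Union>\<D> \<subseteq> {a..b} \<longrightarrow> sum ?len \<D> < \<delta> \<longrightarrow>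
       (\<Sum>K\<in>\<D>. \<bar>?inc K\<bar>) < r * e / 2"
    using abs_continuous_on_division[OF ac re] by (elim exE conjE) (rule that)
  note ac' = ac0[rule_format]
  (* eight small losses: the lengths of the two families differ by at most 3 * \<eta> < \<delta>, and 2 * e - 3 * \<eta> > e / 2 *)
  define \<eta> where "\<eta> = min \<delta> e / 8"
  have \<eta>: "\<eta> > 0" "8 * \<eta> \<le> \<delta>" "8 * \<eta> \<le> e" using \<delta> epos by (auto simp: \<eta>_def)
  obtain T where T: "?E \<subseteq> T" "T \<in> lmeasurable" "measure lebesgue T < e + \<eta>"
    using cInf_lessD[OF ne, of "e + \<eta>"] \<eta>(1) unfolding e_def[symmetric] by auto
  obtain O' where O': "open O'" "?E \<subseteq> O'" "O' \<subseteq> {a<..<b}" "measure lebesgue O' < e + \<eta>" "O' \<in> lmeasurable"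
    by (rule open_superset_small[OF T, of a b]) auto
  have Oab: "O' \<subseteq> {a..b}" using O'(3) by auto
  have cov1: "\<exists>u v. u < v \<and> x \<in> {u..v} \<and> v - u < d \<and> f v - f u > r * (v - u)"
    and cov2: "\<exists>u v. u < v \<and> x \<in> {u..v} \<and> v - u < d \<and> f v - f u < - r * (v - u)"
    if "x \<in> ?E" "d > 0" for x d using that by blast+
  obtain \<I> N1 where I: "\<I> division_of \<Union>\<I>" "\<Union>\<I> \<subseteq> O'"
     "\<And>K. K \<in> \<I> \<Longrightarrow> \<exists>u v. u < v \<and> K = {u..v} \<and> f v - f u > r * (v - u)"
    "N1 \<in> lmeasurable" "measure lebesgue N1 < \<eta>" "?E \<subseteq> \<Union>\<I> \<union> N1"
    by (rule vitali_finite_intervals[OF O'(1) Oab O'(2) cov1 \<eta>(1)]) (assumption | rule that)+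
  define O2 where "O2 = (\<Union>K\<in>\<I>. interior K)"
  have O2: "open O2" "O2 \<subseteq> \<Union>\<I>" unfolding O2_def using interior_subset by (auto simp: open_UN)
  then have O2ab: "O2 \<subseteq> {a..b}" using I(2) Oab by blast
  have cov2': "\<exists>u v. u < v \<and> x \<in> {u..v} \<and> v - u < d \<and> f v - f u < - r * (v - u)"
    if "x \<in> ?E \<inter> O2" "d > 0" for x d using that cov2 by blast
  have EO2: "?E \<inter> O2 \<subseteq> O2" by blast
  obtain \<J> N2 where J: "\<J> division_of \<Union>\<J>" "\<Union>\<J> \<subseteq> O2"
     "\<And>K. K \<in> \<J> \<Longrightarrow> \<exists>u v. u < v \<and> K = {u..v} \<and> f v - f u < - r * (v - u)"
    "N2 \<in> lmeasurable" "measure lebesgue N2 < \<eta>" "?E \<inter> O2 \<subseteq> \<Union>\<J> \<union> N2"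
    by (rule vitali_finite_intervals[OF O2(1) O2ab EO2 cov2' \<eta>(1)]) (assumption | rule that)+
  have ab: "a \<le> b" using epos \<open>\<not> negligible ?E\<close> by (rule_tac ccontr) auto
  have Iab: "\<Union>\<I> \<subseteq> cbox a b" using I(2) Oab by auto
  obtain q1 where q1: "\<I> \<subseteq> q1" "q1 division_of cbox a b"
    by (rule partial_division_extend_interval[OF I(1) Iab])
  define G1 where "G1 = q1 - \<I>"
  have G1d: "G1 division_of \<Union>G1" using q1(2) unfolding G1_def by (metis Diff_subset division_of_subset division_ofD(6))
  have GJ: "interior K \<inter> interior L = {}" if "K \<in> G1" "L \<in> \<J>" for K L
  proof -
    have "interior K \<inter> interior I' = {}" if "I' \<in> \<I>" for I'
      using that \<open>K \<in> G1\<close> q1 division_ofD(5)[OF q1(2), of K I'] unfolding G1_def by auto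
    then have "interior K \<inter> O2 = {}" unfolding O2_def by auto
    moreover have "interior L \<subseteq> O2" using that J(2) interior_subset by blast
    ultimately show ?thesis by auto
  qed
  have disj: "G1 \<inter> \<J> = {}"
  proof -
    have "interior K \<noteq> {}" if "K \<in> \<J>" for K using J(3)[OF that] by (auto simp: interior_atLeastAtMost_real)
    then show ?thesis using GJ by blast
  qed
  have GJd: "(G1 \<union> \<J>) division_of \<Union>(G1 \<union> \<J>)"
    unfolding division_of_def
  proof (intro conjI ballI impI)
    show "finite (G1 \<union> \<J>)" using G1d J(1) by blast
    fix K assume "K \<in> G1 \<union> \<J>"
    then show "K \<noteq> {}" "\<exists>a b. K = cbox a b"
      using division_ofD(3,4)[OF G1d] division_ofD(3,4)[OF J(1)] by blast+
    fix L assume "L \<in> G1 \<union> \<J>" "K \<noteq> L"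
    then show "interior K \<inter> interior L = {}"
      using \<open>K \<in> G1 \<union> \<J>\<close> GJ[of K L] GJ[of L K] division_ofD(5)[OF G1d, of K L] division_ofD(5)[OF J(1), of K L]
      by (simp add: Int_commute) blast
  qed auto
  have GJab: "\<Union>(G1 \<union> \<J>) \<subseteq> cbox a b"
    using division_ofD(6)[OF q1(2)] J(2) O2ab unfolding G1_def by auto
  obtain q2 where q2: "G1 \<union> \<J> \<subseteq> q2" "q2 division_of cbox a b"
    by (rule partial_division_extend_interval[OF GJd GJab])
  define G2 where "G2 = q2 - (G1 \<union> \<J>)"
  have G2d: "G2 division_of \<Union>G2" using q2(2) unfolding G2_def by (metis Diff_subset division_of_subset division_ofD(6))
  have fin: "finite q1" "finite q2" using q1 q2 by auto
  have s1: "sum h q1 = sum h G1 + sum h \<I>" for h :: "real set \<Rightarrow> real"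
    unfolding G1_def using sum.subset_diff[OF q1(1) fin(1)] by simp
  have s2: "sum h q2 = sum h G2 + (sum h G1 + sum h \<J>)" for h :: "real set \<Rightarrow> real"
    unfolding G2_def using sum.subset_diff[OF q2(1) fin(2)] sum.union_disjoint[of G1 \<J> h] disj
    fin q2(1) by (metis finite_Un finite_subset)
  have eqs: "sum h \<I> = sum h G2 + sum h \<J>" if "sum h q1 = sum h q2" for h :: "real set \<Rightarrow> real"
    using s1[of h] s2[of h] that by simp
  have inc: "sum ?inc \<I> = sum ?inc G2 + sum ?inc \<J>"
    using sum_increments_division[of q1 a b f] sum_increments_division[of q2 a b f] q1 q2 ab by (intro eqs) simp
  have len: "sum ?len \<I> = sum ?len G2 + sum ?len \<J>"
    using sum_increments_division[of q1 a b "\<lambda>x. x"] sum_increments_division[of q2 a b "\<lambda>x. x"] q1 q2 ab by (intro eqs) simp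
  have lI: "sum ?len \<I> = measure lebesgue (\<Union>\<I>)" "\<Union>\<I> \<in> lmeasurable" using measure_division_eq[OF I(1)] by auto
  have lJ: "sum ?len \<J> = measure lebesgue (\<Union>\<J>)" "\<Union>\<J> \<in> lmeasurable" using measure_division_eq[OF J(1)] by auto
  have lIle: "sum ?len \<I> < e + \<eta>"
    using measure_mono_fmeasurable[OF I(2), of lebesgue] lI O'(4,5) by (simp add: fmeasurableD)
  have lIge: "sum ?len \<I> \<ge> e - \<eta>"
    using elow[OF I(6)] measure_Un_le[of "\<Union>\<I>" lebesgue N1] lI I(4,5) by (simp add: fmeasurableD fmeasurable.Un)
  have lJge: "sum ?len \<J> \<ge> e - 2 * \<eta>"
  proof -
    define F where "F = (\<Union>K\<in>\<I>. K - interior K)"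
    have F: "negligible F" unfolding F_def
    proof (rule negligible_Union)
      show "finite ((\<lambda>K. K - interior K) ` \<I>)" using I(1) by auto
      fix t assume "t \<in> (\<lambda>K. K - interior K) ` \<I>"
      then obtain u v where "t = {u..v} - interior {u..v}" using I(3) by blast
      then have "t \<subseteq> {u, v}" by (auto simp: interior_atLeastAtMost_real)
      then show "negligible t" by (meson finite.intros negligible_finite negligible_subset)
    qed
    then have F': "F \<in> lmeasurable" "measure lebesgue F = 0" by (auto simp: negligible_iff_measure)
    have "?E \<subseteq> \<Union>\<J> \<union> N2 \<union> N1 \<union> F"
    proof
      fix x assume x: "x \<in> ?E"
      show "x \<in> \<Union>\<J> \<union> N2 \<union> N1 \<union> F"
      proof (cases "x \<in> O2")
        case True
        then show ?thesis using subsetD[OF J(6) IntI[OF x]] by blast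
      next
        case False
        then show ?thesis using subsetD[OF I(6) x] unfolding O2_def F_def by (elim UnE) auto
      qed
    qed
    from elow[OF this] have "e \<le> measure lebesgue (\<Union>\<J> \<union> N2 \<union> N1 \<union> F)"
      using lJ J(4) I(4) F' by (simp add: fmeasurable.Un)
    also have "\<dots> \<le> measure lebesgue (\<Union>\<J> \<union> N2 \<union> N1) + measure lebesgue F"
      using lJ J(4) I(4) F' by (intro measure_Un_le) (auto simp: fmeasurableD)
    also have "\<dots> \<le> measure lebesgue (\<Union>\<J> \<union> N2) + measure lebesgue N1 + measure lebesgue F"
      using lJ J(4) I(4) F' by (intro add_right_mono measure_Un_le) (auto simp: fmeasurableD)
    also have "\<dots> \<le> measure lebesgue (\<Union>\<J>) + measure lebesgue N2 + measure lebesgue N1 + measure lebesgue F"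
      using lJ J(4) I(4) F' by (intro add_right_mono measure_Un_le) (auto simp: fmeasurableD)
    finally show ?thesis using lJ J(5) I(5) F' by simp
  qed
  have "sum ?len G2 < \<delta>" using len lIle lJge \<eta> by simp
  moreover have "\<Union>G2 \<subseteq> {a..b}" using division_ofD(6)[OF q2(2)] unfolding G2_def by auto
  ultimately have g: "(\<Sum>K\<in>G2. \<bar>?inc K\<bar>) < r * e / 2" using ac'[OF G2d] by simp
  have "sum ?inc G2 \<le> (\<Sum>K\<in>G2. \<bar>?inc K\<bar>)" by (intro sum_mono) simp
  moreover have "r * sum ?len \<I> \<le> sum ?inc \<I>"
    unfolding sum_distrib_left
  proof (rule sum_mono)
    fix K assume "K \<in> \<I>"
    then obtain u v where "u < v" "K = {u..v}" "f v - f u > r * (v - u)" using I(3) by blast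
    then show "r * (Sup K - Inf K) \<le> f (Sup K) - f (Inf K)" by simp
  qed
  moreover have "sum ?inc \<J> \<le> - r * sum ?len \<J>"
    unfolding sum_distrib_left
  proof (rule sum_mono)
    fix K assume "K \<in> \<J>"
    then obtain u v where "u < v" "K = {u..v}" "f v - f u < - r * (v - u)" using J(3) by blast
    then show "f (Sup K) - f (Inf K) \<le> - r * (Sup K - Inf K)" by simp
  qed
  ultimately have "r * sum ?len \<I> + r * sum ?len \<J> < r * e / 2" using inc g by simp
  moreover have "r * (e - \<eta>) + r * (e - 2 * \<eta>) \<le> r * sum ?len \<I> + r * sum ?len \<J>"
    using lIge lJge r by (intro add_mono mult_left_mono) auto
  ultimately have "r * (e - \<eta> + (e - 2 * \<eta>)) < r * (e / 2)" by (simp add: algebra_simps)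
  then have "e - \<eta> + (e - 2 * \<eta>) < e / 2" using r by simp
  then show False using \<eta> epos by simp
qed

text \<open>On a piece of small diameter, disjoint intervals have small total length, so by absolute
  continuity their increments sum up to less than 1. If their slopes exceed \<open>2 / e\<close>, then their
  total length is less than \<open>e / 2\<close>, and they cover the piece up to measure \<open>e / 2\<close>.\<close>
lemma negligible_infinite_slopes:
  fixes f :: "real \<Rightarrow> real"
  assumes ac: "abs_continuous_on a b f"
  shows "negligible {x\<in>{a<..<b}. \<forall>q. \<forall>d>0.
      \<exists>u v. u < v \<and> x \<in> {u..v} \<and> v - u < d \<and> f v - f u > q * (v - u)}" (is "negligible ?E")
proof -
  let ?inc = "\<lambda>K. f (Sup K) - f (Inf K)"
  let ?len = "\<lambda>K::real set. Sup K - Inf K"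
  obtain \<delta> where \<delta>: "\<delta> > 0" and ac0: "\<forall>\<D>. \<D> division_of \<Union>\<D> \<longrightarrow> \<Union>\<D> \<subseteq> {a..b} \<longrightarrow> sum ?len \<D> < \<delta> \<longrightarrow>
       (\<Sum>K\<in>\<D>. \<bar>?inc K\<bar>) < 1"
    using abs_continuous_on_division[OF ac zero_less_one] by (elim exE conjE) (rule that)
  note ac' = ac0[rule_format]
  have loc: "negligible (?E \<inter> ball z (\<delta>/4))" for z
    unfolding negligible_outer
  proof (intro allI impI)
    fix e :: real assume e: "e > 0"
    define O' where "O' = {a<..<b} \<inter> ball z (\<delta>/4)"
    have O': "open O'" "O' \<subseteq> {a..b}" "?E \<inter> ball z (\<delta>/4) \<subseteq> O'"
      unfolding O'_def by auto
    have cov: "\<exists>u v. u < v \<and> x \<in> {u..v} \<and> v - u < d \<and> f v - f u > (2/e) * (v - u)"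
      if "x \<in> ?E \<inter> ball z (\<delta>/4)" "d > 0" for x d using that by blast
    have e2: "e / 2 > 0" using e by simp
    obtain \<I> N1 where I: "\<I> division_of \<Union>\<I>" "\<Union>\<I> \<subseteq> O'"
       "\<And>K. K \<in> \<I> \<Longrightarrow> \<exists>u v. u < v \<and> K = {u..v} \<and> f v - f u > (2/e) * (v - u)"
      "N1 \<in> lmeasurable" "measure lebesgue N1 < e/2" "?E \<inter> ball z (\<delta>/4) \<subseteq> \<Union>\<I> \<union> N1"
      by (rule vitali_finite_intervals[OF O' cov e2]) (assumption | rule that)+
    have lI: "sum ?len \<I> = measure lebesgue (\<Union>\<I>)" "\<Union>\<I> \<in> lmeasurable" using measure_division_eq[OF I(1)] by auto
    have "measure lebesgue (\<Union>\<I>) \<le> measure lebesgue (cball z (\<delta>/4))"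
      using I(2) lI unfolding O'_def by (intro measure_mono_fmeasurable) (auto simp: fmeasurableD dist_real_def)
    also have "\<dots> = \<delta> / 2" using \<delta> by (simp add: cball_eq_atLeastAtMost)
    finally have "(\<Sum>K\<in>\<I>. \<bar>?inc K\<bar>) < 1"
      using ac'[OF I(1)] I(2) O'(2) lI \<delta> by auto
    moreover have "sum ?inc \<I> \<le> (\<Sum>K\<in>\<I>. \<bar>?inc K\<bar>)" by (intro sum_mono) simp
    moreover have "(2/e) * sum ?len \<I> \<le> sum ?inc \<I>"
      unfolding sum_distrib_left
    proof (rule sum_mono)
      fix K assume "K \<in> \<I>"
      then obtain u v where "u < v" "K = {u..v}" "f v - f u > (2/e) * (v - u)" using I(3) by blast
      then show "(2/e) * (Sup K - Inf K) \<le> f (Sup K) - f (Inf K)" by simp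
    qed
    ultimately have "(2/e) * measure lebesgue (\<Union>\<I>) < 1" using lI by simp
    then have "measure lebesgue (\<Union>\<I>) < e / 2" using e by (simp add: field_simps)
    moreover have "measure lebesgue (\<Union>\<I> \<union> N1) \<le> measure lebesgue (\<Union>\<I>) + measure lebesgue N1"
      using lI I(4) by (intro measure_Un_le) (auto simp: fmeasurableD)
    ultimately show "\<exists>T. ?E \<inter> ball z (\<delta>/4) \<subseteq> T \<and> T \<in> lmeasurable \<and> measure lebesgue T < e"
      using I(5,6) lI I(4) by (intro exI[of _ "\<Union>\<I> \<union> N1"]) (auto simp: fmeasurable.Un)
  qed
  show ?thesis
  proof (subst locally_negligible_alt, intro ballI)
    fix z assume "z \<in> ?E"
    show "\<exists>U. openin (top_of_set ?E) U \<and> z \<in> U \<and> negligible U"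
      using loc[of z] \<open>z \<in> ?E\<close> \<delta> by (intro exI[of _ "?E \<inter> ball z (\<delta>/4)"]) auto
  qed
qed

text \<open>With \<open>s = 1\<close> this moves the slopes under consideration from \<open>0\<close> to \<open>c\<close>, and with
  \<open>s = - 1\<close> it exchanges upward and downward slopes.\<close>
lemma abs_continuous_on_add_linear:
  fixes f :: "real \<Rightarrow> real"
  assumes ac: "abs_continuous_on a b f"
  shows "abs_continuous_on a b (\<lambda>x. s * f x - c * x)"
  unfolding abs_continuous_on_def
proof (intro allI impI)
  fix \<epsilon> :: real assume \<epsilon>: "\<epsilon> > 0"
  define \<epsilon>' where "\<epsilon>' = \<epsilon> / (2 * (\<bar>s\<bar> + 1))"
  have \<epsilon>': "\<epsilon>' > 0" "\<bar>s\<bar> * \<epsilon>' \<le> \<epsilon> / 2" using \<epsilon> unfolding \<epsilon>'_def by (auto simp: field_simps mult_left_mono)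
  obtain \<delta> where \<delta>: "\<delta> > 0" and *: "\<forall>(m::nat) (u::nat \<Rightarrow> real) (v::nat \<Rightarrow> real).
        (\<forall>k<m. a \<le> u k \<and> u k \<le> v k \<and> v k \<le> b) \<and>
        (\<forall>j<m. \<forall>k<m. j \<noteq> k \<longrightarrow> {u j<..<v j} \<inter> {u k<..<v k} = {}) \<and>
        (\<Sum>k<m. v k - u k) < \<delta>
        \<longrightarrow> (\<Sum>k<m. norm (f (v k) - f (u k))) < \<epsilon>'"
    using mp[OF spec[OF ac[unfolded abs_continuous_on_def]] \<epsilon>'(1)]
    by (elim exE conjE) (rule that)
  define \<delta>' where "\<delta>' = min \<delta> (\<epsilon> / (2 * (\<bar>c\<bar> + 1)))"
  have \<delta>': "\<delta>' > 0" "\<bar>c\<bar> * \<delta>' \<le> \<epsilon> / 2" "\<delta>' \<le> \<delta>"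
  proof -
    have "\<bar>c\<bar> * \<delta>' \<le> \<bar>c\<bar> * (\<epsilon> / (2 * (\<bar>c\<bar> + 1)))" unfolding \<delta>'_def by (intro mult_left_mono) auto
    also have "\<dots> \<le> \<epsilon> / 2" using \<epsilon> by (auto simp: field_simps)
    finally show "\<bar>c\<bar> * \<delta>' \<le> \<epsilon> / 2" .
  qed (use \<delta> \<epsilon> in \<open>auto simp: \<delta>'_def\<close>)
  show "\<exists>\<delta>>0. \<forall>(m::nat) (u::nat \<Rightarrow> real) (v::nat \<Rightarrow> real).
        (\<forall>k<m. a \<le> u k \<and> u k \<le> v k \<and> v k \<le> b) \<and>
        (\<forall>j<m. \<forall>k<m. j \<noteq> k \<longrightarrow> {u j<..<v j} \<inter> {u k<..<v k} = {}) \<and>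
        (\<Sum>k<m. v k - u k) < \<delta>
        \<longrightarrow> (\<Sum>k<m. norm (s * f (v k) - c * v k - (s * f (u k) - c * u k))) < \<epsilon>"
  proof (intro exI[of _ \<delta>'] conjI allI impI)
    fix m :: nat and u v :: "nat \<Rightarrow> real"
    assume A: "(\<forall>k<m. a \<le> u k \<and> u k \<le> v k \<and> v k \<le> b) \<and>
        (\<forall>j<m. \<forall>k<m. j \<noteq> k \<longrightarrow> {u j<..<v j} \<inter> {u k<..<v k} = {}) \<and>
        (\<Sum>k<m. v k - u k) < \<delta>'"
    have "(\<Sum>k<m. v k - u k) < \<delta>" using A \<delta>'(3) by linarith
    with A have l: "(\<Sum>k<m. norm (f (v k) - f (u k))) < \<epsilon>'" by (intro *[rule_format] conjI) auto
    have "(\<Sum>k<m. norm (s * f (v k) - c * v k - (s * f (u k) - c * u k))) \<le>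
        (\<Sum>k<m. \<bar>s\<bar> * norm (f (v k) - f (u k)) + \<bar>c\<bar> * (v k - u k))"
    proof (rule sum_mono)
      fix k assume "k \<in> {..<m}"
      then have "u k \<le> v k" using A by auto
      have "s * f (v k) - c * v k - (s * f (u k) - c * u k) = s * (f (v k) - f (u k)) - c * (v k - u k)"
        by (simp add: algebra_simps)
      also have "norm \<dots> \<le> \<bar>s\<bar> * norm (f (v k) - f (u k)) + \<bar>c\<bar> * norm (v k - u k)"
        by (metis abs_triangle_ineq4 abs_mult real_norm_def)
      finally show "norm (s * f (v k) - c * v k - (s * f (u k) - c * u k)) \<le> \<bar>s\<bar> * norm (f (v k) - f (u k)) + \<bar>c\<bar> * (v k - u k)"
        using \<open>u k \<le> v k\<close> by simp
    qed
    also have "\<dots> = \<bar>s\<bar> * (\<Sum>k<m. norm (f (v k) - f (u k))) + \<bar>c\<bar> * (\<Sum>k<m. v k - u k)"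
      by (simp add: sum.distrib sum_distrib_left)
    also have "\<dots> < \<epsilon>"
    proof (cases "s = 0")
      case True
      have "\<bar>c\<bar> * (\<Sum>k<m. v k - u k) \<le> \<bar>c\<bar> * \<delta>'" using A by (intro mult_left_mono) auto
      then show ?thesis using True \<delta>' \<epsilon> by simp
    next
      case False
      have "\<bar>c\<bar> * (\<Sum>k<m. v k - u k) \<le> \<bar>c\<bar> * \<delta>'" using A by (intro mult_left_mono) auto
      moreover have "\<bar>s\<bar> * (\<Sum>k<m. norm (f (v k) - f (u k))) < \<bar>s\<bar> * \<epsilon>'" using False l by (intro mult_strict_left_mono) auto
      ultimately show ?thesis using \<delta>' \<epsilon>' by linarith
    qed
    finally show "(\<Sum>k<m. norm (s * f (v k) - c * v k - (s * f (u k) - c * u k))) < \<epsilon>" .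
  qed (use \<delta>' in auto)
qed

lemma differentiable_if_slopes_close:
  fixes f :: "real \<Rightarrow> real"
  assumes "\<And>e. e > 0 \<Longrightarrow> \<exists>d>0. \<forall>u v. u < v \<longrightarrow> x \<in> {u..v} \<longrightarrow> v - u < d \<longrightarrow> \<bar>f v - f u - D * (v - u)\<bar> \<le> e * (v - u)"
  shows "(f has_real_derivative D) (at x)"
  unfolding has_field_derivative_def has_derivative_within_alt
proof (intro conjI allI impI bounded_linear_mult_right)
  fix e :: real assume "e > 0"
  then obtain d where d: "d > 0" "\<forall>u v. u < v \<longrightarrow> x \<in> {u..v} \<longrightarrow> v - u < d \<longrightarrow> \<bar>f v - f u - D * (v - u)\<bar> \<le> e * (v - u)"
    using assms by blast
  have "norm (f y - f x - D * (y - x)) \<le> e * norm (y - x)" if "norm (y - x) < d" for y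
  proof (cases y x rule: linorder_cases)
    case less
    then have "\<bar>f x - f y - D * (x - y)\<bar> \<le> e * (x - y)" using d(2)[rule_format, of y x] that by simp
    moreover have "f y - f x - D * (y - x) = - (f x - f y - D * (x - y))" by (simp add: algebra_simps)
    ultimately show ?thesis using less by (simp only: real_norm_def abs_minus_cancel) simp
  next
    case greater
    then show ?thesis using d(2)[rule_format, of x y] that by simp
  qed simp
  then show "\<exists>d>0. \<forall>y\<in>UNIV. norm (y - x) < d \<longrightarrow> norm (f y - f x - D * (y - x)) \<le> e * norm (y - x)"
    using d(1) by blast
qed

text \<open>If no sequence of shrinking intervals around \<open>x\<close> has slopes tending to \<open>\<infinity>\<close> or to
  \<open>- \<infinity>\<close>, then the infimum \<open>D\<close> of all local upper bounds of the slopes is finite. If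
  moreover no rational \<open>c\<close> and \<open>r > 0\<close> are such that slopes above \<open>c + r\<close> and below \<open>c - r\<close>
  both occur at arbitrarily small scale, then the slopes converge to \<open>D\<close>. Each of the countably
  many exceptional conditions fails almost everywhere.\<close>
theorem abs_continuous_on_differentiable_ae:
  fixes f :: "real \<Rightarrow> real"
  assumes ac: "abs_continuous_on a b f"
  shows "negligible {x\<in>{a<..<b}. \<not> f differentiable (at x)}"
proof -
  define Osc where "Osc c r = {x\<in>{a<..<b}. \<forall>d>0.
      (\<exists>u v. u < v \<and> x \<in> {u..v} \<and> v - u < d \<and> f v - f u > (c + r) * (v - u)) \<and>
      (\<exists>u v. u < v \<and> x \<in> {u..v} \<and> v - u < d \<and> f v - f u < (c - r) * (v - u))}" for c r
  define Inft where "Inft s = {x\<in>{a<..<b}. \<forall>q. \<forall>d>0.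
      \<exists>u v. u < v \<and> x \<in> {u..v} \<and> v - u < d \<and> s * f v - s * f u > q * (v - u)}" for s
  have "negligible (Osc c r)" if "r > 0" for c r
  proof -
    have "(1 * f v - c * v - (1 * f u - c * u) > r * (v - u)) = (f v - f u > (c + r) * (v - u))"
      "(1 * f v - c * v - (1 * f u - c * u) < - r * (v - u)) = (f v - f u < (c - r) * (v - u))" for u v
      by (auto simp: algebra_simps)
    then show ?thesis
      using negligible_oscillating_slopes[OF abs_continuous_on_add_linear[OF ac, of 1 c] that]
      unfolding Osc_def by simp
  qed
  then have "negligible (\<Union>(c, r)\<in>\<rat> \<times> (\<rat> \<inter> {0<..}). Osc c r)"
    by (intro negligible_countable_Union countable_image) (auto intro: countable_rat countable_SIGMA)
  moreover have "negligible (Inft s)" for s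
    using negligible_infinite_slopes[OF abs_continuous_on_add_linear[OF ac, of s 0]]
    unfolding Inft_def by simp
  ultimately have "negligible ((\<Union>(c, r)\<in>\<rat> \<times> (\<rat> \<inter> {0<..}). Osc c r) \<union> (Inft 1 \<union> Inft (-1)))"
    by (intro negligible_Un)
  moreover have "{x\<in>{a<..<b}. \<not> f differentiable (at x)} \<subseteq> (\<Union>(c, r)\<in>\<rat> \<times> (\<rat> \<inter> {0<..}). Osc c r) \<union> (Inft 1 \<union> Inft (-1))"
  proof (rule subsetI, rule ccontr)
    fix x assume x: "x \<in> {x\<in>{a<..<b}. \<not> f differentiable (at x)}"
      and nx: "x \<notin> (\<Union>(c, r)\<in>\<rat> \<times> (\<rat> \<inter> {0<..}). Osc c r) \<union> (Inft 1 \<union> Inft (-1))"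
    have xab: "x \<in> {a<..<b}" using x by blast
    define Qs where "Qs = {q. \<exists>d>0. \<forall>u v. u < v \<longrightarrow> x \<in> {u..v} \<longrightarrow> v - u < d \<longrightarrow> f v - f u \<le> q * (v - u)}"
    have "x \<notin> Inft 1" "x \<notin> Inft (-1)" using nx by auto
    then have nI: "\<exists>q. \<exists>d>0. \<not> (\<exists>u v. u < v \<and> x \<in> {u..v} \<and> v - u < d \<and> s * f v - s * f u > q * (v - u))" if "x \<notin> Inft s" for s
      using xab that unfolding Inft_def mem_Collect_eq by (simp only: simp_thms not_all not_imp)
    obtain q1 d1 where q1d: "d1 > 0" "\<not> (\<exists>u v. u < v \<and> x \<in> {u..v} \<and> v - u < d1 \<and> 1 * f v - 1 * f u > q1 * (v - u))"
      using nI[OF \<open>x \<notin> Inft 1\<close>] by (elim exE conjE) (rule that)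
    have "f v - f u \<le> q1 * (v - u)" if "u < v" "x \<in> {u..v}" "v - u < d1" for u v
    proof (rule ccontr)
      assume "\<not> f v - f u \<le> q1 * (v - u)"
      then have "1 * f v - 1 * f u > q1 * (v - u)" by simp
      then show False using q1d(2) that by blast
    qed
    then have q1: "q1 \<in> Qs" using q1d(1) unfolding Qs_def by blast
    obtain q2 d2 where q2: "d2 > 0" "\<And>u v. u < v \<Longrightarrow> x \<in> {u..v} \<Longrightarrow> v - u < d2 \<Longrightarrow> - f v + f u \<le> q2 * (v - u)"
    proof -
      obtain q2 d2 where q2d: "d2 > 0" "\<not> (\<exists>u v. u < v \<and> x \<in> {u..v} \<and> v - u < d2 \<and> - 1 * f v - - 1 * f u > q2 * (v - u))"
        using nI[OF \<open>x \<notin> Inft (-1)\<close>] by (elim exE conjE) (rule that)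
      have "- f v + f u \<le> q2 * (v - u)" if "u < v" "x \<in> {u..v}" "v - u < d2" for u v
      proof (rule ccontr)
        assume "\<not> - f v + f u \<le> q2 * (v - u)"
        then have "- 1 * f v - - 1 * f u > q2 * (v - u)" by simp
        then show False using q2d(2) that by blast
      qed
      then show thesis using q2d(1) by (intro that[of d2 q2])
    qed
    have low: "- q2 \<le> q" if q: "q \<in> Qs" for q
    proof -
      obtain d where d: "d > 0" "\<forall>u v. u < v \<longrightarrow> x \<in> {u..v} \<longrightarrow> v - u < d \<longrightarrow> f v - f u \<le> q * (v - u)"
        using q unfolding Qs_def mem_Collect_eq by (elim exE conjE) (rule that)
      define h where "h = min d d2 / 2"
      have h: "h > 0" "h < d" "h < d2" using d q2 by (auto simp: h_def)
      have "- (q2 * h) \<le> q * h" using d(2)[rule_format, of x "x + h"] q2(2)[of x "x + h"] h by simp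
      then have "(- q2) * h \<le> q * h" by simp
      then show ?thesis using h(1) by (simp only: mult_le_cancel_right_pos)
    qed
    define D where "D = Inf Qs"
    have bdd: "bdd_below Qs" by (rule bdd_belowI) (rule low)
    have "(f has_real_derivative D) (at x)"
    proof (rule differentiable_if_slopes_close)
      fix e :: real assume e: "e > 0"
      obtain q where "q \<in> Qs" "q < D + e"
        using cInf_lessD[of Qs "D + e"] q1 e unfolding D_def by auto
      then obtain d3 where d3: "d3 > 0" "\<forall>u v. u < v \<longrightarrow> x \<in> {u..v} \<longrightarrow> v - u < d3 \<longrightarrow> f v - f u \<le> q * (v - u)"
        unfolding Qs_def mem_Collect_eq by (elim exE conjE) (rule that)
      obtain r where r: "r \<in> \<rat>" "0 < r" "r < e / 4" using Rats_dense_in_real[of 0 "e / 4"] e by auto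
      obtain c where c: "c \<in> \<rat>" "D - e + r < c" "c < D - r" using Rats_dense_in_real[of "D - e + r" "D - r"] r by auto
      have "c + r \<notin> Qs" using cInf_lower[OF _ bdd, of "c + r"] c unfolding D_def by auto
      then have n1: "\<exists>u v. u < v \<and> x \<in> {u..v} \<and> v - u < d \<and> f v - f u > (c + r) * (v - u)" if "d > 0" for d
        using that unfolding Qs_def by (auto simp: not_le)
      have "x \<notin> Osc c r" using nx r c by auto
      then obtain d4 where d4: "d4 > 0" "\<not> ((\<exists>u v. u < v \<and> x \<in> {u..v} \<and> v - u < d4 \<and> f v - f u > (c + r) * (v - u)) \<and>
          (\<exists>u v. u < v \<and> x \<in> {u..v} \<and> v - u < d4 \<and> f v - f u < (c - r) * (v - u)))"
        using xab unfolding Osc_def by blast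
      have d4': "(c - r) * (v - u) \<le> f v - f u" if "u < v" "x \<in> {u..v}" "v - u < d4" for u v
      proof (rule ccontr)
        assume "\<not> (c - r) * (v - u) \<le> f v - f u"
        then have "f v - f u < (c - r) * (v - u)" by simp
        with that have "\<exists>u v. u < v \<and> x \<in> {u..v} \<and> v - u < d4 \<and> f v - f u < (c - r) * (v - u)" by blast
        then show False using d4(2) n1[OF d4(1)] by blast
      qed
      show "\<exists>d>0. \<forall>u v. u < v \<longrightarrow> x \<in> {u..v} \<longrightarrow> v - u < d \<longrightarrow> \<bar>f v - f u - D * (v - u)\<bar> \<le> e * (v - u)"
      proof (intro exI[of _ "min d3 d4"] conjI allI impI)
        fix u v assume uv: "u < v" "x \<in> {u..v}" "v - u < min d3 d4"
        have "f v - f u \<le> q * (v - u)" using d3(2) uv by simp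
        also have "\<dots> \<le> (D + e) * (v - u)" using uv \<open>q < D + e\<close> by (intro mult_right_mono) auto
        finally have up: "f v - f u - D * (v - u) \<le> e * (v - u)" by (simp add: algebra_simps)
        have "(D - e) * (v - u) \<le> (c - r) * (v - u)" using uv c by (intro mult_right_mono) auto
        moreover have "(c - r) * (v - u) \<le> f v - f u" by (rule d4') (use uv in auto)
        ultimately have "(D - e) * (v - u) \<le> f v - f u" by linarith
        then have "- (e * (v - u)) \<le> f v - f u - D * (v - u)" by (simp add: algebra_simps)
        with up show "\<bar>f v - f u - D * (v - u)\<bar> \<le> e * (v - u)" by simp
      qed (use d3 d4 in auto)
    qed
    then show False using x real_differentiable_def by blast
  qed
  ultimately show ?thesis by (rule negligible_subset)
qed

lemma abs_continuous_on_subset: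
  assumes "abs_continuous_on a b f" "a \<le> a'" "b' \<le> b"
  shows "abs_continuous_on a' b' f"
  unfolding abs_continuous_on_def
proof (intro allI impI)
  fix \<epsilon> :: real assume "\<epsilon> > 0"
  from mp[OF spec[OF assms(1)[unfolded abs_continuous_on_def]] this]
  obtain \<delta> where \<delta>: "\<delta> > 0" and *: "\<forall>(m::nat) (u::nat \<Rightarrow> real) (v::nat \<Rightarrow> real).
        (\<forall>k<m. a \<le> u k \<and> u k \<le> v k \<and> v k \<le> b) \<and>
        (\<forall>j<m. \<forall>k<m. j \<noteq> k \<longrightarrow> {u j<..<v j} \<inter> {u k<..<v k} = {}) \<and>
        (\<Sum>k<m. v k - u k) < \<delta>
        \<longrightarrow> (\<Sum>k<m. norm (f (v k) - f (u k))) < \<epsilon>"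
    by (elim exE conjE) (rule that)
  show "\<exists>\<delta>>0. \<forall>(m::nat) (u::nat \<Rightarrow> real) (v::nat \<Rightarrow> real).
        (\<forall>k<m. a' \<le> u k \<and> u k \<le> v k \<and> v k \<le> b') \<and>
        (\<forall>j<m. \<forall>k<m. j \<noteq> k \<longrightarrow> {u j<..<v j} \<inter> {u k<..<v k} = {}) \<and>
        (\<Sum>k<m. v k - u k) < \<delta>
        \<longrightarrow> (\<Sum>k<m. norm (f (v k) - f (u k))) < \<epsilon>"
  proof (intro exI[of _ \<delta>] conjI \<delta> allI impI)
    fix m :: nat and u v :: "nat \<Rightarrow> real"
    assume A: "(\<forall>k<m. a' \<le> u k \<and> u k \<le> v k \<and> v k \<le> b') \<and>
        (\<forall>j<m. \<forall>k<m. j \<noteq> k \<longrightarrow> {u j<..<v j} \<inter> {u k<..<v k} = {}) \<and>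
        (\<Sum>k<m. v k - u k) < \<delta>"
    then have "\<forall>k<m. a \<le> u k \<and> u k \<le> v k \<and> v k \<le> b" using assms(2,3) by force
    then show "(\<Sum>k<m. norm (f (v k) - f (u k))) < \<epsilon>"
      using A by (intro *[rule_format] conjI) auto
  qed
qed

text \<open>In a Riemann sum over a fine tagged division, a tag outside \<open>N\<close> contributes nearly the
  increment of \<open>f\<close> by differentiability. A tag in \<open>N\<close> contributes nothing, and the gauge keeps
  its interval in an open set of small measure around \<open>N\<close>, where the increments of \<open>f\<close> are small
  by absolute continuity.\<close>
theorem abs_continuous_on_has_integral:
  fixes f :: "real \<Rightarrow> real"
  assumes ac: "abs_continuous_on a b f" and ab: "a \<le> b" and neg: "negligible N"
    and D: "\<And>x. x \<in> {a..b} - N \<Longrightarrow> (f has_real_derivative g x) (at x)"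
    and g0: "\<And>x. x \<in> N \<Longrightarrow> g x = 0"
  shows "(g has_integral (f b - f a)) {a..b}"
  unfolding has_integral_factor_content box_real[symmetric]
proof safe
  fix e :: real assume e: "e > 0"
  show "\<exists>d. gauge d \<and> (\<forall>p. p tagged_division_of (cbox a b) \<and> d fine p \<longrightarrow>
    norm ((\<Sum>(x, k)\<in>p. measure lborel k *\<^sub>R g x) - (f b - f a)) \<le> e * measure lborel (cbox a b))"
  proof (cases "a = b")
    case True
    have "(\<Sum>(x, k)\<in>p. measure lborel k *\<^sub>R g x) = 0" if p: "p tagged_division_of cbox a b" for p
    proof (rule sum.neutral, clarify)
      fix x k assume xk: "(x, k) \<in> p"
      obtain u v where k: "k = cbox u v" using tagged_division_ofD(4)[OF p xk] by blast
      have "x \<in> {u..v}" "{u..v} \<subseteq> {a}" using tagged_division_ofD(2,3)[OF p xk] True k by auto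
      then have "u = v" by (metis atLeastAtMost_iff dual_order.refl order_trans singletonD subsetD)
      then show "measure lborel k *\<^sub>R g x = 0" using k by simp
    qed
    then show ?thesis using True by (intro exI[of _ "\<lambda>x. ball x 1"]) auto
  next
    case False
    then have ab: "a < b" using ab by simp
    define e1 where "e1 = e / 2"
    have e1: "e1 > 0" using e by (simp add: e1_def)
    have eab: "e * (b - a) / 2 > 0" using e ab by simp
    obtain \<delta> where \<delta>: "\<delta> > 0" and ac0: "\<forall>\<D>. \<D> division_of \<Union>\<D> \<longrightarrow> \<Union>\<D> \<subseteq> {a..b} \<longrightarrow> (\<Sum>K\<in>\<D>. Sup K - Inf K) < \<delta> \<longrightarrow>
       (\<Sum>K\<in>\<D>. \<bar>f (Sup K) - f (Inf K)\<bar>) < e * (b - a) / 2"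
      using abs_continuous_on_division[OF ac eab] by (elim exE conjE) (rule that)
    note ac' = ac0[rule_format]
    have Nl: "N \<in> sets lebesgue" using neg by (simp add: negligible_imp_sets)
    obtain U where U: "open U" "N \<subseteq> U" "U - N \<in> lmeasurable" "emeasure lebesgue (U - N) < ennreal \<delta>"
      by (rule sets_lebesgue_outer_open[OF Nl \<delta>])
    have Ul: "U \<in> lmeasurable" "measure lebesgue U < \<delta>"
    proof -
      have N0: "N \<in> lmeasurable" "measure lebesgue N = 0" using neg by (auto simp: negligible_iff_measure)
      have eq: "U = N \<union> (U - N)" using U by auto
      then show 1: "U \<in> lmeasurable" using N0(1) U(3) by (metis fmeasurable.Un)
      have "measure lebesgue U \<le> measure lebesgue N + measure lebesgue (U - N)"
        using measure_Un_le[of N lebesgue "U - N"] N0 U(3) eq by (simp add: fmeasurableD)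
      moreover have "measure lebesgue (U - N) < \<delta>"
        using U(3,4) \<delta> by (simp add: emeasure_eq_measure2 ennreal_less_iff)
      ultimately show "measure lebesgue U < \<delta>" using N0 by simp
    qed
    have "\<exists>d>0. x \<in> {a..b} - N \<longrightarrow> (\<forall>y. norm (y - x) < d \<longrightarrow> norm (f y - f x - g x * (y - x)) \<le> e1 * norm (y - x))" for x
    proof (cases "x \<in> {a..b} - N")
      case True
      then show ?thesis
        using D[OF True] e1 unfolding has_field_derivative_def has_derivative_within_alt by fastforce
    qed (auto intro: exI[of _ 1])
    then obtain d where d: "\<And>x. d x > 0" "\<And>x y. x \<in> {a..b} - N \<Longrightarrow> norm (y - x) < d x \<Longrightarrow> norm (f y - f x - g x * (y - x)) \<le> e1 * norm (y - x)"
      by metis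
    define \<gamma> where "\<gamma> x = (if x \<in> N then U else ball x (d x))" for x
    have gauge: "gauge \<gamma>" unfolding gauge_def \<gamma>_def using U d by auto
    show ?thesis
    proof (intro exI[of _ \<gamma>] conjI gauge allI impI, elim conjE)
      fix p assume p: "p tagged_division_of cbox a b" and fine: "\<gamma> fine p"
      have pK: "\<exists>u v. u \<le> v \<and> K = {u..v} \<and> x \<in> {u..v} \<and> {u..v} \<subseteq> {a..b}" if "(x, K) \<in> p" for x K
      proof -
        have 1: "x \<in> K" "K \<subseteq> cbox a b" "\<exists>u v. K = cbox u v"
          using tagged_division_ofD(2,3,4)[OF p that] by auto
        then obtain u v where "K = {u..v}" by auto
        then show ?thesis using 1 by (intro exI[of _ u] exI[of _ v]) auto
      qed
      have finp: "finite p" using p by blast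
      define pN where "pN = {(x, K)\<in>p. x \<in> N}"
      have pNsub: "pN \<subseteq> p" unfolding pN_def by auto
      have eqf: "f b - f a = (\<Sum>(x,K)\<in>p. f (Sup K) - f (Inf K))"
        using additive_tagged_division_1[of a b p f] p ab by simp
      have eql: "b - a = (\<Sum>(x,K)\<in>p. Sup K - Inf K)"
        using additive_tagged_division_1[of a b p "\<lambda>x. x"] p ab by simp
      have "(\<Sum>(x, k)\<in>p. measure lborel k *\<^sub>R g x) - (f b - f a) = (\<Sum>(x,K)\<in>p. measure lborel K * g x - (f (Sup K) - f (Inf K)))"
        unfolding eqf by (simp add: sum_subtractf case_prod_unfold)
      also have "\<dots> = (\<Sum>(x,K)\<in>p - pN. measure lborel K * g x - (f (Sup K) - f (Inf K))) + (\<Sum>(x,K)\<in>pN. measure lborel K * g x - (f (Sup K) - f (Inf K)))"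
        using sum.subset_diff[OF pNsub finp] by simp
      finally have split: "norm ((\<Sum>(x, k)\<in>p. measure lborel k *\<^sub>R g x) - (f b - f a)) \<le>
          norm (\<Sum>(x,K)\<in>p - pN. measure lborel K * g x - (f (Sup K) - f (Inf K))) + norm (\<Sum>(x,K)\<in>pN. measure lborel K * g x - (f (Sup K) - f (Inf K)))"
        using norm_triangle_ineq by simp
      have "norm (\<Sum>(x,K)\<in>p - pN. measure lborel K * g x - (f (Sup K) - f (Inf K))) \<le> (\<Sum>(x,K)\<in>p - pN. e1 * (Sup K - Inf K))"
      proof (rule sum_norm_le, clarify)
        fix x K assume xK: "(x, K) \<in> p" "(x, K) \<notin> pN"
        obtain u v where uv: "u \<le> v" "K = {u..v}" "x \<in> {u..v}" "{u..v} \<subseteq> {a..b}" using pK[OF xK(1)] by blast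
        have xN: "x \<in> {a..b} - N" using xK uv unfolding pN_def by auto
        have "K \<subseteq> ball x (d x)" using fine xK xN unfolding fine_def \<gamma>_def by fastforce
        moreover have "u \<in> K" "v \<in> K" using uv by auto
        ultimately have "u \<in> ball x (d x)" "v \<in> ball x (d x)" by blast+
        then have b1: "norm (f u - f x - g x * (u - x)) \<le> e1 * norm (u - x)" "norm (f v - f x - g x * (v - x)) \<le> e1 * norm (v - x)"
          using d(2)[OF xN] by (auto simp: dist_real_def abs_minus_commute)
        have "measure lborel K * g x - (f (Sup K) - f (Inf K)) = (f u - f x - g x * (u - x)) - (f v - f x - g x * (v - x))"
          using uv by (simp add: algebra_simps)
        also have "norm \<dots> \<le> e1 * norm (u - x) + e1 * norm (v - x)"
          using b1 norm_triangle_ineq4 by (smt (verit))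
        also have "\<dots> = e1 * (v - u)" using uv by (simp add: algebra_simps)
        finally show "norm (measure lborel K * g x - (f (Sup K) - f (Inf K))) \<le> e1 * (Sup K - Inf K)" using uv by simp
      qed
      also have "\<dots> \<le> (\<Sum>(x,K)\<in>p. e1 * (Sup K - Inf K))"
      proof (rule sum_mono2[OF finp])
        fix y assume "y \<in> p - (p - pN)"
        then obtain x K where "y = (x, K)" "(x, K) \<in> p" by (cases y) auto
        then show "0 \<le> (case y of (x, K) \<Rightarrow> e1 * (Sup K - Inf K))" using pK[of x K] e1 by auto
      qed auto
      also have "\<dots> = e1 * (b - a)" unfolding eql by (simp add: sum_distrib_left case_prod_unfold)
      finally have s1: "norm (\<Sum>(x,K)\<in>p - pN. measure lborel K * g x - (f (Sup K) - f (Inf K))) \<le> e * (b - a) / 2"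
        by (simp add: e1_def)
      have pNt: "pN tagged_partial_division_of cbox a b"
        using p pNsub by (meson tagged_division_of_def tagged_partial_division_subset)
      have dv: "snd ` pN division_of \<Union>(snd ` pN)"
        using partial_division_of_tagged_division[OF pNt] .
      have sub: "\<Union>(snd ` pN) \<subseteq> U"
        using fine unfolding fine_def pN_def \<gamma>_def by fastforce
      have subab: "\<Union>(snd ` pN) \<subseteq> {a..b}" using pK unfolding pN_def by fastforce
      have "(\<Sum>K\<in>snd ` pN. Sup K - Inf K) \<le> measure lebesgue U"
        using measure_division_eq[OF dv] Ul(1) sub by (simp add: measure_mono_fmeasurable fmeasurableD)
      then have small: "(\<Sum>K\<in>snd ` pN. \<bar>f (Sup K) - f (Inf K)\<bar>) < e * (b - a) / 2"
        using ac'[OF dv subab] Ul(2) by simp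
      have "(\<Sum>(x,K)\<in>pN. \<bar>f (Sup K) - f (Inf K)\<bar>) = (\<Sum>K\<in>snd ` pN. \<bar>f (Sup K) - f (Inf K)\<bar>)"
      proof -
        have pNtU: "pN tagged_division_of \<Union>(snd ` pN)"
          using pNt tagged_partial_division_of_Union_self by blast
        define dd where "dd K = (if K = {} then 0 else \<bar>f (Sup K) - f (Inf K)\<bar>)" for K :: "real set"
        have "(\<Sum>(x,K)\<in>pN. dd K) = (\<Sum>K\<in>snd ` pN. dd K)"
        proof (rule sum.over_tagged_division_lemma[OF pNtU])
          fix u v :: real assume "box u v = {}"
          then have "v \<le> u" by simp
          then show "dd (cbox u v) = 0" by (cases "u = v") (auto simp: dd_def)
        qed
        moreover have ne: "K \<noteq> {}" if "(x, K) \<in> pN" for x K using pK[of x K] that unfolding pN_def by auto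
        have "(\<Sum>(x,K)\<in>pN. dd K) = (\<Sum>(x,K)\<in>pN. \<bar>f (Sup K) - f (Inf K)\<bar>)"
          using ne by (intro sum.cong) (auto simp: dd_def)
        moreover have "(\<Sum>K\<in>snd ` pN. dd K) = (\<Sum>K\<in>snd ` pN. \<bar>f (Sup K) - f (Inf K)\<bar>)"
          using ne by (intro sum.cong) (auto simp: dd_def)
        ultimately show ?thesis by simp
      qed
      then have small': "(\<Sum>(x,K)\<in>pN. \<bar>f (Sup K) - f (Inf K)\<bar>) < e * (b - a) / 2" using small by simp
      have "norm (\<Sum>(x,K)\<in>pN. measure lborel K * g x - (f (Sup K) - f (Inf K))) \<le> (\<Sum>(x,K)\<in>pN. \<bar>f (Sup K) - f (Inf K)\<bar>)"
        by (rule sum_norm_le) (use g0 in \<open>auto simp: pN_def\<close>)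
      then have s2: "norm (\<Sum>(x,K)\<in>pN. measure lborel K * g x - (f (Sup K) - f (Inf K))) \<le> e * (b - a) / 2" using small' by simp
      show "norm ((\<Sum>(x, k)\<in>p. measure lborel k *\<^sub>R g x) - (f b - f a)) \<le> e * measure lborel (cbox a b)"
        using split s1 s2 ab by simp
    qed
  qed
qed

text \<open>Integrate the inequality \<open>\<bar>z\<bar> \<le> \<kappa> / 2 + z\<^sup>2 / (2 * \<kappa>)\<close> with the derivative in place of
  \<open>z\<close>. Optimizing over \<open>\<kappa>\<close> yields the Cauchy-Schwarz bound, but a free parameter is more
  convenient below.\<close>
theorem abs_continuous_on_energy_bound:
  fixes f :: "real \<Rightarrow> real"
  assumes ac: "abs_continuous_on 0 T f" and st: "0 \<le> s" "s \<le> t" "t \<le> T"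
    and en: "(\<integral>\<^sup>+x\<in>{0..T}. ennreal ((deriv f x)\<^sup>2) \<partial>lborel) \<le> ennreal \<Lambda>" and L: "\<Lambda> \<ge> 0" and \<kappa>: "\<kappa> > 0"
  shows "\<bar>f t - f s\<bar> \<le> \<kappa> * (t - s) / 2 + \<Lambda> / (2 * \<kappa>)"
proof -
  define N where "N = {x\<in>{s<..<t}. \<not> f differentiable (at x)} \<union> {s, t}"
  have acst: "abs_continuous_on s t f" using abs_continuous_on_subset[OF ac st(1,3)] .
  have N: "negligible N" unfolding N_def
    using abs_continuous_on_differentiable_ae[OF acst] by (intro negligible_Un) auto
  define g where "g x = (if x \<in> N then 0 else deriv f x)" for x
  have gi: "(g has_integral (f t - f s)) {s..t}"
  proof (rule abs_continuous_on_has_integral[OF acst st(2) N])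
    fix x assume "x \<in> {s..t} - N"
    then have "f differentiable (at x)" "x \<notin> N" unfolding N_def by (auto simp: less_eq_real_def)
    then show "(f has_real_derivative g x) (at x)"
      unfolding g_def by (simp add: DERIV_deriv_iff_real_differentiable)
  qed (simp add: g_def)
  define h where "h x = (if x \<in> {s..t} then g x else 0)" for x
  have "h \<in> borel_measurable lebesgue"
  proof -
    have "g \<in> borel_measurable (lebesgue_on {s..t})"
      using gi by (intro integrable_imp_measurable) blast
    then have "(\<lambda>x. if x \<in> {s..t} then g x else 0) \<in> borel_measurable lebesgue"
      by (subst borel_measurable_if) auto
    then show ?thesis unfolding h_def .
  qed
  then obtain G where G: "G \<in> borel_measurable lborel" "AE x in lborel. h x = G x"
    using completion_ex_borel_measurable_real[of h lborel] by auto
  have AEh: "AE x in lborel. x \<notin> N"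
  proof -
    have "N \<in> null_sets lebesgue" using N by (simp add: negligible_iff_null_sets)
    then have "AE x in lebesgue. x \<notin> N" by (rule AE_not_in)
    then show ?thesis by (simp add: AE_completion_iff)
  qed
  have "(\<integral>\<^sup>+x. ennreal ((G x)\<^sup>2) \<partial>lborel) \<le> (\<integral>\<^sup>+x\<in>{0..T}. ennreal ((deriv f x)\<^sup>2) \<partial>lborel)"
  proof (rule nn_integral_mono_AE)
    show "AE x in lborel. ennreal ((G x)\<^sup>2) \<le> ennreal ((deriv f x)\<^sup>2) * indicator {0..T} x"
      using G(2) AEh
    proof eventually_elim
      case (elim x)
      then show ?case using st by (cases "x \<in> {s..t}") (auto simp: h_def g_def)
    qed
  qed
  then have Gle: "(\<integral>\<^sup>+x. ennreal ((G x)\<^sup>2) \<partial>lborel) \<le> ennreal \<Lambda>" using en by simp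
  define r where "r = enn2real (\<integral>\<^sup>+x. ennreal ((G x)\<^sup>2) \<partial>lborel)"
  have r: "(\<integral>\<^sup>+x. ennreal ((G x)\<^sup>2) \<partial>lborel) = ennreal r"
    unfolding r_def using Gle by (metis ennreal_enn2real ennreal_less_top le_less_trans)
  have r0: "r \<ge> 0" unfolding r_def by simp
  have rL: "r \<le> \<Lambda>" using Gle r L by simp
  have "((\<lambda>x. (G x)\<^sup>2) has_integral r) UNIV"
    using G(1) r r0 by (intro nn_integral_has_integral) auto
  moreover obtain N2 where N2: "negligible N2" "\<And>x. x \<notin> N2 \<Longrightarrow> h x = G x"
  proof -
    obtain N2 where "{x \<in> space lborel. \<not> h x = G x} \<subseteq> N2" "emeasure lborel N2 = 0" "N2 \<in> sets lborel"
      by (rule AE_E[OF G(2)])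
    then have "N2 \<in> null_sets lborel" by (intro null_setsI)
    then have "negligible N2" by (simp add: negligible_iff_null_sets null_sets_completionI)
    then show ?thesis using \<open>{x \<in> space lborel. \<not> h x = G x} \<subseteq> N2\<close> by (intro that[of N2]) auto
  qed
  ultimately have "((\<lambda>x. (h x)\<^sup>2) has_integral r) UNIV"
    by - (rule has_integral_spike[OF N2(1), rotated], auto)
  moreover have "(\<lambda>x. (h x)\<^sup>2) = (\<lambda>x. if x \<in> {s..t} then (g x)\<^sup>2 else 0)" unfolding h_def by auto
  ultimately have g2: "((\<lambda>x. (g x)\<^sup>2) has_integral r) {s..t}"
    using has_integral_restrict_UNIV[of "{s..t}" "\<lambda>x. (g x)\<^sup>2" r] by simp
  have K: "((\<lambda>x. \<kappa> / 2 + (g x)\<^sup>2 * (1 / (2 * \<kappa>))) has_integral (\<kappa> / 2 * (t - s) + r * (1 / (2 * \<kappa>)))) {s..t}"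
    using has_integral_const_real[of "\<kappa> / 2" s t] st
    by (intro has_integral_add has_integral_mult_left g2) (simp add: mult.commute)
  have amgm: "\<bar>z\<bar> \<le> \<kappa> / 2 + z\<^sup>2 * (1 / (2 * \<kappa>))" for z :: real
  proof -
    have "0 \<le> (\<bar>z\<bar> - \<kappa>)\<^sup>2" by simp
    then have "2 * \<kappa> * \<bar>z\<bar> \<le> \<kappa>\<^sup>2 + z\<^sup>2" by (simp add: power2_eq_square algebra_simps)
    then show ?thesis using \<kappa> by (simp add: field_simps power2_eq_square)
  qed
  have "f t - f s \<le> \<kappa> / 2 * (t - s) + r * (1 / (2 * \<kappa>))"
    by (rule has_integral_le[OF gi K]) (use amgm in \<open>smt (verit)\<close>)
  moreover have "- (f t - f s) \<le> \<kappa> / 2 * (t - s) + r * (1 / (2 * \<kappa>))"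
    by (rule has_integral_le[OF has_integral_neg[OF gi] K]) (use amgm in \<open>smt (verit)\<close>)
  moreover have "r * (1 / (2 * \<kappa>)) \<le> \<Lambda> / (2 * \<kappa>)" using rL \<kappa> by (simp add: divide_right_mono)
  ultimately show ?thesis by (simp add: mult.commute)
qed

section \<open>The cheapest way to hold a given workload\<close>

locale holding_cost =
  fixes C C' :: "'d::{finite,linorder} \<Rightarrow> real \<Rightarrow> real" and mu :: "'d \<Rightarrow> real" and u1 :: real
  assumes mu_pos: "\<And>i. mu i > 0"
    and C_nonneg: "\<And>i x. x \<ge> 0 \<Longrightarrow> C i x \<ge> 0"
    and C_strict_convex: "\<And>i x z u. x \<ge> 0 \<Longrightarrow> z \<ge> 0 \<Longrightarrow> x \<noteq> z \<Longrightarrow> 0 < u \<Longrightarrow> u < 1 \<Longrightarrow>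
           C i (u * x + (1 - u) * z) < u * C i x + (1 - u) * C i z"
    and C_deriv: "\<And>i x. x \<ge> 0 \<Longrightarrow> (C i has_real_derivative C' i x) (at x within {0..})"
    and C'_cont: "\<And>i. continuous_on {0..} (C' i)"
    and C_zero: "\<And>i. C i 0 = 0" "\<And>i. C' i 0 = 0"
    and C_linear: "\<And>i x. x \<ge> 0 \<Longrightarrow> C i x \<le> u1 * x"
begin

lemma C'_le_slope:
  assumes "0 \<le> x" "x < w"
  shows "C' i x * (w - x) \<le> C i w - C i x"
proof -
  have lim: "((\<lambda>y. (C i y - C i x) / (y - x)) \<longlongrightarrow> C' i x) (at x within {x<..<w})"
    using C_deriv[of x i] assms unfolding has_field_derivative_iff
    by (rule_tac tendsto_within_subset) auto
  have nt: "at x within {x<..<w} \<noteq> bot"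
    using assms by (simp add: trivial_limit_within islimpt_greaterThanLessThan1)
  have "\<forall>\<^sub>F y in at x within {x<..<w}. (C i y - C i x) / (y - x) \<le> (C i w - C i x) / (w - x)"
    unfolding eventually_at_filter
  proof (intro always_eventually allI impI)
    fix y assume y: "y \<in> {x<..<w}"
    define t where "t = (y - x) / (w - x)"
    have t: "0 < t" "t < 1" using y assms by (auto simp: t_def)
    have yt: "y = t * w + (1 - t) * x"
    proof -
      have "t * (w - x) = y - x" using assms by (simp add: t_def)
      then show ?thesis by (simp add: algebra_simps)
    qed
    have "C i y < t * C i w + (1 - t) * C i x"
      unfolding yt using t assms by (intro C_strict_convex) auto
    then have "C i y - C i x \<le> t * (C i w - C i x)" by (simp add: algebra_simps)
    then show "(C i y - C i x) / (y - x) \<le> (C i w - C i x) / (w - x)"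
      using y assms by (simp add: t_def divide_simps mult.commute)
  qed
  from tendsto_upperbound[OF lim this nt] show ?thesis
    using assms by (simp add: pos_le_divide_eq)
qed

lemma slope_le_C':
  assumes "0 \<le> w" "w < z"
  shows "C i z - C i w \<le> C' i z * (z - w)"
proof -
  have lim: "((\<lambda>y. (C i y - C i z) / (y - z)) \<longlongrightarrow> C' i z) (at z within {w<..<z})"
    using C_deriv[of z i] assms unfolding has_field_derivative_iff
    by (rule_tac tendsto_within_subset) auto
  have nt: "at z within {w<..<z} \<noteq> bot"
    using assms by (simp add: trivial_limit_within islimpt_greaterThanLessThan2)
  have "\<forall>\<^sub>F y in at z within {w<..<z}. (C i z - C i w) / (z - w) \<le> (C i y - C i z) / (y - z)"
    unfolding eventually_at_filter
  proof (intro always_eventually allI impI)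
    fix y assume y: "y \<in> {w<..<z}"
    define t where "t = (z - y) / (z - w)"
    have t: "0 < t" "t < 1" using y assms by (auto simp: t_def)
    have tz: "t * (z - w) = z - y" using assms by (simp add: t_def)
    then have yt: "y = t * w + (1 - t) * z" by (simp add: algebra_simps)
    have "C i y < t * C i w + (1 - t) * C i z"
      unfolding yt using t assms by (intro C_strict_convex) auto
    then have "t * (C i z - C i w) \<le> C i z - C i y" by (simp add: algebra_simps)
    then have "t * (C i z - C i w) / (z - y) \<le> (C i z - C i y) / (z - y)" using y by (intro divide_right_mono) auto
    moreover have "t * (C i z - C i w) / (z - y) = (C i z - C i w) / (z - w)"
      using t by (simp add: tz[symmetric])
    moreover have "(C i z - C i y) / (z - y) = (C i y - C i z) / (y - z)"
      by (metis minus_diff_eq minus_divide_divide)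
    ultimately show "(C i z - C i w) / (z - w) \<le> (C i y - C i z) / (y - z)" by simp
  qed
  from tendsto_lowerbound[OF lim this nt] show ?thesis
    using assms by (simp add: pos_divide_le_eq)
qed

lemma C'_strict_mono:
  assumes "0 \<le> x" "x < z"
  shows "C' i x < C' i z"
proof -
  define m where "m = (x + z) / 2"
  have m: "x < m" "m < z" "m - x = z - m" "z - m > 0" using assms by (auto simp: m_def field_simps)
  have "C i (1/2 * x + (1 - 1/2) * z) < 1/2 * C i x + (1 - 1/2) * C i z"
    using assms by (intro C_strict_convex) auto
  moreover have "1/2 * x + (1 - 1/2) * z = m" by (simp add: m_def field_simps)
  ultimately have "C i m - C i x < C i z - C i m" by simp
  moreover have "C' i x * (z - m) \<le> C i m - C i x" using C'_le_slope[of x m i] assms m(1) unfolding m(3) by simp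
  moreover have "C i z - C i m \<le> C' i z * (z - m)" using slope_le_C' assms m by simp
  ultimately have "C' i x * (z - m) < C' i z * (z - m)" by linarith
  then show ?thesis by (rule mult_right_less_imp_less) (use m in simp)
qed

lemma C'_less_iff: "0 \<le> x \<Longrightarrow> 0 \<le> z \<Longrightarrow> C' i x < C' i z \<longleftrightarrow> x < z"
  using C'_strict_mono by (metis linorder_neqE_linordered_idom order_less_asym order_less_irrefl)

lemma C'_le_iff: "0 \<le> x \<Longrightarrow> 0 \<le> z \<Longrightarrow> C' i x \<le> C' i z \<longleftrightarrow> x \<le> z"
  using C'_less_iff by (metis linorder_not_le)

lemma C'_nonneg: "0 \<le> x \<Longrightarrow> 0 \<le> C' i x"
  using C'_le_iff[of 0 x i] C_zero by simp

text \<open>By convexity the derivative at \<open>x\<close> is at most the slope of any chord to the right of \<open>x\<close>,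
  and linear growth makes these slopes at most \<open>u1\<close> in the limit.\<close>
lemma C'_le: assumes "0 \<le> x" shows "C' i x \<le> u1"
proof -
  have "((\<lambda>w. u1 + u1 * x / (w - x)) \<longlongrightarrow> u1 + 0) at_top"
    by (intro tendsto_add tendsto_const) real_asymp
  then have lim: "((\<lambda>w. u1 + u1 * x / (w - x)) \<longlongrightarrow> u1) at_top" by simp
  have ev: "\<forall>\<^sub>F w in at_top. C' i x \<le> u1 + u1 * x / (w - x)"
    using eventually_gt_at_top[of x]
  proof eventually_elim
    case (elim w)
    have "C' i x * (w - x) \<le> C i w - C i x" using C'_le_slope assms elim by simp
    also have "\<dots> \<le> u1 * w" using C_linear[of w i] C_nonneg[OF assms, of i] elim assms by simp
    also have "\<dots> = (u1 + u1 * x / (w - x)) * (w - x)" using elim by (simp add: field_simps)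
    finally show ?case using elim by (simp only: mult_le_cancel_right)
  qed
  show ?thesis by (rule tendsto_lowerbound[OF lim ev]) simp
qed

lemma u1_nonneg: "0 \<le> u1"
  using C'_le[of 0] C_zero by simp

lemma C_mono:
  assumes "0 \<le> x" "x \<le> z"
  shows "C i x \<le> C i z"
proof (cases "x = z")
  case False
  then have "0 \<le> C' i x * (z - x)" using C'_nonneg[OF assms(1)] assms by simp
  then show ?thesis using C'_le_slope[of x z i] assms False by simp
qed simp

lemma C_Lipschitz_le:
  assumes "0 \<le> x" "x \<le> z"
  shows "C i z \<le> C i x + u1 * (z - x)"
proof (cases "x = z")
  case False
  have "C' i z * (z - x) \<le> u1 * (z - x)" using C'_le[of z i] assms by (intro mult_right_mono) auto
  moreover have "C i z - C i x \<le> C' i z * (z - x)" using slope_le_C'[of x z i] assms False by simp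
  ultimately show ?thesis by linarith
qed simp

lemma continuous_on_C: "continuous_on {0..} (C i)"
  using C_deriv by (meson DERIV_continuous atLeast_iff continuous_on_eq_continuous_within)

lemma continuous_on_total_cost: "continuous_on {x::(real, 'd) vec. \<forall>i. 0 \<le> x $ i} (total_cost C)"
proof -
  have "continuous_on {x::(real, 'd) vec. \<forall>i. 0 \<le> x $ i} (\<lambda>x. C i (x $ i))" for i
    by (rule continuous_on_compose2[OF continuous_on_C]) (auto intro!: continuous_intros)
  then show ?thesis unfolding total_cost_def by (intro continuous_on_sum)
qed

definition workload :: "(real, 'd) vec \<Rightarrow> real" where
  "workload x = (\<Sum>i\<in>UNIV. x $ i / mu i)"

definition feasible :: "real \<Rightarrow> ((real, 'd) vec) set" where
  "feasible w = {x. (\<forall>i. 0 \<le> x $ i) \<and> workload x = w}"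

lemma le_workload: "(\<And>i. 0 \<le> x $ i) \<Longrightarrow> x $ i \<le> mu i * workload x"
proof -
  assume "\<And>i. 0 \<le> x $ i"
  then have "x $ i / mu i \<le> workload x"
    unfolding workload_def using mu_pos by (intro member_le_sum) (auto intro!: divide_nonneg_pos)
  then show ?thesis using mu_pos[of i] by (simp add: field_simps)
qed

lemma workload_nonneg: "(\<And>i. 0 \<le> x $ i) \<Longrightarrow> 0 \<le> workload x"
  unfolding workload_def using mu_pos by (intro sum_nonneg) (auto intro!: divide_nonneg_pos)

lemma compact_feasible: "compact (feasible w)"
  unfolding compact_eq_bounded_closed
proof
  have "norm x \<le> (\<Sum>i\<in>UNIV. mu i * w)" if "x \<in> feasible w" for x
  proof -
    have "norm x \<le> (\<Sum>i\<in>UNIV. \<bar>x $ i\<bar>)" using norm_le_l1_cart .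
    also have "\<dots> \<le> (\<Sum>i\<in>UNIV. mu i * w)"
      using that le_workload[of x] by (intro sum_mono) (auto simp: feasible_def)
    finally show ?thesis .
  qed
  then show "bounded (feasible w)" by (auto simp: bounded_iff)
  show "closed (feasible w)"
    unfolding feasible_def workload_def
    by (intro closed_Collect_conj closed_Collect_all closed_Collect_le closed_Collect_eq)
      (auto intro!: continuous_intros less_imp_neq[OF mu_pos, symmetric])
qed

text \<open>Moving a small amount \<open>h\<close> of work from class \<open>j\<close> to class \<open>i\<close> preserves the workload and
  cannot lower the cost of a minimizer; dividing by \<open>h\<close> and letting \<open>h\<close> tend to zero compares the
  two indices. The constraint of nonnegativity does not interfere: as indices vanish at empty queues,
  the class of larger index has a nonempty queue from which work can be taken.\<close>
lemma minimizer_equalizes: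
  assumes x: "x \<in> feasible w" and min: "\<And>z. z \<in> feasible w \<Longrightarrow> total_cost C x \<le> total_cost C z"
  shows "mu i * C' i (x $ i) = mu j * C' j (x $ j)"
proof -
  have xn: "0 \<le> x $ k" for k using x by (auto simp: feasible_def)
  have "\<not> mu i * C' i (x $ i) < mu j * C' j (x $ j)" for i j
  proof
    assume less: "mu i * C' i (x $ i) < mu j * C' j (x $ j)"
    then have ij: "i \<noteq> j" by auto
    have "0 \<le> mu i * C' i (x $ i)" using C'_nonneg[OF xn] mu_pos[of i] by simp
    then have xj: "0 < x $ j" using less C_zero(2)[of j] xn[of j] by (cases "x $ j = 0") auto
    have ev: "mu j * C' j (x $ j - mu j * h) \<le> mu i * C' i (x $ i + mu i * h)" if h: "0 < h" "h < x $ j / mu j" for h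
    proof -
      have mjh: "mu j * h < x $ j" "0 < mu j * h" "0 < mu i * h" using h mu_pos by (auto simp: field_simps)
      define z where "z = (\<chi> k. if k = i then x $ i + mu i * h else if k = j then x $ j - mu j * h else x $ k)"
      have z: "z $ i = x $ i + mu i * h" "z $ j = x $ j - mu j * h" "\<And>k. k \<noteq> i \<Longrightarrow> k \<noteq> j \<Longrightarrow> z $ k = x $ k"
        using ij by (auto simp: z_def)
      have split: "(\<Sum>k\<in>UNIV. f k) = f i + (f j + (\<Sum>k\<in>UNIV - {i} - {j}. f k))" for f :: "'d \<Rightarrow> real"
        using ij by (simp add: sum.remove[of UNIV i] sum.remove[of "UNIV - {i}" j])
      have rest: "(\<Sum>k\<in>UNIV - {i} - {j}. g k (z $ k)) = (\<Sum>k\<in>UNIV - {i} - {j}. g k (x $ k))" for g :: "'d \<Rightarrow> real \<Rightarrow> real"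
        using z by (intro sum.cong) auto
      have "workload z = workload x"
        unfolding workload_def split[of "\<lambda>k. z $ k / mu k"] split[of "\<lambda>k. x $ k / mu k"] rest[of "\<lambda>k t. t / mu k"] z
        using mu_pos[of i] mu_pos[of j] by (simp add: field_simps)
      moreover have "0 \<le> z $ k" for k using xn mjh mu_pos[of i] h by (auto simp: z_def)
      ultimately have "total_cost C x \<le> total_cost C z" using x by (intro min) (auto simp: feasible_def)
      then have "C i (x $ i) + C j (x $ j) \<le> C i (x $ i + mu i * h) + C j (x $ j - mu j * h)"
        unfolding total_cost_def split[of "\<lambda>k. C k (z $ k)"] split[of "\<lambda>k. C k (x $ k)"] rest[of C] z by simp
      moreover have "C i (x $ i + mu i * h) - C i (x $ i) \<le> C' i (x $ i + mu i * h) * (mu i * h)"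
        using slope_le_C'[of "x $ i" "x $ i + mu i * h" i] xn mjh by simp
      moreover have "C' j (x $ j - mu j * h) * (mu j * h) \<le> C j (x $ j) - C j (x $ j - mu j * h)"
        using C'_le_slope[of "x $ j - mu j * h" "x $ j" j] xn mjh by simp
      ultimately have "(mu j * C' j (x $ j - mu j * h)) * h \<le> (mu i * C' i (x $ i + mu i * h)) * h"
        by (simp add: algebra_simps)
      then show ?thesis using h by simp
    qed
    have at: "at (0::real) within {0<..<x $ j / mu j} \<noteq> bot"
      using xj mu_pos[of j] by (simp add: trivial_limit_within islimpt_greaterThanLessThan1)
    have l1: "((\<lambda>h. mu j * C' j (x $ j - mu j * h)) \<longlongrightarrow> mu j * C' j (x $ j - mu j * 0)) (at 0 within {0<..<x $ j / mu j})"
    proof (intro tendsto_mult tendsto_const)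
      have "continuous_on {0..x $ j / mu j} (\<lambda>h. C' j (x $ j - mu j * h))"
        by (rule continuous_on_compose2[OF C'_cont]) (use mu_pos[of j] in \<open>auto intro!: continuous_intros simp: field_simps\<close>)
      then have "((\<lambda>h. C' j (x $ j - mu j * h)) \<longlongrightarrow> C' j (x $ j - mu j * 0)) (at 0 within {0..x $ j / mu j})"
        unfolding continuous_on_def using xj mu_pos[of j] by (metis atLeastAtMost_iff divide_pos_pos less_eq_real_def order_refl)
      then show "((\<lambda>h. C' j (x $ j - mu j * h)) \<longlongrightarrow> C' j (x $ j - mu j * 0)) (at 0 within {0<..<x $ j / mu j})"
        by (rule tendsto_within_subset) auto
    qed
    have l2: "((\<lambda>h. mu i * C' i (x $ i + mu i * h)) \<longlongrightarrow> mu i * C' i (x $ i + mu i * 0)) (at 0 within {0<..<x $ j / mu j})"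
    proof (intro tendsto_mult tendsto_const)
      have "continuous_on {0..} (\<lambda>h. C' i (x $ i + mu i * h))"
        by (rule continuous_on_compose2[OF C'_cont]) (use mu_pos[of i] xn in \<open>auto intro!: continuous_intros add_nonneg_nonneg\<close>)
      then have "((\<lambda>h. C' i (x $ i + mu i * h)) \<longlongrightarrow> C' i (x $ i + mu i * 0)) (at 0 within {0..})"
        unfolding continuous_on_def by blast
      then show "((\<lambda>h. C' i (x $ i + mu i * h)) \<longlongrightarrow> C' i (x $ i + mu i * 0)) (at 0 within {0<..<x $ j / mu j})"
        by (rule tendsto_within_subset) auto
    qed
    have "mu j * C' j (x $ j - mu j * 0) \<le> mu i * C' i (x $ i + mu i * 0)"
      by (rule tendsto_le[OF at l2 l1]) (use ev in \<open>auto simp: eventually_at_filter\<close>)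
    then show False using less by simp
  qed
  then show ?thesis by (metis linorder_neqE_linordered_idom)
qed

lemma equilibrium_exists:
  assumes "0 \<le> w"
  shows "\<exists>x. x \<in> feasible w \<and> (\<forall>z\<in>feasible w. total_cost C x \<le> total_cost C z) \<and>
    (\<forall>i j. mu i * C' i (x $ i) = mu j * C' j (x $ j))"
proof -
  define z :: "(real, 'd) vec" where "z = (\<chi> i. mu i * (w / CARD('d)))"
  have "workload z = w" using mu_pos by (simp add: workload_def z_def less_imp_neq[OF mu_pos, symmetric])
  moreover have "0 \<le> z $ i" for i using assms mu_pos[of i] by (simp add: z_def)
  ultimately have ne: "feasible w \<noteq> {}" by (auto simp: feasible_def)
  have "continuous_on (feasible w) (total_cost C)"
    by (rule continuous_on_subset[OF continuous_on_total_cost]) (auto simp: feasible_def)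
  from continuous_attains_inf[OF compact_feasible ne this] obtain x where
    x: "x \<in> feasible w" "\<And>z. z \<in> feasible w \<Longrightarrow> total_cost C x \<le> total_cost C z" by blast
  then show ?thesis using minimizer_equalizes[OF x] by blast
qed

text \<open>The cheapest vector of workload \<open>w\<close>, at which the indices of all classes coincide.\<close>
definition equilibrium :: "real \<Rightarrow> (real, 'd) vec" where
  "equilibrium w = (SOME x. x \<in> feasible w \<and> (\<forall>z\<in>feasible w. total_cost C x \<le> total_cost C z) \<and>
    (\<forall>i j. mu i * C' i (x $ i) = mu j * C' j (x $ j)))"

lemma equilibrium:
  assumes "0 \<le> w"
  shows "0 \<le> equilibrium w $ i" "workload (equilibrium w) = w"
    "\<And>z. (\<And>i. 0 \<le> z $ i) \<Longrightarrow> workload z = w \<Longrightarrow> total_cost C (equilibrium w) \<le> total_cost C z"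
    "mu i * C' i (equilibrium w $ i) = mu j * C' j (equilibrium w $ j)"
  using someI_ex[OF equilibrium_exists[OF assms]] unfolding equilibrium_def[symmetric]
  by (auto simp: feasible_def)

text \<open>At both equilibria the indices of all classes coincide, and each index is strictly
  increasing in its queue. If one queue were to decrease, all of them would, and so would the
  workload.\<close>
lemma equilibrium_mono:
  assumes w: "0 \<le> w" "w \<le> w'"
  shows "equilibrium w $ i \<le> equilibrium w' $ i"
proof (rule ccontr)
  assume "\<not> equilibrium w $ i \<le> equilibrium w' $ i"
  then have i: "equilibrium w' $ i < equilibrium w $ i" by simp
  have w': "0 \<le> w'" using w by simp
  note e = equilibrium[OF w(1)] and e' = equilibrium[OF w']
  have "equilibrium w' $ k < equilibrium w $ k" for k
  proof -
    have "mu k * C' k (equilibrium w' $ k) = mu i * C' i (equilibrium w' $ i)" by (rule e'(4))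
    also have "\<dots> < mu i * C' i (equilibrium w $ i)" using i e'(1) mu_pos[of i] by (simp add: C'_strict_mono)
    also have "\<dots> = mu k * C' k (equilibrium w $ k)" by (rule e(4))
    finally show ?thesis using mu_pos[of k] e(1) e'(1) by (simp add: C'_less_iff)
  qed
  then have "workload (equilibrium w') < workload (equilibrium w)"
    unfolding workload_def using mu_pos by (intro sum_strict_mono divide_strict_right_mono) auto
  then show False using e(2) e'(2) w by simp
qed

text \<open>As all queues increase with the workload, no single class takes more than the whole
  increment.\<close>
lemma equilibrium_Lipschitz_le:
  assumes w: "0 \<le> w" "w \<le> w'"
  shows "equilibrium w' $ i \<le> equilibrium w $ i + mu i * (w' - w)"
proof -
  have w': "0 \<le> w'" using w by simp
  have "equilibrium w' $ i / mu i - equilibrium w $ i / mu i \<le> (\<Sum>k\<in>UNIV. equilibrium w' $ k / mu k - equilibrium w $ k / mu k)"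
    using equilibrium_mono[OF w] less_imp_le[OF mu_pos]
    by (intro member_le_sum) (auto intro!: divide_right_mono)
  also have "\<dots> = w' - w"
    using equilibrium(2)[OF w(1)] equilibrium(2)[OF w'] by (simp add: sum_subtractf workload_def)
  finally show ?thesis using mu_pos[of i] by (simp add: field_simps)
qed

lemma equilibrium_Lipschitz:
  assumes "0 \<le> w" "0 \<le> w'"
  shows "\<bar>equilibrium w' $ i - equilibrium w $ i\<bar> \<le> mu i * \<bar>w' - w\<bar>"
  using equilibrium_mono[of w w' i] equilibrium_mono[of w' w i]
    equilibrium_Lipschitz_le[of w w' i] equilibrium_Lipschitz_le[of w' w i] assms by (cases "w \<le> w'") auto

lemma equilibrium_0: "equilibrium 0 $ i = 0"
  using equilibrium(1,2)[of 0] le_workload[of "equilibrium 0" i] by (simp add: order_antisym)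

definition min_cost :: "real \<Rightarrow> real" where
  "min_cost w = total_cost C (equilibrium w)"

lemma min_cost_le: "(\<And>i. 0 \<le> x $ i) \<Longrightarrow> min_cost (workload x) \<le> total_cost C x"
  unfolding min_cost_def using workload_nonneg by (intro equilibrium(3)) auto

lemma min_cost_mono: "0 \<le> w \<Longrightarrow> w \<le> w' \<Longrightarrow> min_cost w \<le> min_cost w'"
  unfolding min_cost_def total_cost_def
  by (intro sum_mono C_mono equilibrium(1) equilibrium_mono)

definition mu_total :: real where "mu_total = (\<Sum>i\<in>UNIV. mu i)"
definition theta_total :: real where "theta_total = (\<Sum>i\<in>UNIV. 1 / mu i)"

lemma mu_total_pos: "0 < mu_total"
  unfolding mu_total_def using mu_pos by (intro sum_pos) auto

lemma theta_total_pos: "0 < theta_total"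
  unfolding theta_total_def using mu_pos by (intro sum_pos) auto

lemma min_cost_Lipschitz_le:
  assumes "0 \<le> w" "w \<le> w'"
  shows "min_cost w' \<le> min_cost w + u1 * mu_total * (w' - w)"
proof -
  have "min_cost w' \<le> (\<Sum>i\<in>UNIV. C i (equilibrium w $ i) + u1 * (mu i * (w' - w)))"
    unfolding min_cost_def total_cost_def
  proof (rule sum_mono)
    fix i
    have "C i (equilibrium w' $ i) \<le> C i (equilibrium w $ i) + u1 * (equilibrium w' $ i - equilibrium w $ i)"
      using assms by (intro C_Lipschitz_le equilibrium(1) equilibrium_mono)
    also have "\<dots> \<le> C i (equilibrium w $ i) + u1 * (mu i * (w' - w))"
      using equilibrium_Lipschitz_le[OF assms, of i] u1_nonneg by (intro add_left_mono mult_left_mono) auto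
    finally show "C i (equilibrium w' $ i) \<le> C i (equilibrium w $ i) + u1 * (mu i * (w' - w))" .
  qed
  also have "\<dots> = min_cost w + u1 * mu_total * (w' - w)"
    by (simp add: sum.distrib min_cost_def total_cost_def mu_total_def sum_distrib_left sum_distrib_right mult.assoc)
  finally show ?thesis .
qed

lemma min_cost_Lipschitz:
  assumes "0 \<le> w" "0 \<le> w'"
  shows "\<bar>min_cost w' - min_cost w\<bar> \<le> u1 * mu_total * \<bar>w' - w\<bar>"
  using min_cost_mono[of w w'] min_cost_mono[of w' w] min_cost_Lipschitz_le[of w w']
    min_cost_Lipschitz_le[of w' w] assms by (cases "w \<le> w'") auto

lemma continuous_on_min_cost: "continuous_on {0..} min_cost"
proof -
  have "(u1 * mu_total)-lipschitz_on {0..} min_cost"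
    using min_cost_Lipschitz u1_nonneg mu_total_pos by (intro lipschitz_onI) (auto simp: dist_real_def abs_minus_commute)
  then show ?thesis by (rule lipschitz_on_continuous_on)
qed

text \<open>A one-sided estimate suffices, because the workload is that of the equilibrium: whatever
  one class holds in excess is missing in the other classes, which miss little.\<close>
lemma total_cost_near_equilibrium:
  assumes x: "\<And>i. 0 \<le> x $ i" and near: "\<And>j. equilibrium (workload x) $ j - \<eta> \<le> x $ j" and \<eta>: "0 \<le> \<eta>"
  shows "total_cost C x \<le> min_cost (workload x) + u1 * mu_total * theta_total * \<eta>"
proof -
  define e where "e = equilibrium (workload x)"
  have w: "0 \<le> workload x" using workload_nonneg x .
  have e: "0 \<le> e $ i" "workload e = workload x" for i using equilibrium[OF w] unfolding e_def by auto
  have "C i (x $ i) \<le> C i (e $ i) + u1 * (mu i * (theta_total * \<eta>))" for i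
  proof -
    have "x $ i / mu i - e $ i / mu i + (\<Sum>k\<in>UNIV - {i}. x $ k / mu k - e $ k / mu k) = 0"
      using e(2) sum.remove[of UNIV i "\<lambda>k. x $ k / mu k - e $ k / mu k"]
      by (simp add: workload_def sum_subtractf)
    moreover have "(\<Sum>k\<in>UNIV - {i}. - \<eta> / mu k) \<le> (\<Sum>k\<in>UNIV - {i}. x $ k / mu k - e $ k / mu k)"
    proof (rule sum_mono)
      fix k
      have "- \<eta> \<le> x $ k - e $ k" using near[of k] by (simp add: e_def)
      then have "- \<eta> / mu k \<le> (x $ k - e $ k) / mu k"
        by (rule divide_right_mono) (use mu_pos[of k] in simp)
      then show "- \<eta> / mu k \<le> x $ k / mu k - e $ k / mu k" by (simp add: diff_divide_distrib)
    qed
    moreover have "(\<Sum>k\<in>UNIV - {i}. \<eta> / mu k) \<le> theta_total * \<eta>"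
      using \<eta> mu_pos unfolding theta_total_def sum_distrib_right
      by (simp) (intro sum_mono2; auto intro!: divide_nonneg_pos)
    ultimately have "x $ i / mu i \<le> e $ i / mu i + theta_total * \<eta>" by (simp add: sum_negf)
    then have xe: "x $ i \<le> e $ i + mu i * (theta_total * \<eta>)" using mu_pos[of i] by (simp add: field_simps)
    have m0: "0 \<le> mu i * (theta_total * \<eta>)" using \<eta> mu_pos[of i] theta_total_pos by simp
    have "C i (x $ i) \<le> C i (e $ i + mu i * (theta_total * \<eta>))" using xe x by (intro C_mono) auto
    also have "\<dots> \<le> C i (e $ i) + u1 * (mu i * (theta_total * \<eta>))"
      using C_Lipschitz_le[of "e $ i" "e $ i + mu i * (theta_total * \<eta>)" i] e m0 by simp
    finally show ?thesis .
  qed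
  then have "total_cost C x \<le> (\<Sum>i\<in>UNIV. C i (e $ i) + u1 * (mu i * (theta_total * \<eta>)))"
    unfolding total_cost_def by (intro sum_mono)
  also have "\<dots> = min_cost (workload x) + u1 * mu_total * theta_total * \<eta>"
    by (simp add: sum.distrib min_cost_def total_cost_def mu_total_def sum_distrib_left sum_distrib_right mult.assoc e_def)
  finally show ?thesis .
qed

text \<open>Some class holds at least its equilibrium share, since otherwise the workload would be
  too small. Its index is then at least the common index of the equilibrium, and a fortiori so is
  the index of the class with priority.\<close>
lemma priority_region_above_equilibrium:
  assumes x: "x \<in> priority_region mu C' j"
  shows "equilibrium (workload x) $ j \<le> x $ j" "0 < x $ j"
proof -
  have xn: "0 \<le> x $ k" for k using x by (auto simp: priority_region_def)
  have x0: "x \<noteq> 0" and j: "j = Min {k. mu k * C' k (x $ k) = (MAX j. mu j * C' j (x $ j))}"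
    using x by (auto simp: priority_region_def)
  let ?M = "MAX j. mu j * C' j (x $ j)"
  have "?M \<in> range (\<lambda>j. mu j * C' j (x $ j))" by (intro Max_in) auto
  then have "{k. mu k * C' k (x $ k) = ?M} \<noteq> {}" by (auto simp: image_iff)
  then have "j \<in> {k. mu k * C' k (x $ k) = ?M}" unfolding j by (intro Min_in) auto
  then have max: "mu k * C' k (x $ k) \<le> mu j * C' j (x $ j)" for k by (simp add: Max_ge)
  have w: "0 \<le> workload x" using workload_nonneg xn .
  note e = equilibrium[OF w]
  obtain k where k: "equilibrium (workload x) $ k \<le> x $ k"
  proof (rule ccontr)
    assume "\<not> thesis"
    then have "\<And>k. x $ k < equilibrium (workload x) $ k" using that by (meson not_le)
    then have "workload x < workload (equilibrium (workload x))"
      unfolding workload_def[of x] workload_def[of "equilibrium _"] using mu_pos by (intro sum_strict_mono divide_strict_right_mono) auto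
    then show False using e(2) by simp
  qed
  have "mu j * C' j (equilibrium (workload x) $ j) = mu k * C' k (equilibrium (workload x) $ k)" by (rule e(4))
  also have "\<dots> \<le> mu k * C' k (x $ k)" using k e(1) xn mu_pos[of k] by (simp add: C'_le_iff)
  also have "\<dots> \<le> mu j * C' j (x $ j)" by (rule max)
  finally show "equilibrium (workload x) $ j \<le> x $ j" using e(1) xn mu_pos[of j] by (simp add: C'_le_iff)
  obtain l where "x $ l \<noteq> 0" using x0 by (metis vec_eq_iff zero_index)
  then have "0 < x $ l" using xn[of l] by simp
  then have "0 < mu l * C' l (x $ l)" using C'_strict_mono[of 0 "x $ l" l] C_zero(2) mu_pos[of l] by simp
  then have "0 < mu j * C' j (x $ j)" using max[of l] by simp
  then show "0 < x $ j" using C_zero(2)[of j] xn[of j] by (cases "x $ j = 0") auto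
qed

end

section \<open>Reflection at zero\<close>

text \<open>The least non-decreasing nonnegative function that lifts \<open>x\<close> above zero; adding it to
  \<open>x\<close> gives the Skorokhod reflection of \<open>x\<close>.\<close>
definition regulator :: "(real \<Rightarrow> real) \<Rightarrow> real \<Rightarrow> real" where
  "regulator x t = (SUP s\<in>{0..t}. max 0 (- x s))"

definition reflected :: "(real \<Rightarrow> real) \<Rightarrow> real \<Rightarrow> real" where
  "reflected x t = x t + regulator x t"

lemma regulator_le:
  assumes "0 \<le> t" "0 \<le> B" "\<And>s. 0 \<le> s \<Longrightarrow> s \<le> t \<Longrightarrow> - x s \<le> B"
  shows "regulator x t \<le> B"
  unfolding regulator_def using assms by (intro cSUP_least) auto

lemma regulator_ge:
  assumes "\<And>s. 0 \<le> s \<Longrightarrow> s \<le> t \<Longrightarrow> \<bar>x s\<bar> \<le> R" "0 \<le> s" "s \<le> t"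
  shows "- x s \<le> regulator x t" "0 \<le> regulator x t"
proof -
  have "max 0 (- x r) \<le> \<bar>R\<bar>" if "0 \<le> r" "r \<le> t" for r using assms(1)[OF that] by linarith
  then have "bdd_above ((\<lambda>s. max 0 (- x s)) ` {0..t})" by (intro bdd_aboveI2[of _ _ "\<bar>R\<bar>"]) auto
  then have "max 0 (- x s) \<le> regulator x t"
    unfolding regulator_def using assms by (intro cSUP_upper) auto
  then show "- x s \<le> regulator x t" "0 \<le> regulator x t" by auto
qed

lemma regulator_mono:
  assumes "\<And>s. 0 \<le> s \<Longrightarrow> s \<le> t \<Longrightarrow> \<bar>x s\<bar> \<le> R" "0 \<le> s" "s \<le> t"
  shows "regulator x s \<le> regulator x t"
  using assms regulator_ge[of t x R] by (intro regulator_le) auto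

lemma regulator_0: "0 \<le> x 0 \<Longrightarrow> regulator x 0 = 0"
  unfolding regulator_def by simp

lemma regulator_Lipschitz:
  assumes "\<And>s. 0 \<le> s \<Longrightarrow> s \<le> t \<Longrightarrow> \<bar>x s\<bar> \<le> R" "\<And>s. 0 \<le> s \<Longrightarrow> s \<le> t \<Longrightarrow> \<bar>z s\<bar> \<le> R"
    "\<And>s. 0 \<le> s \<Longrightarrow> s \<le> t \<Longrightarrow> \<bar>x s - z s\<bar> \<le> e" "0 \<le> t"
  shows "\<bar>regulator x t - regulator z t\<bar> \<le> e"
proof -
  have e: "0 \<le> e" using assms(3)[of 0] assms(4) by auto
  have "regulator x t \<le> regulator z t + e"
    using assms e regulator_ge[of t z R] by (intro regulator_le) (smt (verit))+
  moreover have "regulator z t \<le> regulator x t + e"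
    using assms e regulator_ge[of t x R] by (intro regulator_le) (smt (verit))+
  ultimately show ?thesis by linarith
qed

lemma reflected_Lipschitz:
  assumes "\<And>s. 0 \<le> s \<Longrightarrow> s \<le> t \<Longrightarrow> \<bar>x s\<bar> \<le> R" "\<And>s. 0 \<le> s \<Longrightarrow> s \<le> t \<Longrightarrow> \<bar>z s\<bar> \<le> R"
    "\<And>s. 0 \<le> s \<Longrightarrow> s \<le> t \<Longrightarrow> \<bar>x s - z s\<bar> \<le> e" "0 \<le> t"
  shows "\<bar>reflected x t - reflected z t\<bar> \<le> 2 * e"
proof -
  have "\<bar>regulator x t - regulator z t\<bar> \<le> e" by (rule regulator_Lipschitz) (fact assms)+
  then show ?thesis using assms(3)[of t] assms(4) unfolding reflected_def by auto
qed

lemma reflected_nonneg: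
  assumes "\<And>s. 0 \<le> s \<Longrightarrow> s \<le> t \<Longrightarrow> \<bar>x s\<bar> \<le> R" "0 \<le> t"
  shows "0 \<le> reflected x t"
  using regulator_ge(1)[where x=x and s=t and t=t and R=R] assms unfolding reflected_def by auto

lemma reflected_le:
  assumes "\<And>s. 0 \<le> s \<Longrightarrow> s \<le> t \<Longrightarrow> \<bar>x s\<bar> \<le> R" "0 \<le> t"
  shows "reflected x t \<le> 2 * R"
proof -
  have "regulator x t \<le> R"
    using assms by (intro regulator_le) (smt (verit))+
  then show ?thesis using assms(1)[of t] assms(2) unfolding reflected_def by auto
qed

lemma regulator_increment:
  assumes R: "\<And>s. 0 \<le> s \<Longrightarrow> s \<le> t \<Longrightarrow> \<bar>x s\<bar> \<le> R" and st: "0 \<le> s" "s \<le> t"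
    and e: "\<And>r. s \<le> r \<Longrightarrow> r \<le> t \<Longrightarrow> \<bar>x r - x s\<bar> \<le> e"
  shows "regulator x t \<le> regulator x s + e"
proof (rule regulator_le)
  have e0: "0 \<le> e" using e[of s] st by auto
  show "0 \<le> t" using st by simp
  have R': "\<And>r. 0 \<le> r \<Longrightarrow> r \<le> s \<Longrightarrow> \<bar>x r\<bar> \<le> R" using R st by auto
  show "0 \<le> regulator x s + e" using regulator_ge(2)[of s x R s, OF R'] st e0 by simp
  fix r assume r: "0 \<le> r" "r \<le> t"
  show "- x r \<le> regulator x s + e"
  proof (cases "r \<le> s")
    case True
    then show ?thesis using regulator_ge(1)[of s x R r, OF R'] r e0 by simp
  next
    case False
    then have "- x r \<le> - x s + e" using e[of r] r by auto
    then show ?thesis using regulator_ge(1)[of s x R s, OF R'] st by simp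
  qed
qed

lemma reflected_increment:
  assumes R: "\<And>s. 0 \<le> s \<Longrightarrow> s \<le> t \<Longrightarrow> \<bar>x s\<bar> \<le> R" and st: "0 \<le> s" "s \<le> t"
    and e: "\<And>r. s \<le> r \<Longrightarrow> r \<le> t \<Longrightarrow> \<bar>x r - x s\<bar> \<le> e"
  shows "\<bar>reflected x t - reflected x s\<bar> \<le> 2 * e"
proof -
  have "regulator x t \<le> regulator x s + e" by (rule regulator_increment) (fact assms)+
  moreover have "regulator x s \<le> regulator x t" by (rule regulator_mono) (fact assms)+
  ultimately show ?thesis using e[of t] st unfolding reflected_def by linarith
qed

lemma continuous_on_regulator:
  assumes "continuous_on {0..T} x"
  shows "continuous_on {0..T} (regulator x)"
proof -
  have "bounded (x ` {0..T})" using assms by (intro compact_imp_bounded compact_continuous_image) auto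
  then obtain R where R: "\<And>s. 0 \<le> s \<Longrightarrow> s \<le> T \<Longrightarrow> \<bar>x s\<bar> \<le> R"
    by (force simp: bounded_iff)
  have uc: "uniformly_continuous_on {0..T} x" using assms by (intro compact_uniformly_continuous) auto
  have "uniformly_continuous_on {0..T} (regulator x)"
    unfolding uniformly_continuous_on_def
  proof (intro allI impI)
    fix e :: real assume "0 < e"
    then have "0 < e / 2" by simp
    then obtain d where d: "d > 0" "\<And>r r'. r \<in> {0..T} \<Longrightarrow> r' \<in> {0..T} \<Longrightarrow> dist r' r < d \<Longrightarrow> dist (x r') (x r) < e / 2"
      using uc unfolding uniformly_continuous_on_def by metis
    have half: "\<bar>regulator x t - regulator x s\<bar> \<le> e / 2" if st: "0 \<le> s" "s \<le> t" "t \<le> T" "t - s < d" for s t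
    proof -
      have R': "\<bar>x r\<bar> \<le> R" if "0 \<le> r" "r \<le> t" for r using R that st by auto
      have e': "\<bar>x r - x s\<bar> \<le> e / 2" if "s \<le> r" "r \<le> t" for r
        using d(2)[of s r] that st by (simp add: dist_real_def)
      have "regulator x t \<le> regulator x s + e / 2" by (rule regulator_increment) (fact R' st e')+
      moreover have "regulator x s \<le> regulator x t" by (rule regulator_mono) (fact R' st)+
      ultimately show ?thesis by simp
    qed
    have "dist (regulator x t) (regulator x s) < e" if st: "s \<in> {0..T}" "t \<in> {0..T}" "dist t s < d" for s t
      using half[of s t] half[of t s] st \<open>0 < e\<close> by (cases "s \<le> t") (auto simp: dist_real_def abs_minus_commute)
    then show "\<exists>d>0. \<forall>s\<in>{0..T}. \<forall>t\<in>{0..T}. dist t s < d \<longrightarrow> dist (regulator x t) (regulator x s) < e"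
      using d(1) by blast
  qed
  then show ?thesis by (rule uniformly_continuous_imp_continuous)
qed

lemma continuous_on_reflected:
  "continuous_on {0..T} x \<Longrightarrow> continuous_on {0..T} (reflected x)"
  unfolding reflected_def by (intro continuous_on_add continuous_on_regulator)

text \<open>A non-decreasing \<open>l\<close> with \<open>0 \<le> l 0\<close> that keeps \<open>x + l\<close> nonnegative dominates the running supremum of
  \<open>- x\<close>.\<close>
lemma reflected_minimal:
  assumes "0 \<le> t" "\<And>s. 0 \<le> s \<Longrightarrow> s \<le> t \<Longrightarrow> 0 \<le> x s + l s" "0 \<le> l 0"
    "\<And>s. 0 \<le> s \<Longrightarrow> s \<le> t \<Longrightarrow> l s \<le> l t"
  shows "reflected x t \<le> x t + l t"
proof -
  have "regulator x t \<le> l t"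
  proof (rule regulator_le)
    show "0 \<le> l t" using assms(3) assms(4)[of 0] assms(1) by simp
    fix s assume "0 \<le> s" "s \<le> t"
    then show "- x s \<le> l t" using assms(2)[of s] assms(4)[of s] by linarith
  qed (use assms in auto)
  then show ?thesis unfolding reflected_def by simp
qed

text \<open>At the last time \<open>s\<close> where \<open>x + l\<close> vanishes one has \<open>l s = - x s\<close>, which is at most the
  regulator, and \<open>l\<close> does not change afterwards. Only \<open>l\<close> is assumed continuous, since the
  scaled queueing processes jump; therefore \<open>s\<close> is only a limit of zeros \<open>z\<close>, and
  \<open>l z = - x z\<close> is used along these.\<close>
lemma reflected_maximal:
  assumes t: "0 \<le> t" and R: "\<And>s. 0 \<le> s \<Longrightarrow> s \<le> t \<Longrightarrow> \<bar>x s\<bar> \<le> R"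
    and start: "x 0 + l 0 = 0" and cont: "continuous_on {0..t} l"
    and flat: "\<And>s r. 0 \<le> s \<Longrightarrow> s \<le> r \<Longrightarrow> r \<le> t \<Longrightarrow> (\<And>u. s < u \<Longrightarrow> u \<le> r \<Longrightarrow> x u + l u \<noteq> 0) \<Longrightarrow> l r = l s"
  shows "x t + l t \<le> reflected x t"
proof -
  define Z where "Z = {s\<in>{0..t}. x s + l s = 0}"
  have Z: "0 \<in> Z" "Z \<subseteq> {0..t}" using start t by (auto simp: Z_def)
  have bdd: "bdd_above Z" using Z by (meson bdd_above_Icc bdd_above_mono)
  define s where "s = Sup Z"
  have s: "0 \<le> s" "s \<le> t"
    unfolding s_def using Z bdd by (auto intro!: cSup_upper cSup_least)
  have lt: "l t = l s"
  proof (rule flat[OF s(1,2) order_refl])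
    fix u assume u: "s < u" "u \<le> t"
    show "x u + l u \<noteq> 0"
    proof
      assume "x u + l u = 0"
      then have "u \<in> Z" using u s by (auto simp: Z_def)
      then show False using cSup_upper[OF _ bdd, of u] u unfolding s_def by simp
    qed
  qed
  have "s \<in> closure Z" unfolding s_def using Z bdd by (intro closure_contains_Sup) auto
  then obtain z where z: "\<And>n. z n \<in> Z" "z \<longlonglongrightarrow> s" unfolding closure_sequential by blast
  have "(\<lambda>n. l (z n)) \<longlonglongrightarrow> l s"
  proof (rule continuous_on_tendsto_compose[OF cont z(2)])
    show "\<forall>\<^sub>F n in sequentially. z n \<in> {0..t}" using z(1) Z(2) by (intro always_eventually) blast
  qed (use s in auto)
  moreover have "l (z n) \<le> regulator x t" for n
  proof -
    have "z n \<in> Z" by (rule z)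
    then have zn: "0 \<le> z n" "z n \<le> t" "x (z n) + l (z n) = 0" by (auto simp: Z_def)
    then show ?thesis using regulator_ge(1)[where x=x and t=t and s="z n" and R=R] R by simp
  qed
  ultimately have "l s \<le> regulator x t" by (intro LIMSEQ_le_const2) auto
  then show ?thesis unfolding reflected_def using lt by simp
qed

lemma reflected_cong:
  "(\<And>s. 0 \<le> s \<Longrightarrow> s \<le> t \<Longrightarrow> x s = z s) \<Longrightarrow> 0 \<le> t \<Longrightarrow> reflected x t = reflected z t"
  unfolding reflected_def regulator_def by (auto intro!: arg_cong2[of _ _ _ _ "(+)"] SUP_cong)

section \<open>The value of the game\<close>

lemma space_borel_sigma: "space (borel_sigma X) = topspace X"
  unfolding borel_sigma_def by (rule space_measure_of) (use openin_subset in blast)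

lemma measurable_borel_sigma_if_continuous_map:
  assumes f: "continuous_map X Y f"
  shows "f \<in> borel_sigma X \<rightarrow>\<^sub>M borel_sigma Y"
  unfolding borel_sigma_def
proof (rule measurable_measure_of)
  show "{U. openin Y U} \<subseteq> Pow (topspace Y)" using openin_subset by blast
  have sp: "space (sigma (topspace X) {U. openin X U}) = topspace X"
    by (rule space_measure_of) (use openin_subset in blast)
  show "f \<in> space (sigma (topspace X) {U. openin X U}) \<rightarrow> topspace Y"
    using f unfolding sp continuous_map_def by auto
  fix U assume "U \<in> {U. openin Y U}"
  then have "openin X {x \<in> topspace X. f x \<in> U}" using f unfolding continuous_map_def by auto
  moreover have "f -` U \<inter> space (sigma (topspace X) {U. openin X U}) = {x \<in> topspace X. f x \<in> U}"
    unfolding sp by auto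
  ultimately show "f -` U \<inter> space (sigma (topspace X) {U. openin X U}) \<in> sets (sigma (topspace X) {U. openin X U})"
    using openin_subset[of X] by (subst sets_measure_of) (auto intro: sigma_sets.Basic)
qed

locale workload_game = holding_cost C C' mu u1
  for C C' :: "'d::{finite,linorder} \<Rightarrow> real \<Rightarrow> real" and mu :: "'d \<Rightarrow> real" and u1 :: real +
  fixes T :: real and rho :: "'d \<Rightarrow> real" and y :: "(real, 'd) vec"
  assumes T_pos: "0 < T" and rho_pos: "\<And>i. 0 < rho i" and rho_le_1: "\<And>i. rho i \<le> 1"
begin

lemma rho_time: "0 \<le> t \<Longrightarrow> t \<le> T \<Longrightarrow> 0 \<le> rho i * t \<and> rho i * t \<le> t"
  using rho_pos[of i] rho_le_1[of i] by (simp add: mult_left_le_one_le)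

lemma rho_time_T: "0 \<le> t \<Longrightarrow> t \<le> T \<Longrightarrow> rho i * t \<le> T"
  using rho_time[of t i] by linarith

text \<open>The dynamics of the game in the absence of control, its workload, and the cost of the
  best response to \<open>\<psi>\<close>.\<close>
definition free_path :: "(real \<Rightarrow> (real, 'd) vec \<times> (real, 'd) vec) \<Rightarrow> real \<Rightarrow> (real, 'd) vec" where
  "free_path \<psi> t = t *\<^sub>R y + fst (\<psi> t) - time_scale rho (\<lambda>s. snd (\<psi> s)) t"

definition netput :: "(real \<Rightarrow> (real, 'd) vec \<times> (real, 'd) vec) \<Rightarrow> real \<Rightarrow> real" where
  "netput \<psi> t = workload (free_path \<psi> t)"

definition path_cost :: "(real \<Rightarrow> (real, 'd) vec \<times> (real, 'd) vec) \<Rightarrow> real" where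
  "path_cost \<psi> = integral {0..T} (\<lambda>t. min_cost (reflected (netput \<psi>) t))"

lemma workload_add: "workload (x + z) = workload x + workload z"
  by (simp add: workload_def add_divide_distrib sum.distrib)

lemma workload_diff: "workload (x - z) = workload x - workload z"
  by (simp add: workload_def diff_divide_distrib sum_subtractf)

lemma workload_abs_le:
  assumes "\<And>i. \<bar>x $ i\<bar> \<le> e"
  shows "\<bar>workload x\<bar> \<le> theta_total * e"
proof -
  have "\<bar>workload x\<bar> \<le> (\<Sum>i\<in>UNIV. \<bar>x $ i / mu i\<bar>)" unfolding workload_def by (rule sum_abs)
  also have "\<dots> \<le> (\<Sum>i\<in>UNIV. 1 / mu i * e)"
  proof (rule sum_mono)
    fix i
    have "\<bar>x $ i\<bar> / mu i \<le> e / mu i" using assms[of i] mu_pos[of i] by (intro divide_right_mono) auto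
    then show "\<bar>x $ i / mu i\<bar> \<le> 1 / mu i * e" using mu_pos[of i] by simp
  qed
  finally show ?thesis by (simp add: theta_total_def sum_distrib_right)
qed

lemma game_dataD:
  assumes "\<psi> \<in> game_data T"
  shows "\<psi> \<in> extensional {0..T}" "continuous_on {0..T} \<psi>" "\<psi> 0 = 0" "\<psi> \<in> mspace (cont_metric T)"
  using assms by (auto simp: game_data_def mspace_cont_metric)

lemma continuous_on_free_path:
  assumes "continuous_on {0..T} \<psi>"
  shows "continuous_on {0..T} (free_path \<psi>)"
proof -
  have "continuous_on {0..T} (\<lambda>t. \<psi> (rho i * t))" for i
    by (rule continuous_on_compose2[OF assms]) (auto intro!: continuous_intros simp: rho_time rho_time_T)
  then show ?thesis
    unfolding free_path_def time_scale_def using assms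
    by (intro continuous_intros continuous_on_vec_lambda)
qed

lemma continuous_on_workload: "continuous_on S f \<Longrightarrow> continuous_on S (\<lambda>t. workload (f t))"
  unfolding workload_def by (intro continuous_intros) (auto simp: less_imp_neq[OF mu_pos, symmetric])

lemma continuous_on_netput:
  "continuous_on {0..T} \<psi> \<Longrightarrow> continuous_on {0..T} (netput \<psi>)"
  using continuous_on_workload[OF continuous_on_free_path] unfolding netput_def .

lemma netput_bounded:
  assumes "continuous_on {0..T} \<psi>"
  shows "\<exists>R. \<forall>s. 0 \<le> s \<longrightarrow> s \<le> T \<longrightarrow> \<bar>netput \<psi> s\<bar> \<le> R"
proof -
  have "bounded (netput \<psi> ` {0..T})"
    using continuous_on_netput[OF assms] by (intro compact_imp_bounded compact_continuous_image) auto
  then obtain R where "\<forall>s\<in>{0..T}. \<bar>netput \<psi> s\<bar> \<le> R" by (auto simp: bounded_iff)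
  then show ?thesis by (intro exI[of _ R]) auto
qed

lemma reflected_netput_nonneg:
  assumes "continuous_on {0..T} \<psi>" "0 \<le> t" "t \<le> T"
  shows "0 \<le> reflected (netput \<psi>) t"
proof -
  obtain R where R: "\<And>s. 0 \<le> s \<Longrightarrow> s \<le> T \<Longrightarrow> \<bar>netput \<psi> s\<bar> \<le> R" using netput_bounded[OF assms(1)] by blast
  show ?thesis by (rule reflected_nonneg[where R=R]) (use R assms in auto)
qed

lemma continuous_on_path_cost_integrand:
  assumes "continuous_on {0..T} \<psi>"
  shows "continuous_on {0..T} (\<lambda>t. min_cost (reflected (netput \<psi>) t))"
  by (rule continuous_on_compose2[OF continuous_on_min_cost continuous_on_reflected[OF continuous_on_netput[OF assms]]])
    (use reflected_netput_nonneg[OF assms] in auto)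

lemma free_path_close:
  assumes "\<And>t. 0 \<le> t \<Longrightarrow> t \<le> T \<Longrightarrow> dist (\<psi> t) (\<psi>' t) \<le> D" "0 \<le> t" "t \<le> T"
  shows "\<bar>(free_path \<psi> t - free_path \<psi>' t) $ i\<bar> \<le> 2 * D"
proof -
  have c: "\<bar>fst (\<psi> s) $ i - fst (\<psi>' s) $ i\<bar> \<le> D" "\<bar>snd (\<psi> s) $ i - snd (\<psi>' s) $ i\<bar> \<le> D" if "0 \<le> s" "s \<le> T" for s
  proof -
    have "\<bar>fst (\<psi> s) $ i - fst (\<psi>' s) $ i\<bar> \<le> norm (fst (\<psi> s) - fst (\<psi>' s))"
      using component_le_norm_cart[of "fst (\<psi> s) - fst (\<psi>' s)" i] by simp
    also have "\<dots> \<le> dist (\<psi> s) (\<psi>' s)" using dist_fst_le[of "\<psi> s" "\<psi>' s"] by (simp add: dist_norm)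
    finally show "\<bar>fst (\<psi> s) $ i - fst (\<psi>' s) $ i\<bar> \<le> D" using assms(1)[OF that] by simp
    have "\<bar>snd (\<psi> s) $ i - snd (\<psi>' s) $ i\<bar> \<le> norm (snd (\<psi> s) - snd (\<psi>' s))"
      using component_le_norm_cart[of "snd (\<psi> s) - snd (\<psi>' s)" i] by simp
    also have "\<dots> \<le> dist (\<psi> s) (\<psi>' s)" using dist_snd_le[of "\<psi> s" "\<psi>' s"] by (simp add: dist_norm)
    finally show "\<bar>snd (\<psi> s) $ i - snd (\<psi>' s) $ i\<bar> \<le> D" using assms(1)[OF that] by simp
  qed
  show ?thesis
    using c(1)[OF assms(2,3)] c(2)[of "rho i * t"] rho_time[OF assms(2,3), of i] rho_time_T[OF assms(2,3), of i]
    by (simp add: free_path_def time_scale_def)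
qed

lemma reflected_netput_close:
  assumes c: "continuous_on {0..T} \<psi>" "continuous_on {0..T} \<psi>'"
    and D: "\<And>t. 0 \<le> t \<Longrightarrow> t \<le> T \<Longrightarrow> dist (\<psi> t) (\<psi>' t) \<le> D" and t: "0 \<le> t" "t \<le> T"
  shows "\<bar>reflected (netput \<psi>) t - reflected (netput \<psi>') t\<bar> \<le> 4 * theta_total * D"
proof -
  obtain R where R: "\<And>s. 0 \<le> s \<Longrightarrow> s \<le> T \<Longrightarrow> \<bar>netput \<psi> s\<bar> \<le> R" using netput_bounded[OF c(1)] by blast
  obtain R' where R': "\<And>s. 0 \<le> s \<Longrightarrow> s \<le> T \<Longrightarrow> \<bar>netput \<psi>' s\<bar> \<le> R'" using netput_bounded[OF c(2)] by blast
  have "\<bar>reflected (netput \<psi>) t - reflected (netput \<psi>') t\<bar> \<le> 2 * (theta_total * (2 * D))"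
  proof (rule reflected_Lipschitz[where R="max R R'"])
    fix s assume s: "0 \<le> s" "s \<le> t"
    show "\<bar>netput \<psi> s\<bar> \<le> max R R'" "\<bar>netput \<psi>' s\<bar> \<le> max R R'" using R[of s] R'[of s] s t by auto
    show "\<bar>netput \<psi> s - netput \<psi>' s\<bar> \<le> theta_total * (2 * D)"
      unfolding netput_def workload_diff[symmetric]
      using free_path_close[OF D] s t by (intro workload_abs_le) auto
  qed (use t in auto)
  then show ?thesis by simp
qed

lemma path_cost_Lipschitz:
  assumes c: "continuous_on {0..T} \<psi>" "continuous_on {0..T} \<psi>'"
    and D: "\<And>t. 0 \<le> t \<Longrightarrow> t \<le> T \<Longrightarrow> dist (\<psi> t) (\<psi>' t) \<le> D"
  shows "path_cost \<psi> \<le> path_cost \<psi>' + T * (u1 * mu_total * (4 * theta_total * D))"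
proof -
  let ?K = "u1 * mu_total * (4 * theta_total * D)"
  have i: "(\<lambda>t. min_cost (reflected (netput \<psi>) t)) integrable_on {0..T}" if "continuous_on {0..T} \<psi>" for \<psi>
    by (rule integrable_continuous_real[OF continuous_on_path_cost_integrand[OF that]])
  have "path_cost \<psi> \<le> integral {0..T} (\<lambda>t. min_cost (reflected (netput \<psi>') t) + ?K)"
    unfolding path_cost_def
  proof (rule integral_le[OF i[OF c(1)]])
    show "(\<lambda>t. min_cost (reflected (netput \<psi>') t) + ?K) integrable_on {0..T}"
      by (intro integrable_add i[OF c(2)] integrable_const_ivl)
    fix t assume "t \<in> {0..T}"
    then have t: "0 \<le> t" "t \<le> T" by auto
    have "\<bar>min_cost (reflected (netput \<psi>) t) - min_cost (reflected (netput \<psi>') t)\<bar> \<le>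
      u1 * mu_total * \<bar>reflected (netput \<psi>) t - reflected (netput \<psi>') t\<bar>"
      by (intro min_cost_Lipschitz reflected_netput_nonneg c t)
    also have "\<dots> \<le> ?K"
      using reflected_netput_close[OF c D t] u1_nonneg mu_total_pos by (intro mult_left_mono) auto
    finally show "min_cost (reflected (netput \<psi>) t) \<le> min_cost (reflected (netput \<psi>') t) + ?K" by simp
  qed
  also have "\<dots> = path_cost \<psi>' + T * ?K"
    unfolding path_cost_def using T_pos by (subst integral_add) (auto intro!: i[OF c(2)])
  finally show ?thesis .
qed

lemma inner_theta: "(\<chi> i. 1 / mu i) \<bullet> x = workload x"
  by (simp add: inner_vec_def workload_def)

lemma game_dynamics_eq: "game_dynamics rho y \<psi> \<zeta> t = free_path \<psi> t + \<zeta> t"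
  by (simp add: game_dynamics_def free_path_def)

lemma netput_0: "\<psi> 0 = 0 \<Longrightarrow> netput \<psi> 0 = 0"
  by (simp add: netput_def free_path_def workload_def time_scale_def)

text \<open>The workload of the dynamics is the netput plus a non-decreasing term, hence at least the
  reflected netput. The cost at each time is at least the cost of the cheapest vector of that
  workload, which increases with the workload.\<close>
lemma path_cost_le_strategy:
  assumes \<alpha>: "\<alpha> \<in> admissible_strategies T mu rho y" and \<psi>: "\<psi> \<in> game_data T"
  shows "ereal (path_cost \<psi>) - I \<psi> \<le> game_cost T rho y C I \<psi> (\<alpha> \<psi>)"
proof -
  let ?\<phi> = "game_dynamics rho y \<psi> (\<alpha> \<psi>)"
  have pos: "0 \<le> ?\<phi> t $ i" if "0 \<le> t" "t \<le> T" for t i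
    using \<alpha> \<psi> that by (auto simp: admissible_strategies_def)
  have "\<alpha> \<psi> \<in> game_controls T mu"
  proof -
    have "\<alpha> \<in> borel_sigma (subtopology (mtopology_of (cont_metric T)) (game_data T))
             \<rightarrow>\<^sub>M borel_sigma (subtopology (mtopology_of (cont_metric T)) (game_controls T mu))"
      using \<alpha> by (auto simp: admissible_strategies_def game_strategies_def)
    from measurable_space[OF this, unfolded space_borel_sigma] show ?thesis
      using \<psi> by (simp add: game_data_def)
  qed
  then have \<zeta>: "continuous_on {0..T} (\<alpha> \<psi>)" "workload (\<alpha> \<psi> 0) = 0" "mono_on {0..T} (\<lambda>t. workload (\<alpha> \<psi> t))"
    by (auto simp: game_controls_def mspace_cont_metric inner_theta)
  note c = game_dataD(2)[OF \<psi>]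
  have cont: "continuous_on {0..T} ?\<phi>"
    unfolding game_dynamics_eq[abs_def] by (intro continuous_on_add continuous_on_free_path c \<zeta>)
  have "path_cost \<psi> \<le> integral {0..T} (\<lambda>t. total_cost C (?\<phi> t))"
    unfolding path_cost_def
  proof (rule integral_le)
    show "(\<lambda>t. min_cost (reflected (netput \<psi>) t)) integrable_on {0..T}"
      by (rule integrable_continuous_real[OF continuous_on_path_cost_integrand[OF c]])
    show "(\<lambda>t. total_cost C (?\<phi> t)) integrable_on {0..T}"
      by (rule integrable_continuous_real, rule continuous_on_compose2[OF continuous_on_total_cost cont]) (use pos in auto)
    fix t assume "t \<in> {0..T}"
    then have t: "0 \<le> t" "t \<le> T" by auto
    have wl: "workload (?\<phi> s) = netput \<psi> s + workload (\<alpha> \<psi> s)" for s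
      by (simp add: game_dynamics_eq workload_add netput_def)
    have "reflected (netput \<psi>) t \<le> netput \<psi> t + workload (\<alpha> \<psi> t)"
    proof (rule reflected_minimal[OF t(1)])
      fix s assume s: "0 \<le> s" "s \<le> t"
      show "0 \<le> netput \<psi> s + workload (\<alpha> \<psi> s)"
        unfolding wl[symmetric] using pos s t by (intro workload_nonneg) auto
      show "workload (\<alpha> \<psi> s) \<le> workload (\<alpha> \<psi> t)"
        using \<zeta>(3) s t by (auto intro: mono_onD)
    qed (use \<zeta> in auto)
    then have "min_cost (reflected (netput \<psi>) t) \<le> min_cost (workload (?\<phi> t))"
      unfolding wl by (intro min_cost_mono reflected_netput_nonneg c t)
    also have "\<dots> \<le> total_cost C (?\<phi> t)" using pos t by (intro min_cost_le) auto
    finally show "min_cost (reflected (netput \<psi>) t) \<le> total_cost C (?\<phi> t)" .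
  qed
  then show ?thesis unfolding game_cost_def by (intro ereal_minus_mono) auto
qed

text \<open>The control that turns the dynamics into the equilibrium whose workload is the reflected
  netput.\<close>
definition optimal_strategy :: "(real \<Rightarrow> (real, 'd) vec \<times> (real, 'd) vec) \<Rightarrow> real \<Rightarrow> (real, 'd) vec" where
  "optimal_strategy \<psi> = restrict (\<lambda>t. equilibrium (reflected (netput \<psi>) t) - free_path \<psi> t) {0..T}"

lemma optimal_dynamics:
  "0 \<le> t \<Longrightarrow> t \<le> T \<Longrightarrow> game_dynamics rho y \<psi> (optimal_strategy \<psi>) t = equilibrium (reflected (netput \<psi>) t)"
  by (simp add: game_dynamics_eq optimal_strategy_def)

lemma continuous_on_equilibrium: "continuous_on {0..} equilibrium"
proof -
  have "continuous_on {0..} (\<lambda>w. \<chi> i. equilibrium w $ i)"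
  proof (rule continuous_on_vec_lambda)
    fix i
    have "(mu i)-lipschitz_on {0..} (\<lambda>w. equilibrium w $ i)"
      using equilibrium_Lipschitz mu_pos[of i] by (intro lipschitz_onI) (auto simp: dist_real_def)
    then show "continuous_on {0..} (\<lambda>w. equilibrium w $ i)" by (rule lipschitz_on_continuous_on)
  qed
  then show ?thesis by simp
qed

text \<open>The workload of this control is the regulator of the netput, which starts at zero and is
  non-decreasing.\<close>
lemma optimal_strategy_in_controls:
  assumes \<psi>: "\<psi> \<in> game_data T"
  shows "optimal_strategy \<psi> \<in> game_controls T mu"
proof -
  note c = game_dataD(2)[OF \<psi>]
  have "continuous_on {0..T} (\<lambda>t. equilibrium (reflected (netput \<psi>) t) - free_path \<psi> t)"
    by (intro continuous_on_diff continuous_on_free_path c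
        continuous_on_compose2[OF continuous_on_equilibrium continuous_on_reflected[OF continuous_on_netput[OF c]]])
      (use reflected_netput_nonneg[OF c] in auto)
  then have 1: "optimal_strategy \<psi> \<in> mspace (cont_metric T)"
    unfolding mspace_cont_metric optimal_strategy_def by (auto elim: continuous_on_eq)
  have wl: "workload (optimal_strategy \<psi> t) = regulator (netput \<psi>) t" if "0 \<le> t" "t \<le> T" for t
    using that equilibrium(2)[OF reflected_netput_nonneg[OF c that]]
    by (simp add: optimal_strategy_def workload_diff reflected_def netput_def)
  obtain R where R: "\<And>s. 0 \<le> s \<Longrightarrow> s \<le> T \<Longrightarrow> \<bar>netput \<psi> s\<bar> \<le> R" using netput_bounded[OF c] by blast
  have "mono_on {0..T} (\<lambda>t. workload (optimal_strategy \<psi> t))"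
  proof (rule mono_onI)
    fix r s assume rs: "r \<in> {0..T}" "s \<in> {0..T}" "r \<le> s"
    have "regulator (netput \<psi>) r \<le> regulator (netput \<psi>) s"
      by (rule regulator_mono[where R=R]) (use R rs in auto)
    then show "workload (optimal_strategy \<psi> r) \<le> workload (optimal_strategy \<psi> s)" using rs by (simp add: wl)
  qed
  moreover have "workload (optimal_strategy \<psi> 0) = 0"
    using T_pos game_dataD(3)[OF \<psi>] by (simp add: wl regulator_0 netput_0)
  ultimately show ?thesis using 1 by (simp add: game_controls_def inner_theta)
qed

lemma optimal_strategy_close:
  assumes c: "continuous_on {0..T} \<psi>" "continuous_on {0..T} \<psi>'"
    and D: "\<And>t. 0 \<le> t \<Longrightarrow> t \<le> T \<Longrightarrow> dist (\<psi> t) (\<psi>' t) \<le> D" and t: "0 \<le> t" "t \<le> T"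
  shows "dist (optimal_strategy \<psi> t) (optimal_strategy \<psi>' t) \<le> (\<Sum>i\<in>(UNIV::'d set). mu i * (4 * theta_total) + 2) * D"
proof -
  let ?x = "optimal_strategy \<psi> t - optimal_strategy \<psi>' t"
  have "norm ?x \<le> (\<Sum>i\<in>UNIV. \<bar>?x $ i\<bar>)" by (rule norm_le_l1_cart)
  also have "\<dots> \<le> (\<Sum>i\<in>UNIV. (mu i * (4 * theta_total) + 2) * D)"
  proof (rule sum_mono)
    fix i
    have "\<bar>equilibrium (reflected (netput \<psi>) t) $ i - equilibrium (reflected (netput \<psi>') t) $ i\<bar> \<le>
        mu i * \<bar>reflected (netput \<psi>) t - reflected (netput \<psi>') t\<bar>"
      by (intro equilibrium_Lipschitz reflected_netput_nonneg c t)
    also have "\<dots> \<le> mu i * (4 * theta_total * D)"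
      using reflected_netput_close[OF c D t] less_imp_le[OF mu_pos[of i]] by (intro mult_left_mono) auto
    finally have "\<bar>equilibrium (reflected (netput \<psi>) t) $ i - equilibrium (reflected (netput \<psi>') t) $ i\<bar> \<le> mu i * (4 * theta_total * D)" .
    moreover have "?x $ i = (equilibrium (reflected (netput \<psi>) t) $ i - equilibrium (reflected (netput \<psi>') t) $ i)
        - (free_path \<psi> t - free_path \<psi>' t) $ i"
      using t by (simp add: optimal_strategy_def)
    moreover have "\<bar>(free_path \<psi> t - free_path \<psi>' t) $ i\<bar> \<le> 2 * D" by (rule free_path_close[OF D t])
    ultimately have "\<bar>?x $ i\<bar> \<le> mu i * (4 * theta_total * D) + 2 * D" by linarith
    then show "\<bar>?x $ i\<bar> \<le> (mu i * (4 * theta_total) + 2) * D" by (simp add: algebra_simps)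
  qed
  finally show ?thesis by (simp add: dist_norm sum_distrib_right)
qed

text \<open>Measurability holds because the strategy is Lipschitz for the uniform metric, and causality
  because the regulator at time \<open>t\<close> is a supremum over \<open>[0, t]\<close>.\<close>
lemma optimal_strategy_admissible: "optimal_strategy \<in> admissible_strategies T mu rho y"
proof -
  define L where "L = (\<Sum>i\<in>(UNIV::'d set). mu i * (4 * theta_total) + 2)"
  have ts: "topspace (top_of_set {0..T}) \<noteq> {}" using T_pos by simp
  have "Lipschitz_continuous_map (submetric (cont_metric T) (game_data T)) (cont_metric T) optimal_strategy"
    unfolding Lipschitz_continuous_map_def
  proof (intro conjI exI[of _ L] ballI)
    show "optimal_strategy \<in> mspace (submetric (cont_metric T) (game_data T)) \<rightarrow> mspace (cont_metric T)"
      using optimal_strategy_in_controls by (auto simp: game_controls_def)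
    fix \<psi> \<psi>' :: "real \<Rightarrow> (real, 'd) vec \<times> (real, 'd) vec"
    assume "\<psi> \<in> mspace (submetric (cont_metric T) (game_data T))" "\<psi>' \<in> mspace (submetric (cont_metric T) (game_data T))"
    then have \<psi>: "\<psi> \<in> game_data T" "\<psi>' \<in> game_data T" by auto
    note m = game_dataD(4)[OF \<psi>(1)] game_dataD(4)[OF \<psi>(2)]
    have m': "optimal_strategy \<psi> \<in> mspace (cont_metric T)" "optimal_strategy \<psi>' \<in> mspace (cont_metric T)"
      using optimal_strategy_in_controls[OF \<psi>(1)] optimal_strategy_in_controls[OF \<psi>(2)] by (auto simp: game_controls_def)
    have "dist (\<psi> t) (\<psi>' t) \<le> mdist (cont_metric T) \<psi> \<psi>'" if "0 \<le> t" "t \<le> T" for t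
      using cfunspace_mdist_le[of \<psi> "top_of_set {0..T}" euclidean_metric \<psi>' "mdist (cont_metric T) \<psi> \<psi>'", OF _ _ ts] m that
      unfolding cont_metric_def by auto
    from optimal_strategy_close[OF game_dataD(2)[OF \<psi>(1)] game_dataD(2)[OF \<psi>(2)] this]
    have "dist (optimal_strategy \<psi> t) (optimal_strategy \<psi>' t) \<le> L * mdist (cont_metric T) \<psi> \<psi>'" if "0 \<le> t" "t \<le> T" for t
      using that unfolding L_def by auto
    then have "mdist (cont_metric T) (optimal_strategy \<psi>) (optimal_strategy \<psi>') \<le> L * mdist (cont_metric T) \<psi> \<psi>'"
      using cfunspace_mdist_le[of "optimal_strategy \<psi>" "top_of_set {0..T}" euclidean_metric "optimal_strategy \<psi>'", OF _ _ ts] m'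
      unfolding cont_metric_def by auto
    then show "mdist (cont_metric T) (optimal_strategy \<psi>) (optimal_strategy \<psi>') \<le> L * mdist (submetric (cont_metric T) (game_data T)) \<psi> \<psi>'"
      by simp
  qed
  from Lipschitz_continuous_imp_continuous_map[OF this]
  have "continuous_map (subtopology (mtopology_of (cont_metric T)) (game_data T)) (mtopology_of (cont_metric T)) optimal_strategy"
    by (simp only: mtopology_of_submetric)
  then have "continuous_map (subtopology (mtopology_of (cont_metric T)) (game_data T))
      (subtopology (mtopology_of (cont_metric T)) (game_controls T mu)) optimal_strategy"
    using optimal_strategy_in_controls by (auto simp: continuous_map_in_subtopology)
  from measurable_borel_sigma_if_continuous_map[OF this]
  have meas: "optimal_strategy \<in> borel_sigma (subtopology (mtopology_of (cont_metric T)) (game_data T))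
             \<rightarrow>\<^sub>M borel_sigma (subtopology (mtopology_of (cont_metric T)) (game_controls T mu))" .
  have caus: "optimal_strategy \<psi> s = optimal_strategy \<psi>' s"
    if *: "t \<in> {0..T}" "\<forall>s\<in>{0..t}. fst (\<psi> s) = fst (\<psi>' s) \<and>
               time_scale rho (\<lambda>r. snd (\<psi> r)) s = time_scale rho (\<lambda>r. snd (\<psi>' r)) s" "s \<in> {0..t}" for \<psi> \<psi>' :: "real \<Rightarrow> (real, 'd) vec \<times> (real, 'd) vec" and t s
  proof -
    have fp: "free_path \<psi> r = free_path \<psi>' r" if "0 \<le> r" "r \<le> s" for r
      using *(2,3) that unfolding free_path_def by auto
    then have "reflected (netput \<psi>) s = reflected (netput \<psi>') s"
      using *(3) by (intro reflected_cong) (auto simp: netput_def)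
    then show ?thesis using fp[of s] *(3) by (simp add: optimal_strategy_def)
  qed
  have pos: "0 \<le> game_dynamics rho y \<psi> (optimal_strategy \<psi>) t $ i" if "\<psi> \<in> game_data T" "t \<in> {0..T}" for \<psi> :: "real \<Rightarrow> (real, 'd) vec \<times> (real, 'd) vec" and t i
    using that by (simp add: optimal_dynamics) (intro equilibrium(1) reflected_netput_nonneg game_dataD(2); simp)
  show ?thesis
    unfolding admissible_strategies_def game_strategies_def
    using meas caus pos by blast
qed

text \<open>The strategy that attains the lower bound \<open>path_cost_le_strategy\<close> does so for all paths
  simultaneously.\<close>
theorem game_value_eq:
  "game_value T mu rho y C I = (SUP \<psi>\<in>game_data T. ereal (path_cost \<psi>) - I \<psi>)"
proof (rule antisym)
  have "game_cost T rho y C I \<psi> (optimal_strategy \<psi>) = ereal (path_cost \<psi>) - I \<psi>"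
    for \<psi> :: "real \<Rightarrow> (real, 'd) vec \<times> (real, 'd) vec"
  proof -
    have "integral {0..T} (\<lambda>t. total_cost C (game_dynamics rho y \<psi> (optimal_strategy \<psi>) t)) = path_cost \<psi>"
      unfolding path_cost_def min_cost_def by (rule integral_cong) (simp add: optimal_dynamics)
    then show ?thesis by (simp add: game_cost_def)
  qed
  then show "game_value T mu rho y C I \<le> (SUP \<psi>\<in>game_data T. ereal (path_cost \<psi>) - I \<psi>)"
    unfolding game_value_def using INF_lower[OF optimal_strategy_admissible, of "\<lambda>\<alpha>. SUP \<psi>\<in>game_data T. game_cost T rho y C I \<psi> (\<alpha> \<psi>)"]
    by simp
  show "(SUP \<psi>\<in>game_data T. ereal (path_cost \<psi>) - I \<psi>) \<le> game_value T mu rho y C I"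
    unfolding game_value_def
    by (intro INF_greatest SUP_mono) (use path_cost_le_strategy in blast)
qed

end

section \<open>Tubes in the Skorokhod space and large deviations\<close>

lemma continuous_in_skorokhod_space:
  fixes \<psi> :: "real \<Rightarrow> 'a::metric_space"
  assumes "\<psi> \<in> extensional {0..T}" "continuous_on {0..T} \<psi>"
  shows "\<psi> \<in> skorokhod_space T"
  unfolding skorokhod_space_def rcll_on_def
proof (intro CollectI conjI ballI assms(1))
  fix t assume t: "t \<in> {0..<T}"
  have "continuous_on {t..T} \<psi>" by (rule continuous_on_subset[OF assms(2)]) (use t in auto)
  from continuous_on_Icc_at_rightD[OF this] show "(\<psi> \<longlongrightarrow> \<psi> t) (at_right t)" using t by simp
next
  fix t assume t: "t \<in> {0<..T}"
  have "continuous_on {0..t} \<psi>" by (rule continuous_on_subset[OF assms(2)]) (use t in auto)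
  from continuous_on_Icc_at_leftD[OF this] show "\<exists>l. (\<psi> \<longlongrightarrow> l) (at_left t)" using t by auto
qed

lemma skorokhod_dist_lessD:
  fixes x :: "real \<Rightarrow> 'a::metric_space"
  assumes xy: "x \<in> skorokhod_space T" "z \<in> skorokhod_space T" and e: "skorokhod_dist T x z < e"
  shows "\<exists>\<tau>\<in>time_changes T. \<forall>t\<in>{0..T}. \<bar>\<tau> t - t\<bar> \<le> e \<and> dist (x (\<tau> t)) (z t) \<le> e"
proof -
  define E where "E = {e. 0 < e \<and> (\<exists>\<tau>\<in>time_changes T. \<forall>t\<in>{0..T}. \<bar>\<tau> t - t\<bar> \<le> e \<and> dist (x (\<tau> t)) (z t) \<le> e)}"
  have idt: "(\<lambda>t. t) \<in> time_changes T"
    by (auto simp: time_changes_def strict_mono_on_def)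
  have "bounded (x ` {0..T} \<union> z ` {0..T})"
    using xy rcll_on_bounded by (auto simp: skorokhod_space_def bounded_Un)
  then obtain B where B: "\<And>u v. u \<in> x ` {0..T} \<union> z ` {0..T} \<Longrightarrow> v \<in> x ` {0..T} \<union> z ` {0..T} \<Longrightarrow> dist u v \<le> B"
    using bounded_two_points by metis
  have "max B 1 \<in> E"
    unfolding E_def using B idt by (auto intro!: bexI[of _ "\<lambda>t. t"] simp: le_max_iff_disj)
  then have "E \<noteq> {}" by blast
  moreover have "skorokhod_dist T x z = Inf E" using xy by (simp add: skorokhod_dist_def E_def)
  ultimately obtain e' where "e' \<in> E" "e' < e" using cInf_lessD[of E e] e by auto
  then obtain \<tau> where "\<tau> \<in> time_changes T" "\<forall>t\<in>{0..T}. \<bar>\<tau> t - t\<bar> \<le> e' \<and> dist (x (\<tau> t)) (z t) \<le> e'"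
    unfolding E_def by auto
  then show ?thesis using \<open>e' < e\<close> by (intro bexI[of _ \<tau>]) force+
qed

text \<open>The bound \<open>q\<close> is uniform in time. The pointwise condition \<open>dist (f t) (\<psi> t) < r\<close> would not
  give an open set, since a path with jumps may approach distance \<open>r\<close> without attaining it.\<close>
definition open_tube :: "real \<Rightarrow> (real \<Rightarrow> 'a::metric_space) \<Rightarrow> real \<Rightarrow> (real \<Rightarrow> 'a) set" where
  "open_tube T \<psi> r = {f \<in> skorokhod_space T. \<exists>q<r. \<forall>t\<in>{0..T}. dist (f t) (\<psi> t) \<le> q}"

definition closed_tube :: "real \<Rightarrow> (real \<Rightarrow> 'a::metric_space) \<Rightarrow> real \<Rightarrow> (real \<Rightarrow> 'a) set" where
  "closed_tube T \<psi> r = {f \<in> skorokhod_space T. \<forall>t\<in>{0..T}. dist (f t) (\<psi> t) \<le> r}"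

lemma topspace_skorokhod: "topspace (skorokhod_topology T :: (real \<Rightarrow> 'a::metric_space) topology) = skorokhod_space T"
  unfolding skorokhod_topology_def by (rule Metric_space.topspace_mtopology[OF Metric_space_skorokhod])

text \<open>A time change of size \<open>e\<close> moves the center \<open>\<psi>\<close> by no more than its modulus of continuity, so for
  a continuous center closeness in the Skorokhod metric preserves the tube with a small loss.\<close>
lemma openin_open_tube:
  fixes \<psi> :: "real \<Rightarrow> 'a::metric_space"
  assumes c: "continuous_on {0..T} \<psi>"
  shows "openin (skorokhod_topology T) (open_tube T \<psi> r)"
proof -
  interpret S: Metric_space "skorokhod_space T :: (real \<Rightarrow> 'a) set" "skorokhod_dist T" by (rule Metric_space_skorokhod)
  have uc: "uniformly_continuous_on {0..T} \<psi>" using c by (intro compact_uniformly_continuous) auto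
  show ?thesis
    unfolding skorokhod_topology_def S.openin_mtopology
  proof (intro conjI allI impI)
    show "open_tube T \<psi> r \<subseteq> skorokhod_space T" by (auto simp: open_tube_def)
    fix f assume "f \<in> open_tube T \<psi> r"
    then obtain q where f: "f \<in> skorokhod_space T" and q: "q < r" "\<And>t. t \<in> {0..T} \<Longrightarrow> dist (f t) (\<psi> t) \<le> q"
      by (auto simp: open_tube_def)
    define h where "h = (r - q) / 3"
    have "3 * h = r - q" by (simp add: h_def)
    then have h: "h > 0" "q + 2 * h < r" using q(1) by linarith+
    obtain d where d: "d > 0" "\<And>s t. s \<in> {0..T} \<Longrightarrow> t \<in> {0..T} \<Longrightarrow> dist t s < d \<Longrightarrow> dist (\<psi> t) (\<psi> s) < h"
      using uc h(1) unfolding uniformly_continuous_on_def by metis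
    define e where "e = min h (d / 2)"
    have e: "e > 0" "e \<le> h" "e < d" using h d by (auto simp: e_def)
    have "g \<in> open_tube T \<psi> r" if "g \<in> S.mball f e" for g
    proof -
      have g: "g \<in> skorokhod_space T" "skorokhod_dist T f g < e" using that by (auto simp: S.in_mball)
      obtain \<tau> where \<tau>: "\<tau> \<in> time_changes T" "\<And>t. t \<in> {0..T} \<Longrightarrow> \<bar>\<tau> t - t\<bar> \<le> e \<and> dist (f (\<tau> t)) (g t) \<le> e"
        using skorokhod_dist_lessD[OF f g] by blast
      have "dist (g t) (\<psi> t) \<le> q + 2 * h" if t: "t \<in> {0..T}" for t
      proof -
        have \<tau>t: "\<tau> t \<in> {0..T}" using \<tau>(1) t by (auto simp: time_changes_def)
        have "dist (g t) (\<psi> t) \<le> dist (f (\<tau> t)) (g t) + dist (f (\<tau> t)) (\<psi> t)" by (rule dist_triangle3)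
        also have "dist (f (\<tau> t)) (\<psi> t) \<le> dist (f (\<tau> t)) (\<psi> (\<tau> t)) + dist (\<psi> (\<tau> t)) (\<psi> t)" by (rule dist_triangle)
        finally show ?thesis
          using \<tau>(2)[OF t] q(2)[OF \<tau>t] d(2)[OF t \<tau>t] e by (simp add: dist_real_def)
      qed
      then show ?thesis using g h(2) by (auto simp: open_tube_def)
    qed
    then show "\<exists>e>0. S.mball f e \<subseteq> open_tube T \<psi> r" using e(1) by blast
  qed
qed

lemma closedin_closed_tube:
  fixes \<psi> :: "real \<Rightarrow> 'a::metric_space"
  assumes c: "continuous_on {0..T} \<psi>"
  shows "closedin (skorokhod_topology T) (closed_tube T \<psi> r)"
proof -
  interpret S: Metric_space "skorokhod_space T :: (real \<Rightarrow> 'a) set" "skorokhod_dist T" by (rule Metric_space_skorokhod)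
  have uc: "uniformly_continuous_on {0..T} \<psi>" using c by (intro compact_uniformly_continuous) auto
  show ?thesis
    unfolding skorokhod_topology_def closedin_def S.openin_mtopology S.topspace_mtopology
  proof (intro conjI allI impI)
    show "closed_tube T \<psi> r \<subseteq> skorokhod_space T" by (auto simp: closed_tube_def)
    fix f assume "f \<in> skorokhod_space T - closed_tube T \<psi> r"
    then obtain t where f: "f \<in> skorokhod_space T" and t: "t \<in> {0..T}" "r < dist (f t) (\<psi> t)"
      by (auto simp: closed_tube_def not_le)
    define h where "h = (dist (f t) (\<psi> t) - r) / 3"
    have "3 * h = dist (f t) (\<psi> t) - r" by (simp add: h_def)
    then have h: "h > 0" "r + 2 * h < dist (f t) (\<psi> t)" using t(2) by linarith+
    obtain d where d: "d > 0" "\<And>s t. s \<in> {0..T} \<Longrightarrow> t \<in> {0..T} \<Longrightarrow> dist t s < d \<Longrightarrow> dist (\<psi> t) (\<psi> s) < h"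
      using uc h(1) unfolding uniformly_continuous_on_def by metis
    define e where "e = min h (d / 2)"
    have e: "e > 0" "e \<le> h" "e < d" using h d by (auto simp: e_def)
    have "g \<in> skorokhod_space T - closed_tube T \<psi> r" if "g \<in> S.mball f e" for g
    proof -
      have g: "g \<in> skorokhod_space T" "skorokhod_dist T g f < e" using that by (auto simp: S.in_mball S.commute)
      obtain \<tau> where \<tau>: "\<tau> \<in> time_changes T" "\<And>t. t \<in> {0..T} \<Longrightarrow> \<bar>\<tau> t - t\<bar> \<le> e \<and> dist (g (\<tau> t)) (f t) \<le> e"
        using skorokhod_dist_lessD[OF g(1) f g(2)] by blast
      have \<tau>t: "\<tau> t \<in> {0..T}" using \<tau>(1) t by (auto simp: time_changes_def)
      have "dist (f t) (\<psi> t) \<le> dist (g (\<tau> t)) (f t) + dist (g (\<tau> t)) (\<psi> t)" by (rule dist_triangle3)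
      moreover have "dist (g (\<tau> t)) (\<psi> t) \<le> dist (g (\<tau> t)) (\<psi> (\<tau> t)) + dist (\<psi> (\<tau> t)) (\<psi> t)" by (rule dist_triangle)
      ultimately have "r < dist (g (\<tau> t)) (\<psi> (\<tau> t))"
        using \<tau>(2)[OF t(1)] d(2)[OF t(1) \<tau>t] e h(2) by (simp add: dist_real_def)
      then show ?thesis using g \<tau>t by (auto simp: closed_tube_def not_le)
    qed
    then show "\<exists>e>0. S.mball f e \<subseteq> skorokhod_space T - closed_tube T \<psi> r" using e(1) by blast
  qed auto
qed

lemma ennreal_le_exp_if_ln_less:
  assumes "0 < \<beta>" "ereal (1 / \<beta>) * ln_ennreal p < ereal r"
  shows "p \<le> ennreal (exp (\<beta> * r))"
proof (cases "p = 0")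
  case False
  have "p \<noteq> \<infinity>"
  proof
    assume "p = \<infinity>"
    then show False using assms by (simp add: ln_ennreal_def)
  qed
  then obtain q where q: "p = ennreal q" "0 \<le> q" by (cases p) auto
  then have q0: "0 < q" using False by (cases "q = 0") auto
  have "ln q / \<beta> < r" using assms(2) q False q0 by (simp add: ln_ennreal_def)
  then have "ln q \<le> \<beta> * r" using assms(1) by (simp add: field_simps)
  then have "q \<le> exp (\<beta> * r)" using q0 by (metis exp_le_cancel_iff exp_ln)
  then show ?thesis using q by (simp add: ennreal_leI)
qed simp

lemma ln_ennreal_le_if_le_exp:
  assumes "0 < \<beta>" "p \<le> ennreal (exp (\<beta> * r))"
  shows "ereal (1 / \<beta>) * ln_ennreal p \<le> ereal r"
proof (cases "p = 0")
  case True
  then show ?thesis using assms by (simp add: ln_ennreal_def)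
next
  case False
  obtain q where q: "p = ennreal q" "0 \<le> q" using assms(2) by (cases p) (auto simp: top_unique)
  then have q0: "0 < q" using False by (cases "q = 0") auto
  have "q \<le> exp (\<beta> * r)" using assms(2) q by simp
  then have "ln q \<le> \<beta> * r" using q0 by (metis ln_exp ln_le_cancel_iff exp_gt_zero)
  then have "ln q / \<beta> \<le> r" using assms(1) by (simp add: field_simps)
  then show ?thesis using q False by (simp add: ln_ennreal_def)
qed

lemma ln_ennreal_ge_if_ge_exp_times:
  assumes \<beta>: "0 < \<beta>" and ge: "ennreal (exp (\<beta> * r)) * q \<le> p"
  shows "ereal r + ereal (1 / \<beta>) * ln_ennreal q \<le> ereal (1 / \<beta>) * ln_ennreal p"
proof (cases "q = 0")
  case True
  then show ?thesis using \<beta> by (simp add: ln_ennreal_def)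
next
  case q0: False
  show ?thesis
  proof (cases "p = \<infinity>")
    case True
    then show ?thesis using \<beta> by (simp add: ln_ennreal_def)
  next
    case False
    then obtain p' where p': "p = ennreal p'" "0 \<le> p'" by (cases p) auto
    have "q \<noteq> \<infinity>" using ge p' by (auto simp: ennreal_mult_eq_top_iff top_unique ennreal_mult_top)
    then obtain q' where q': "q = ennreal q'" "0 \<le> q'" by (cases q) auto
    then have q'0: "0 < q'" using q0 by (cases "q' = 0") auto
    have le: "exp (\<beta> * r) * q' \<le> p'" using ge p' q' by (simp add: ennreal_mult'[symmetric])
    then have p'0: "0 < p'" using q'0 by (smt (verit) exp_gt_zero mult_pos_pos)
    have "\<beta> * r + ln q' = ln (exp (\<beta> * r) * q')" using q'0 by (simp add: ln_mult)
    also have "\<dots> \<le> ln p'" using le q'0 p'0 by simp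
    finally have "(\<beta> * r + ln q') / \<beta> \<le> ln p' / \<beta>" using \<beta> by (intro divide_right_mono) auto
    then have "r + ln q' / \<beta> \<le> ln p' / \<beta>" using \<beta> by (simp add: add_divide_distrib)
    then show ?thesis using p' q' p'0 q'0 by (simp add: ln_ennreal_def)
  qed
qed

lemma LDP_upper_eventually:
  assumes ldp: "satisfies_LDP M X b Z I" and F: "closedin X F" and r: "- (INF \<psi>\<in>F. I \<psi>) < ereal r"
    and b: "filterlim b at_top sequentially"
  shows "\<forall>\<^sub>F n in sequentially. emeasure M {\<omega> \<in> space M. Z n \<omega> \<in> F} \<le> ennreal (exp ((b n)\<^sup>2 * r))"
proof -
  have "limsup (\<lambda>n. ereal (1 / (b n)\<^sup>2) * ln_ennreal (emeasure M {\<omega> \<in> space M. Z n \<omega> \<in> F})) < ereal r"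
    using ldp F r unfolding satisfies_LDP_def by (meson le_less_trans)
  from Limsup_lessD[OF this] have "\<forall>\<^sub>F n in sequentially. ereal (1 / (b n)\<^sup>2) * ln_ennreal (emeasure M {\<omega> \<in> space M. Z n \<omega> \<in> F}) < ereal r" .
  moreover have "\<forall>\<^sub>F n in sequentially. 0 < b n" using b by (simp add: filterlim_at_top_dense)
  ultimately show ?thesis
    by eventually_elim (rule ennreal_le_exp_if_ln_less, auto)
qed

text \<open>Total boundedness as in the theorem of Arzela and Ascoli: encode a function by the
  approximate values that it takes on a finite grid, chosen from a finite net of the range. There are
  finitely many codes, and equicontinuous functions with the same code are close.\<close>
lemma finite_sup_net:
  fixes \<F> :: "(real \<Rightarrow> 'b::heine_borel) set"
  assumes T: "0 \<le> T" and bd: "bounded (\<Union>f\<in>\<F>. f ` {0..T})"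
    and eq: "\<And>e. e > 0 \<Longrightarrow> \<exists>d>0. \<forall>f\<in>\<F>. \<forall>s\<in>{0..T}. \<forall>t\<in>{0..T}. \<bar>s - t\<bar> \<le> d \<longrightarrow> dist (f s) (f t) \<le> e"
    and \<delta>: "\<delta> > 0"
  shows "\<exists>\<Psi>\<subseteq>\<F>. finite \<Psi> \<and> (\<forall>f\<in>\<F>. \<exists>\<psi>\<in>\<Psi>. \<forall>t\<in>{0..T}. dist (f t) (\<psi> t) \<le> \<delta>)"
proof -
  define e where "e = \<delta> / 4"
  have e: "e > 0" using \<delta> by (simp add: e_def)
  obtain d where d: "d > 0" "\<And>f s t. f \<in> \<F> \<Longrightarrow> s \<in> {0..T} \<Longrightarrow> t \<in> {0..T} \<Longrightarrow> \<bar>s - t\<bar> \<le> d \<Longrightarrow> dist (f s) (f t) \<le> e"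
    using eq[OF e] by (elim exE conjE) (rule that, assumption, blast)
  obtain m0 :: nat where "T / d \<le> real m0" using real_arch_simple by blast
  then obtain m :: nat where m: "m > 0" "T / d \<le> real m" by (intro that[of "Suc m0"]) auto
  have "compact (closure (\<Union>f\<in>\<F>. f ` {0..T}))" using bd by (simp add: compact_closure)
  then have "\<exists>K. finite K \<and> closure (\<Union>f\<in>\<F>. f ` {0..T}) \<subseteq> (\<Union>x\<in>K. ball x e)"
    using e by (simp only: compact_eq_totally_bounded)
  then obtain K where K: "finite K" "closure (\<Union>f\<in>\<F>. f ` {0..T}) \<subseteq> (\<Union>x\<in>K. ball x e)"
    by (elim exE conjE) (rule that)
  have near: "\<exists>c\<in>K. dist c (f t) < e" if "f \<in> \<F>" "t \<in> {0..T}" for f t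
  proof -
    have "f t \<in> closure (\<Union>f\<in>\<F>. f ` {0..T})" by (rule subsetD[OF closure_subset], rule UN_I[OF that(1)], rule imageI, rule that(2))
    with K(2) have "f t \<in> (\<Union>x\<in>K. ball x e)" by (rule subsetD)
    then show ?thesis by (auto simp: mem_ball)
  qed
  define g where "g k = T * real k / real m" for k :: nat
  have gT: "g k \<in> {0..T}" if "k \<le> m" for k
    using that m T by (auto simp: g_def field_simps mult_left_mono)
  define code where "code f = (\<lambda>k\<in>{..m}. SOME c. c \<in> K \<and> dist c (f (g k)) < e)" for f
  have code: "code f k \<in> K \<and> dist (code f k) (f (g k)) < e" if "f \<in> \<F>" "k \<le> m" for f k
  proof -
    have "\<exists>c. c \<in> K \<and> dist c (f (g k)) < e" using near[OF that(1) gT[OF that(2)]] by blast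
    from someI_ex[OF this] show ?thesis using that(2) by (simp add: code_def)
  qed
  have "code ` \<F> \<subseteq> PiE {..m} (\<lambda>_. K)"
  proof (rule image_subsetI, rule PiE_I)
    fix f k assume "f \<in> \<F>" "k \<in> {..m}"
    then show "code f k \<in> K" using code by auto
  qed (auto simp: code_def)
  then have fin: "finite (code ` \<F>)" by (rule finite_subset) (simp add: finite_PiE K(1))
  define rep where "rep c = (SOME f. f \<in> \<F> \<and> code f = c)" for c
  have rep: "rep c \<in> \<F> \<and> code (rep c) = c" if c: "c \<in> code ` \<F>" for c
  proof -
    from c obtain f where "f \<in> \<F> \<and> code f = c" by blast
    then show ?thesis unfolding rep_def by (rule someI[where P="\<lambda>f. f \<in> \<F> \<and> code f = c"])
  qed
  show ?thesis
  proof (intro exI[of _ "rep ` code ` \<F>"] conjI ballI)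
    show "rep ` code ` \<F> \<subseteq> \<F>" using rep by blast
    show "finite (rep ` code ` \<F>)" using fin by simp
    fix f assume f: "f \<in> \<F>"
    let ?h = "rep (code f)"
    have h: "?h \<in> \<F>" "code ?h = code f" using rep[of "code f"] f by auto
    have "dist (f t) (?h t) \<le> \<delta>" if t: "t \<in> {0..T}" for t
    proof -
      define k where "k = nat \<lfloor>t * real m / T\<rfloor>"
      have kk: "k \<le> m \<and> \<bar>t - g k\<bar> \<le> d"
      proof (cases "T = 0")
        case True
        then show ?thesis using t d by (simp add: g_def k_def)
      next
        case False
        then have T: "0 < T" using T by simp
        have k1: "real k \<le> t * real m / T" "t * real m / T < real k + 1"
          using t T m unfolding k_def by (auto simp: of_nat_floor)
        have "t * real m / T \<le> real m" using t T m by (simp add: field_simps mult_right_mono)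
        then have "k \<le> m" using k1 by linarith
        moreover have "g k \<le> t" "t < g k + T / real m" using k1 T m by (auto simp: g_def field_simps)
        moreover have "T / real m \<le> d" using m d T by (simp add: field_simps)
        ultimately show ?thesis by linarith
      qed
      then have k: "k \<le> m" "\<bar>t - g k\<bar> \<le> d" by auto
      have "dist (f t) (f (g k)) \<le> e" "dist (?h t) (?h (g k)) \<le> e"
        using d(2)[OF f t gT[OF k(1)] k(2)] d(2)[OF h(1) t gT[OF k(1)] k(2)] by auto
      moreover have "dist (code f k) (f (g k)) < e" "dist (code f k) (?h (g k)) < e"
        using code[OF f k(1)] code[OF h(1) k(1)] h(2) by auto
      moreover have "dist (f t) (?h t) \<le> dist (f t) (f (g k)) + dist (f (g k)) (?h t)" by (rule dist_triangle)
      moreover have "dist (f (g k)) (?h t) \<le> dist (f (g k)) (code f k) + dist (code f k) (?h t)" by (rule dist_triangle)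
      moreover have "dist (code f k) (?h t) \<le> dist (code f k) (?h (g k)) + dist (?h (g k)) (?h t)" by (rule dist_triangle)
      ultimately show ?thesis by (simp add: e_def dist_commute)
    qed
    then show "\<exists>\<psi>\<in>rep ` code ` \<F>. \<forall>t\<in>{0..T}. dist (f t) (\<psi> t) \<le> \<delta>" using f by blast
  qed
qed

section \<open>Level sets of the rate function\<close>

lemma abs_continuous_on_component:
  fixes \<psi> :: "real \<Rightarrow> real^'d::finite"
  assumes "abs_continuous_on a b \<psi>"
  shows "abs_continuous_on a b (\<lambda>r. \<psi> r $ i)"
  unfolding abs_continuous_on_def
proof (intro allI impI)
  fix \<epsilon> :: real assume "\<epsilon> > 0"
  from mp[OF spec[OF assms[unfolded abs_continuous_on_def]] this]
  obtain \<delta> where \<delta>: "\<delta> > 0" and *: "\<forall>(m::nat) (u::nat \<Rightarrow> real) (v::nat \<Rightarrow> real).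
        (\<forall>k<m. a \<le> u k \<and> u k \<le> v k \<and> v k \<le> b) \<and>
        (\<forall>j<m. \<forall>k<m. j \<noteq> k \<longrightarrow> {u j<..<v j} \<inter> {u k<..<v k} = {}) \<and>
        (\<Sum>k<m. v k - u k) < \<delta>
        \<longrightarrow> (\<Sum>k<m. norm (\<psi> (v k) - \<psi> (u k))) < \<epsilon>"
    by (elim exE conjE) (rule that)
  show "\<exists>\<delta>>0. \<forall>(m::nat) (u::nat \<Rightarrow> real) (v::nat \<Rightarrow> real).
        (\<forall>k<m. a \<le> u k \<and> u k \<le> v k \<and> v k \<le> b) \<and>
        (\<forall>j<m. \<forall>k<m. j \<noteq> k \<longrightarrow> {u j<..<v j} \<inter> {u k<..<v k} = {}) \<and>
        (\<Sum>k<m. v k - u k) < \<delta>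
        \<longrightarrow> (\<Sum>k<m. norm (\<psi> (v k) $ i - \<psi> (u k) $ i)) < \<epsilon>"
  proof (intro exI[of _ \<delta>] conjI \<delta> allI impI)
    fix m :: nat and u v :: "nat \<Rightarrow> real"
    assume A: "(\<forall>k<m. a \<le> u k \<and> u k \<le> v k \<and> v k \<le> b) \<and>
        (\<forall>j<m. \<forall>k<m. j \<noteq> k \<longrightarrow> {u j<..<v j} \<inter> {u k<..<v k} = {}) \<and>
        (\<Sum>k<m. v k - u k) < \<delta>"
    have "(\<Sum>k<m. norm (\<psi> (v k) $ i - \<psi> (u k) $ i)) \<le> (\<Sum>k<m. norm (\<psi> (v k) - \<psi> (u k)))"
      by (intro sum_mono) (metis component_le_norm_cart real_norm_def vector_minus_component)
    also have "\<dots> < \<epsilon>" using *[rule_format, OF A] .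
    finally show "(\<Sum>k<m. norm (\<psi> (v k) $ i - \<psi> (u k) $ i)) < \<epsilon>" .
  qed
qed

lemma rate_part_nonneg:
  assumes "\<And>i. 0 < s i"
  shows "0 \<le> rate_part T s \<psi>"
  unfolding rate_part_def using assms by (auto intro!: sum_nonneg ereal_0_le_mult simp: less_imp_le)

lemma rate_part_equicontinuous:
  fixes \<psi> :: "real \<Rightarrow> real^'d::finite"
  assumes s: "\<And>i. 0 < s i" and fin: "rate_part T s \<psi> \<le> ereal L" and L: "0 \<le> L" and \<kappa>: "0 < \<kappa>"
    and rt: "0 \<le> r" "r \<le> t" "t \<le> T"
  shows "\<bar>\<psi> t $ i - \<psi> r $ i\<bar> \<le> \<kappa> * (t - r) / 2 + s i * L / \<kappa>"
proof -
  have ac: "abs_continuous_on 0 T \<psi>" and sum: "rate_part T s \<psi> = (\<Sum>i\<in>UNIV. ereal (1 / (2 * s i)) *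
           enn2ereal (\<integral>\<^sup>+t\<in>{0..T}. ennreal ((deriv (\<lambda>r. \<psi> r $ i) t)\<^sup>2) \<partial>lborel))"
    using fin unfolding rate_part_def by (auto split: if_splits)
  let ?E = "\<integral>\<^sup>+t\<in>{0..T}. ennreal ((deriv (\<lambda>r. \<psi> r $ i) t)\<^sup>2) \<partial>lborel"
  have "ereal (1 / (2 * s i)) * enn2ereal ?E \<le> rate_part T s \<psi>"
    unfolding sum sum.remove[OF finite UNIV_I[of i]] using s
    by (intro add_increasing2 sum_nonneg) (auto intro!: ereal_0_le_mult simp: less_imp_le)
  then have le: "ereal (1 / (2 * s i)) * enn2ereal ?E \<le> ereal L" using fin by simp
  have "?E \<le> ennreal (2 * s i * L)"
  proof (cases ?E)
    case top
    then show ?thesis using le s[of i] by (simp add: top_ereal_def)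
  next
    case (real e)
    then have "1 / (2 * s i) * e \<le> L" using le by simp
    then have "e \<le> 2 * s i * L" using s[of i] by (simp add: field_simps)
    then show ?thesis using real by (simp add: ennreal_leI)
  qed
  from abs_continuous_on_energy_bound[OF abs_continuous_on_component[OF ac] rt this _ \<kappa>]
  have "\<bar>\<psi> t $ i - \<psi> r $ i\<bar> \<le> \<kappa> * (t - r) / 2 + 2 * s i * L / (2 * \<kappa>)" using s[of i] L by simp
  then show ?thesis by simp
qed

lemma rate_function_finiteD:
  fixes \<psi> :: "real \<Rightarrow> (real^'d::finite) \<times> (real^'d)"
  assumes s: "\<And>i. 0 < s1 i" "\<And>i. 0 < s2 i" and L: "rate_function T s1 s2 \<psi> \<le> ereal L"
  shows "rate_part T s1 (\<lambda>t. fst (\<psi> t)) \<le> ereal L" "rate_part T s2 (\<lambda>t. snd (\<psi> t)) \<le> ereal L" "\<psi> 0 = 0" "0 \<le> L"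
proof -
  have n: "0 \<le> rate_part T s1 (\<lambda>t. fst (\<psi> t))" "0 \<le> rate_part T s2 (\<lambda>t. snd (\<psi> t))"
    using s by (auto intro: rate_part_nonneg)
  show 1: "rate_part T s1 (\<lambda>t. fst (\<psi> t)) \<le> ereal L"
    using L n(2) unfolding rate_function_def by (meson ereal_le_add_self order_trans)
  show 2: "rate_part T s2 (\<lambda>t. snd (\<psi> t)) \<le> ereal L"
    using L n(1) unfolding rate_function_def by (meson ereal_le_add_self2 order_trans)
  have "fst (\<psi> 0) = 0" "snd (\<psi> 0) = 0" using 1 2 unfolding rate_part_def by (auto split: if_splits)
  then show "\<psi> 0 = 0" by (simp add: prod_eq_iff)
  show "0 \<le> L" using n(1) 1 by (metis ereal_less_eq(5) order_trans)
qed

text \<open>The bound \<open>L\<close> controls the energy of each coordinate, and the energy controls the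
  increments for every choice of \<open>\<kappa>\<close>.\<close>
lemma rate_function_equicontinuous:
  fixes \<psi> :: "real \<Rightarrow> (real^'d::finite) \<times> (real^'d)"
  assumes s: "\<And>i. 0 < s1 i" "\<And>i. 0 < s2 i" and L: "rate_function T s1 s2 \<psi> \<le> ereal L" and \<kappa>: "0 < \<kappa>"
    and rt: "r \<in> {0..T}" "t \<in> {0..T}"
  shows "dist (\<psi> r) (\<psi> t) \<le> real CARD('d) * (\<kappa> * \<bar>r - t\<bar>) + (\<Sum>i\<in>UNIV. s1 i + s2 i) * L / \<kappa>"
proof -
  have *: "dist (\<psi> t) (\<psi> r) \<le> real CARD('d) * (\<kappa> * (t - r)) + (\<Sum>i\<in>UNIV. s1 i + s2 i) * L / \<kappa>"
    if rt: "0 \<le> r" "r \<le> t" "t \<le> T" for r t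
  proof -
    note f = rate_function_finiteD[OF s L]
    have "dist (\<psi> t) (\<psi> r) \<le> norm (fst (\<psi> t) - fst (\<psi> r)) + norm (snd (\<psi> t) - snd (\<psi> r))"
      unfolding dist_norm fst_diff[symmetric] snd_diff[symmetric] by (metis norm_Pair_le prod.collapse)
    also have "\<dots> \<le> (\<Sum>i\<in>UNIV. \<bar>(fst (\<psi> t) - fst (\<psi> r)) $ i\<bar>) + (\<Sum>i\<in>UNIV. \<bar>(snd (\<psi> t) - snd (\<psi> r)) $ i\<bar>)"
      by (intro add_mono norm_le_l1_cart)
    also have "\<dots> \<le> (\<Sum>i\<in>UNIV. \<kappa> * (t - r) / 2 + s1 i * L / \<kappa>) + (\<Sum>i\<in>(UNIV::'d set). \<kappa> * (t - r) / 2 + s2 i * L / \<kappa>)"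
      using rate_part_equicontinuous[OF s(1) f(1,4) \<kappa> rt] rate_part_equicontinuous[OF s(2) f(2,4) \<kappa> rt]
      by (intro add_mono sum_mono) auto
    also have "\<dots> = real CARD('d) * (\<kappa> * (t - r)) + (\<Sum>i\<in>UNIV. s1 i + s2 i) * L / \<kappa>"
    proof -
      have "(\<Sum>i\<in>UNIV. g i * L / \<kappa>) = sum g UNIV * L / \<kappa>" for g :: "'d \<Rightarrow> real"
        by (simp add: sum_distrib_right sum_divide_distrib)
      then show ?thesis by (simp add: sum.distrib distrib_right add_divide_distrib)
    qed
    finally show ?thesis .
  qed
  show ?thesis
    using *[of r t] *[of t r] rt by (cases "r \<le> t") (auto simp: dist_commute abs_minus_commute)
qed

lemma rate_function_modulus:
  assumes s: "\<And>i. 0 < s1 i" "\<And>i. 0 < s2 i" and e: "0 < e" and L0: "0 \<le> L"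
  shows "\<exists>d>0. \<forall>\<psi> :: real \<Rightarrow> (real^'d::finite) \<times> (real^'d). rate_function T s1 s2 \<psi> \<le> ereal L \<longrightarrow>
     (\<forall>r\<in>{0..T}. \<forall>t\<in>{0..T}. \<bar>r - t\<bar> \<le> d \<longrightarrow> dist (\<psi> r) (\<psi> t) \<le> e)"
proof -
  define \<Sigma> where "\<Sigma> = (\<Sum>i\<in>UNIV. s1 i + s2 i) * L"
  have \<Sigma>: "0 \<le> \<Sigma>" unfolding \<Sigma>_def using s L0 by (intro mult_nonneg_nonneg sum_nonneg) (auto simp: less_imp_le)
  (* \<kappa> makes the energy term at most e / 2, and then d does so for the linear term *)
  define \<kappa> where "\<kappa> = (\<Sigma> + 1) * 2 / e"
  have \<kappa>: "0 < \<kappa>" "\<Sigma> / \<kappa> \<le> e / 2" using \<Sigma> e by (auto simp: \<kappa>_def field_simps)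
  define d where "d = e / (2 * \<kappa> * real CARD('d))"
  have d: "0 < d" "real CARD('d) * (\<kappa> * d) \<le> e / 2" using e \<kappa> by (auto simp: d_def)
  show ?thesis
  proof (intro exI[of _ d] conjI d(1) allI impI ballI)
    fix \<psi> :: "real \<Rightarrow> (real^'d::finite) \<times> (real^'d)" and r t
    assume L: "rate_function T s1 s2 \<psi> \<le> ereal L" and rt: "r \<in> {0..T}" "t \<in> {0..T}" "\<bar>r - t\<bar> \<le> d"
    have "dist (\<psi> r) (\<psi> t) \<le> real CARD('d) * (\<kappa> * \<bar>r - t\<bar>) + (\<Sum>i\<in>UNIV. s1 i + s2 i) * L / \<kappa>"
      by (rule rate_function_equicontinuous[OF s L \<kappa>(1) rt(1,2)])
    also have "\<dots> \<le> real CARD('d) * (\<kappa> * d) + \<Sigma> / \<kappa>"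
      unfolding \<Sigma>_def using rt \<kappa> by (intro add_mono mult_left_mono) auto
    finally show "dist (\<psi> r) (\<psi> t) \<le> e" using d(2) \<kappa>(2) by linarith
  qed
qed

lemma rate_function_finite_in_game_data:
  fixes \<psi> :: "real \<Rightarrow> (real^'d::finite) \<times> (real^'d)"
  assumes s: "\<And>i. 0 < s1 i" "\<And>i. 0 < s2 i" and L: "rate_function T s1 s2 \<psi> \<le> ereal L"
    and ext: "\<psi> \<in> extensional {0..T}"
  shows "\<psi> \<in> game_data T"
proof -
  note f = rate_function_finiteD[OF s L]
  have "uniformly_continuous_on {0..T} \<psi>"
    unfolding uniformly_continuous_on_def
  proof (intro allI impI)
    fix e :: real assume "0 < e"
    then obtain d where d: "d > 0" "\<And>r t. r \<in> {0..T} \<Longrightarrow> t \<in> {0..T} \<Longrightarrow> \<bar>r - t\<bar> \<le> d \<Longrightarrow> dist (\<psi> r) (\<psi> t) \<le> e / 2"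
    proof -
      have "0 < e / 2" using \<open>0 < e\<close> by simp
      from rate_function_modulus[where ?s1.0=s1 and ?s2.0=s2, OF s this f(4), of T] obtain d where d: "d > 0"
        "\<forall>\<psi> :: real \<Rightarrow> (real^'d::finite) \<times> (real^'d). rate_function T s1 s2 \<psi> \<le> ereal L \<longrightarrow>
         (\<forall>r\<in>{0..T}. \<forall>t\<in>{0..T}. \<bar>r - t\<bar> \<le> d \<longrightarrow> dist (\<psi> r) (\<psi> t) \<le> e / 2)"
        by (elim exE conjE) (rule that)
      show thesis using d(2)[rule_format, OF L] by (intro that[OF d(1)])
    qed
    then show "\<exists>d>0. \<forall>x\<in>{0..T}. \<forall>x'\<in>{0..T}. dist x' x < d \<longrightarrow> dist (\<psi> x') (\<psi> x) < e"
      using \<open>0 < e\<close> by (intro exI[of _ d]) (force simp: dist_real_def)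
  qed
  then have "continuous_on {0..T} \<psi>" by (rule uniformly_continuous_imp_continuous)
  then show ?thesis using ext f(3) by (simp add: game_data_def mspace_cont_metric)
qed

theorem rate_function_sublevel_net:
  assumes s: "\<And>i. 0 < s1 i" "\<And>i. 0 < s2 i" and T: "0 \<le> T" and \<delta>: "0 < \<delta>"
  shows "\<exists>\<Psi>\<subseteq>game_data T. finite \<Psi> \<and>
    (\<forall>\<psi> :: real \<Rightarrow> (real^'d::finite) \<times> (real^'d). \<psi> \<in> skorokhod_space T \<and> rate_function T s1 s2 \<psi> \<le> ereal L \<longrightarrow>
        (\<exists>\<psi>'\<in>\<Psi>. \<forall>t\<in>{0..T}. dist (\<psi> t) (\<psi>' t) \<le> \<delta>))"
proof -
  define \<F> where "\<F> = {\<psi> :: real \<Rightarrow> (real^'d::finite) \<times> (real^'d). \<psi> \<in> skorokhod_space T \<and> rate_function T s1 s2 \<psi> \<le> ereal L}"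
  show ?thesis
  proof (cases "\<F> = {}")
    case True
    then show ?thesis by (intro exI[of _ "{}"]) (auto simp: \<F>_def)
  next
    case False
    then have L0: "0 \<le> L" using rate_function_finiteD(4)[OF s] by (auto simp: \<F>_def)
    have sub: "\<F> \<subseteq> game_data T"
      using rate_function_finite_in_game_data[OF s] by (auto simp: \<F>_def skorokhod_space_def)
    have "norm (\<psi> t) \<le> real CARD('d) * T + (\<Sum>i\<in>UNIV. s1 i + s2 i) * L" if \<psi>: "\<psi> \<in> \<F>" "t \<in> {0..T}" for \<psi> t
    proof -
      have L: "rate_function T s1 s2 \<psi> \<le> ereal L" using \<psi> by (simp add: \<F>_def)
      have "dist (\<psi> t) (\<psi> 0) \<le> real CARD('d) * (1 * \<bar>t - 0\<bar>) + (\<Sum>i\<in>UNIV. s1 i + s2 i) * L / 1"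
        using T \<psi> by (intro rate_function_equicontinuous[OF s L]) auto
      moreover have "real CARD('d) * t \<le> real CARD('d) * T" using \<psi> by (intro mult_left_mono) auto
      moreover have "dist (\<psi> t) (\<psi> 0) = norm (\<psi> t)" "\<bar>t - 0\<bar> = t" using rate_function_finiteD(3)[OF s L] \<psi>(2) by (auto simp: dist_norm)
      ultimately show ?thesis by (simp only: mult_1 div_by_1)
    qed
    then have bd: "bounded (\<Union>f\<in>\<F>. f ` {0..T})"
      unfolding bounded_iff by (intro exI[of _ "real CARD('d) * T + (\<Sum>i\<in>UNIV. s1 i + s2 i) * L"]) auto
    have eq: "\<exists>d>0. \<forall>f\<in>\<F>. \<forall>r\<in>{0..T}. \<forall>t\<in>{0..T}. \<bar>r - t\<bar> \<le> d \<longrightarrow> dist (f r) (f t) \<le> e" if e: "0 < e" for e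
    proof -
      from rate_function_modulus[where ?s1.0=s1 and ?s2.0=s2, OF s e L0, of T] obtain d where d: "d > 0"
        "\<forall>\<psi> :: real \<Rightarrow> (real^'d::finite) \<times> (real^'d). rate_function T s1 s2 \<psi> \<le> ereal L \<longrightarrow>
         (\<forall>r\<in>{0..T}. \<forall>t\<in>{0..T}. \<bar>r - t\<bar> \<le> d \<longrightarrow> dist (\<psi> r) (\<psi> t) \<le> e)"
        by (elim exE conjE) (rule that)
      show ?thesis
        using d(2) by (intro exI[of _ d] conjI d(1) ballI impI) (simp add: \<F>_def)
    qed
    have "\<exists>\<Psi>\<subseteq>\<F>. finite \<Psi> \<and> (\<forall>f\<in>\<F>. \<exists>\<psi>\<in>\<Psi>. \<forall>t\<in>{0..T}. dist (f t) (\<psi> t) \<le> \<delta>)"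
      by (rule finite_sup_net[OF T bd _ \<delta>]) (rule eq)
    then obtain \<Psi> where \<Psi>: "\<Psi> \<subseteq> \<F>" "finite \<Psi>" "\<forall>f\<in>\<F>. \<exists>\<psi>\<in>\<Psi>. \<forall>t\<in>{0..T}. dist (f t) (\<psi> t) \<le> \<delta>"
      by (elim exE conjE) (rule that)
    show ?thesis
    proof (intro exI[of _ \<Psi>] conjI allI impI)
      show "\<Psi> \<subseteq> game_data T" "finite \<Psi>" using \<Psi>(1,2) sub by auto
      fix \<psi> :: "real \<Rightarrow> (real^'d::finite) \<times> (real^'d)"
      assume "\<psi> \<in> skorokhod_space T \<and> rate_function T s1 s2 \<psi> \<le> ereal L"
      then show "\<exists>\<psi>'\<in>\<Psi>. \<forall>t\<in>{0..T}. dist (\<psi> t) (\<psi>' t) \<le> \<delta>"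
        using bspec[OF \<Psi>(3), of \<psi>] by (simp add: \<F>_def)
    qed
  qed
qed

section \<open>Renewal processes\<close>

text \<open>The sample paths for which the renewal process is finite. With bounded partial
  sums, the supremum in its definition would be taken over an infinite set of natural numbers.\<close>
locale renewal_path =
  fixes X :: "nat \<Rightarrow> real" and r :: real
  assumes X_pos: "\<And>l. 1 \<le> l \<Longrightarrow> 0 < X l" and r_pos: "0 < r"
    and diverges: "\<And>t. \<exists>l. t < (\<Sum>k=1..l. X k)"
begin

definition epoch :: "nat \<Rightarrow> real" where
  "epoch l = (\<Sum>k=1..l. X k / r)"

lemma epoch_0 [simp]: "epoch 0 = 0"
  by (simp add: epoch_def)

lemma epoch_Suc: "epoch l < epoch (Suc l)"
  using X_pos[of "Suc l"] r_pos by (simp add: epoch_def)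

lemma epoch_less_iff: "epoch l < epoch m \<longleftrightarrow> l < m"
  using epoch_Suc by (metis lift_Suc_mono_less_iff)

lemma epoch_le_iff: "epoch l \<le> epoch m \<longleftrightarrow> l \<le> m"
  using epoch_less_iff by (metis linorder_not_le)

lemma epoch_unbounded: "\<exists>l. t < epoch l"
proof -
  obtain l where "t * r < (\<Sum>k=1..l. X k)" using diverges by blast
  then have "t < epoch l"
    using r_pos by (simp add: epoch_def sum_divide_distrib[symmetric] pos_less_divide_eq)
  then show ?thesis ..
qed

lemma finite_epochs: "finite {l. epoch l \<le> t}"
proof -
  obtain m where "t < epoch m" using epoch_unbounded by blast
  then have "{l. epoch l \<le> t} \<subseteq> {..m}" using epoch_le_iff by (auto) (metis linorder_le_cases order_le_less_trans order_less_irrefl order_trans)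
  then show ?thesis by (rule finite_subset) simp
qed

lemma le_renewal_count_iff:
  assumes "0 \<le> t"
  shows "l \<le> renewal_count X r t \<longleftrightarrow> epoch l \<le> t"
proof -
  have ne: "{l. epoch l \<le> t} \<noteq> {}" using assms by (auto intro: exI[of _ 0])
  have N: "renewal_count X r t = Max {l. epoch l \<le> t}"
    unfolding renewal_count_def epoch_def[symmetric] using finite_epochs ne by (intro cSup_eq_Max)
  have "epoch (renewal_count X r t) \<le> t"
    using Max_in[OF finite_epochs ne] unfolding N by simp
  then show ?thesis
    using epoch_le_iff[of l "renewal_count X r t"] Max_ge[OF finite_epochs, of l t] unfolding N by fastforce
qed

lemma epoch_renewal_count:
  assumes "0 \<le> t"
  shows "epoch (renewal_count X r t) \<le> t" "t < epoch (Suc (renewal_count X r t))"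
  using le_renewal_count_iff[OF assms, of "renewal_count X r t"] le_renewal_count_iff[OF assms, of "Suc (renewal_count X r t)"]
  by auto

lemma renewal_count_eqI:
  assumes "epoch l \<le> t" "t < epoch (Suc l)"
  shows "renewal_count X r t = l"
proof -
  have "epoch 0 \<le> epoch l" by (simp only: epoch_le_iff)
  then have "0 \<le> t" using assms by simp
  then show ?thesis using assms le_renewal_count_iff[of t l] le_renewal_count_iff[of t "Suc l"] by simp
qed

lemma renewal_count_mono: "0 \<le> s \<Longrightarrow> s \<le> t \<Longrightarrow> renewal_count X r s \<le> renewal_count X r t"
  using le_renewal_count_iff[of t "renewal_count X r s"] epoch_renewal_count(1)[of s] by simp

lemma renewal_count_0: "renewal_count X r 0 = 0"
  using epoch_Suc[of 0] by (intro renewal_count_eqI) auto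

lemma eventually_at_right_renewal_count:
  assumes "0 \<le> t"
  shows "\<forall>\<^sub>F s in at_right t. renewal_count X r s = renewal_count X r t"
  unfolding eventually_at_right_field
  using epoch_renewal_count[OF assms]
  by (intro exI[of _ "epoch (Suc (renewal_count X r t))"]) (auto intro!: renewal_count_eqI)

text \<open>Before \<open>t\<close> the process is constant for a while, and it jumps by at most one, because
  positive interarrival times prevent simultaneous renewals.\<close>
lemma left_limit_renewal_count:
  assumes "0 < t"
  obtains l v where "0 \<le> v" "v < t" "\<And>s. v \<le> s \<Longrightarrow> s < t \<Longrightarrow> renewal_count X r s = l"
    "renewal_count X r t \<le> l + 1"
proof (cases "epoch (renewal_count X r t) < t")
  case True
  have "epoch 0 \<le> epoch (renewal_count X r t)" by (simp only: epoch_le_iff)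
  then show ?thesis
    using True epoch_renewal_count[of t] assms
    by (intro that[of "epoch (renewal_count X r t)" "renewal_count X r t"]) (auto intro!: renewal_count_eqI)
next
  case False
  then have eq: "epoch (renewal_count X r t) = t" using epoch_renewal_count(1)[of t] assms by simp
  then obtain l where l: "renewal_count X r t = Suc l" using assms by (cases "renewal_count X r t") auto
  have "epoch 0 \<le> epoch l" by (simp only: epoch_le_iff)
  then show ?thesis
    using eq l epoch_Suc[of l] by (intro that[of "epoch l" l]) (auto intro!: renewal_count_eqI)
qed

end

text \<open>The expectation of \<open>exp (- S\<^sub>l)\<close>, with \<open>S\<^sub>l\<close> the sum of the first \<open>l\<close> variables, is the power
  \<open>q ^ l\<close> of a number \<open>q < 1\<close> by independence. On the event that all sums stay below \<open>K\<close> the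
  integrand is at least \<open>exp (- K)\<close>, so this event is null.\<close>
lemma (in prob_space) AE_partial_sums_unbounded:
  fixes X :: "'i \<Rightarrow> nat \<Rightarrow> 'a \<Rightarrow> real"
  assumes pos: "\<And>l \<omega>. 1 \<le> l \<Longrightarrow> \<omega> \<in> space M \<Longrightarrow> 0 < X i l \<omega>"
    and indep: "indep_vars (\<lambda>_. borel) (\<lambda>(i, l). X i l) (UNIV \<times> {1..})"
    and ident: "\<And>l. 1 \<le> l \<Longrightarrow> distr M borel (X i l) = distr M borel (X i 1)"
  shows "AE \<omega> in M. \<forall>t. \<exists>l. t < (\<Sum>k=1..l. X i k \<omega>)"
proof -
  have rv [measurable]: "random_variable borel (X i l)" if "1 \<le> l" for l
    using indep that unfolding indep_vars_def by fastforce
  define q where "q = expectation (\<lambda>\<omega>. exp (- X i 1 \<omega>))"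
  have int: "integrable M (\<lambda>\<omega>. exp (- X i l \<omega>))" if l: "1 \<le> l" for l
  proof (rule integrable_const_bound[of _ 1])
    show "AE \<omega> in M. norm (exp (- X i l \<omega>)) \<le> 1" using pos[OF l] by (intro AE_I2) (simp add: less_imp_le)
    show "(\<lambda>\<omega>. exp (- X i l \<omega>)) \<in> borel_measurable M" using rv[OF l] by measurable
  qed
  have q1: "q < 1" unfolding q_def
    using pos[of 1] by (intro expectation_less int AE_I2) auto
  have q0: "0 \<le> q" unfolding q_def by (intro integral_nonneg_AE AE_I2) simp
  have ql: "expectation (\<lambda>\<omega>. exp (- X i l \<omega>)) = q" if l: "1 \<le> l" for l
  proof -
    have "expectation (\<lambda>\<omega>. exp (- X i l \<omega>)) = integral\<^sup>L (distr M borel (X i l)) (\<lambda>x. exp (- x))"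
      using rv[OF l] by (subst integral_distr) auto
    also have "\<dots> = q" unfolding ident[OF l] q_def using rv[of 1] by (subst integral_distr) auto
    finally show ?thesis .
  qed
  have prod: "integrable M (\<lambda>\<omega>. exp (- (\<Sum>k=1..l. X i k \<omega>)))" "expectation (\<lambda>\<omega>. exp (- (\<Sum>k=1..l. X i k \<omega>))) = q ^ l" for l
  proof -
    have iv0: "indep_vars (\<lambda>_. borel) (\<lambda>(i, l). X i l) ({i} \<times> {1..l})"
      by (rule indep_vars_subset[OF indep]) auto
    have iv: "indep_vars (\<lambda>_. borel) (\<lambda>p \<omega>. exp (- (case p of (i, l) \<Rightarrow> X i l) \<omega>)) ({i} \<times> {1..l})"
      by (rule indep_vars_compose2[OF iv0, where Y="\<lambda>_ x. exp (- x)"]) auto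
    have I: "integrable M (\<lambda>\<omega>. exp (- (case p of (i, l) \<Rightarrow> X i l) \<omega>))" if "p \<in> {i} \<times> {1..l}" for p
      using that int by auto
    have eq: "(\<Prod>p\<in>{i} \<times> {1..l}. exp (- (case p of (i, l) \<Rightarrow> X i l) \<omega>)) = exp (- (\<Sum>k=1..l. X i k \<omega>))" for \<omega>
    proof -
      have "(\<Prod>p\<in>{i} \<times> {1..l}. exp (- (case p of (i, l) \<Rightarrow> X i l) \<omega>)) = exp (\<Sum>p\<in>{i} \<times> {1..l}. - (case p of (i, l) \<Rightarrow> X i l) \<omega>)"
        by (subst exp_sum) auto
      also have "(\<Sum>p\<in>{i} \<times> {1..l}. - (case p of (i, l) \<Rightarrow> X i l) \<omega>) = - (\<Sum>k=1..l. X i k \<omega>)"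
        using sum.cartesian_product[of "\<lambda>j k. - X j k \<omega>" "{1..l}" "{i}"] by (simp add: sum_negf case_prod_beta)
      finally show ?thesis .
    qed
    have fin: "finite ({i} \<times> {1..l})" by simp
    show "integrable M (\<lambda>\<omega>. exp (- (\<Sum>k=1..l. X i k \<omega>)))"
      using indep_vars_integrable[OF fin iv I] unfolding eq by simp
    have "expectation (\<lambda>\<omega>. exp (- (\<Sum>k=1..l. X i k \<omega>))) = (\<Prod>p\<in>{i} \<times> {1..l}. expectation (\<lambda>\<omega>. exp (- (case p of (i, l) \<Rightarrow> X i l) \<omega>)))"
      using indep_vars_lebesgue_integral[OF fin iv I] unfolding eq by simp
    also have "\<dots> = (\<Prod>p\<in>{i} \<times> {1..l}. q)" using ql by (intro prod.cong) auto
    finally show "expectation (\<lambda>\<omega>. exp (- (\<Sum>k=1..l. X i k \<omega>))) = q ^ l" by simp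
  qed
  have null: "AE \<omega> in M. \<exists>l. real K < (\<Sum>k=1..l. X i k \<omega>)" for K :: nat
  proof -
    define E where "E = {\<omega> \<in> space M. \<forall>l. (\<Sum>k=1..l. X i k \<omega>) \<le> real K}"
    have E [measurable]: "E \<in> sets M" unfolding E_def
      using rv by (intro sets.sets_Collect_countable_All borel_measurable_le borel_measurable_sum borel_measurable_const) auto
    have bound: "exp (- real K) * prob E \<le> q ^ l" for l
    proof -
      have "exp (- real K) * prob E = expectation (\<lambda>\<omega>. exp (- real K) * indicator E \<omega>)" by simp
      also have "\<dots> \<le> expectation (\<lambda>\<omega>. exp (- (\<Sum>k=1..l. X i k \<omega>)))"
      proof (rule integral_mono[OF _ prod(1)])
        show "integrable M (\<lambda>\<omega>. exp (- real K) * indicator E \<omega>)" by (auto simp: less_top[symmetric])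
        fix \<omega> show "exp (- real K) * indicator E \<omega> \<le> exp (- (\<Sum>k=1..l. X i k \<omega>))"
          by (auto simp: E_def indicator_def)
      qed
      finally show ?thesis using prod(2) by simp
    qed
    have "(\<lambda>l. q ^ l) \<longlonglongrightarrow> 0" using q0 q1 by (intro LIMSEQ_realpow_zero)
    from LIMSEQ_le_const[OF this] have "exp (- real K) * prob E \<le> 0" using bound by blast
    then have "prob E = 0" by (simp add: mult_le_0_iff measure_le_0_iff)
    then have "E \<in> null_sets M" using E by (simp add: emeasure_eq_measure null_setsI)
    then show ?thesis by (rule AE_I') (auto simp: E_def not_less)
  qed
  then have "AE \<omega> in M. \<forall>K::nat. \<exists>l. real K < (\<Sum>k=1..l. X i k \<omega>)" by (simp add: AE_all_countable)
  then show ?thesis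
  proof eventually_elim
    case (elim \<omega>)
    then show ?case by (meson less_le_trans order_le_less_trans real_arch_simple)
  qed
qed

lemma (in complete_measure) sets_if_AE_eq:
  assumes "E \<subseteq> space M" "E' \<in> sets M" "AE \<omega> in M. \<omega> \<in> E \<longleftrightarrow> \<omega> \<in> E'"
  shows "E \<in> sets M"
proof -
  obtain N where N: "{\<omega> \<in> space M. \<not> (\<omega> \<in> E \<longleftrightarrow> \<omega> \<in> E')} \<subseteq> N" "emeasure M N = 0" "N \<in> sets M"
    by (rule AE_E[OF assms(3)])
  then have "N \<in> null_sets M" by (intro null_setsI)
  have sub: "E - E' \<subseteq> N" "E' - E \<subseteq> N" using N(1) assms(1) sets.sets_into_space[OF assms(2)] by blast+
  have "E - E' \<in> sets M" "E' - E \<in> sets M" using complete[OF sub(1) \<open>N \<in> null_sets M\<close>] complete[OF sub(2) \<open>N \<in> null_sets M\<close>] by auto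
  moreover have "E = (E' - (E' - E)) \<union> (E - E')" by blast
  ultimately show ?thesis using assms(2) by (metis sets.Diff sets.Un)
qed

text \<open>The end point is added because the right-continuity of a path gives no information
  about its value at \<open>T\<close>.\<close>
definition time_grid :: "real \<Rightarrow> real set" where
  "time_grid T = insert T (\<rat> \<inter> {0..T})"

lemma countable_time_grid: "countable (time_grid T)"
  by (simp add: time_grid_def countable_rat)

lemma time_grid_subset: "0 \<le> T \<Longrightarrow> time_grid T \<subseteq> {0..T}"
  by (auto simp: time_grid_def)

lemma right_continuous_le_if_time_grid_le:
  fixes h :: "real \<Rightarrow> real"
  assumes h: "\<And>t. 0 \<le> t \<Longrightarrow> t < T \<Longrightarrow> (h \<longlongrightarrow> h t) (at_right t)"
    and le: "\<And>t. t \<in> time_grid T \<Longrightarrow> h t \<le> q" and t: "0 \<le> t" "t \<le> T"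
  shows "h t \<le> q"
proof (cases "t = T")
  case True
  then show ?thesis using le by (simp add: time_grid_def)
next
  case False
  then have tT: "t < T" using t by simp
  show ?thesis
  proof (rule ccontr)
    assume "\<not> h t \<le> q"
    then have "\<forall>\<^sub>F s in at_right t. q < h s" by (intro order_tendstoD(1)[OF h[OF t(1) tT]]) simp
    then obtain b where b: "b > t" "\<And>s. t < s \<Longrightarrow> s < b \<Longrightarrow> q < h s" unfolding eventually_at_right_field by blast
    obtain s where s: "s \<in> \<rat>" "t < s" "s < min b T" using Rats_dense_in_real[of t "min b T"] b tT by auto
    then have "s \<in> time_grid T" using t by (auto simp: time_grid_def)
    then show False using le[of s] b(2)[of s] s by simp
  qed
qed

text \<open>On good paths \<open>l \<le> renewal_count\<close> means that the \<open>l\<close>-th epoch is at most \<open>t\<close>. The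
  remaining paths form a null set, where completeness of the measure settles the matter.\<close>
lemma renewal_count_measurable:
  fixes X :: "nat \<Rightarrow> 'a \<Rightarrow> real"
  assumes M: "complete_measure M" and rv: "\<And>l. 1 \<le> l \<Longrightarrow> X l \<in> borel_measurable M"
    and good: "AE \<omega> in M. renewal_path (\<lambda>l. X l \<omega>) r" and t: "0 \<le> t"
  shows "(\<lambda>\<omega>. renewal_count (\<lambda>l. X l \<omega>) r t) \<in> measurable M (count_space UNIV)"
proof -
  interpret complete_measure M by (rule M)
  have *: "{\<omega> \<in> space M. l \<le> renewal_count (\<lambda>l. X l \<omega>) r t} \<in> sets M" for l
  proof (rule sets_if_AE_eq)
    show "{\<omega> \<in> space M. (\<Sum>k=1..l. X k \<omega> / r) \<le> t} \<in> sets M"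
      using rv by (intro borel_measurable_le borel_measurable_sum borel_measurable_divide borel_measurable_const) auto
    show "AE \<omega> in M. \<omega> \<in> {\<omega> \<in> space M. l \<le> renewal_count (\<lambda>l. X l \<omega>) r t} \<longleftrightarrow>
        \<omega> \<in> {\<omega> \<in> space M. (\<Sum>k=1..l. X k \<omega> / r) \<le> t}"
      using good
    proof eventually_elim
      case (elim \<omega>)
      interpret renewal_path "\<lambda>l. X l \<omega>" r by (rule elim)
      show ?case using le_renewal_count_iff[OF t] by (simp add: epoch_def)
    qed
  qed auto
  show ?thesis
  proof (rule measurable_count_space_eq2_countable[THEN iffD2], intro conjI ballI)
    fix l :: nat
    have "(\<lambda>\<omega>. renewal_count (\<lambda>l. X l \<omega>) r t) -` {l} \<inter> space M =
      {\<omega> \<in> space M. l \<le> renewal_count (\<lambda>l. X l \<omega>) r t} - {\<omega> \<in> space M. Suc l \<le> renewal_count (\<lambda>l. X l \<omega>) r t}"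
      by auto
    then show "(\<lambda>\<omega>. renewal_count (\<lambda>l. X l \<omega>) r t) -` {l} \<inter> space M \<in> sets M" using * by auto
  qed auto
qed

section \<open>Queues under a work-conserving priority rule, path by path\<close>

context workload_game
begin

text \<open>The parameters of the system with index \<open>N\<close>, scaled in the way they enter the queue
  equation, are within \<open>\<kappa>\<close> of their limits.\<close>
definition params_close :: "real \<Rightarrow> real \<Rightarrow> real \<Rightarrow> ('d \<Rightarrow> real) \<Rightarrow> ('d \<Rightarrow> real) \<Rightarrow> bool" where
  "params_close \<kappa> N c lamn mun \<longleftrightarrow> (\<forall>i. \<bar>N / mun i - 1 / mu i\<bar> \<le> \<kappa> \<and>
     \<bar>(lamn i - rho i * mun i) / c - y $ i\<bar> \<le> \<kappa> \<and> c / lamn i \<le> \<kappa>) \<and> c / N \<le> \<kappa>"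

definition drift_bound :: real where "drift_bound = 1 + (\<Sum>i\<in>UNIV. \<bar>y $ i\<bar>)"

definition queue_bound :: "real \<Rightarrow> real" where
  "queue_bound R = 8 * mu_total * theta_total * (drift_bound * T + 2 * R)"

definition time_bound :: "real \<Rightarrow> real" where
  "time_bound R = 2 * theta_total * (queue_bound R + drift_bound * T + 2 * R)"

text \<open>The constants 24 and 7 count the multiples of \<open>\<delta>\<close> by which, respectively, the workload
  and the queue of a single unserved class may change in \<open>state_space_collapse\<close>.\<close>
definition collapse_rate :: real where "collapse_rate = 24 * mu_total * theta_total + 7"

lemma drift_bound_ge: "1 \<le> drift_bound" "\<bar>y $ i\<bar> + 1 \<le> drift_bound"
  unfolding drift_bound_def using member_le_sum[of i UNIV "\<lambda>i. \<bar>y $ i\<bar>"] by (auto intro: sum_nonneg)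

lemma collapse_rate_pos: "0 < collapse_rate"
  unfolding collapse_rate_def using mu_total_pos theta_total_pos by (simp add: add_pos_pos)

lemma queue_bound_nonneg: "0 \<le> R \<Longrightarrow> 0 \<le> queue_bound R"
  using mu_total_pos theta_total_pos drift_bound_ge T_pos by (simp add: queue_bound_def)

end

text \<open>A deterministic path of the queueing system: \<open>a\<close> and \<open>s\<close> are the scaled deviations of
  the arrivals and the potential services from their means, and \<open>E i t\<close> is the time devoted to
  class \<open>i\<close> up to time \<open>t\<close>. The last two assumptions express that the server never idles while
  customers are present, and never serves a class that holds less than its equilibrium share.\<close>
locale queue_path = workload_game C C' mu u1 T rho y
  for C C' :: "'d::{finite,linorder} \<Rightarrow> real \<Rightarrow> real" and mu :: "'d \<Rightarrow> real" and u1 T :: real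
    and rho :: "'d \<Rightarrow> real" and y :: "(real, 'd) vec" +
  fixes N c :: real and lamn mun :: "'d \<Rightarrow> real" and a s :: "real \<Rightarrow> (real, 'd) vec"
    and E :: "'d \<Rightarrow> real \<Rightarrow> real" and q :: "real \<Rightarrow> (real, 'd) vec"
  assumes rho_sum: "(\<Sum>i\<in>UNIV. rho i) = 1"
    and N_pos: "0 < N" and c_pos: "0 < c" and lamn_pos: "\<And>i. 0 < lamn i" and mun_pos: "\<And>i. 0 < mun i"
    and q_eq: "\<And>t i. 0 \<le> t \<Longrightarrow> t \<le> T \<Longrightarrow> q t $ i = a t $ i - s (E i t) $ i + (lamn i * t - mun i * E i t) / c"
    and q_nonneg: "\<And>t i. 0 \<le> t \<Longrightarrow> t \<le> T \<Longrightarrow> 0 \<le> q t $ i"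
    and q_0: "q 0 = 0"
    and E_0: "\<And>i. E i 0 = 0"
    and E_mono: "\<And>i r t. 0 \<le> r \<Longrightarrow> r \<le> t \<Longrightarrow> t \<le> T \<Longrightarrow> E i r \<le> E i t"
    and E_total: "\<And>r t. 0 \<le> r \<Longrightarrow> r \<le> t \<Longrightarrow> t \<le> T \<Longrightarrow> (\<Sum>i\<in>UNIV. E i t - E i r) \<le> t - r"
    and work_conserving: "\<And>r t. 0 \<le> r \<Longrightarrow> r \<le> t \<Longrightarrow> t \<le> T \<Longrightarrow>
        (\<And>u. r < u \<Longrightarrow> u \<le> t \<Longrightarrow> q u \<noteq> 0) \<Longrightarrow> (\<Sum>i\<in>UNIV. E i t - E i r) = t - r"
    and priority: "\<And>j r t. 0 \<le> r \<Longrightarrow> r \<le> t \<Longrightarrow> t \<le> T \<Longrightarrow>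
        (\<And>u. r < u \<Longrightarrow> u \<le> t \<Longrightarrow> q u $ j < equilibrium (workload (q u)) $ j) \<Longrightarrow> E j t = E j r"
begin

lemma E_Lipschitz: "0 \<le> r \<Longrightarrow> r \<le> t \<Longrightarrow> t \<le> T \<Longrightarrow> E i t - E i r \<le> t - r"
  using E_total[of r t] E_mono[of r t]
    member_le_sum[of i UNIV "\<lambda>i. E i t - E i r"] by auto

lemma E_range: "0 \<le> t \<Longrightarrow> t \<le> T \<Longrightarrow> 0 \<le> E i t \<and> E i t \<le> t"
  using E_mono[of 0 t i] E_Lipschitz[of 0 t i] E_0[of i] by auto

lemma continuous_on_E: "continuous_on {0..T} (E i)"
proof -
  have "1-lipschitz_on {0..T} (E i)"
  proof (rule lipschitz_onI)
    fix r t assume "r \<in> {0..T}" "t \<in> {0..T}"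
    then show "dist (E i r) (E i t) \<le> 1 * dist r t"
      using E_mono[of r t i] E_mono[of t r i] E_Lipschitz[of r t i] E_Lipschitz[of t r i]
      by (cases "r \<le> t") (auto simp: dist_real_def)
  qed simp
  then show ?thesis by (rule lipschitz_on_continuous_on)
qed

text \<open>The counterparts of \<open>y\<close>, \<open>\<theta>\<close>, the netput and the workload before the limit is
  taken. The work that is lost by idling plays the role of the regulator.\<close>
definition pre_drift :: "'d \<Rightarrow> real" where "pre_drift i = (lamn i - rho i * mun i) / c"
definition pre_theta :: "'d \<Rightarrow> real" where "pre_theta i = N / mun i"
definition pre_netput :: "real \<Rightarrow> real" where
  "pre_netput t = (\<Sum>i\<in>UNIV. pre_theta i * (pre_drift i * t + a t $ i - s (E i t) $ i))"
definition pre_workload :: "real \<Rightarrow> real" where "pre_workload t = (\<Sum>i\<in>UNIV. pre_theta i * q t $ i)"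
definition idle_work :: "real \<Rightarrow> real" where "idle_work t = N / c * (t - (\<Sum>i\<in>UNIV. E i t))"

lemma pre_theta_pos: "0 < pre_theta i"
  using N_pos mun_pos by (simp add: pre_theta_def)

lemma q_eq':
  assumes "0 \<le> t" "t \<le> T"
  shows "q t $ i = pre_drift i * t + a t $ i - s (E i t) $ i + mun i / c * (rho i * t - E i t)"
proof -
  have "(lamn i * t - mun i * E i t) / c = pre_drift i * t + mun i / c * (rho i * t - E i t)"
    using c_pos by (simp add: pre_drift_def field_simps)
  then show ?thesis unfolding q_eq[OF assms] by simp
qed

text \<open>In the sum over the classes the terms \<open>rho i * t\<close> add up to \<open>t\<close>, since the system is
  critically loaded.\<close>
lemma pre_workload_eq:
  assumes "0 \<le> t" "t \<le> T"
  shows "pre_workload t = pre_netput t + idle_work t"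
proof -
  have "pre_theta i * q t $ i = pre_theta i * (pre_drift i * t + a t $ i - s (E i t) $ i) + N / c * (rho i * t - E i t)" for i
    unfolding q_eq'[OF assms] using mun_pos[of i] by (simp add: pre_theta_def field_simps)
  then have "pre_workload t = pre_netput t + (\<Sum>i\<in>UNIV. N / c * (rho i * t - E i t))"
    by (simp add: pre_workload_def pre_netput_def sum.distrib)
  also have "(\<Sum>i\<in>UNIV. N / c * (rho i * t - E i t)) = N / c * ((\<Sum>i\<in>UNIV. rho i) * t - (\<Sum>i\<in>UNIV. E i t))"
  proof -
    have "(\<Sum>i\<in>UNIV. rho i * t - E i t) = (\<Sum>i\<in>UNIV. rho i) * t - (\<Sum>i\<in>UNIV. E i t)"
      by (simp add: sum_subtractf sum_distrib_right)
    then show ?thesis by (simp only: sum_distrib_left[symmetric])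
  qed
  finally show ?thesis by (simp add: rho_sum idle_work_def)
qed

lemma pre_workload_nonneg: "0 \<le> t \<Longrightarrow> t \<le> T \<Longrightarrow> 0 \<le> pre_workload t"
  unfolding pre_workload_def using pre_theta_pos q_nonneg by (intro sum_nonneg mult_nonneg_nonneg) (auto simp: less_imp_le)

lemma idle_work_mono: "0 \<le> r \<Longrightarrow> r \<le> t \<Longrightarrow> t \<le> T \<Longrightarrow> idle_work r \<le> idle_work t"
  using E_total[of r t] N_pos c_pos unfolding idle_work_def
  by (intro mult_left_mono) (auto simp: sum_subtractf)

lemma continuous_on_idle_work: "continuous_on {0..T} idle_work"
  unfolding idle_work_def by (intro continuous_intros continuous_on_E)

text \<open>Idle work accumulates only while the system is empty, by work conservation. Together with
  \<open>pre_workload_eq\<close> this says that the workload solves the reflection problem for the netput.\<close>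
lemma pre_workload_eq_reflected:
  assumes R: "\<And>r. 0 \<le> r \<Longrightarrow> r \<le> T \<Longrightarrow> \<bar>pre_netput r\<bar> \<le> R" and t: "0 \<le> t" "t \<le> T"
  shows "pre_workload t = reflected pre_netput t"
proof (rule antisym)
  have R': "\<And>r. 0 \<le> r \<Longrightarrow> r \<le> t \<Longrightarrow> \<bar>pre_netput r\<bar> \<le> R" using R t by auto
  have w0: "pre_workload 0 = 0" using q_0 by (simp add: pre_workload_def)
  have "pre_netput t + idle_work t \<le> reflected pre_netput t"
  proof (rule reflected_maximal[where R=R])
    show "pre_netput 0 + idle_work 0 = 0" using pre_workload_eq[of 0] w0 t by simp
    show "continuous_on {0..t} idle_work" by (rule continuous_on_subset[OF continuous_on_idle_work]) (use t in auto)
    fix r' r assume r: "0 \<le> r'" "r' \<le> r" "r \<le> t" "\<And>u. r' < u \<Longrightarrow> u \<le> r \<Longrightarrow> pre_netput u + idle_work u \<noteq> 0"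
    have "(\<Sum>i\<in>UNIV. E i r - E i r') = r - r'"
    proof (rule work_conserving)
      fix u assume u: "r' < u" "u \<le> r"
      show "q u \<noteq> 0"
      proof
        assume "q u = 0"
        then have "pre_workload u = 0" by (simp add: pre_workload_def)
        then show False using r(4)[OF u] pre_workload_eq[of u] u r t by simp
      qed
    qed (use r t in auto)
    then show "idle_work r = idle_work r'" unfolding idle_work_def by (simp add: sum_subtractf)
  qed (use R' t in auto)
  then show "pre_workload t \<le> reflected pre_netput t" using pre_workload_eq[OF t] by simp
  have "reflected pre_netput t \<le> pre_netput t + idle_work t"
  proof (rule reflected_minimal)
    show "0 \<le> pre_netput r + idle_work r" if "0 \<le> r" "r \<le> t" for r using pre_workload_eq[of r] pre_workload_nonneg[of r] that t by simp
    show "idle_work r \<le> idle_work t" if "0 \<le> r" "r \<le> t" for r using idle_work_mono[OF that t(2)] .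
    show "0 \<le> idle_work 0" by (simp add: idle_work_def E_0)
  qed (use t in auto)
  then show "reflected pre_netput t \<le> pre_workload t" using pre_workload_eq[OF t] by simp
qed

end

locale bounded_queue_path = queue_path C C' mu u1 T rho y N c lamn mun a s E q
  for C C' :: "'d::{finite,linorder} \<Rightarrow> real \<Rightarrow> real" and mu :: "'d \<Rightarrow> real" and u1 T :: real
    and rho :: "'d \<Rightarrow> real" and y :: "(real, 'd) vec" and N c lamn mun a s E q +
  fixes R \<kappa> :: real
  assumes params: "params_close \<kappa> N c lamn mun"
    and \<kappa>: "0 < \<kappa>" "\<kappa> \<le> 1" "\<And>i. \<kappa> \<le> 1 / (2 * mu i)"
    and a_le: "\<And>t i. 0 \<le> t \<Longrightarrow> t \<le> T \<Longrightarrow> \<bar>a t $ i\<bar> \<le> R"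
    and s_le: "\<And>t i. 0 \<le> t \<Longrightarrow> t \<le> T \<Longrightarrow> \<bar>s t $ i\<bar> \<le> R"
begin

lemma R_nonneg: "0 \<le> R"
  using a_le[of 0] T_pos by (metis abs_ge_zero less_imp_le order_refl order_trans)

lemma pre_drift_close: "\<bar>pre_drift i - y $ i\<bar> \<le> \<kappa>"
  using params by (simp add: params_close_def pre_drift_def)

lemma pre_drift_le: "\<bar>pre_drift i\<bar> \<le> drift_bound"
  using pre_drift_close[of i] \<kappa>(2) drift_bound_ge(2)[of i] by linarith

lemma pre_theta_close: "\<bar>pre_theta i - 1 / mu i\<bar> \<le> \<kappa>"
  using params by (simp add: params_close_def pre_theta_def)

lemma pre_theta_le: "pre_theta i \<le> 2 * (1 / mu i)"
proof -
  have "\<kappa> \<le> 1 / mu i" using \<kappa>(3)[of i] mu_pos[of i] by (simp add: field_simps)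
  then show ?thesis using pre_theta_close[of i] by linarith
qed

lemma pre_theta_ge: "1 / (2 * mu i) \<le> pre_theta i"
proof -
  have "1 / mu i - 1 / (2 * mu i) = 1 / (2 * mu i)" using mu_pos[of i] by (simp add: field_simps)
  then show ?thesis using pre_theta_close[of i] \<kappa>(3)[of i] by linarith
qed

lemma input_le:
  assumes t: "0 \<le> t" "t \<le> T"
  shows "\<bar>pre_drift i * t + a t $ i - s (E i t) $ i\<bar> \<le> drift_bound * T + 2 * R"
proof -
  have "\<bar>pre_drift i * t\<bar> \<le> drift_bound * T"
    unfolding abs_mult using pre_drift_le[of i] t drift_bound_ge by (intro mult_mono) auto
  moreover have "\<bar>s (E i t) $ i\<bar> \<le> R" using E_range[OF t, of i] t by (intro s_le) auto
  ultimately show ?thesis using a_le[OF t, of i] by linarith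
qed

lemma pre_netput_le:
  assumes t: "0 \<le> t" "t \<le> T"
  shows "\<bar>pre_netput t\<bar> \<le> 2 * theta_total * (drift_bound * T + 2 * R)"
proof -
  have "\<bar>pre_netput t\<bar> \<le> (\<Sum>i\<in>UNIV. \<bar>pre_theta i * (pre_drift i * t + a t $ i - s (E i t) $ i)\<bar>)"
    unfolding pre_netput_def by (rule sum_abs)
  also have "\<dots> \<le> (\<Sum>i\<in>UNIV. 2 * (1 / mu i) * (drift_bound * T + 2 * R))"
  proof (rule sum_mono)
    fix i
    have "0 \<le> 2 * (1 / mu i)" using mu_pos[of i] by simp
    then show "\<bar>pre_theta i * (pre_drift i * t + a t $ i - s (E i t) $ i)\<bar> \<le> 2 * (1 / mu i) * (drift_bound * T + 2 * R)"
      unfolding abs_mult using pre_theta_le[of i] pre_theta_pos[of i] input_le[OF t, of i] by (intro mult_mono) auto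
  qed
  also have "\<dots> = 2 * theta_total * (drift_bound * T + 2 * R)"
    by (simp add: theta_total_def sum_distrib_left sum_distrib_right)
  finally show ?thesis .
qed

text \<open>The workload is a reflection of the netput and therefore bounded by twice its size.\<close>
lemma q_le:
  assumes t: "0 \<le> t" "t \<le> T"
  shows "q t $ i \<le> queue_bound R"
proof -
  let ?X = "2 * theta_total * (drift_bound * T + 2 * R)"
  have "pre_workload t = reflected pre_netput t" by (rule pre_workload_eq_reflected[OF pre_netput_le t])
  also have "\<dots> \<le> 2 * ?X" by (rule reflected_le) (use pre_netput_le t in auto)
  finally have w: "pre_workload t \<le> 2 * ?X" .
  have "pre_theta i * q t $ i \<le> pre_workload t"
    unfolding pre_workload_def using q_nonneg[OF t] pre_theta_pos by (intro member_le_sum) (auto simp: less_imp_le)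
  moreover have "1 / (2 * mu i) * q t $ i \<le> pre_theta i * q t $ i"
    using pre_theta_ge q_nonneg[OF t] by (intro mult_right_mono) auto
  ultimately have "1 / (2 * mu i) * q t $ i \<le> 2 * ?X" using w by linarith
  then have "q t $ i \<le> 2 * mu i * (2 * ?X)" using mu_pos[of i] by (simp add: field_simps)
  also have "\<dots> \<le> 2 * mu_total * (2 * ?X)"
  proof (intro mult_right_mono mult_left_mono)
    show "mu i \<le> mu_total" unfolding mu_total_def using mu_pos by (intro member_le_sum) (auto simp: less_imp_le)
    show "0 \<le> 2 * ?X" using theta_total_pos drift_bound_ge T_pos R_nonneg by simp
  qed auto
  finally show ?thesis by (simp add: queue_bound_def)
qed

lemma total_cost_le:
  assumes t: "0 \<le> t" "t \<le> T"
  shows "total_cost C (q t) \<le> real CARD('d) * (u1 * queue_bound R)"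
proof -
  have "total_cost C (q t) \<le> (\<Sum>i\<in>(UNIV::'d set). u1 * queue_bound R)"
    unfolding total_cost_def
  proof (rule sum_mono)
    fix i
    have "C i (q t $ i) \<le> u1 * q t $ i" by (rule C_linear[OF q_nonneg[OF t]])
    also have "\<dots> \<le> u1 * queue_bound R" using q_le[OF t] u1_nonneg by (intro mult_left_mono) auto
    finally show "C i (q t $ i) \<le> u1 * queue_bound R" .
  qed
  then show ?thesis by simp
qed

text \<open>If the time spent on class \<open>i\<close> differed from \<open>rho i * t\<close> at the time scale 1, then the
  queue would be of fluid order \<open>N\<close>, whereas \<open>q_le\<close> bounds it by a multiple of \<open>c\<close>.\<close>
lemma E_close:
  assumes t: "0 \<le> t" "t \<le> T"
  shows "\<bar>E i t - rho i * t\<bar> \<le> \<kappa> * time_bound R"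
proof -
  let ?v = "q t $ i - (pre_drift i * t + a t $ i - s (E i t) $ i)"
  have "rho i * t - E i t = c / N * (pre_theta i * ?v)"
    unfolding q_eq'[OF t] using c_pos N_pos mun_pos[of i] by (simp add: pre_theta_def field_simps)
  then have "\<bar>E i t - rho i * t\<bar> = c / N * (pre_theta i * \<bar>?v\<bar>)"
    using c_pos N_pos pre_theta_pos[of i] by (simp add: abs_minus_commute[of "E i t"] abs_mult)
  also have "\<dots> \<le> \<kappa> * (2 * (1 / mu i) * (queue_bound R + drift_bound * T + 2 * R))"
  proof (intro mult_mono)
    show "c / N \<le> \<kappa>" using params by (simp add: params_close_def)
    show "pre_theta i \<le> 2 * (1 / mu i)" by (rule pre_theta_le)
    show "\<bar>?v\<bar> \<le> queue_bound R + drift_bound * T + 2 * R"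
      using q_le[OF t, of i] q_nonneg[OF t, of i] input_le[OF t, of i] by linarith
  qed (use \<kappa> mu_pos[of i] pre_theta_pos[of i] in \<open>auto simp: less_imp_le\<close>)
  also have "\<dots> \<le> \<kappa> * time_bound R"
  proof -
    have "1 / mu i \<le> theta_total" unfolding theta_total_def using mu_pos by (intro member_le_sum) (auto simp: less_imp_le)
    moreover have "0 \<le> queue_bound R + drift_bound * T + 2 * R"
      using queue_bound_nonneg[OF R_nonneg] drift_bound_ge T_pos R_nonneg by simp
    ultimately show ?thesis unfolding time_bound_def using \<kappa> by (intro mult_left_mono mult_right_mono) auto
  qed
  finally show ?thesis .
qed

end

text \<open>Arrivals and services follow \<open>\<psi>\<close> up to \<open>\<delta>\<close>. The time \<open>h\<close> is so short that the path
  \<open>\<psi>\<close> and the drift change by at most \<open>\<delta>\<close> during \<open>h\<close>, and \<open>\<kappa>\<close> is small in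
  comparison with \<open>h\<close> and \<open>\<delta>\<close>.\<close>
locale tracking_queue_path = bounded_queue_path C C' mu u1 T rho y N c lamn mun a s E q R \<kappa>
  for C C' :: "'d::{finite,linorder} \<Rightarrow> real \<Rightarrow> real" and mu :: "'d \<Rightarrow> real" and u1 T :: real
    and rho :: "'d \<Rightarrow> real" and y :: "(real, 'd) vec" and N c lamn mun a s E q R \<kappa> +
  fixes \<psi> :: "real \<Rightarrow> (real, 'd) vec \<times> (real, 'd) vec" and \<delta> h :: real
  assumes \<delta>: "0 < \<delta>" and h: "0 < h" and \<psi>_cont: "continuous_on {0..T} \<psi>"
    and a_close: "\<And>t i. 0 \<le> t \<Longrightarrow> t \<le> T \<Longrightarrow> \<bar>a t $ i - fst (\<psi> t) $ i\<bar> \<le> \<delta>"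
    and s_close: "\<And>t i. 0 \<le> t \<Longrightarrow> t \<le> T \<Longrightarrow> \<bar>s t $ i - snd (\<psi> t) $ i\<bar> \<le> \<delta>"
    and \<psi>_modulus: "\<And>t r i. 0 \<le> t \<Longrightarrow> t \<le> T \<Longrightarrow> 0 \<le> r \<Longrightarrow> r \<le> T \<Longrightarrow> \<bar>t - r\<bar> \<le> h \<Longrightarrow>
        \<bar>fst (\<psi> t) $ i - fst (\<psi> r) $ i\<bar> \<le> \<delta> \<and> \<bar>snd (\<psi> t) $ i - snd (\<psi> r) $ i\<bar> \<le> \<delta>"
    and h_drift: "drift_bound * h \<le> \<delta>"
    and \<kappa>_time: "\<kappa> * time_bound R \<le> h"
    and \<kappa>_input: "\<kappa> * (real CARD('d) * (drift_bound * T + 2 * R) + theta_total * T) \<le> theta_total * \<delta>"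
    and \<kappa>_queue: "\<kappa> * (real CARD('d) * queue_bound R) \<le> theta_total * \<delta>"
    and \<kappa>_wait: "\<kappa> * (queue_bound R + 4 * R + \<delta>) \<le> h"
begin

lemma service_close:
  assumes t: "0 \<le> t" "t \<le> T"
  shows "\<bar>s (E i t) $ i - snd (\<psi> (rho i * t)) $ i\<bar> \<le> 2 * \<delta>"
proof -
  have e: "0 \<le> E i t" "E i t \<le> T" using E_range[OF t, of i] t by auto
  have "\<bar>E i t - rho i * t\<bar> \<le> h" using E_close[OF t, of i] \<kappa>_time by linarith
  then have "\<bar>snd (\<psi> (E i t)) $ i - snd (\<psi> (rho i * t)) $ i\<bar> \<le> \<delta>"
    using \<psi>_modulus[OF e, of "rho i * t" i] rho_time[OF t, of i] rho_time_T[OF t, of i] by auto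
  then show ?thesis using s_close[OF e, of i] by linarith
qed

lemma netput_eq: "netput \<psi> t = (\<Sum>i\<in>UNIV. (1 / mu i) * (y $ i * t + fst (\<psi> t) $ i - snd (\<psi> (rho i * t)) $ i))"
  by (simp add: netput_def workload_def free_path_def time_scale_def mult.commute)

lemma pre_netput_close:
  assumes t: "0 \<le> t" "t \<le> T"
  shows "\<bar>pre_netput t - netput \<psi> t\<bar> \<le> 4 * theta_total * \<delta>"
proof -
  define v where "v i = pre_drift i * t + a t $ i - s (E i t) $ i" for i
  define v' where "v' i = y $ i * t + fst (\<psi> t) $ i - snd (\<psi> (rho i * t)) $ i" for i
  have vv: "\<bar>v i - v' i\<bar> \<le> \<kappa> * T + 3 * \<delta>" for i
  proof -
    have "\<bar>(pre_drift i - y $ i) * t\<bar> \<le> \<kappa> * T" unfolding abs_mult using pre_drift_close[of i] t \<kappa> by (intro mult_mono) auto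
    then have "\<bar>pre_drift i * t - y $ i * t\<bar> \<le> \<kappa> * T" by (simp add: left_diff_distrib)
    then show ?thesis using a_close[OF t, of i] service_close[OF t, of i] unfolding v_def v'_def by linarith
  qed
  have "\<bar>pre_theta i * v i - 1 / mu i * v' i\<bar> \<le> \<kappa> * (drift_bound * T + 2 * R) + 1 / mu i * (\<kappa> * T + 3 * \<delta>)" for i
  proof -
    have "pre_theta i * v i - 1 / mu i * v' i = (pre_theta i - 1 / mu i) * v i + 1 / mu i * (v i - v' i)"
      by (simp add: algebra_simps)
    also have "\<bar>\<dots>\<bar> \<le> \<bar>pre_theta i - 1 / mu i\<bar> * \<bar>v i\<bar> + 1 / mu i * \<bar>v i - v' i\<bar>"
      using mu_pos[of i] abs_triangle_ineq[of "(pre_theta i - 1 / mu i) * v i" "1 / mu i * (v i - v' i)"] by (simp add: abs_mult)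
    also have "\<dots> \<le> \<kappa> * (drift_bound * T + 2 * R) + 1 / mu i * (\<kappa> * T + 3 * \<delta>)"
      using pre_theta_close[of i] input_le[OF t, of i] vv[of i] mu_pos[of i] \<kappa> unfolding v_def[symmetric]
      by (intro add_mono mult_mono) auto
    finally show ?thesis .
  qed
  then have "(\<Sum>i\<in>UNIV. \<bar>pre_theta i * v i - 1 / mu i * v' i\<bar>) \<le> (\<Sum>i\<in>UNIV. \<kappa> * (drift_bound * T + 2 * R) + 1 / mu i * (\<kappa> * T + 3 * \<delta>))"
    by (intro sum_mono)
  also have "\<dots> = \<kappa> * (real CARD('d) * (drift_bound * T + 2 * R) + theta_total * T) + 3 * theta_total * \<delta>"
  proof -
    have "(\<Sum>i\<in>UNIV. 1 / mu i * (\<kappa> * T + 3 * \<delta>)) = theta_total * (\<kappa> * T + 3 * \<delta>)"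
      unfolding theta_total_def by (simp only: sum_distrib_right)
    then show ?thesis by (simp add: sum.distrib algebra_simps)
  qed
  also have "\<dots> \<le> 4 * theta_total * \<delta>" using \<kappa>_input by linarith
  finally have le: "(\<Sum>i\<in>UNIV. \<bar>pre_theta i * v i - 1 / mu i * v' i\<bar>) \<le> 4 * theta_total * \<delta>" .
  have "pre_netput t - netput \<psi> t = (\<Sum>i\<in>UNIV. pre_theta i * v i - 1 / mu i * v' i)"
    by (simp add: pre_netput_def netput_eq v_def v'_def sum_subtractf)
  then show ?thesis using order_trans[OF sum_abs le] by (simp only:)
qed

text \<open>The netput is close to the netput of \<open>\<psi>\<close>, reflection at most doubles the distance, and
  replacing the scaled rates by their limits in the workload costs another multiple of
  \<open>\<delta>\<close>.\<close>
lemma workload_close: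
  assumes t: "0 \<le> t" "t \<le> T"
  shows "\<bar>workload (q t) - reflected (netput \<psi>) t\<bar> \<le> 9 * theta_total * \<delta>"
proof -
  obtain R' where R': "\<And>r. 0 \<le> r \<Longrightarrow> r \<le> T \<Longrightarrow> \<bar>netput \<psi> r\<bar> \<le> R'" using netput_bounded[OF \<psi>_cont] by blast
  let ?X = "2 * theta_total * (drift_bound * T + 2 * R)"
  have "\<bar>reflected pre_netput t - reflected (netput \<psi>) t\<bar> \<le> 2 * (4 * theta_total * \<delta>)"
  proof (rule reflected_Lipschitz[where R="max ?X R'"])
    fix r assume r: "0 \<le> r" "r \<le> t"
    show "\<bar>pre_netput r\<bar> \<le> max ?X R'" using pre_netput_le[of r] r t by (simp add: le_max_iff_disj)
    show "\<bar>netput \<psi> r\<bar> \<le> max ?X R'" using R'[of r] r t by (simp add: le_max_iff_disj)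
    show "\<bar>pre_netput r - netput \<psi> r\<bar> \<le> 4 * theta_total * \<delta>" using pre_netput_close r t by simp
  qed (use t in auto)
  moreover have "pre_workload t = reflected pre_netput t" by (rule pre_workload_eq_reflected[OF pre_netput_le t])
  moreover have "\<bar>workload (q t) - pre_workload t\<bar> \<le> theta_total * \<delta>"
  proof -
    have "workload (q t) - pre_workload t = (\<Sum>i\<in>UNIV. (1 / mu i - pre_theta i) * q t $ i)"
      by (simp add: workload_def pre_workload_def sum_subtractf left_diff_distrib)
    also have "\<bar>\<dots>\<bar> \<le> (\<Sum>i\<in>UNIV. \<bar>(1 / mu i - pre_theta i) * q t $ i\<bar>)" by (rule sum_abs)
    also have "\<dots> \<le> (\<Sum>i\<in>(UNIV::'d set). \<kappa> * queue_bound R)"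
      unfolding abs_mult using pre_theta_close q_le[OF t] q_nonneg[OF t] \<kappa>
      by (intro sum_mono mult_mono) (auto simp: abs_minus_commute)
    also have "\<dots> \<le> theta_total * \<delta>" using \<kappa>_queue by (simp add: mult.left_commute)
    finally show ?thesis .
  qed
  ultimately show ?thesis by linarith
qed

lemma reflected_netput_increment:
  assumes r: "0 \<le> r" "r \<le> t" "t \<le> T" "t - r \<le> h"
  shows "\<bar>reflected (netput \<psi>) t - reflected (netput \<psi>) r\<bar> \<le> 6 * theta_total * \<delta>"
proof -
  obtain R' where R': "\<And>r. 0 \<le> r \<Longrightarrow> r \<le> T \<Longrightarrow> \<bar>netput \<psi> r\<bar> \<le> R'" using netput_bounded[OF \<psi>_cont] by blast
  have "\<bar>reflected (netput \<psi>) t - reflected (netput \<psi>) r\<bar> \<le> 2 * (theta_total * (3 * \<delta>))"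
  proof (rule reflected_increment[where R=R'])
    fix u assume u: "r \<le> u" "u \<le> t"
    have "\<bar>(free_path \<psi> u - free_path \<psi> r) $ i\<bar> \<le> 3 * \<delta>" for i
    proof -
      have "\<bar>y $ i * (u - r)\<bar> \<le> drift_bound * h"
        unfolding abs_mult using drift_bound_ge(2)[of i] u r by (intro mult_mono) auto
      then have 1: "\<bar>y $ i * (u - r)\<bar> \<le> \<delta>" using h_drift by simp
      have 2: "\<bar>fst (\<psi> u) $ i - fst (\<psi> r) $ i\<bar> \<le> \<delta>" using \<psi>_modulus[of u r i] u r by auto
      have "rho i * u - rho i * r = rho i * (u - r)" by (simp add: right_diff_distrib)
      moreover have "0 \<le> rho i * (u - r)" "rho i * (u - r) \<le> u - r"
        using u rho_pos[of i] rho_le_1[of i] by (auto simp: mult_left_le_one_le)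
      ultimately have "\<bar>rho i * u - rho i * r\<bar> \<le> h" using u r by linarith
      then have 3: "\<bar>snd (\<psi> (rho i * u)) $ i - snd (\<psi> (rho i * r)) $ i\<bar> \<le> \<delta>"
        using \<psi>_modulus[of "rho i * u" "rho i * r" i] rho_time[of u i] rho_time[of r i] u r by auto
      show ?thesis using 1 2 3 by (simp add: free_path_def time_scale_def algebra_simps)
    qed
    then show "\<bar>netput \<psi> u - netput \<psi> r\<bar> \<le> theta_total * (3 * \<delta>)"
      unfolding netput_def workload_diff[symmetric] by (rule workload_abs_le)
  qed (use R' r in auto)
  then show ?thesis by simp
qed

text \<open>Suppose that class \<open>j\<close> is far below its equilibrium share at time \<open>t\<close>, and consider the last time
  \<open>z\<close> at which it was less far below. Since then it has been below its share and has received no service.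
  Arrivals come at a rate that is huge in the scaled time, and the queue is bounded, so only a time
  shorter than \<open>h\<close> has passed. During such a time neither the equilibrium nor the deviations
  change by more than a multiple of \<open>\<delta>\<close>, so the distance to the equilibrium cannot have grown as
  assumed.\<close>
lemma state_space_collapse:
  assumes t: "0 \<le> t" "t \<le> T"
  shows "equilibrium (workload (q t)) $ j - 2 * collapse_rate * \<delta> \<le> q t $ j"
proof (rule ccontr)
  define \<eta> where "\<eta> = 2 * collapse_rate * \<delta>"
  define e where "e u = equilibrium (workload (q u)) $ j" for u
  assume "\<not> equilibrium (workload (q t)) $ j - 2 * collapse_rate * \<delta> \<le> q t $ j"
  then have neg: "q t $ j < e t - \<eta>" by (simp add: e_def \<eta>_def)
  note cr = collapse_rate_pos
  then have \<eta>: "0 < \<eta>" using \<delta> by (simp add: \<eta>_def)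
  have wq: "0 \<le> workload (q u)" if "0 \<le> u" "u \<le> T" for u using q_nonneg[OF that] by (rule workload_nonneg)
  define Z where "Z = {u\<in>{0..t}. e u - \<eta> / 2 \<le> q u $ j}"
  have "workload (q 0) = 0" using q_0 by (simp add: workload_def)
  then have "e 0 = 0" by (simp add: e_def equilibrium_0)
  then have Z0: "0 \<in> Z" using t \<eta> q_0 by (simp add: Z_def)
  have bdd: "bdd_above Z" by (rule bdd_aboveI[of _ t]) (auto simp: Z_def)
  define z where "z = Sup Z"
  have z: "0 \<le> z" "z \<le> t" unfolding z_def using Z0 bdd by (auto intro!: cSup_upper cSup_least simp: Z_def)
  (* the time of service after r \<in> Z is at most \<epsilon>, and completes services of scaled size at most \<delta> *)
  define \<epsilon> where "\<epsilon> = min h (c * \<delta> / mun j)"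
  have \<epsilon>: "0 < \<epsilon>" "\<epsilon> \<le> h" "mun j * \<epsilon> / c \<le> \<delta>"
  proof -
    show "0 < \<epsilon>" "\<epsilon> \<le> h" using h c_pos \<delta> mun_pos[of j] by (auto simp: \<epsilon>_def)
    have "mun j * \<epsilon> / c \<le> mun j * (c * \<delta> / mun j) / c"
      using c_pos mun_pos[of j] by (intro divide_right_mono mult_left_mono) (auto simp: \<epsilon>_def)
    then show "mun j * \<epsilon> / c \<le> \<delta>" using c_pos mun_pos[of j] by simp
  qed
  obtain r where rZ: "r \<in> Z" and rz: "z - \<epsilon> < r"
    using less_cSupD[of Z "z - \<epsilon>"] Z0 \<epsilon>(1) unfolding z_def by auto
  have r: "0 \<le> r" "r \<le> z" "e r - \<eta> / 2 \<le> q r $ j"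
    using rZ cSup_upper[OF rZ bdd] by (auto simp: Z_def z_def)
  have "E j t = E j z"
  proof (rule priority[OF z(1,2) t(2)])
    fix u assume u: "z < u" "u \<le> t"
    have "u \<notin> Z" using cSup_upper[OF _ bdd, of u] u unfolding z_def by auto
    then have "q u $ j < e u - \<eta> / 2" using u z by (auto simp: Z_def)
    then show "q u $ j < equilibrium (workload (q u)) $ j" using \<eta> by (simp add: e_def)
  qed
  moreover have "E j z - E j r \<le> z - r" using E_Lipschitz[of r z j] r z t by simp
  ultimately have Ed: "E j t - E j r \<le> \<epsilon>" "0 \<le> E j t - E j r" using rz E_mono[of r t j] r z t by auto
  have rT: "r \<le> T" "r \<le> t" using r z t by auto
  have incr: "q t $ j - q r $ j = (a t $ j - a r $ j) - (s (E j t) $ j - s (E j r) $ j) + lamn j * (t - r) / c - mun j * (E j t - E j r) / c"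
    unfolding q_eq[OF t] q_eq[OF r(1) rT(1)] by (simp add: diff_divide_distrib algebra_simps)
  have m: "mun j * (E j t - E j r) / c \<le> \<delta>"
  proof -
    have "mun j * (E j t - E j r) / c \<le> mun j * \<epsilon> / c"
      using Ed mun_pos[of j] c_pos by (intro divide_right_mono mult_left_mono) auto
    then show ?thesis using \<epsilon>(3) by simp
  qed
  have Et: "0 \<le> E j t" "E j t \<le> T" "0 \<le> E j r" "E j r \<le> T" using E_range[OF t, of j] E_range[OF r(1) rT(1), of j] t rT by auto
  have "lamn j * (t - r) / c \<le> queue_bound R + 4 * R + \<delta>"
    using incr m q_le[OF t, of j] q_nonneg[OF r(1) rT(1), of j] a_le[OF t, of j] a_le[OF r(1) rT(1), of j]
      s_le[OF Et(1,2), of j] s_le[OF Et(3,4), of j] by linarith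
  then have "c / lamn j * (lamn j * (t - r) / c) \<le> c / lamn j * (queue_bound R + 4 * R + \<delta>)"
    using c_pos lamn_pos[of j] by (intro mult_left_mono) auto
  then have "t - r \<le> c / lamn j * (queue_bound R + 4 * R + \<delta>)" using c_pos lamn_pos[of j] by simp
  also have "\<dots> \<le> \<kappa> * (queue_bound R + 4 * R + \<delta>)"
    using params queue_bound_nonneg[OF R_nonneg] R_nonneg \<delta> by (intro mult_right_mono) (auto simp: params_close_def)
  finally have tr: "t - r \<le> h" using \<kappa>_wait by simp
  have "0 \<le> lamn j * (t - r) / c" using lamn_pos[of j] c_pos rT by simp
  moreover have "\<bar>a t $ j - a r $ j\<bar> \<le> 3 * \<delta>"
    using a_close[OF t, of j] a_close[OF r(1) rT(1), of j] \<psi>_modulus[OF t r(1) rT(1), of j] tr rT by auto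
  moreover have "\<bar>s (E j t) $ j - s (E j r) $ j\<bar> \<le> 3 * \<delta>"
    using s_close[OF Et(1,2), of j] s_close[OF Et(3,4), of j] \<psi>_modulus[OF Et, of j] Ed \<epsilon>(2) by auto
  ultimately have "q r $ j - 7 * \<delta> \<le> q t $ j" using incr m by linarith
  then have gap: "\<eta> / 2 < e t - e r + 7 * \<delta>" using r(3) neg by linarith
  have "\<bar>workload (q t) - workload (q r)\<bar> \<le> 24 * theta_total * \<delta>"
    using workload_close[OF t] workload_close[OF r(1) rT(1)] reflected_netput_increment[OF r(1) rT(2) t(2) tr] by linarith
  have "\<bar>e t - e r\<bar> \<le> mu j * \<bar>workload (q t) - workload (q r)\<bar>"
    unfolding e_def by (intro equilibrium_Lipschitz wq t r rT)
  also have "\<dots> \<le> mu_total * (24 * theta_total * \<delta>)"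
  proof (intro mult_mono)
    show "mu j \<le> mu_total" unfolding mu_total_def using mu_pos by (intro member_le_sum) (auto simp: less_imp_le)
  qed (use \<open>\<bar>workload (q t) - workload (q r)\<bar> \<le> 24 * theta_total * \<delta>\<close> mu_total_pos in auto)
  finally have "e t - e r + 7 * \<delta> \<le> collapse_rate * \<delta>" by (simp add: collapse_rate_def algebra_simps)
  then show False using gap by (simp add: \<eta>_def)
qed

text \<open>The cost of the queue is close to the cost of the equilibrium with the same workload, by
  the collapse, and that workload is close to the reflected netput of \<open>\<psi>\<close>.\<close>
lemma total_cost_close:
  assumes t: "0 \<le> t" "t \<le> T"
  shows "\<bar>total_cost C (q t) - min_cost (reflected (netput \<psi>) t)\<bar> \<le>
    u1 * mu_total * theta_total * (9 + 2 * collapse_rate) * \<delta>"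
proof -
  let ?w = "workload (q t)" and ?g = "reflected (netput \<psi>) t"
  have w: "0 \<le> ?w" using q_nonneg[OF t] by (rule workload_nonneg)
  have g: "0 \<le> ?g" by (rule reflected_netput_nonneg[OF \<psi>_cont t])
  note cr = collapse_rate_pos
  have "\<bar>min_cost ?w - min_cost ?g\<bar> \<le> u1 * mu_total * \<bar>?w - ?g\<bar>" by (rule min_cost_Lipschitz[OF g w])
  also have "\<dots> \<le> u1 * mu_total * (9 * theta_total * \<delta>)"
    using workload_close[OF t] u1_nonneg mu_total_pos by (intro mult_left_mono) auto
  finally have 1: "\<bar>min_cost ?w - min_cost ?g\<bar> \<le> u1 * mu_total * (9 * theta_total * \<delta>)" .
  have 2: "min_cost ?w \<le> total_cost C (q t)" by (rule min_cost_le) (rule q_nonneg[OF t])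
  have 3: "total_cost C (q t) \<le> min_cost ?w + u1 * mu_total * theta_total * (2 * collapse_rate * \<delta>)"
    by (rule total_cost_near_equilibrium) (use q_nonneg[OF t] state_space_collapse[OF t] cr \<delta> in auto)
  have 4: "0 \<le> u1 * mu_total * theta_total * (2 * collapse_rate * \<delta>)"
    using u1_nonneg mu_total_pos theta_total_pos cr \<delta> by simp
  have "u1 * mu_total * theta_total * (9 + 2 * collapse_rate) * \<delta> =
    u1 * mu_total * (9 * theta_total * \<delta>) + u1 * mu_total * theta_total * (2 * collapse_rate * \<delta>)"
    by (simp add: algebra_simps)
  then show ?thesis using 1 2 3 4 by linarith
qed

end

section \<open>Sample paths of the generalized c-mu rule\<close>

text \<open>A right-continuous function is the pointwise limit of its values at grid points strictly
  to the right, which are step functions of time, and it is bounded.\<close>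
lemma rcll_on_integrable:
  fixes f :: "real \<Rightarrow> real"
  assumes f: "rcll_on T f"
  shows "f integrable_on {0..T}"
proof -
  define g where "g k t = (real_of_int \<lfloor>real (Suc k) * t\<rfloor> + 1) / real (Suc k)" for k t
  have g: "t < g k t" "g k t \<le> t + inverse (real (Suc k))" for k t
  proof -
    have "real (Suc k) * t < real_of_int \<lfloor>real (Suc k) * t\<rfloor> + 1" "real_of_int \<lfloor>real (Suc k) * t\<rfloor> \<le> real (Suc k) * t" by linarith+
    then show "t < g k t" "g k t \<le> t + inverse (real (Suc k))" by (simp_all add: g_def field_simps del: of_nat_Suc)
  qed
  define F where "F t = (if 0 \<le> t \<and> t < T then f t else 0)" for t
  define Fk where "Fk k t = (if 0 \<le> t \<and> t < T then f (min T (g k t)) else 0)" for k t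
  have meas_Fk: "Fk k \<in> borel_measurable borel" for k
  proof -
    have "(\<lambda>t. \<lfloor>real (Suc k) * t\<rfloor>) \<in> measurable borel (count_space UNIV)" by measurable
    from measurable_compose[OF this, of "\<lambda>j. f (min T ((real_of_int j + 1) / real (Suc k)))" borel]
    have "(\<lambda>t. f (min T (g k t))) \<in> borel_measurable borel" unfolding g_def by simp
    then show ?thesis unfolding Fk_def by measurable
  qed
  have "(\<lambda>k. Fk k t) \<longlonglongrightarrow> F t" for t
  proof (cases "0 \<le> t \<and> t < T")
    case True
    have lim: "(\<lambda>k. min T (g k t)) \<longlonglongrightarrow> t"
    proof (rule tendsto_sandwich)
      show "\<forall>\<^sub>F k in sequentially. t \<le> min T (g k t)" using g(1)[of t] True by (simp add: less_imp_le)
      show "\<forall>\<^sub>F k in sequentially. min T (g k t) \<le> t + inverse (real (Suc k))" using g(2)[where t=t] by (auto intro!: always_eventually min.coboundedI2)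
      show "(\<lambda>k. t + inverse (real (Suc k))) \<longlonglongrightarrow> t"
        using tendsto_add[OF tendsto_const LIMSEQ_inverse_real_of_nat, of t] by simp
      show "(\<lambda>k::nat. t) \<longlonglongrightarrow> t" by simp
    qed
    have gt: "min T (g k t) \<in> {t<..} \<and> min T (g k t) \<noteq> t" for k using g(1)[of t k] True by (auto simp: min_def)
    have "filterlim (\<lambda>k. min T (g k t)) (at_right t) sequentially"
      unfolding filterlim_at by (intro conjI always_eventually allI lim conjunct1[OF gt] conjunct2[OF gt])
    moreover have "(f \<longlongrightarrow> f t) (at_right t)" using f True by (auto simp: rcll_on_def)
    ultimately show ?thesis unfolding F_def Fk_def using True filterlim_compose by fastforce
  next
    case False
    then have "F t = 0" "\<And>k. Fk k t = 0" by (auto simp: F_def Fk_def)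
    then show ?thesis by simp
  qed
  then have meas: "F \<in> borel_measurable borel" by (rule borel_measurable_LIMSEQ_real[OF _ meas_Fk])
  obtain B where B: "\<And>t. t \<in> {0..T} \<Longrightarrow> \<bar>f t\<bar> \<le> B" using rcll_on_bounded[OF f] unfolding bounded_iff by fastforce
  have "F integrable_on {0..T}"
  proof (rule measurable_bounded_by_integrable_imp_integrable)
    show "F \<in> borel_measurable (lebesgue_on {0..T})"
      using meas by (intro measurable_restrict_space1 measurable_completion) auto
    show "(\<lambda>t. \<bar>B\<bar>) integrable_on {0..T}" by (rule integrable_const_ivl)
    show "norm (F t) \<le> \<bar>B\<bar>" if "t \<in> {0..T}" for t using B[OF that] by (auto simp: F_def)
  qed auto
  then show ?thesis
    by (rule integrable_spike[of _ _ "{T}"]) (auto simp: F_def)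
qed

lemma rcll_on_component:
  assumes "rcll_on T f"
  shows "rcll_on T (\<lambda>t. f t $ i)"
  unfolding rcll_on_def
proof (intro conjI ballI)
  show "((\<lambda>t. f t $ i) \<longlongrightarrow> f t $ i) (at_right t)" if "t \<in> {0..<T}" for t
    using assms that by (intro tendsto_vec_nth) (auto simp: rcll_on_def)
  show "\<exists>l. ((\<lambda>t. f t $ i) \<longlongrightarrow> l) (at_left t)" if t: "t \<in> {0<..T}" for t
  proof -
    obtain l where "(f \<longlongrightarrow> l) (at_left t)" using assms t unfolding rcll_on_def by blast
    then show ?thesis by (intro exI[of _ "l $ i"] tendsto_vec_nth)
  qed
qed

text \<open>The queueing processes as functionals of a single sample path.\<close>
definition path_effort :: "(real \<Rightarrow> real^'d::finite) \<Rightarrow> 'd \<Rightarrow> real \<Rightarrow> real" where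
  "path_effort Bp i t = integral {0..t} (\<lambda>s. Bp s $ i)"

definition path_queue ::
  "('d::finite \<Rightarrow> nat \<Rightarrow> real) \<Rightarrow> ('d \<Rightarrow> nat \<Rightarrow> real) \<Rightarrow> ('d \<Rightarrow> real) \<Rightarrow> ('d \<Rightarrow> real) \<Rightarrow> (real \<Rightarrow> real^'d) \<Rightarrow> 'd \<Rightarrow> real \<Rightarrow> real" where
  "path_queue XA XS lamn mun Bp i t =
     real (renewal_count (XA i) (lamn i) t) - real (renewal_count (XS i) (mun i) (path_effort Bp i t))"

definition path_deviation :: "real \<Rightarrow> ('d::finite \<Rightarrow> real) \<Rightarrow> ('d \<Rightarrow> nat \<Rightarrow> real) \<Rightarrow> real \<Rightarrow> real^'d" where
  "path_deviation c r X t = (\<chi> i. (real (renewal_count (X i) (r i) t) - r i * t) / c)"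

lemma path_deviation_rcll:
  assumes X: "\<And>i. renewal_path (X i) (r i)"
  shows "0 \<le> t \<Longrightarrow> (path_deviation c r X \<longlongrightarrow> path_deviation c r X t) (at_right t)"
    and "0 < t \<Longrightarrow> \<exists>l. (path_deviation c r X \<longlongrightarrow> l) (at_left t)"
proof -
  assume t: "0 \<le> t"
  have "((\<lambda>s. (real (renewal_count (X i) (r i) s) - r i * s) / c) \<longlongrightarrow> (real (renewal_count (X i) (r i) t) - r i * t) / c) (at_right t)" for i
  proof -
    interpret renewal_path "X i" "r i" by (rule X)
    have "((\<lambda>s. (real (renewal_count (X i) (r i) t) - r i * s) * inverse c) \<longlongrightarrow> (real (renewal_count (X i) (r i) t) - r i * t) * inverse c) (at_right t)"
      by (intro tendsto_intros)
    moreover have "\<forall>\<^sub>F s in at_right t. (real (renewal_count (X i) (r i) t) - r i * s) * inverse c =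
        (real (renewal_count (X i) (r i) s) - r i * s) * inverse c"
      using eventually_at_right_renewal_count[OF t] by eventually_elim simp
    ultimately show ?thesis unfolding divide_inverse by (rule Lim_transform_eventually)
  qed
  then show "(path_deviation c r X \<longlongrightarrow> path_deviation c r X t) (at_right t)"
    unfolding path_deviation_def[abs_def] by (intro tendsto_vec_lambda)
next
  assume t: "0 < t"
  have "\<exists>l. ((\<lambda>s. (real (renewal_count (X i) (r i) s) - r i * s) / c) \<longlongrightarrow> l) (at_left t)" for i
  proof -
    interpret renewal_path "X i" "r i" by (rule X)
    obtain l v where lv: "0 \<le> v" "v < t" "\<And>s. v \<le> s \<Longrightarrow> s < t \<Longrightarrow> renewal_count (X i) (r i) s = l"
      by (rule left_limit_renewal_count[OF t]) (rule that; assumption)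
    have "((\<lambda>s. (real l - r i * s) * inverse c) \<longlongrightarrow> (real l - r i * t) * inverse c) (at_left t)"
      by (intro tendsto_intros)
    moreover have "\<forall>\<^sub>F s in at_left t. (real l - r i * s) * inverse c = (real (renewal_count (X i) (r i) s) - r i * s) / c"
      unfolding eventually_at_left_field using lv by (intro exI[of _ v]) (auto simp: divide_inverse)
    ultimately show ?thesis by (blast intro: Lim_transform_eventually)
  qed
  then obtain l where "\<And>i. ((\<lambda>s. (real (renewal_count (X i) (r i) s) - r i * s) / c) \<longlongrightarrow> l i) (at_left t)" by metis
  then have "(path_deviation c r X \<longlongrightarrow> (\<chi> i. l i)) (at_left t)"
    unfolding path_deviation_def[abs_def] by (intro tendsto_vec_lambda)
  then show "\<exists>l. (path_deviation c r X \<longlongrightarrow> l) (at_left t)" by blast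
qed

lemma path_deviation_in_skorokhod_space:
  assumes X: "\<And>i. renewal_path (X i) (r i)" and Z: "\<And>i. renewal_path (Z i) (r' i)"
  shows "restrict (\<lambda>t. (path_deviation c r X t, path_deviation c r' Z t)) {0..T} \<in> skorokhod_space T"
proof -
  let ?f = "\<lambda>t. (path_deviation c r X t, path_deviation c r' Z t)"
  have "rcll_on T (restrict ?f {0..T})"
    unfolding rcll_on_def
  proof (intro conjI ballI)
    fix t assume t: "t \<in> {0..<T}"
    have "(?f \<longlongrightarrow> ?f t) (at_right t)" using t by (intro tendsto_Pair path_deviation_rcll X Z) auto
    moreover have "\<forall>\<^sub>F s in at_right t. ?f s = restrict ?f {0..T} s"
      unfolding eventually_at_right_field using t by (intro exI[of _ T]) auto
    ultimately have "(restrict ?f {0..T} \<longlongrightarrow> ?f t) (at_right t)" by (rule Lim_transform_eventually)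
    then show "(restrict ?f {0..T} \<longlongrightarrow> restrict ?f {0..T} t) (at_right t)" using t by simp
  next
    fix t assume t: "t \<in> {0<..T}"
    obtain l1 l2 where "(path_deviation c r X \<longlongrightarrow> l1) (at_left t)" "(path_deviation c r' Z \<longlongrightarrow> l2) (at_left t)"
      using path_deviation_rcll(2)[of X r t c, OF X] path_deviation_rcll(2)[of Z r' t c, OF Z] t by auto
    then have "(?f \<longlongrightarrow> (l1, l2)) (at_left t)" by (intro tendsto_Pair)
    moreover have "\<forall>\<^sub>F s in at_left t. ?f s = restrict ?f {0..T} s"
      unfolding eventually_at_left_field using t by (intro exI[of _ 0]) auto
    ultimately show "\<exists>l. (restrict ?f {0..T} \<longlongrightarrow> l) (at_left t)" by (blast intro: Lim_transform_eventually)
  qed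
  then show ?thesis by (simp add: skorokhod_space_def)
qed

locale priority_path = workload_game C C' mu u1 T rho y
  for C C' :: "'d::{finite,linorder} \<Rightarrow> real \<Rightarrow> real" and mu :: "'d \<Rightarrow> real" and u1 T :: real
    and rho :: "'d \<Rightarrow> real" and y :: "(real, 'd) vec" +
  fixes XA XS :: "'d \<Rightarrow> nat \<Rightarrow> real" and N c :: real and lamn mun :: "'d \<Rightarrow> real" and Bp :: "real \<Rightarrow> (real, 'd) vec"
  assumes rho_sum: "(\<Sum>i\<in>UNIV. rho i) = 1" and N_pos: "0 < N" and c_pos: "0 < c"
    and arrivals: "\<And>i. renewal_path (XA i) (lamn i)" and services: "\<And>i. renewal_path (XS i) (mun i)"
    and B_rcll: "rcll_on T Bp"
    and B_effort: "\<And>t. t \<in> {0..T} \<Longrightarrow> Bp t \<in> effort_set"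
    and B_idle: "\<And>t i. t \<in> {0..T} \<Longrightarrow> path_queue XA XS lamn mun Bp i t = 0 \<Longrightarrow> Bp t $ i = 0"
    and B_cmu: "\<And>t i. t \<in> {0..T} \<Longrightarrow>
        Bp t $ i = indicator (priority_region mu C' i) (\<chi> i. path_queue XA XS lamn mun Bp i t / c)"
begin

abbreviation "E \<equiv> path_effort Bp"
abbreviation "Q \<equiv> path_queue XA XS lamn mun Bp"

definition q :: "real \<Rightarrow> (real, 'd) vec" where "q t = (\<chi> i. Q i t / c)"

lemma B_integrable: "0 \<le> r \<Longrightarrow> t \<le> T \<Longrightarrow> (\<lambda>s. Bp s $ i) integrable_on {r..t}"
  using rcll_on_integrable[OF rcll_on_component[OF B_rcll, of i]] by (rule integrable_subinterval_real) auto

lemma E_diff: "0 \<le> r \<Longrightarrow> r \<le> t \<Longrightarrow> t \<le> T \<Longrightarrow> E i t - E i r = integral {r..t} (\<lambda>s. Bp s $ i)"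
  using Henstock_Kurzweil_Integration.integral_combine[of 0 r t "\<lambda>s. Bp s $ i"] B_integrable[of 0 t i]
  by (simp add: path_effort_def)

lemma E_0: "E i 0 = 0"
  by (simp add: path_effort_def)

lemma B_nonneg: "t \<in> {0..T} \<Longrightarrow> 0 \<le> Bp t $ i"
  using B_effort by (auto simp: effort_set_def)

lemma E_mono: "0 \<le> r \<Longrightarrow> r \<le> t \<Longrightarrow> t \<le> T \<Longrightarrow> E i r \<le> E i t"
  using E_diff[of r t i] integral_nonneg[OF B_integrable[of r t i]] B_nonneg by fastforce

lemma sum_E_diff:
  assumes "0 \<le> r" "r \<le> t" "t \<le> T"
  shows "(\<Sum>i\<in>UNIV. E i t - E i r) = integral {r..t} (\<lambda>s. \<Sum>i\<in>UNIV. Bp s $ i)"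
  using assms by (simp add: E_diff integral_sum B_integrable)

lemma E_total:
  assumes "0 \<le> r" "r \<le> t" "t \<le> T"
  shows "(\<Sum>i\<in>UNIV. E i t - E i r) \<le> t - r"
proof -
  have "integral {r..t} (\<lambda>s. \<Sum>i\<in>UNIV. Bp s $ i) \<le> integral {r..t} (\<lambda>s. 1)"
    using assms B_effort by (intro integral_le integrable_sum B_integrable) (auto simp: effort_set_def)
  then show ?thesis using assms by (simp add: sum_E_diff)
qed

lemma E_total_eq:
  assumes rt: "0 \<le> r" "r \<le> t" "t \<le> T" and one: "\<And>u. r < u \<Longrightarrow> u \<le> t \<Longrightarrow> (\<Sum>i\<in>UNIV. Bp u $ i) = 1"
  shows "(\<Sum>i\<in>UNIV. E i t - E i r) = t - r"
proof -
  have "integral {r..t} (\<lambda>s. \<Sum>i\<in>UNIV. Bp s $ i) = integral {r..t} (\<lambda>s. 1)"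
    by (rule integral_spike[of "{r}"]) (use one in auto)
  then show ?thesis using rt by (simp add: sum_E_diff)
qed

lemma E_const:
  assumes rt: "0 \<le> r" "r \<le> t" "t \<le> T" and zero: "\<And>u. r < u \<Longrightarrow> u < t \<Longrightarrow> Bp u $ i = 0"
  shows "E i t = E i r"
proof -
  have "integral {r..t} (\<lambda>s. Bp s $ i) = integral {r..t} (\<lambda>s. 0)"
    by (rule integral_spike[of "{r, t}"]) (use zero in auto)
  then show ?thesis using E_diff[OF rt, of i] by simp
qed

lemma E_nonneg: "0 \<le> t \<Longrightarrow> t \<le> T \<Longrightarrow> 0 \<le> E i t"
  using E_mono[of 0 t i] E_0 by simp

lemma E_Lipschitz: "0 \<le> r \<Longrightarrow> r \<le> t \<Longrightarrow> t \<le> T \<Longrightarrow> E i t - E i r \<le> t - r"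
  using E_total[of r t] E_mono[of r t] member_le_sum[of i UNIV "\<lambda>i. E i t - E i r"] by auto

lemma unserved_if_nonpos:
  assumes "t \<in> {0..T}" "Q i t \<le> 0"
  shows "Bp t $ i = 0"
proof (cases "Q i t = 0")
  case False
  then have "(\<chi> i. Q i t / c) \<notin> priority_region mu C' i"
    using assms c_pos by (auto simp: priority_region_def divide_less_0_iff not_le intro!: exI[of _ i])
  then show ?thesis using B_cmu[OF assms(1), of i] by simp
qed (use B_idle assms in simp)

abbreviation "Ac i \<equiv> renewal_count (XA i) (lamn i)"
abbreviation "Sc i \<equiv> renewal_count (XS i) (mun i)"

lemma Q_eq: "Q i t = real (Ac i t) - real (Sc i (E i t))"
  by (simp add: path_queue_def)

lemma Ac_mono: "0 \<le> r \<Longrightarrow> r \<le> t \<Longrightarrow> Ac i r \<le> Ac i t"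
  by (rule renewal_path.renewal_count_mono[OF arrivals])

text \<open>A class without customers is not served, so its queue should never become negative. As
  time is continuous, this takes an argument at the last time \<open>z\<close> when the queue was nonnegative.
  No service happens after \<open>z\<close>, so the queue is negative at \<open>z\<close> already. Just before \<open>z\<close> at most one
  service is completed at a time, so a positive queue could not have become negative at \<open>z\<close>.
  Hence it was nonpositive, there was no service, and the queue could not decrease.\<close>
lemma Q_nonneg:
  assumes t: "0 \<le> t" "t \<le> T"
  shows "0 \<le> Q i t"
proof (rule ccontr)
  interpret S: renewal_path "XS i" "mun i" by (rule services)
  interpret A: renewal_path "XA i" "lamn i" by (rule arrivals)
  assume "\<not> 0 \<le> Q i t"
  then have neg: "Q i t < 0" by simp
  define Z where "Z = {u\<in>{0..t}. 0 \<le> Q i u}"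
  have Q0: "Q i 0 = 0" by (simp add: Q_eq E_0 A.renewal_count_0 S.renewal_count_0)
  then have Z0: "0 \<in> Z" using t by (simp add: Z_def)
  have bdd: "bdd_above Z" by (rule bdd_aboveI[of _ t]) (auto simp: Z_def)
  define z where "z = Sup Z"
  have z: "0 \<le> z" "z \<le> t" unfolding z_def using Z0 bdd by (auto intro!: cSup_upper cSup_least simp: Z_def)
  have after: "Q i u < 0" if "z < u" "u \<le> t" for u
    using cSup_upper[OF _ bdd, of u] that z unfolding z_def by (auto simp: Z_def not_le[symmetric])
  have "E i t = E i z"
    by (rule E_const[OF z t(2)]) (use after t z unserved_if_nonpos in \<open>auto simp: less_imp_le\<close>)
  then have Qz: "Q i z < 0" using neg Ac_mono[OF z, of i] by (simp add: Q_eq)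
  then have zpos: "0 < z" using Q0 z by (cases "z = 0") auto
  have zT: "z \<le> T" using z t by simp
  show False
  proof (cases "E i z = 0")
    case True
    then show False using Qz S.renewal_count_0 by (simp add: Q_eq)
  next
    case False
    then have Ez: "0 < E i z" using E_nonneg[of z i] z t by simp
    obtain l v where lv: "0 \<le> v" "v < E i z" "\<And>s. v \<le> s \<Longrightarrow> s < E i z \<Longrightarrow> Sc i s = l" "Sc i (E i z) \<le> l + 1"
      by (rule S.left_limit_renewal_count[OF Ez]) (rule that; assumption)
    (* the effort is 1-Lipschitz, so from r on it has already passed v *)
    define r where "r = max 0 (z - (E i z - v) / 2)"
    have r: "0 \<le> r" "r < z" "z - r < E i z - v" using lv zpos by (auto simp: r_def max_def field_simps)
    have vE: "v \<le> E i u" if "r \<le> u" "u \<le> z" for u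
      using E_Lipschitz[of u z i] that r z zT by linarith
    have nonpos: "Q i u \<le> 0" if u: "r \<le> u" "u < z" for u
    proof (rule ccontr)
      assume "\<not> Q i u \<le> 0"
      then have "1 \<le> real (Ac i u) - real (Sc i (E i u))" by (simp add: Q_eq)
      moreover have "Sc i (E i z) \<le> Sc i (E i u) + 1"
      proof (cases "E i u < E i z")
        case True
        then show ?thesis using lv(3)[of "E i u"] lv(4) vE[of u] u by simp
      next
        case False
        then have "E i u = E i z" using E_mono[of u z i] u r zT by simp
        then show ?thesis by simp
      qed
      moreover have "Ac i u \<le> Ac i z" using u r by (intro Ac_mono) auto
      ultimately have "0 \<le> Q i z" by (simp add: Q_eq)
      then show False using Qz by simp
    qed
    have E_rz: "E i z = E i u" if "r \<le> u" "u \<le> z" for u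
      by (rule E_const) (use that r zT nonpos unserved_if_nonpos in auto)
    obtain x where x: "x \<in> Z" "r < x" using less_cSupD[of Z r] Z0 r unfolding z_def by auto
    then have xz: "x \<le> z" "0 \<le> Q i x" using cSup_upper[OF x(1) bdd] by (auto simp: Z_def z_def)
    have "Q i x \<le> Q i z"
      using E_rz[of x] x xz r Ac_mono[of x z i] by (simp add: Q_eq)
    then show False using xz Qz by simp
  qed
qed

lemma q_nonneg: "0 \<le> t \<Longrightarrow> t \<le> T \<Longrightarrow> 0 \<le> q t $ i"
  using Q_nonneg[of t i] c_pos by (simp add: q_def)

lemma sum_B_eq_1:
  assumes t: "t \<in> {0..T}" and q: "q t \<noteq> 0"
  shows "(\<Sum>i\<in>UNIV. Bp t $ i) = 1"
proof -
  let ?m = "Min {k. mu k * C' k (q t $ k) = (MAX j. mu j * C' j (q t $ j))}"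
  have "Bp t $ i = (if i = ?m then 1 else 0)" for i
    using B_cmu[OF t, of i] q_nonneg t q unfolding q_def[symmetric] by (auto simp: priority_region_def indicator_def)
  then show ?thesis by simp
qed

sublocale queue_path C C' mu u1 T rho y N c lamn mun "path_deviation c lamn XA" "path_deviation c mun XS" E q
proof
  show "0 < lamn i" "0 < mun i" for i using renewal_path.r_pos[OF arrivals] renewal_path.r_pos[OF services] by auto
  show "q t $ i = path_deviation c lamn XA t $ i - path_deviation c mun XS (E i t) $ i + (lamn i * t - mun i * E i t) / c"
    for t i by (simp add: q_def Q_eq path_deviation_def diff_divide_distrib)
  show "q 0 = 0"
    by (simp add: q_def Q_eq E_0 vec_eq_iff renewal_path.renewal_count_0[OF arrivals] renewal_path.renewal_count_0[OF services])
  show "(\<Sum>i\<in>UNIV. E i t - E i r) = t - r"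
    if "0 \<le> r" "r \<le> t" "t \<le> T" "\<And>u. r < u \<Longrightarrow> u \<le> t \<Longrightarrow> q u \<noteq> 0" for r t
    using that by (intro E_total_eq sum_B_eq_1) auto
  show "E j t = E j r" if "0 \<le> r" "r \<le> t" "t \<le> T"
    "\<And>u. r < u \<Longrightarrow> u \<le> t \<Longrightarrow> q u $ j < equilibrium (workload (q u)) $ j" for j r t
  proof (rule E_const[OF that(1,2,3)])
    fix u assume u: "r < u" "u < t"
    then have "q u \<notin> priority_region mu C' j"
      using that(4)[of u] priority_region_above_equilibrium(1)[of "q u" j] by auto
    then show "Bp u $ j = 0" using B_cmu[of u j] u that unfolding q_def by simp
  qed
qed (use rho_sum N_pos c_pos E_0 E_mono E_total q_nonneg in auto)

text \<open>Arrivals and departures are monotone in time, so the queue is measurable.\<close>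
lemma total_cost_integrable: "(\<lambda>t. total_cost C (q t)) integrable_on {0..T}"
  unfolding total_cost_def
proof (rule integrable_sum)
  fix i :: 'd assume "i \<in> UNIV"
  have mA: "(\<lambda>t. real (Ac i t)) integrable_on {0..T}"
    by (rule integrable_on_mono_on) (auto intro!: mono_onI Ac_mono)
  have mS: "(\<lambda>t. real (Sc i (E i t))) integrable_on {0..T}"
    by (rule integrable_on_mono_on)
      (auto intro!: mono_onI renewal_path.renewal_count_mono[OF services] E_mono E_nonneg)
  have "(\<lambda>t. (real (Ac i t) - real (Sc i (E i t))) / c) \<in> borel_measurable (lebesgue_on {0..T})"
    using integrable_imp_measurable[OF mA] integrable_imp_measurable[OF mS] by measurable
  then have qm: "(\<lambda>t. q t $ i) \<in> borel_measurable (lebesgue_on {0..T})" by (simp add: q_def Q_eq)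
  have "continuous_on UNIV (\<lambda>x. C i (max 0 x))"
    by (rule continuous_on_compose2[OF continuous_on_C]) (auto intro!: continuous_intros)
  then have "(\<lambda>x. C i (max 0 x)) \<in> borel_measurable borel" by (rule borel_measurable_continuous_onI)
  from measurable_compose[OF qm this]
  have m: "(\<lambda>t. C i (max 0 (q t $ i))) \<in> borel_measurable (lebesgue_on {0..T})" .
  have "(\<lambda>t. C i (max 0 (q t $ i))) integrable_on {0..T}"
  proof (rule measurable_bounded_by_integrable_imp_integrable[OF m])
    show "(\<lambda>t. C i (real (Ac i T) / c)) integrable_on {0..T}" by (rule integrable_const_ivl)
    fix t assume t: "t \<in> {0..T}"
    have "q t $ i \<le> real (Ac i T) / c"
      using Ac_mono[of t T i] t c_pos by (simp add: q_def Q_eq divide_right_mono)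
    then have "C i (max 0 (q t $ i)) \<le> C i (real (Ac i T) / c)"
      using c_pos by (intro C_mono) auto
    then show "norm (C i (max 0 (q t $ i))) \<le> C i (real (Ac i T) / c)" using C_nonneg[of "max 0 (q t $ i)" i] by simp
  qed auto
  then show "(\<lambda>t. C i (q t $ i)) integrable_on {0..T}"
    by (rule integrable_eq) (use q_nonneg in auto)
qed auto

end

section \<open>The sequence of queueing systems\<close>

lemma exists_small_factor:
  fixes v X :: "'i::finite \<Rightarrow> real"
  assumes "\<And>i. 0 < v i" "\<And>i. 0 \<le> X i" "0 < k0"
  shows "\<exists>k>0. k \<le> k0 \<and> (\<forall>i. k * X i \<le> v i)"
proof -
  define k where "k = Min (insert k0 (range (\<lambda>i. v i / (X i + 1))))"
  have fin: "finite (insert k0 (range (\<lambda>i. v i / (X i + 1))))" by simp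
  have "k \<le> x" if "x \<in> insert k0 (range (\<lambda>i. v i / (X i + 1)))" for x
    unfolding k_def using that by (rule Min_le[OF fin])
  then have k: "k \<le> k0" "\<And>i. k \<le> v i / (X i + 1)" by blast+
  have pos: "0 < v i / (X i + 1)" for i using assms(1)[of i] assms(2)[of i] by simp
  have "0 < k" unfolding k_def using pos assms(3) by (subst Min_gr_iff) auto
  moreover have "k * X i \<le> v i" for i
  proof -
    have "k * X i \<le> k * (X i + 1)" using \<open>0 < k\<close> by simp
    also have "\<dots> \<le> v i / (X i + 1) * (X i + 1)" using k(2)[of i] assms(2)[of i] by (intro mult_right_mono) auto
    also have "\<dots> = v i" using assms(2)[of i] by (simp add: add_nonneg_eq_0_iff)
    finally show ?thesis .
  qed
  ultimately show ?thesis using k(1) by blast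
qed

lemma exists_small_multiple:
  fixes a g :: real
  assumes "0 \<le> a" "0 < g"
  shows "\<exists>\<delta>>0. a * \<delta> \<le> g"
proof (intro exI conjI)
  have "a * (g / (a + 1)) \<le> (a + 1) * (g / (a + 1))" using assms by (intro mult_right_mono) auto
  also have "\<dots> = g" using assms by (simp add: add_nonneg_eq_0_iff)
  finally show "a * (g / (a + 1)) \<le> g" .
qed (use assms in simp)

lemma borel_measurable_vec:
  fixes f :: "'a \<Rightarrow> real^'d::finite"
  assumes "\<And>i. (\<lambda>x. f x $ i) \<in> borel_measurable M"
  shows "f \<in> borel_measurable M"
  unfolding borel_measurable_euclidean_space[of f]
  using assms by (auto simp: Basis_vec_def inner_axis)

lemma sets_Collect_countable_Bex_set:
  assumes "countable I" "\<And>i. i \<in> I \<Longrightarrow> {x \<in> space M. P i x} \<in> sets M"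
  shows "{x \<in> space M. \<exists>i\<in>I. P i x} \<in> sets M"
proof -
  have "{x \<in> space M. \<exists>i\<in>I. P i x} = (\<Union>i\<in>I. {x \<in> space M. P i x})" by blast
  then show ?thesis using assms by (simp only: sets.countable_UN'')
qed

lemma sets_Collect_countable_Ball_set:
  assumes "countable I" "\<And>i. i \<in> I \<Longrightarrow> {x \<in> space M. P i x} \<in> sets M"
  shows "{x \<in> space M. \<forall>i\<in>I. P i x} \<in> sets M"
proof -
  have "{x \<in> space M. \<not> P i x} \<in> sets M" if "i \<in> I" for i
    using sets.sets_Collect_neg[of M "P i"] assms(2)[OF that] by simp
  from sets_Collect_countable_Bex_set[OF assms(1) this]
  have "{x \<in> space M. \<exists>i\<in>I. \<not> P i x} \<in> sets M" by simp
  from sets.sets_Collect_neg[OF this] show ?thesis by simp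
qed

text \<open>The queueing systems of the theorem, with the assumptions on the distribution of the
  primitives condensed to the divergence of their partial sums, and the heavy traffic limits of the
  parameters condensed to \<open>params_close\<close>.\<close>
locale gcmu_system = workload_game C C' mu u1 T rho y
  for C C' :: "'d::{finite,linorder} \<Rightarrow> real \<Rightarrow> real" and mu :: "'d \<Rightarrow> real" and u1 T :: real
    and rho :: "'d \<Rightarrow> real" and y :: "(real, 'd) vec" +
  fixes M :: "'w measure" and IA ST :: "'d \<Rightarrow> nat \<Rightarrow> 'w \<Rightarrow> real"
    and lam_n mu_n :: "nat \<Rightarrow> 'd \<Rightarrow> real" and b c :: "nat \<Rightarrow> real" and s1 s2 :: "'d \<Rightarrow> real"
    and B :: "nat \<Rightarrow> real \<Rightarrow> 'w \<Rightarrow> (real, 'd) vec"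
    and At St :: "nat \<Rightarrow> real \<Rightarrow> 'w \<Rightarrow> (real, 'd) vec"
  assumes M: "prob_space M" "complete_measure M"
    and rv: "\<And>i l. 1 \<le> l \<Longrightarrow> IA i l \<in> borel_measurable M" "\<And>i l. 1 \<le> l \<Longrightarrow> ST i l \<in> borel_measurable M"
    and pos: "\<And>i l \<omega>. 1 \<le> l \<Longrightarrow> \<omega> \<in> space M \<Longrightarrow> 0 < IA i l \<omega>" "\<And>i l \<omega>. 1 \<le> l \<Longrightarrow> \<omega> \<in> space M \<Longrightarrow> 0 < ST i l \<omega>"
    and unbounded: "\<And>i. AE \<omega> in M. \<forall>t. \<exists>l. t < (\<Sum>k=1..l. IA i k \<omega>)" "\<And>i. AE \<omega> in M. \<forall>t. \<exists>l. t < (\<Sum>k=1..l. ST i k \<omega>)"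
    and rho_sum: "(\<Sum>i\<in>UNIV. rho i) = 1"
    and rates_pos: "\<And>n i. 0 < lam_n n i" "\<And>n i. 0 < mu_n n i"
    and b: "filterlim b at_top sequentially"
    and c: "\<And>n. c n = b n * sqrt (real n)"
    and params: "\<And>\<kappa>. 0 < \<kappa> \<Longrightarrow> \<forall>\<^sub>F n in sequentially. params_close \<kappa> (real n) (c n) (lam_n n) (mu_n n)"
    and s_pos: "\<And>i. 0 < s1 i" "\<And>i. 0 < s2 i"
    and At: "\<And>n. At n = scaled_deviation (c n) (lam_n n) (renewal_processes IA (lam_n n))"
    and St: "\<And>n. St n = scaled_deviation (c n) (mu_n n) (renewal_processes ST (mu_n n))"
    and mdp: "satisfies_LDP M (skorokhod_topology T) b
                (\<lambda>n \<omega>. restrict (\<lambda>t. (At n t \<omega>, St n t \<omega>)) {0..T}) (rate_function T s1 s2)"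
    and exp_moments: "\<And>u::real.
           limsup (\<lambda>n. ereal (1 / (b n)\<^sup>2) *
             ln_ennreal (\<integral>\<^sup>+\<omega>. ennreal (exp ((b n)\<^sup>2 * u *
               ((SUP s\<in>{0..T}. norm (At n s \<omega>)) + (SUP s\<in>{0..T}. norm (St n s \<omega>))))) \<partial>M)) < \<infinity>"
    and B: "\<And>n. generalized_cmu M T mu C' (c n) (renewal_processes IA (lam_n n)) (renewal_processes ST (mu_n n)) (B n)"
begin

interpretation M: prob_space M by (rule M)
interpretation M: complete_measure M by (rule M)

abbreviation "Z n \<omega> \<equiv> restrict (\<lambda>t. (At n t \<omega>, St n t \<omega>)) {0..T}"
abbreviation "XA \<omega> \<equiv> \<lambda>i k. IA i k \<omega>"
abbreviation "XS \<omega> \<equiv> \<lambda>i k. ST i k \<omega>"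
abbreviation "Qn n \<equiv> scaled_queue (c n) (renewal_processes IA (lam_n n)) (renewal_processes ST (mu_n n)) (B n)"
abbreviation "J n \<equiv> risk_sensitive_cost M T C (b n) (Qn n)"

definition queue_cost :: "nat \<Rightarrow> 'w \<Rightarrow> real" where
  "queue_cost n \<omega> = integral {0..T} (\<lambda>t. total_cost C (Qn n t \<omega>))"

definition deviation_norm :: "nat \<Rightarrow> 'w \<Rightarrow> real" where
  "deviation_norm n \<omega> = (SUP s\<in>{0..T}. norm (At n s \<omega>)) + (SUP s\<in>{0..T}. norm (St n s \<omega>))"

lemma AE_renewal:
  "AE \<omega> in M. \<forall>i. renewal_path (\<lambda>k. IA i k \<omega>) (lam_n n i) \<and> renewal_path (\<lambda>k. ST i k \<omega>) (mu_n n i)"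
proof -
  have "AE \<omega> in M. \<forall>i. (\<forall>t. \<exists>l. t < (\<Sum>k=1..l. IA i k \<omega>)) \<and> (\<forall>t. \<exists>l. t < (\<Sum>k=1..l. ST i k \<omega>))"
    using unbounded by (simp add: AE_all_countable)
  moreover have "AE \<omega> in M. \<omega> \<in> space M" by simp
  ultimately show ?thesis
    by eventually_elim (use pos rates_pos in \<open>auto simp: renewal_path_def\<close>)
qed

lemma At_eq: "At n t \<omega> = path_deviation (c n) (lam_n n) (XA \<omega>) t"
  by (simp add: At scaled_deviation_def path_deviation_def renewal_processes_def)

lemma St_eq: "St n t \<omega> = path_deviation (c n) (mu_n n) (XS \<omega>) t"
  by (simp add: St scaled_deviation_def path_deviation_def renewal_processes_def)

lemma AE_Z: "AE \<omega> in M. Z n \<omega> \<in> skorokhod_space T"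
  using AE_renewal[of n]
proof eventually_elim
  case (elim \<omega>)
  show ?case
    unfolding At_eq St_eq by (rule path_deviation_in_skorokhod_space) (use elim in auto)
qed

lemma eventually_pos: "\<forall>\<^sub>F n in sequentially. 0 < b n \<and> 0 < c n \<and> 0 < real n"
proof -
  have "\<forall>\<^sub>F n in sequentially. 0 < b n" using b by (simp add: filterlim_at_top_dense)
  moreover have "\<forall>\<^sub>F n in sequentially. 0 < n" by (rule eventually_gt_at_top)
  ultimately show ?thesis by eventually_elim (simp add: c)
qed

lemma AE_path:
  assumes "0 < c n" "0 < real n"
  shows "AE \<omega> in M. priority_path C C' mu u1 T rho (XA \<omega>) (XS \<omega>) (real n) (c n) (lam_n n) (mu_n n) (\<lambda>t. B n t \<omega>)"
proof -
  have queue: "queue_length (renewal_processes IA (lam_n n)) (renewal_processes ST (mu_n n)) (B n) i t \<omega> =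
      path_queue (XA \<omega>) (XS \<omega>) (lam_n n) (mu_n n) (\<lambda>t. B n t \<omega>) i t" for i t \<omega>
    by (simp add: queue_length_def path_queue_def departures_def renewal_processes_def effort_def path_effort_def)
  have eff: "\<forall>t\<in>{0..T}. \<forall>\<omega>\<in>space M. B n t \<omega> \<in> effort_set"
    using B[of n] by (simp add: generalized_cmu_def admissible_control_def)
  have "AE \<omega> in M. rcll_on T (\<lambda>t. B n t \<omega>)"
    "AE \<omega> in M. \<forall>t\<in>{0..T}. \<forall>i. queue_length (renewal_processes IA (lam_n n)) (renewal_processes ST (mu_n n)) (B n) i t \<omega> = 0 \<longrightarrow> B n t \<omega> $ i = 0"
    "AE \<omega> in M. \<forall>t\<in>{0..T}. \<forall>i. B n t \<omega> $ i = indicator (priority_region mu C' i) (Qn n t \<omega>)"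
    using B[of n] by (auto simp: generalized_cmu_def admissible_control_def)
  moreover have "AE \<omega> in M. \<omega> \<in> space M" by simp
  ultimately show ?thesis
    using AE_renewal[of n]
  proof eventually_elim
    case (elim \<omega>)
    show ?case
    proof (rule priority_path.intro[OF workload_game_axioms], rule priority_path_axioms.intro)
      show "t \<in> {0..T} \<Longrightarrow> B n t \<omega> \<in> effort_set" for t using eff elim by blast
      show "t \<in> {0..T} \<Longrightarrow> path_queue (XA \<omega>) (XS \<omega>) (lam_n n) (mu_n n) (\<lambda>t. B n t \<omega>) i t = 0 \<Longrightarrow> B n t \<omega> $ i = 0" for t i
        using elim(2) unfolding queue by blast
      show "t \<in> {0..T} \<Longrightarrow> B n t \<omega> $ i = indicator (priority_region mu C' i) (\<chi> i. path_queue (XA \<omega>) (XS \<omega>) (lam_n n) (mu_n n) (\<lambda>t. B n t \<omega>) i t / c n)" for t i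
        using elim(3) unfolding scaled_queue_def queue by blast
    qed (use elim assms rho_sum in auto)
  qed
qed

lemma Qn_eq:
  assumes "priority_path C C' mu u1 T rho (XA \<omega>) (XS \<omega>) (real n) (c n) (lam_n n) (mu_n n) (\<lambda>t. B n t \<omega>)"
  shows "Qn n t \<omega> = priority_path.q (XA \<omega>) (XS \<omega>) (c n) (lam_n n) (mu_n n) (\<lambda>t. B n t \<omega>) t"
  by (simp add: priority_path.q_def[OF assms] scaled_queue_def queue_length_def path_queue_def departures_def
      renewal_processes_def effort_def path_effort_def)

lemma norm_le_deviation_norm:
  assumes Z: "Z n \<omega> \<in> skorokhod_space T" and t: "0 \<le> t" "t \<le> T"
  shows "norm (At n t \<omega>) \<le> deviation_norm n \<omega>" "norm (St n t \<omega>) \<le> deviation_norm n \<omega>"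
proof -
  have "bounded (Z n \<omega> ` {0..T})" using Z by (intro rcll_on_bounded) (simp add: skorokhod_space_def)
  then obtain R where R: "\<And>t. t \<in> {0..T} \<Longrightarrow> norm (At n t \<omega>, St n t \<omega>) \<le> R"
    unfolding bounded_iff by fastforce
  have "norm (At n t \<omega>) \<le> R" "norm (St n t \<omega>) \<le> R" if "t \<in> {0..T}" for t
    using R[OF that] norm_fst_le[of "At n t \<omega>" "St n t \<omega>"] norm_snd_le[of "St n t \<omega>" "At n t \<omega>"] by auto
  note le = this
  have bdd: "bdd_above ((\<lambda>s. norm (At n s \<omega>)) ` {0..T})" "bdd_above ((\<lambda>s. norm (St n s \<omega>)) ` {0..T})"
    by (rule bdd_aboveI2[where M=R], erule le)+
  have up: "norm (At n s \<omega>) \<le> (SUP s\<in>{0..T}. norm (At n s \<omega>))" "norm (St n s \<omega>) \<le> (SUP s\<in>{0..T}. norm (St n s \<omega>))"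
    if "s \<in> {0..T}" for s using bdd that by (auto intro: cSUP_upper)
  have "0 \<le> (SUP s\<in>{0..T}. norm (At n s \<omega>))" "0 \<le> (SUP s\<in>{0..T}. norm (St n s \<omega>))"
    using up[of 0] T_pos norm_ge_zero order_trans by (metis atLeastAtMost_iff less_imp_le order_refl)+
  then show "norm (At n t \<omega>) \<le> deviation_norm n \<omega>" "norm (St n t \<omega>) \<le> deviation_norm n \<omega>"
    unfolding deviation_norm_def using up[of t] t by auto
qed

lemma exists_small_kappa: "\<exists>k>0. k \<le> 1 \<and> (\<forall>i. k \<le> 1 / (2 * mu i))"
proof -
  have "\<exists>k>0. k \<le> 1 \<and> (\<forall>i. k * 1 \<le> 1 / (2 * mu i))"
    by (rule exists_small_factor) (use mu_pos in auto)
  then show ?thesis by simp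
qed

text \<open>Linear growth of the cost in the deviations is what makes the exponential moments
  applicable.\<close>
lemma crude_cost_bound:
  "\<exists>K. \<forall>\<^sub>F n in sequentially. AE \<omega> in M. queue_cost n \<omega> \<le> K * (1 + deviation_norm n \<omega>)"
proof -
  obtain k where k: "0 < k" "k \<le> 1" "\<And>i. k \<le> 1 / (2 * mu i)" using exists_small_kappa by blast
  define K where "K = T * (real CARD('d) * (u1 * (8 * mu_total * theta_total * (drift_bound * T + 2))))"
  have "\<forall>\<^sub>F n in sequentially. AE \<omega> in M. queue_cost n \<omega> \<le> K * (1 + deviation_norm n \<omega>)"
    using params[OF k(1)] eventually_pos
  proof eventually_elim
    case (elim n)
    have "AE \<omega> in M. priority_path C C' mu u1 T rho (XA \<omega>) (XS \<omega>) (real n) (c n) (lam_n n) (mu_n n) (\<lambda>t. B n t \<omega>)"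
      by (rule AE_path) (use elim in auto)
    then show ?case
      using AE_Z[of n]
    proof eventually_elim
      case (elim \<omega>)
      interpret P: priority_path C C' mu u1 T rho y "XA \<omega>" "XS \<omega>" "real n" "c n" "lam_n n" "mu_n n" "\<lambda>t. B n t \<omega>" by (rule elim(1))
      interpret bounded_queue_path C C' mu u1 T rho y "real n" "c n" "lam_n n" "mu_n n"
        "path_deviation (c n) (lam_n n) (XA \<omega>)" "path_deviation (c n) (mu_n n) (XS \<omega>)" "path_effort (\<lambda>t. B n t \<omega>)" P.q "deviation_norm n \<omega>" k
      proof
        show "params_close k (real n) (c n) (lam_n n) (mu_n n)" by fact
        show "0 < k" "k \<le> 1" "k \<le> 1 / (2 * mu i)" for i using k by auto
        fix t i assume t: "0 \<le> t" "t \<le> T"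
        show "\<bar>path_deviation (c n) (lam_n n) (XA \<omega>) t $ i\<bar> \<le> deviation_norm n \<omega>"
          using norm_le_deviation_norm(1)[OF elim(2) t] component_le_norm_cart[of "At n t \<omega>" i] by (simp add: At_eq)
        show "\<bar>path_deviation (c n) (mu_n n) (XS \<omega>) t $ i\<bar> \<le> deviation_norm n \<omega>"
          using norm_le_deviation_norm(2)[OF elim(2) t] component_le_norm_cart[of "St n t \<omega>" i] by (simp add: St_eq)
      qed
      have "queue_cost n \<omega> = integral {0..T} (\<lambda>t. total_cost C (P.q t))"
        unfolding queue_cost_def Qn_eq[OF elim(1)] ..
      also have "\<dots> \<le> integral {0..T} (\<lambda>t. real CARD('d) * (u1 * queue_bound (deviation_norm n \<omega>)))"
        by (intro integral_le P.total_cost_integrable integrable_const_ivl total_cost_le) auto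
      also have "\<dots> = T * (real CARD('d) * (u1 * queue_bound (deviation_norm n \<omega>)))" using T_pos by simp
      also have "\<dots> \<le> T * (real CARD('d) * (u1 * (8 * mu_total * theta_total * ((drift_bound * T + 2) * (1 + deviation_norm n \<omega>)))))"
      proof -
        have "0 \<le> drift_bound * T * deviation_norm n \<omega>" using drift_bound_ge T_pos R_nonneg by simp
        then have "drift_bound * T + 2 * deviation_norm n \<omega> \<le> (drift_bound * T + 2) * (1 + deviation_norm n \<omega>)" by (simp add: algebra_simps)
        then show ?thesis unfolding queue_bound_def using T_pos u1_nonneg mu_total_pos theta_total_pos
          by (intro mult_left_mono) auto
      qed
      also have "\<dots> = K * (1 + deviation_norm n \<omega>)" by (simp add: K_def)
      finally show "queue_cost n \<omega> \<le> K * (1 + deviation_norm n \<omega>)" .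
    qed
  qed
  then show ?thesis by blast
qed

definition tracking_const :: real where
  "tracking_const = T * (u1 * mu_total * theta_total * (9 + 2 * collapse_rate))"

lemma tracking_const_nonneg: "0 \<le> tracking_const"
  unfolding tracking_const_def using T_pos u1_nonneg mu_total_pos theta_total_pos collapse_rate_pos by simp

text \<open>For a fixed continuous \<open>\<psi>\<close>, uniform continuity yields \<open>h\<close>, and then the parameters of the
  system satisfy all smallness conditions eventually.\<close>
lemma cost_tracks_path_cost:
  assumes \<psi>: "\<psi> \<in> game_data T" and \<delta>: "0 < \<delta>"
  shows "\<forall>\<^sub>F n in sequentially. AE \<omega> in M. (\<forall>t\<in>{0..T}. dist (Z n \<omega> t) (\<psi> t) \<le> \<delta>) \<longrightarrow>
    \<bar>queue_cost n \<omega> - path_cost \<psi>\<bar> \<le> tracking_const * \<delta>"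
proof -
  note \<psi>c = game_dataD(2)[OF \<psi>]
  have "uniformly_continuous_on {0..T} \<psi>" using \<psi>c by (intro compact_uniformly_continuous) auto
  then obtain h0 where h0: "0 < h0" "\<And>r t. r \<in> {0..T} \<Longrightarrow> t \<in> {0..T} \<Longrightarrow> dist t r < h0 \<Longrightarrow> dist (\<psi> t) (\<psi> r) < \<delta>"
    unfolding uniformly_continuous_on_def using \<delta> by metis
  define h where "h = min (h0 / 2) (\<delta> / drift_bound)"
  have h: "0 < h" "h < h0" "drift_bound * h \<le> \<delta>"
  proof -
    have d: "0 < drift_bound" using drift_bound_ge(1) by simp
    show "0 < h" "h < h0" using h0 \<delta> d by (auto simp: h_def)
    have "drift_bound * h \<le> drift_bound * (\<delta> / drift_bound)" using d by (intro mult_left_mono) (auto simp: h_def)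
    then show "drift_bound * h \<le> \<delta>" using d by simp
  qed
  have "bounded (\<psi> ` {0..T})" using \<psi>c by (intro compact_imp_bounded compact_continuous_image) auto
  then obtain R0 where R0: "\<And>t. t \<in> {0..T} \<Longrightarrow> norm (\<psi> t) \<le> R0"
    unfolding bounded_iff by fastforce
  define R where "R = R0 + \<delta>"
  have "0 \<le> R0" by (rule order_trans[OF norm_ge_zero R0[of 0]]) (use T_pos in simp)
  then have Rnn: "0 \<le> R" using \<delta> unfolding R_def by linarith
  obtain k0 where k0: "0 < k0" "k0 \<le> 1" "\<And>i. k0 \<le> 1 / (2 * mu i)" using exists_small_kappa by blast
  (* the four smallness conditions k * X p \<le> v p on k, indexed by pairs of truth values *)
  define X :: "bool \<times> bool \<Rightarrow> real" where
    "X p = (case p of (True, True) \<Rightarrow> time_bound R | (True, False) \<Rightarrow> real CARD('d) * (drift_bound * T + 2 * R) + theta_total * T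
        | (False, True) \<Rightarrow> real CARD('d) * queue_bound R | (False, False) \<Rightarrow> queue_bound R + 4 * R + \<delta>)" for p
  define v :: "bool \<times> bool \<Rightarrow> real" where
    "v p = (case p of (True, True) \<Rightarrow> h | (True, False) \<Rightarrow> theta_total * \<delta>
        | (False, True) \<Rightarrow> theta_total * \<delta> | (False, False) \<Rightarrow> h)" for p
  have "\<exists>k>0. k \<le> k0 \<and> (\<forall>p. k * X p \<le> v p)"
  proof (rule exists_small_factor)
    fix p :: "bool \<times> bool"
    show "0 < v p" using h \<delta> theta_total_pos by (auto simp: v_def split: prod.split bool.split)
    show "0 \<le> X p"
      using queue_bound_nonneg[OF Rnn] Rnn \<delta> theta_total_pos drift_bound_ge T_pos
      by (auto simp: X_def time_bound_def split: prod.split bool.split)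
  qed (rule k0(1))
  then obtain k where k: "0 < k" "k \<le> k0" "\<And>p. k * X p \<le> v p" by blast
  have kX: "k * time_bound R \<le> h"
    "k * (real CARD('d) * (drift_bound * T + 2 * R) + theta_total * T) \<le> theta_total * \<delta>"
    "k * (real CARD('d) * queue_bound R) \<le> theta_total * \<delta>" "k * (queue_bound R + 4 * R + \<delta>) \<le> h"
    using k(3)[of "(True, True)"] k(3)[of "(True, False)"] k(3)[of "(False, True)"] k(3)[of "(False, False)"]
    by (simp_all only: X_def v_def prod.case bool.case)
  show ?thesis
    using params[OF k(1)] eventually_pos
  proof eventually_elim
    case (elim n)
    have "AE \<omega> in M. priority_path C C' mu u1 T rho (XA \<omega>) (XS \<omega>) (real n) (c n) (lam_n n) (mu_n n) (\<lambda>t. B n t \<omega>)"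
      by (rule AE_path) (use elim in auto)
    then show ?case
    proof (eventually_elim, intro impI)
      fix \<omega>
      assume path: "priority_path C C' mu u1 T rho (XA \<omega>) (XS \<omega>) (real n) (c n) (lam_n n) (mu_n n) (\<lambda>t. B n t \<omega>)"
        and close: "\<forall>t\<in>{0..T}. dist (Z n \<omega> t) (\<psi> t) \<le> \<delta>"
      interpret P: priority_path C C' mu u1 T rho y "XA \<omega>" "XS \<omega>" "real n" "c n" "lam_n n" "mu_n n" "\<lambda>t. B n t \<omega>" by (rule path)
      have cl: "norm (At n t \<omega> - fst (\<psi> t)) \<le> \<delta>" "norm (St n t \<omega> - snd (\<psi> t)) \<le> \<delta>" if "0 \<le> t" "t \<le> T" for t
        using close that dist_fst_le[of "Z n \<omega> t" "\<psi> t"] dist_snd_le[of "Z n \<omega> t" "\<psi> t"] by (force simp: dist_norm)+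
      have compA: "\<bar>At n t \<omega> $ i - fst (\<psi> t) $ i\<bar> \<le> \<delta>" and compS: "\<bar>St n t \<omega> $ i - snd (\<psi> t) $ i\<bar> \<le> \<delta>" if "0 \<le> t" "t \<le> T" for t i
        using cl[OF that] component_le_norm_cart[of "At n t \<omega> - fst (\<psi> t)" i] component_le_norm_cart[of "St n t \<omega> - snd (\<psi> t)" i] by auto
      have \<psi>R: "\<bar>fst (\<psi> t) $ i\<bar> \<le> R0" "\<bar>snd (\<psi> t) $ i\<bar> \<le> R0" if "0 \<le> t" "t \<le> T" for t i
        using R0[of t] that component_le_norm_cart[of "fst (\<psi> t)" i] component_le_norm_cart[of "snd (\<psi> t)" i]
          norm_fst_le[of "fst (\<psi> t)" "snd (\<psi> t)"] norm_snd_le[of "snd (\<psi> t)" "fst (\<psi> t)"] by auto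
      interpret tracking_queue_path C C' mu u1 T rho y "real n" "c n" "lam_n n" "mu_n n"
        "path_deviation (c n) (lam_n n) (XA \<omega>)" "path_deviation (c n) (mu_n n) (XS \<omega>)" "path_effort (\<lambda>t. B n t \<omega>)" P.q R k \<psi> \<delta> h
      proof
        show "params_close k (real n) (c n) (lam_n n) (mu_n n)" by fact
        show "0 < k" "k \<le> 1" "k \<le> 1 / (2 * mu i)" for i using k k0(2) k0(3)[of i] by auto
        show "\<bar>path_deviation (c n) (lam_n n) (XA \<omega>) t $ i\<bar> \<le> R" "\<bar>path_deviation (c n) (mu_n n) (XS \<omega>) t $ i\<bar> \<le> R"
          if "0 \<le> t" "t \<le> T" for t i
          using compA[OF that, of i] compS[OF that, of i] \<psi>R[OF that, of i] unfolding At_eq St_eq R_def by linarith+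
        show "\<bar>path_deviation (c n) (lam_n n) (XA \<omega>) t $ i - fst (\<psi> t) $ i\<bar> \<le> \<delta>"
          "\<bar>path_deviation (c n) (mu_n n) (XS \<omega>) t $ i - snd (\<psi> t) $ i\<bar> \<le> \<delta>" if "0 \<le> t" "t \<le> T" for t i
          using compA[OF that, of i] compS[OF that, of i] unfolding At_eq St_eq by auto
        show "\<bar>fst (\<psi> t) $ i - fst (\<psi> r) $ i\<bar> \<le> \<delta> \<and> \<bar>snd (\<psi> t) $ i - snd (\<psi> r) $ i\<bar> \<le> \<delta>"
          if tr: "0 \<le> t" "t \<le> T" "0 \<le> r" "r \<le> T" "\<bar>t - r\<bar> \<le> h" for t r i
        proof -
          have "dist (\<psi> t) (\<psi> r) < \<delta>" by (rule h0(2)) (use tr h in \<open>auto simp: dist_real_def\<close>)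
          then show ?thesis
            using dist_fst_le[of "\<psi> t" "\<psi> r"] dist_snd_le[of "\<psi> t" "\<psi> r"]
              component_le_norm_cart[of "fst (\<psi> t) - fst (\<psi> r)" i] component_le_norm_cart[of "snd (\<psi> t) - snd (\<psi> r)" i]
            by (auto simp: dist_norm)
        qed
      qed (use \<delta> h \<psi>c kX in auto)
      let ?f = "\<lambda>t. total_cost C (P.q t)" and ?g = "\<lambda>t. min_cost (reflected (netput \<psi>) t)"
      let ?K = "u1 * mu_total * theta_total * (9 + 2 * collapse_rate) * \<delta>"
      have g: "?g integrable_on {0..T}" by (rule integrable_continuous_real[OF continuous_on_path_cost_integrand[OF \<psi>c]])
      have "queue_cost n \<omega> = integral {0..T} ?f" unfolding queue_cost_def Qn_eq[OF path] ..
      then have "\<bar>queue_cost n \<omega> - path_cost \<psi>\<bar> = norm (integral {0..T} (\<lambda>t. ?f t - ?g t))"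
        unfolding path_cost_def by (simp add: integral_diff P.total_cost_integrable g)
      also have "\<dots> \<le> integral {0..T} (\<lambda>t. ?K)"
      proof (rule integral_norm_bound_integral)
        show "norm (?f t - ?g t) \<le> ?K" if "t \<in> {0..T}" for t
          using total_cost_close[of t] that by simp
      qed (rule integrable_diff P.total_cost_integrable g integrable_const_ivl)+
      also have "\<dots> = tracking_const * \<delta>" using T_pos by (simp add: tracking_const_def)
      finally show "\<bar>queue_cost n \<omega> - path_cost \<psi>\<bar> \<le> tracking_const * \<delta>" .
    qed
  qed
qed

lemma measurable_deviation:
  assumes X: "\<And>i l. 1 \<le> l \<Longrightarrow> X i l \<in> borel_measurable M"
    and good: "\<And>i. AE \<omega> in M. renewal_path (\<lambda>k. X i k \<omega>) (r i)" and t: "0 \<le> t"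
  shows "(\<lambda>\<omega>. path_deviation c' r (\<lambda>i k. X i k \<omega>) t) \<in> borel_measurable M"
proof (rule borel_measurable_vec)
  fix i
  have "(\<lambda>\<omega>. renewal_count (\<lambda>l. X i l \<omega>) (r i) t) \<in> measurable M (count_space UNIV)"
    by (rule renewal_count_measurable[OF M(2) X good t])
  from measurable_compose[OF this, of real borel]
  have "(\<lambda>\<omega>. real (renewal_count (\<lambda>l. X i l \<omega>) (r i) t)) \<in> borel_measurable M" by simp
  then show "(\<lambda>\<omega>. path_deviation c' r (\<lambda>i k. X i k \<omega>) t $ i) \<in> borel_measurable M"
    unfolding path_deviation_def vec_lambda_beta by measurable
qed

lemma measurable_At: "0 \<le> t \<Longrightarrow> At n t \<in> borel_measurable M"
  and measurable_St: "0 \<le> t \<Longrightarrow> St n t \<in> borel_measurable M"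
proof -
  assume t: "0 \<le> t"
  have g: "AE \<omega> in M. renewal_path (\<lambda>k. IA i k \<omega>) (lam_n n i)" "AE \<omega> in M. renewal_path (\<lambda>k. ST i k \<omega>) (mu_n n i)" for i
    using AE_renewal[of n] by (auto elim: eventually_mono)
  show "At n t \<in> borel_measurable M" "St n t \<in> borel_measurable M"
    using measurable_deviation[where X=IA and r="lam_n n" and c'="c n", OF rv(1) g(1) t]
      measurable_deviation[where X=ST and r="mu_n n" and c'="c n", OF rv(2) g(2) t]
    by (simp_all only: At_eq[abs_def] St_eq[abs_def])
qed

lemma measurable_dist_Z:
  assumes "t \<in> {0..T}"
  shows "(\<lambda>\<omega>. dist (Z n \<omega> t) p) \<in> borel_measurable M"
proof -
  have "(\<lambda>\<omega>. (At n t \<omega>, St n t \<omega>)) \<in> borel_measurable M"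
    using measurable_At[of t n] measurable_St[of t n] assms by (intro borel_measurable_Pair) auto
  then have "(\<lambda>\<omega>. dist (At n t \<omega>, St n t \<omega>) p) \<in> borel_measurable M"
    by (intro borel_measurable_dist borel_measurable_const)
  then show ?thesis using assms by simp
qed

text \<open>For right-continuous paths countably many times suffice, which makes the tube events
  measurable.\<close>
lemma sup_dist_le_iff:
  assumes f: "f \<in> skorokhod_space T" and \<psi>: "\<psi> \<in> game_data T"
  shows "(\<forall>t\<in>{0..T}. dist (f t) (\<psi> t) \<le> q) \<longleftrightarrow> (\<forall>t\<in>time_grid T. dist (f t) (\<psi> t) \<le> q)"
proof
  assume le: "\<forall>t\<in>{0..T}. dist (f t) (\<psi> t) \<le> q"
  show "\<forall>t\<in>time_grid T. dist (f t) (\<psi> t) \<le> q"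
    by (rule ballI, rule bspec[OF le], rule subsetD[OF time_grid_subset[OF less_imp_le[OF T_pos]]])
next
  assume le: "\<forall>t\<in>time_grid T. dist (f t) (\<psi> t) \<le> q"
  have \<psi>': "\<psi> \<in> skorokhod_space T" by (rule continuous_in_skorokhod_space) (use game_dataD[OF \<psi>] in auto)
  show "\<forall>t\<in>{0..T}. dist (f t) (\<psi> t) \<le> q"
  proof
    fix t assume t: "t \<in> {0..T}"
    show "dist (f t) (\<psi> t) \<le> q"
    proof (rule right_continuous_le_if_time_grid_le[where h="\<lambda>t. dist (f t) (\<psi> t)"])
      fix s assume s: "0 \<le> s" "s < T"
      show "((\<lambda>t. dist (f t) (\<psi> t)) \<longlongrightarrow> dist (f s) (\<psi> s)) (at_right s)"
        using f \<psi>' s unfolding skorokhod_space_def rcll_on_def by (intro tendsto_dist) auto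
    qed (use le t in auto)
  qed
qed

lemma measurable_grid_le:
  assumes "\<psi> \<in> game_data T"
  shows "{\<omega> \<in> space M. \<forall>t\<in>time_grid T. dist (Z n \<omega> t) (\<psi> t) \<le> q} \<in> sets M"
proof (rule sets_Collect_countable_Ball_set[OF countable_time_grid])
  fix t assume "t \<in> time_grid T"
  then have "t \<in> {0..T}" using time_grid_subset[of T] T_pos by auto
  from measurable_dist_Z[OF this]
  show "{\<omega> \<in> space M. dist (Z n \<omega> t) (\<psi> t) \<le> q} \<in> sets M" by (intro borel_measurable_le borel_measurable_const)
qed

lemma measurable_closed_tube:
  assumes \<psi>: "\<psi> \<in> game_data T"
  shows "{\<omega> \<in> space M. Z n \<omega> \<in> closed_tube T \<psi> r} \<in> sets M"
proof (rule M.sets_if_AE_eq[OF _ measurable_grid_le[OF \<psi>, of n r]])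
  show "AE \<omega> in M. \<omega> \<in> {\<omega> \<in> space M. Z n \<omega> \<in> closed_tube T \<psi> r} \<longleftrightarrow>
      \<omega> \<in> {\<omega> \<in> space M. \<forall>t\<in>time_grid T. dist (Z n \<omega> t) (\<psi> t) \<le> r}"
    using AE_Z[of n]
  proof eventually_elim
    case (elim \<omega>)
    then show ?case using sup_dist_le_iff[OF elim \<psi>, of r] by (simp add: closed_tube_def)
  qed
qed auto

lemma measurable_open_tube:
  assumes \<psi>: "\<psi> \<in> game_data T"
  shows "{\<omega> \<in> space M. Z n \<omega> \<in> open_tube T \<psi> r} \<in> sets M"
proof (rule M.sets_if_AE_eq)
  show "{\<omega> \<in> space M. \<exists>q\<in>\<rat> \<inter> {..<r}. \<forall>t\<in>time_grid T. dist (Z n \<omega> t) (\<psi> t) \<le> q} \<in> sets M"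
    by (rule sets_Collect_countable_Bex_set[OF countable_Int1[OF countable_rat] measurable_grid_le[OF \<psi>]])
  show "AE \<omega> in M. \<omega> \<in> {\<omega> \<in> space M. Z n \<omega> \<in> open_tube T \<psi> r} \<longleftrightarrow>
      \<omega> \<in> {\<omega> \<in> space M. \<exists>q\<in>\<rat> \<inter> {..<r}. \<forall>t\<in>time_grid T. dist (Z n \<omega> t) (\<psi> t) \<le> q}"
    using AE_Z[of n]
  proof eventually_elim
    case (elim \<omega>)
    have "(\<exists>q<r. \<forall>t\<in>{0..T}. dist (Z n \<omega> t) (\<psi> t) \<le> q) \<longleftrightarrow> (\<exists>q\<in>\<rat> \<inter> {..<r}. \<forall>t\<in>{0..T}. dist (Z n \<omega> t) (\<psi> t) \<le> q)"
    proof
      assume "\<exists>q<r. \<forall>t\<in>{0..T}. dist (Z n \<omega> t) (\<psi> t) \<le> q"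
      then obtain q where q: "q < r" "\<forall>t\<in>{0..T}. dist (Z n \<omega> t) (\<psi> t) \<le> q" by blast
      obtain p where p: "p \<in> \<rat>" "q < p" "p < r" using Rats_dense_in_real[OF q(1)] by blast
      have "\<forall>t\<in>{0..T}. dist (Z n \<omega> t) (\<psi> t) \<le> p"
      proof
        fix t assume "t \<in> {0..T}"
        with q(2) have "dist (Z n \<omega> t) (\<psi> t) \<le> q" by (rule bspec)
        then show "dist (Z n \<omega> t) (\<psi> t) \<le> p" using p(2) by linarith
      qed
      with p show "\<exists>q\<in>\<rat> \<inter> {..<r}. \<forall>t\<in>{0..T}. dist (Z n \<omega> t) (\<psi> t) \<le> q" by (intro bexI[of _ p]) auto
    qed blast
    also have "\<dots> \<longleftrightarrow> (\<exists>q\<in>\<rat> \<inter> {..<r}. \<forall>t\<in>time_grid T. dist (Z n \<omega> t) (\<psi> t) \<le> q)"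
      by (simp only: sup_dist_le_iff[OF elim \<psi>])
    finally show ?case using elim unfolding open_tube_def by blast
  qed
qed auto

lemma measurable_deviation_norm: "deviation_norm n \<in> borel_measurable M"
proof -
  have *: "(\<lambda>\<omega>. SUP s\<in>{0..T}. norm (f s \<omega>)) \<in> borel_measurable M"
    if f: "\<And>s. 0 \<le> s \<Longrightarrow> f s \<in> borel_measurable M"
      and rc: "AE \<omega> in M. \<forall>s. 0 \<le> s \<longrightarrow> s < T \<longrightarrow> ((\<lambda>s. f s \<omega>) \<longlongrightarrow> f s \<omega>) (at_right s)"
      and bd: "AE \<omega> in M. bdd_above ((\<lambda>s. norm (f s \<omega>)) ` {0..T})" for f :: "real \<Rightarrow> 'w \<Rightarrow> (real, 'd) vec"
    unfolding borel_measurable_iff_le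
  proof
    fix q :: real
    show "{\<omega> \<in> space M. (SUP s\<in>{0..T}. norm (f s \<omega>)) \<le> q} \<in> sets M"
    proof (rule M.sets_if_AE_eq)
      show "{\<omega> \<in> space M. \<forall>s\<in>time_grid T. norm (f s \<omega>) \<le> q} \<in> sets M"
      proof (rule sets_Collect_countable_Ball_set[OF countable_time_grid])
        fix s assume "s \<in> time_grid T"
        then have "0 \<le> s" using time_grid_subset[of T] T_pos by auto
        then have "(\<lambda>\<omega>. norm (f s \<omega>)) \<in> borel_measurable M" using f by measurable
        then show "{\<omega> \<in> space M. norm (f s \<omega>) \<le> q} \<in> sets M" by (intro borel_measurable_le borel_measurable_const)
      qed
      show "AE \<omega> in M. \<omega> \<in> {\<omega> \<in> space M. (SUP s\<in>{0..T}. norm (f s \<omega>)) \<le> q} \<longleftrightarrow>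
          \<omega> \<in> {\<omega> \<in> space M. \<forall>s\<in>time_grid T. norm (f s \<omega>) \<le> q}"
        using rc bd
      proof eventually_elim
        case (elim \<omega>)
        have "(SUP s\<in>{0..T}. norm (f s \<omega>)) \<le> q \<longleftrightarrow> (\<forall>s\<in>{0..T}. norm (f s \<omega>) \<le> q)"
          using T_pos by (intro cSUP_le_iff elim(2)) auto
        also have "\<dots> \<longleftrightarrow> (\<forall>s\<in>time_grid T. norm (f s \<omega>) \<le> q)"
        proof
          assume le: "\<forall>s\<in>{0..T}. norm (f s \<omega>) \<le> q"
          show "\<forall>s\<in>time_grid T. norm (f s \<omega>) \<le> q"
            by (rule ballI, rule bspec[OF le], rule subsetD[OF time_grid_subset[OF less_imp_le[OF T_pos]]])
        next
          assume le: "\<forall>s\<in>time_grid T. norm (f s \<omega>) \<le> q"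
          show "\<forall>s\<in>{0..T}. norm (f s \<omega>) \<le> q"
          proof
            fix t assume t: "t \<in> {0..T}"
            show "norm (f t \<omega>) \<le> q"
              by (rule right_continuous_le_if_time_grid_le[where h="\<lambda>t. norm (f t \<omega>)"])
                (use le t elim(1) in \<open>auto intro: tendsto_norm\<close>)
          qed
        qed
        finally show ?case by simp
      qed
    qed auto
  qed
  have rcA: "AE \<omega> in M. \<forall>s. 0 \<le> s \<longrightarrow> s < T \<longrightarrow> ((\<lambda>s. At n s \<omega>) \<longlongrightarrow> At n s \<omega>) (at_right s)"
    and rcS: "AE \<omega> in M. \<forall>s. 0 \<le> s \<longrightarrow> s < T \<longrightarrow> ((\<lambda>s. St n s \<omega>) \<longlongrightarrow> St n s \<omega>) (at_right s)"
    using AE_renewal[of n] unfolding At_eq St_eq by (auto elim!: eventually_mono intro!: path_deviation_rcll(1))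
  have bdA: "AE \<omega> in M. bdd_above ((\<lambda>s. norm (At n s \<omega>)) ` {0..T})"
    using AE_Z[of n] by eventually_elim (auto intro!: bdd_aboveI2[where M="deviation_norm n _"] norm_le_deviation_norm)
  have bdS: "AE \<omega> in M. bdd_above ((\<lambda>s. norm (St n s \<omega>)) ` {0..T})"
    using AE_Z[of n] by eventually_elim (auto intro!: bdd_aboveI2[where M="deviation_norm n _"] norm_le_deviation_norm)
  show ?thesis
    unfolding deviation_norm_def[abs_def]
    by (intro borel_measurable_add * measurable_At measurable_St rcA rcS bdA bdS)
qed

abbreviation "Rate \<equiv> rate_function T s1 s2"
definition opt_value :: ereal where "opt_value = (SUP \<psi>\<in>game_data T. ereal (path_cost \<psi>) - Rate \<psi>)"

lemma J_eq: "J n = ereal (1 / (b n)\<^sup>2) * ln_ennreal (\<integral>\<^sup>+\<omega>. ennreal (exp ((b n)\<^sup>2 * queue_cost n \<omega>)) \<partial>M)"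
  by (simp add: risk_sensitive_cost_def queue_cost_def)

lemma Rate_nonneg: "0 \<le> Rate \<psi>"
  unfolding rate_function_def using s_pos by (intro add_nonneg_nonneg rate_part_nonneg)

text \<open>Choose \<open>\<psi>\<close> nearly optimal for \<open>opt_value\<close>. On the event that the deviations
  stay in a small tube around \<open>\<psi>\<close>, the cost is at least \<open>path_cost \<psi>\<close> up to a small error, and by
  the large deviation lower bound this event has exponential weight at least \<open>- Rate \<psi>\<close>.\<close>
lemma cost_lower_bound:
  assumes v: "ereal v < opt_value"
  shows "\<forall>\<^sub>F n in sequentially. ereal v \<le> J n"
proof -
  obtain \<psi> where \<psi>: "\<psi> \<in> game_data T" "ereal v < ereal (path_cost \<psi>) - Rate \<psi>"
    using v unfolding opt_value_def less_SUP_iff by (elim bexE) (rule that)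
  have "Rate \<psi> \<noteq> \<infinity>" "Rate \<psi> \<noteq> - \<infinity>" using \<psi>(2) Rate_nonneg[of \<psi>] by auto
  then obtain i where i: "Rate \<psi> = ereal i" by (cases "Rate \<psi>") auto
  define gap where "gap = path_cost \<psi> - i - v"
  have gap: "0 < gap" using \<psi>(2) i by (simp add: gap_def)
  obtain \<delta> where \<delta>: "0 < \<delta>" "tracking_const * \<delta> \<le> gap / 3"
    using exists_small_multiple[of tracking_const "gap / 3"] tracking_const_nonneg gap by auto
  define g where "g = - i - gap / 3"
  let ?P = "\<lambda>n. emeasure M {\<omega> \<in> space M. Z n \<omega> \<in> open_tube T \<psi> \<delta>}"
  have "\<psi> \<in> open_tube T \<psi> \<delta>"
    using \<delta>(1) continuous_in_skorokhod_space game_dataD(1,2)[OF \<psi>(1)] by (auto simp: open_tube_def intro!: exI[of _ 0])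
  then have "(INF \<psi>\<in>open_tube T \<psi> \<delta>. Rate \<psi>) \<le> ereal i" unfolding i[symmetric] by (rule INF_lower)
  then have "ereal g < - (INF \<psi>\<in>open_tube T \<psi> \<delta>. Rate \<psi>)"
    using gap by (cases "INF \<psi>\<in>open_tube T \<psi> \<delta>. Rate \<psi>") (auto simp: g_def)
  also have "\<dots> \<le> liminf (\<lambda>n. ereal (1 / (b n)\<^sup>2) * ln_ennreal (?P n))"
    using mdp openin_open_tube[OF game_dataD(2)[OF \<psi>(1)], of \<delta>] unfolding satisfies_LDP_def by blast
  finally have "\<forall>\<^sub>F n in sequentially. ereal g < ereal (1 / (b n)\<^sup>2) * ln_ennreal (?P n)"
    by (rule less_LiminfD)
  moreover note cost_tracks_path_cost[OF \<psi>(1) \<delta>(1)] eventually_pos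
  ultimately show ?thesis
  proof eventually_elim
    case (elim n)
    let ?k = "path_cost \<psi> - tracking_const * \<delta>"
    have b2: "0 < (b n)\<^sup>2" using elim(3) by simp
    have "ennreal (exp ((b n)\<^sup>2 * ?k)) * ?P n =
        (\<integral>\<^sup>+\<omega>. ennreal (exp ((b n)\<^sup>2 * ?k)) * indicator {\<omega> \<in> space M. Z n \<omega> \<in> open_tube T \<psi> \<delta>} \<omega> \<partial>M)"
      by (rule nn_integral_cmult_indicator[symmetric]) (rule measurable_open_tube[OF \<psi>(1)])
    also have "\<dots> \<le> (\<integral>\<^sup>+\<omega>. ennreal (exp ((b n)\<^sup>2 * queue_cost n \<omega>)) \<partial>M)"
    proof (rule nn_integral_mono_AE)
      show "AE \<omega> in M. ennreal (exp ((b n)\<^sup>2 * ?k)) * indicator {\<omega> \<in> space M. Z n \<omega> \<in> open_tube T \<psi> \<delta>} \<omega> \<le>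
          ennreal (exp ((b n)\<^sup>2 * queue_cost n \<omega>))"
        using elim(2)
      proof eventually_elim
        case (elim \<omega>)
        show ?case
        proof (cases "Z n \<omega> \<in> open_tube T \<psi> \<delta>")
          case True
          then have "\<forall>t\<in>{0..T}. dist (Z n \<omega> t) (\<psi> t) \<le> \<delta>" unfolding open_tube_def by fastforce
          then have "?k \<le> queue_cost n \<omega>" using elim by linarith
          then have "(b n)\<^sup>2 * ?k \<le> (b n)\<^sup>2 * queue_cost n \<omega>" by (intro mult_left_mono) auto
          then show ?thesis by (auto simp: indicator_def intro!: ennreal_leI)
        qed simp
      qed
    qed
    finally have "ereal ?k + ereal (1 / (b n)\<^sup>2) * ln_ennreal (?P n) \<le> J n"
      unfolding J_eq by (rule ln_ennreal_ge_if_ge_exp_times[OF b2])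
    moreover have "ereal ?k + ereal g \<le> ereal ?k + ereal (1 / (b n)\<^sup>2) * ln_ennreal (?P n)"
      using elim(1) by (intro add_left_mono less_imp_le)
    moreover have "?k + g = v + (gap - gap / 3 - tracking_const * \<delta>)" by (simp add: g_def gap_def)
    then have "v \<le> ?k + g" using \<delta>(2) gap by argo
    then have "ereal v \<le> ereal ?k + ereal g" by simp
    ultimately show "ereal v \<le> J n" by (meson order_trans)
  qed
qed

text \<open>On an unlikely event, the part of the cost below the level \<open>k\<close> is compensated by the
  probability, and the part above \<open>k\<close> by a second exponential moment.\<close>
lemma exp_le_split: "exp x \<le> exp (2 * x - k) + exp (k::real)"
proof (cases "x \<le> k")
  case True
  then have "exp x \<le> exp k" by simp
  then show ?thesis using exp_gt_zero[of "2 * x - k"] by linarith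
next
  case False
  then have "exp x \<le> exp (2 * x - k)" by simp
  then show ?thesis using exp_gt_zero[of k] by linarith
qed

lemma tail_moment:
  "\<exists>K1 m. (\<forall>\<^sub>F n in sequentially. AE \<omega> in M. queue_cost n \<omega> \<le> K1 * (1 + deviation_norm n \<omega>)) \<and>
    (\<forall>\<^sub>F n in sequentially. (\<integral>\<^sup>+\<omega>. ennreal (exp ((b n)\<^sup>2 * (2 * (K1 * (1 + deviation_norm n \<omega>))))) \<partial>M) \<le> ennreal (exp ((b n)\<^sup>2 * m)))"
proof -
  obtain K1 where K1: "\<forall>\<^sub>F n in sequentially. AE \<omega> in M. queue_cost n \<omega> \<le> K1 * (1 + deviation_norm n \<omega>)"
    using crude_cost_bound by blast
  let ?L = "\<lambda>n. ereal (1 / (b n)\<^sup>2) * ln_ennreal (\<integral>\<^sup>+\<omega>. ennreal (exp ((b n)\<^sup>2 * (2 * K1) * deviation_norm n \<omega>)) \<partial>M)"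
  have "limsup ?L < \<infinity>" using exp_moments[of "2 * K1"] by (simp only: deviation_norm_def)
  then obtain m0 where "limsup ?L < ereal m0" using ereal_dense2 by blast
  from Limsup_lessD[OF this] have "\<forall>\<^sub>F n in sequentially. ?L n < ereal m0" .
  then have "\<forall>\<^sub>F n in sequentially. (\<integral>\<^sup>+\<omega>. ennreal (exp ((b n)\<^sup>2 * (2 * (K1 * (1 + deviation_norm n \<omega>))))) \<partial>M) \<le> ennreal (exp ((b n)\<^sup>2 * (m0 + 2 * K1)))"
    using eventually_pos
  proof eventually_elim
    case (elim n)
    then have b2: "0 < (b n)\<^sup>2" by simp
    have "(\<integral>\<^sup>+\<omega>. ennreal (exp ((b n)\<^sup>2 * (2 * (K1 * (1 + deviation_norm n \<omega>))))) \<partial>M) =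
        (\<integral>\<^sup>+\<omega>. ennreal (exp ((b n)\<^sup>2 * (2 * K1))) * ennreal (exp ((b n)\<^sup>2 * (2 * K1) * deviation_norm n \<omega>)) \<partial>M)"
      by (simp add: ennreal_mult'[symmetric] exp_add[symmetric] algebra_simps)
    also have "\<dots> = ennreal (exp ((b n)\<^sup>2 * (2 * K1))) * (\<integral>\<^sup>+\<omega>. ennreal (exp ((b n)\<^sup>2 * (2 * K1) * deviation_norm n \<omega>)) \<partial>M)"
      using measurable_deviation_norm[of n] by (intro nn_integral_cmult) measurable
    also have "\<dots> \<le> ennreal (exp ((b n)\<^sup>2 * (2 * K1))) * ennreal (exp ((b n)\<^sup>2 * m0))"
      using ennreal_le_exp_if_ln_less[OF b2 elim(1)] by (rule mult_left_mono) simp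
    also have "\<dots> = ennreal (exp ((b n)\<^sup>2 * (m0 + 2 * K1)))"
      by (simp add: ennreal_mult'[symmetric] exp_add[symmetric] algebra_simps)
    finally show ?case .
  qed
  then show ?thesis using K1 by blast
qed

text \<open>Cover the level set of the rate function at a high level \<open>L\<close> by finitely many tubes. On the
  tube around \<open>\<psi>\<close> the cost is close to \<open>path_cost \<psi>\<close>, the rate function is at least
  \<open>path_cost \<psi> - opt_value\<close> up to a small error, and the exponential of the cost times the probability is at most
  \<open>exp (b\<^sup>2 * opt_value)\<close> up to this error. The complement \<open>F\<close> of the tubes is closed and
  has rate at least \<open>L\<close>, which outweighs the cost by \<open>exp_le_split\<close>. A finite sum of exponentials is of
  the order of the largest one, since \<open>b\<close> tends to infinity.\<close>
lemma cost_upper_bound: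
  assumes v: "opt_value < ereal v"
  shows "\<forall>\<^sub>F n in sequentially. J n \<le> ereal v"
proof -
  obtain v' where v': "opt_value < ereal v'" "v' < v" using ereal_dense2[OF v] by auto
  define gap where "gap = v - v'"
  have gap: "0 < gap" using v' by (simp add: gap_def)
  obtain K1 m where crude: "\<forall>\<^sub>F n in sequentially. AE \<omega> in M. queue_cost n \<omega> \<le> K1 * (1 + deviation_norm n \<omega>)"
    and mom: "\<forall>\<^sub>F n in sequentially. (\<integral>\<^sup>+\<omega>. ennreal (exp ((b n)\<^sup>2 * (2 * (K1 * (1 + deviation_norm n \<omega>))))) \<partial>M) \<le> ennreal (exp ((b n)\<^sup>2 * m))"
    using tail_moment by (elim exE conjE) (rule that)
  (* for k = m - v' the moment part is at most exp (b^2 * v'), and rate L > k - v' makes the other part as small *)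
  define k where "k = m - v'"
  define L where "L = k - v' + 1"
  define Kp where "Kp = T * (u1 * mu_total * (4 * theta_total))"
  have Kp: "0 \<le> Kp" using T_pos u1_nonneg mu_total_pos theta_total_pos by (simp add: Kp_def)
  obtain \<delta> where \<delta>: "0 < \<delta>" "2 * (tracking_const + Kp) * \<delta> \<le> gap / 4"
    using exists_small_multiple[of "2 * (tracking_const + Kp)" "gap / 4"] tracking_const_nonneg Kp gap by auto
  obtain \<Psi> where \<Psi>: "\<Psi> \<subseteq> game_data T" "finite \<Psi>"
    "\<forall>\<psi> :: real \<Rightarrow> (real, 'd) vec \<times> (real, 'd) vec. \<psi> \<in> skorokhod_space T \<and> Rate \<psi> \<le> ereal L \<longrightarrow>
        (\<exists>\<psi>'\<in>\<Psi>. \<forall>t\<in>{0..T}. dist (\<psi> t) (\<psi>' t) \<le> \<delta>)"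
    using rate_function_sublevel_net[where ?s1.0=s1 and ?s2.0=s2 and L=L, OF s_pos less_imp_le[OF T_pos] \<delta>(1)]
    by (elim exE conjE) (rule that)
  define F where "F = skorokhod_space T - (\<Union>\<psi>\<in>\<Psi>. open_tube T \<psi> (2 * \<delta>))"
  have Fclosed: "closedin (skorokhod_topology T) F"
  proof -
    have "openin (skorokhod_topology T) (\<Union>\<psi>\<in>\<Psi>. open_tube T \<psi> (2 * \<delta>))"
      using \<Psi>(1) game_dataD(2) by (intro openin_Union) (auto intro!: openin_open_tube)
    then show ?thesis unfolding F_def using closedin_diff[OF closedin_topspace] by (metis topspace_skorokhod)
  qed
  have "ereal L \<le> (INF \<psi>\<in>F. Rate \<psi>)"
  proof (rule INF_greatest, rule ccontr)
    fix \<psi> assume f: "\<psi> \<in> F" "\<not> ereal L \<le> Rate \<psi>"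
    then have "\<psi> \<in> skorokhod_space T \<and> Rate \<psi> \<le> ereal L" by (auto simp: F_def)
    then obtain \<psi>' where p: "\<psi>' \<in> \<Psi>" "\<forall>t\<in>{0..T}. dist (\<psi> t) (\<psi>' t) \<le> \<delta>" using \<Psi>(3) by blast
    then have "\<psi> \<in> open_tube T \<psi>' (2 * \<delta>)" using f(1) \<delta>(1) by (auto simp: open_tube_def F_def intro!: exI[of _ \<delta>])
    then show False using f(1) p(1) by (auto simp: F_def)
  qed
  then have "- (INF \<psi>\<in>F. Rate \<psi>) \<le> - ereal L" by (simp only: ereal_minus_le_minus)
  also have "\<dots> < ereal (v' - k)" by (simp add: L_def)
  finally have evF: "\<forall>\<^sub>F n in sequentially. emeasure M {\<omega> \<in> space M. Z n \<omega> \<in> F} \<le> ennreal (exp ((b n)\<^sup>2 * (v' - k)))"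
    by (rule LDP_upper_eventually[OF mdp Fclosed _ b])
  define p where "p \<psi> = path_cost \<psi> - Kp * (2 * \<delta>)" for \<psi>
  have evT: "\<forall>\<^sub>F n in sequentially. \<forall>\<psi>\<in>\<Psi>. emeasure M {\<omega> \<in> space M. Z n \<omega> \<in> closed_tube T \<psi> (2 * \<delta>)} \<le> ennreal (exp ((b n)\<^sup>2 * (v' - p \<psi> + gap / 8)))"
  proof (rule eventually_ball_finite[OF \<Psi>(2)], rule ballI)
    fix \<psi> assume "\<psi> \<in> \<Psi>"
    then have \<psi>: "\<psi> \<in> game_data T" using \<Psi>(1) by blast
    have "ereal (p \<psi> - v') \<le> (INF f\<in>closed_tube T \<psi> (2 * \<delta>). Rate f)"
    proof (rule INF_greatest)
      fix f assume f: "f \<in> closed_tube T \<psi> (2 * \<delta>)"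
      show "ereal (p \<psi> - v') \<le> Rate f"
      proof (cases "Rate f")
        case (real i)
        have fg: "f \<in> game_data T"
          by (rule rate_function_finite_in_game_data[where L=i and ?s1.0=s1 and ?s2.0=s2]) (use f real s_pos in \<open>auto simp: closed_tube_def skorokhod_space_def\<close>)
        have "path_cost \<psi> \<le> path_cost f + T * (u1 * mu_total * (4 * theta_total * (2 * \<delta>)))"
          by (rule path_cost_Lipschitz) (use f game_dataD(2)[OF \<psi>] game_dataD(2)[OF fg] in \<open>auto simp: closed_tube_def dist_commute\<close>)
        then have "p \<psi> \<le> path_cost f" by (simp add: p_def Kp_def mult.assoc)
        moreover have "ereal (path_cost f) - Rate f \<le> opt_value" unfolding opt_value_def using fg by (rule SUP_upper)
        then have "ereal (path_cost f) - Rate f < ereal v'" using v'(1) by (rule le_less_trans)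
        ultimately show ?thesis using real by simp
      next
        case MInf
        then show ?thesis using Rate_nonneg[of f] by simp
      qed simp
    qed
    then have "- (INF f\<in>closed_tube T \<psi> (2 * \<delta>). Rate f) \<le> - ereal (p \<psi> - v')" by (simp only: ereal_minus_le_minus)
    also have "\<dots> < ereal (v' - p \<psi> + gap / 8)" using gap by simp
    finally show "\<forall>\<^sub>F n in sequentially. emeasure M {\<omega> \<in> space M. Z n \<omega> \<in> closed_tube T \<psi> (2 * \<delta>)} \<le> ennreal (exp ((b n)\<^sup>2 * (v' - p \<psi> + gap / 8)))"
      by (rule LDP_upper_eventually[OF mdp closedin_closed_tube[OF game_dataD(2)[OF \<psi>]] _ b])
  qed
  have evC: "\<forall>\<^sub>F n in sequentially. \<forall>\<psi>\<in>\<Psi>. AE \<omega> in M. (\<forall>t\<in>{0..T}. dist (Z n \<omega> t) (\<psi> t) \<le> 2 * \<delta>) \<longrightarrow>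
      \<bar>queue_cost n \<omega> - path_cost \<psi>\<bar> \<le> tracking_const * (2 * \<delta>)"
    using \<Psi>(1) \<delta>(1) by (intro eventually_ball_finite[OF \<Psi>(2)] ballI cost_tracks_path_cost) auto
  have evN: "\<forall>\<^sub>F n in sequentially. real (card \<Psi> + 2) \<le> exp ((b n)\<^sup>2 * (gap / 2))"
  proof -
    have "filterlim (\<lambda>n. exp ((b n)\<^sup>2 * (gap / 2))) at_top sequentially"
      using b gap by (intro filterlim_compose[OF exp_at_top] filterlim_at_top_mult_tendsto_pos[OF tendsto_const]
          filterlim_pow_at_top) auto
    then show ?thesis by (simp add: filterlim_at_top)
  qed
  show ?thesis
    using crude mom evF evT evC evN eventually_pos
  proof eventually_elim
    case (elim n)
    note ecrude = elim(1) and emom = elim(2) and eF = elim(3) and eT = elim(4) and eC = elim(5) and eN = elim(6)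
    have b2: "0 < (b n)\<^sup>2" using elim(7) by simp
    let ?\<beta> = "(b n)\<^sup>2"
    let ?CT = "\<lambda>\<psi>. {\<omega> \<in> space M. Z n \<omega> \<in> closed_tube T \<psi> (2 * \<delta>)}"
    let ?F = "{\<omega> \<in> space M. Z n \<omega> \<in> F}"
    let ?X = "\<lambda>\<omega>. ?\<beta> * (2 * (K1 * (1 + deviation_norm n \<omega>)))"
    let ?e = "\<lambda>x. ennreal (exp x)"
    have mT: "?CT \<psi> \<in> sets M" if "\<psi> \<in> \<Psi>" for \<psi> using \<Psi>(1) that by (intro measurable_closed_tube) auto
    have mF: "?F \<in> sets M"
    proof (rule M.sets_if_AE_eq)
      show "space M - (\<Union>\<psi>\<in>\<Psi>. {\<omega> \<in> space M. Z n \<omega> \<in> open_tube T \<psi> (2 * \<delta>)}) \<in> sets M"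
        using \<Psi>(1) by (intro sets.Diff sets.top sets.finite_UN \<Psi>(2) measurable_open_tube) auto
      show "AE \<omega> in M. \<omega> \<in> ?F \<longleftrightarrow> \<omega> \<in> space M - (\<Union>\<psi>\<in>\<Psi>. {\<omega> \<in> space M. Z n \<omega> \<in> open_tube T \<psi> (2 * \<delta>)})"
        using AE_Z[of n] by eventually_elim (auto simp: F_def)
    qed auto
    have AEC: "AE \<omega> in M. \<forall>\<psi>\<in>\<Psi>. (\<forall>t\<in>{0..T}. dist (Z n \<omega> t) (\<psi> t) \<le> 2 * \<delta>) \<longrightarrow>
        \<bar>queue_cost n \<omega> - path_cost \<psi>\<bar> \<le> tracking_const * (2 * \<delta>)"
      by (intro AE_finite_allI[OF \<Psi>(2)] bspec[OF eC])
    have mX: "(\<lambda>\<omega>. ?e (?X \<omega>)) \<in> borel_measurable M" using measurable_deviation_norm[of n] by measurable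
    have "(\<integral>\<^sup>+\<omega>. ?e (?\<beta> * queue_cost n \<omega>) \<partial>M) \<le>
       (\<integral>\<^sup>+\<omega>. (\<Sum>\<psi>\<in>\<Psi>. ?e (?\<beta> * (path_cost \<psi> + tracking_const * (2 * \<delta>))) * indicator (?CT \<psi>) \<omega>) +
         (?e (- (?\<beta> * k)) * ?e (?X \<omega>) + ?e (?\<beta> * k) * indicator ?F \<omega>) \<partial>M)"
    proof (rule nn_integral_mono_AE)
      show "AE \<omega> in M. ?e (?\<beta> * queue_cost n \<omega>) \<le>
          (\<Sum>\<psi>\<in>\<Psi>. ?e (?\<beta> * (path_cost \<psi> + tracking_const * (2 * \<delta>))) * indicator (?CT \<psi>) \<omega>) +
         (?e (- (?\<beta> * k)) * ?e (?X \<omega>) + ?e (?\<beta> * k) * indicator ?F \<omega>)"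
        using AE_Z[of n] ecrude AEC AE_space[of M]
      proof eventually_elim
        case (elim \<omega>)
        show ?case
        proof (cases "Z n \<omega> \<in> F")
          case True
          have "?\<beta> * queue_cost n \<omega> \<le> ?\<beta> * (K1 * (1 + deviation_norm n \<omega>))" using elim(2) by (intro mult_left_mono) auto
          then have "exp (?\<beta> * queue_cost n \<omega>) \<le> exp (?\<beta> * (K1 * (1 + deviation_norm n \<omega>)))" by simp
          also have "\<dots> \<le> exp (2 * (?\<beta> * (K1 * (1 + deviation_norm n \<omega>))) - ?\<beta> * k) + exp (?\<beta> * k)" by (rule exp_le_split)
          finally have "exp (?\<beta> * queue_cost n \<omega>) \<le> exp (- (?\<beta> * k)) * exp (?X \<omega>) + exp (?\<beta> * k)"
            by (simp add: exp_add[symmetric] algebra_simps)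
          then have "?e (?\<beta> * queue_cost n \<omega>) \<le> ?e (- (?\<beta> * k)) * ?e (?X \<omega>) + ?e (?\<beta> * k)"
            by (simp add: ennreal_mult'[symmetric] ennreal_plus[symmetric] ennreal_leI del: ennreal_plus)
          also have "\<dots> = ?e (- (?\<beta> * k)) * ?e (?X \<omega>) + ?e (?\<beta> * k) * indicator ?F \<omega>" using True elim(4) by simp
          finally show ?thesis by (rule add_increasing[OF zero_le])
        next
          case False
          then obtain \<psi> where \<psi>: "\<psi> \<in> \<Psi>" "Z n \<omega> \<in> open_tube T \<psi> (2 * \<delta>)" using elim(1) unfolding F_def by blast
          then have cl: "\<forall>t\<in>{0..T}. dist (Z n \<omega> t) (\<psi> t) \<le> 2 * \<delta>" unfolding open_tube_def by fastforce
          then have "queue_cost n \<omega> \<le> path_cost \<psi> + tracking_const * (2 * \<delta>)" using elim(3) \<psi>(1) by fastforce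
          then have "?\<beta> * queue_cost n \<omega> \<le> ?\<beta> * (path_cost \<psi> + tracking_const * (2 * \<delta>))" by (intro mult_left_mono) auto
          then have "?e (?\<beta> * queue_cost n \<omega>) \<le> ?e (?\<beta> * (path_cost \<psi> + tracking_const * (2 * \<delta>))) * indicator (?CT \<psi>) \<omega>"
            using cl elim(1,4) by (simp add: closed_tube_def ennreal_leI)
          also have "\<dots> \<le> (\<Sum>\<psi>\<in>\<Psi>. ?e (?\<beta> * (path_cost \<psi> + tracking_const * (2 * \<delta>))) * indicator (?CT \<psi>) \<omega>)"
            by (rule member_le_sum[where f="\<lambda>\<psi>. ?e (?\<beta> * (path_cost \<psi> + tracking_const * (2 * \<delta>))) * indicator (?CT \<psi>) \<omega>", OF \<psi>(1) _ \<Psi>(2)]) simp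
          finally show ?thesis by (rule add_increasing2[OF zero_le])
        qed
      qed
    qed
    also have "\<dots> = (\<Sum>\<psi>\<in>\<Psi>. ?e (?\<beta> * (path_cost \<psi> + tracking_const * (2 * \<delta>))) * emeasure M (?CT \<psi>)) +
         (?e (- (?\<beta> * k)) * (\<integral>\<^sup>+\<omega>. ?e (?X \<omega>) \<partial>M) + ?e (?\<beta> * k) * emeasure M ?F)"
      using mT mF mX by (simp add: nn_integral_add nn_integral_sum nn_integral_cmult nn_integral_cmult_indicator)
    also have "\<dots> \<le> (\<Sum>\<psi>\<in>\<Psi>. ?e (?\<beta> * (v' + gap / 2))) + (?e (?\<beta> * (v' + gap / 2)) + ?e (?\<beta> * (v' + gap / 2)))"
    proof (intro add_mono sum_mono)
      have prod: "?e x * q \<le> ?e z" if "q \<le> ?e w" "x + w \<le> z" for x w z :: real and q :: ennreal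
      proof -
        have "?e x * q \<le> ?e x * ?e w" using that(1) by (intro mult_left_mono) auto
        also have "\<dots> = ?e (x + w)" by (simp add: ennreal_mult'[symmetric] exp_add)
        also have "\<dots> \<le> ?e z" using that(2) by (intro ennreal_leI) simp
        finally show ?thesis .
      qed
      show "?e (?\<beta> * (path_cost \<psi> + tracking_const * (2 * \<delta>))) * emeasure M (?CT \<psi>) \<le> ?e (?\<beta> * (v' + gap / 2))" if "\<psi> \<in> \<Psi>" for \<psi>
      proof (rule prod)
        show "emeasure M (?CT \<psi>) \<le> ?e (?\<beta> * (v' - p \<psi> + gap / 8))" using eT that by blast
        have "(path_cost \<psi> + tracking_const * (2 * \<delta>)) + (v' - p \<psi> + gap / 8) \<le> v' + gap / 2"
          using \<delta>(2) gap by (simp add: p_def algebra_simps)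
        then show "?\<beta> * (path_cost \<psi> + tracking_const * (2 * \<delta>)) + ?\<beta> * (v' - p \<psi> + gap / 8) \<le> ?\<beta> * (v' + gap / 2)"
          unfolding distrib_left[symmetric] by (intro mult_left_mono) auto
      qed
      show "?e (- (?\<beta> * k)) * (\<integral>\<^sup>+\<omega>. ?e (?X \<omega>) \<partial>M) \<le> ?e (?\<beta> * (v' + gap / 2))"
      proof (rule prod[OF emom])
        have "?\<beta> * (m - k) \<le> ?\<beta> * (v' + gap / 2)" using gap by (intro mult_left_mono) (auto simp: k_def)
        then show "- (?\<beta> * k) + ?\<beta> * m \<le> ?\<beta> * (v' + gap / 2)" by (simp add: algebra_simps)
      qed
      show "?e (?\<beta> * k) * emeasure M ?F \<le> ?e (?\<beta> * (v' + gap / 2))"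
      proof (rule prod[OF eF])
        have "?\<beta> * (k + (v' - k)) \<le> ?\<beta> * (v' + gap / 2)" using gap by (intro mult_left_mono) auto
        then show "?\<beta> * k + ?\<beta> * (v' - k) \<le> ?\<beta> * (v' + gap / 2)" by (simp only: distrib_left)
      qed
    qed
    also have "\<dots> = ennreal (real (card \<Psi> + 2) * exp (?\<beta> * (v' + gap / 2)))"
    proof -
      have "ennreal (real (card \<Psi> + 2) * exp (?\<beta> * (v' + gap / 2))) = of_nat (card \<Psi> + 2) * ?e (?\<beta> * (v' + gap / 2))"
        by (simp add: ennreal_mult' ennreal_of_nat_eq_real_of_nat)
      then show ?thesis by (simp add: algebra_simps)
    qed
    also have "\<dots> \<le> ennreal (exp (?\<beta> * (gap / 2)) * exp (?\<beta> * (v' + gap / 2)))"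
      using eN by (intro ennreal_leI mult_right_mono) auto
    also have "\<dots> = ennreal (exp (?\<beta> * v))"
      by (simp add: exp_add[symmetric] gap_def algebra_simps)
    finally show "J n \<le> ereal v" unfolding J_eq by (rule ln_ennreal_le_if_le_exp[OF b2])
  qed
qed

theorem cost_tendsto_opt_value: "J \<longlonglongrightarrow> opt_value"
proof (rule order_tendstoI)
  fix a assume "a < opt_value"
  then obtain v where v: "a < ereal v" "ereal v < opt_value" using ereal_dense2 by blast
  show "\<forall>\<^sub>F n in sequentially. a < J n"
    using cost_lower_bound[OF v(2)] by eventually_elim (rule less_le_trans[OF v(1)])
next
  fix a assume "opt_value < a"
  then obtain v where v: "opt_value < ereal v" "ereal v < a" using ereal_dense2 by blast
  show "\<forall>\<^sub>F n in sequentially. J n < a"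
    using cost_upper_bound[OF v(1)] by eventually_elim (rule le_less_trans[OF _ v(2)])
qed

end

section \<open>Asymptotic optimality\<close>

lemma tendsto_imp_eventually_close:
  fixes f :: "nat \<Rightarrow> real"
  assumes "f \<longlonglongrightarrow> l" "0 < \<kappa>"
  shows "\<forall>\<^sub>F n in sequentially. \<bar>f n - l\<bar> \<le> \<kappa>"
  using tendstoD[OF assms] by eventually_elim (simp add: dist_real_def)

theorem theorem2p4:
  fixes M :: "'w measure"
    and T :: real
    and IA ST :: "'d::{finite,linorder} \<Rightarrow> nat \<Rightarrow> 'w \<Rightarrow> real"
    and varIA varST :: "'d \<Rightarrow> real"
    and lam_n mu_n :: "nat \<Rightarrow> 'd \<Rightarrow> real"
    and lam mu lamt mut rho :: "'d \<Rightarrow> real"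
    and b c :: "nat \<Rightarrow> real"
    and C C' :: "'d \<Rightarrow> real \<Rightarrow> real"
    and A S :: "nat \<Rightarrow> 'd \<Rightarrow> real \<Rightarrow> 'w \<Rightarrow> nat"
    and At St :: "nat \<Rightarrow> real \<Rightarrow> 'w \<Rightarrow> (real, 'd) vec"
    and y :: "(real, 'd) vec"
    and I :: "(real \<Rightarrow> (real, 'd) vec \<times> (real, 'd) vec) \<Rightarrow> ereal"
    and B :: "nat \<Rightarrow> real \<Rightarrow> 'w \<Rightarrow> (real, 'd) vec"
  assumes T: "T > 0"
    and M: "prob_space M" "complete_measure M"
    \<comment> \<open>interarrival times\<close>
    and IA_pos: "\<And>i l \<omega>. l \<ge> 1 \<Longrightarrow> \<omega> \<in> space M \<Longrightarrow> IA i l \<omega> > 0"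
    and IA_indep: "prob_space.indep_vars M (\<lambda>_. borel) (\<lambda>(i, l). IA i l) (UNIV \<times> {1..})"
    and IA_ident: "\<And>i l. l \<ge> 1 \<Longrightarrow> distr M borel (IA i l) = distr M borel (IA i 1)"
    and IA_int: "\<And>i l. l \<ge> 1 \<Longrightarrow> integrable M (IA i l)"
                "\<And>i l. l \<ge> 1 \<Longrightarrow> integrable M (\<lambda>\<omega>. (IA i l \<omega>)\<^sup>2)"
    and IA_mean: "\<And>i l. l \<ge> 1 \<Longrightarrow> prob_space.expectation M (IA i l) = 1"
    and IA_var: "\<And>i l. l \<ge> 1 \<Longrightarrow> prob_space.variance M (IA i l) = varIA i"
                "\<And>i. varIA i > 0"
    \<comment> \<open>service times\<close>
    and ST_pos: "\<And>i l \<omega>. l \<ge> 1 \<Longrightarrow> \<omega> \<in> space M \<Longrightarrow> ST i l \<omega> > 0"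
    and ST_indep: "prob_space.indep_vars M (\<lambda>_. borel) (\<lambda>(i, l). ST i l) (UNIV \<times> {1..})"
    and ST_ident: "\<And>i l. l \<ge> 1 \<Longrightarrow> distr M borel (ST i l) = distr M borel (ST i 1)"
    and ST_int: "\<And>i l. l \<ge> 1 \<Longrightarrow> integrable M (ST i l)"
                "\<And>i l. l \<ge> 1 \<Longrightarrow> integrable M (\<lambda>\<omega>. (ST i l \<omega>)\<^sup>2)"
    and ST_mean: "\<And>i l. l \<ge> 1 \<Longrightarrow> prob_space.expectation M (ST i l) = 1"
    and ST_var: "\<And>i l. l \<ge> 1 \<Longrightarrow> prob_space.variance M (ST i l) = varST i"
                "\<And>i. varST i > 0"
    \<comment> \<open>moderate deviation heavy traffic parameters\<close>
    and rates_pos: "\<And>n i. lam_n n i > 0" "\<And>n i. mu_n n i > 0"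
    and b: "filterlim b at_top sequentially" "(\<lambda>n. b n / sqrt (real n)) \<longlonglongrightarrow> 0"
    and c: "\<And>n. c n = b n * sqrt (real n)"
    and lim_pos: "\<And>i. lam i > 0" "\<And>i. mu i > 0"
    and lam: "\<And>i. (\<lambda>n. lam_n n i / real n) \<longlonglongrightarrow> lam i"
    and mu: "\<And>i. (\<lambda>n. mu_n n i / real n) \<longlonglongrightarrow> mu i"
    and lamt: "\<And>i. (\<lambda>n. (lam_n n i - real n * lam i) / c n) \<longlonglongrightarrow> lamt i"
    and mut: "\<And>i. (\<lambda>n. (mu_n n i - real n * mu i) / c n) \<longlonglongrightarrow> mut i"
    and rho: "\<And>i. rho i = lam i / mu i"
    and critical: "(\<Sum>i\<in>UNIV. rho i) = 1"
    \<comment> \<open>cost functions\<close>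
    and C_nonneg: "\<And>i x. x \<ge> 0 \<Longrightarrow> C i x \<ge> 0"
    and C_strict_mono: "\<And>i. strict_mono_on {0..} (C i)"
    and C_strict_convex: "\<And>i x z u. x \<ge> 0 \<Longrightarrow> z \<ge> 0 \<Longrightarrow> x \<noteq> z \<Longrightarrow> 0 < u \<Longrightarrow> u < 1 \<Longrightarrow>
           C i (u * x + (1 - u) * z) < u * C i x + (1 - u) * C i z"
    and C_deriv: "\<And>i x. x \<ge> 0 \<Longrightarrow> (C i has_real_derivative C' i x) (at x within {0..})"
    and C'_cont: "\<And>i. continuous_on {0..} (C' i)"
    and C_zero: "\<And>i. C i 0 = 0" "\<And>i. C' i 0 = 0"
    and C_linear: "\<exists>u1. \<forall>i. \<forall>x\<ge>0. C i x \<le> u1 * x"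
    \<comment> \<open>arrivals, potential services and their scaled versions\<close>
    and A: "\<And>n. A n = renewal_processes IA (lam_n n)"
    and S: "\<And>n. S n = renewal_processes ST (mu_n n)"
    and At: "\<And>n. At n = scaled_deviation (c n) (lam_n n) (A n)"
    and St: "\<And>n. St n = scaled_deviation (c n) (mu_n n) (S n)"
    \<comment> \<open>rate function and drift of the game\<close>
    and I: "I = rate_function T (\<lambda>i. lam i * varIA i) (\<lambda>i. mu i * varST i)"
    and y: "y = (\<chi> i. lamt i - rho i * mut i)"
    \<comment> \<open>(i) moderate deviation principle\<close>
    and mdp: "satisfies_LDP M (skorokhod_topology T) b
                (\<lambda>n \<omega>. restrict (\<lambda>t. (At n t \<omega>, St n t \<omega>)) {0..T}) I"
    \<comment> \<open>(ii) exponential moments\<close>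
    and exp_moments: "\<And>u::real.
           limsup (\<lambda>n. ereal (1 / (b n)\<^sup>2) *
             ln_ennreal (\<integral>\<^sup>+\<omega>. ennreal (exp ((b n)\<^sup>2 * u *
               ((SUP s\<in>{0..T}. norm (At n s \<omega>)) + (SUP s\<in>{0..T}. norm (St n s \<omega>))))) \<partial>M)) < \<infinity>"
    \<comment> \<open>the preemptive generalized c-mu rule\<close>
    and B: "\<And>n. generalized_cmu M T mu C' (c n) (A n) (S n) (B n)"
  shows "(\<lambda>n. risk_sensitive_cost M T C (b n) (scaled_queue (c n) (A n) (S n) (B n)))
           \<longlonglongrightarrow> game_value T mu rho y C I"
proof -
  interpret prob_space M by (rule M)
  obtain u1 where u1: "\<And>i x. x \<ge> 0 \<Longrightarrow> C i x \<le> u1 * x" using C_linear by blast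
  have rho_pos: "0 < rho i" for i using lim_pos by (simp add: rho)
  have rho_le_1: "rho i \<le> 1" for i
    using member_le_sum[of i UNIV rho] less_imp_le[OF rho_pos] critical by simp
  have rv: "IA i l \<in> borel_measurable M" "ST i l \<in> borel_measurable M" if "1 \<le> l" for i l
    using IA_indep ST_indep that unfolding indep_vars_def by fastforce+
  have params: "\<forall>\<^sub>F n in sequentially. workload_game.params_close mu rho y \<kappa> (real n) (c n) (lam_n n) (mu_n n)"
    if \<kappa>: "0 < \<kappa>" and game: "workload_game C C' mu u1 T rho" for \<kappa>
  proof -
    have "(\<lambda>n. b n / sqrt (real n)) \<longlonglongrightarrow> 0" by (rule b)
    moreover have cn: "c n / real n = b n / sqrt (real n)" for n
      by (cases "n = 0") (simp_all add: c field_simps)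
    ultimately have c0: "(\<lambda>n. c n / real n) \<longlonglongrightarrow> 0" by simp
    have ev: "\<forall>\<^sub>F n in sequentially. 0 < n \<and> 0 < c n"
      using eventually_gt_at_top[of 0] b(1)[unfolded filterlim_at_top_dense, rule_format, of 0]
      by eventually_elim (simp add: c)
    have close: "\<forall>\<^sub>F n in sequentially. \<bar>real n / mu_n n i - 1 / mu i\<bar> \<le> \<kappa> \<and>
        \<bar>(lam_n n i - rho i * mu_n n i) / c n - y $ i\<bar> \<le> \<kappa> \<and> c n / lam_n n i \<le> \<kappa>" for i
    proof -
      have "(\<lambda>n. inverse (mu_n n i / real n)) \<longlonglongrightarrow> inverse (mu i)"
        using mu[of i] lim_pos(2)[of i] by (intro tendsto_inverse) auto
      then have 1: "(\<lambda>n. real n / mu_n n i) \<longlonglongrightarrow> 1 / mu i" by (simp add: inverse_eq_divide)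
      (* the first-order terms cancel because rho i * mu i = lam i *)
      have "(\<lambda>n. (lam_n n i - real n * lam i) / c n - rho i * ((mu_n n i - real n * mu i) / c n)) \<longlonglongrightarrow> lamt i - rho i * mut i"
        by (intro tendsto_intros lamt mut)
      moreover have "(lam_n n i - real n * lam i) / c n - rho i * ((mu_n n i - real n * mu i) / c n) =
          (lam_n n i - rho i * mu_n n i) / c n" for n
      proof -
        have "rho i * mu i = lam i" using lim_pos(2)[of i] by (simp add: rho)
        then have "rho i * (mu_n n i - real n * mu i) = rho i * mu_n n i - real n * lam i" by (simp add: algebra_simps)
        then show ?thesis by (simp add: diff_divide_distrib[symmetric])
      qed
      ultimately have 2: "(\<lambda>n. (lam_n n i - rho i * mu_n n i) / c n) \<longlonglongrightarrow> y $ i" by (simp add: y)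
      have "(\<lambda>n. (c n / real n) / (lam_n n i / real n)) \<longlonglongrightarrow> 0 / lam i"
        using lim_pos(1)[of i] by (intro tendsto_divide c0 lam) auto
      then have 3: "(\<lambda>n. (c n / real n) / (lam_n n i / real n)) \<longlonglongrightarrow> 0" by simp
      show ?thesis
        using tendsto_imp_eventually_close[OF 1 \<kappa>] tendsto_imp_eventually_close[OF 2 \<kappa>]
          tendsto_imp_eventually_close[OF 3 \<kappa>] ev
        by eventually_elim (auto simp: abs_of_pos[OF rates_pos(1)])
    qed
    have "\<forall>\<^sub>F n in sequentially. \<forall>i. \<bar>real n / mu_n n i - 1 / mu i\<bar> \<le> \<kappa> \<and>
        \<bar>(lam_n n i - rho i * mu_n n i) / c n - y $ i\<bar> \<le> \<kappa> \<and> c n / lam_n n i \<le> \<kappa>"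
      using close by (rule eventually_all_finite)
    with tendsto_imp_eventually_close[OF c0 \<kappa>] ev
    show ?thesis
      by eventually_elim (auto simp: workload_game.params_close_def[OF game])
  qed
  have game: "workload_game C C' mu u1 T rho"
    by (intro workload_game.intro holding_cost.intro workload_game_axioms.intro;
        fact lim_pos C_nonneg C_strict_convex C_deriv C'_cont C_zero u1 T rho_pos rho_le_1)
  interpret gcmu_system C C' mu u1 T rho y M IA ST lam_n mu_n b c "\<lambda>i. lam i * varIA i" "\<lambda>i. mu i * varST i" B At St
  proof (intro gcmu_system.intro gcmu_system_axioms.intro game)
    show "AE \<omega> in M. \<forall>t. \<exists>l. t < (\<Sum>k=1..l. IA i k \<omega>)" for i
      by (rule AE_partial_sums_unbounded[OF IA_pos IA_indep IA_ident])
    show "AE \<omega> in M. \<forall>t. \<exists>l. t < (\<Sum>k=1..l. ST i k \<omega>)" for i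
      by (rule AE_partial_sums_unbounded[OF ST_pos ST_indep ST_ident])
    show "\<forall>\<^sub>F n in sequentially. workload_game.params_close mu rho y \<kappa> (real n) (c n) (lam_n n) (mu_n n)" if "0 < \<kappa>" for \<kappa>
      by (rule params[OF that game])
    show "0 < lam i * varIA i" "0 < mu i * varST i" for i using lim_pos IA_var(2) ST_var(2) by simp_all
    show "At n = scaled_deviation (c n) (lam_n n) (renewal_processes IA (lam_n n))"
      "St n = scaled_deviation (c n) (mu_n n) (renewal_processes ST (mu_n n))" for n
      using At St A S by simp_all
    show "satisfies_LDP M (skorokhod_topology T) b (\<lambda>n \<omega>. restrict (\<lambda>t. (At n t \<omega>, St n t \<omega>)) {0..T})
        (rate_function T (\<lambda>i. lam i * varIA i) (\<lambda>i. mu i * varST i))" using mdp unfolding I .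
    show "generalized_cmu M T mu C' (c n) (renewal_processes IA (lam_n n)) (renewal_processes ST (mu_n n)) (B n)" for n
      using B[of n] A S by simp
  qed (use M rv IA_pos ST_pos critical rates_pos b(1) c exp_moments in auto)
  have "game_value T mu rho y C I = opt_value" unfolding opt_value_def I by (rule game_value_eq)
  then show ?thesis using cost_tendsto_opt_value by (simp add: A S)
qed

end
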